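(* Assume the Riemann hypothesis. Let $\Phi$ be a function satisfying: (1) $\Phi(u)\ge 0$ for real $u$, and for every $\tau>0$ the function $f(z)=\Phi(\tau z)$ is analytic in the strip $|\mathrm{Im}\,z|\le 0.5+\delta$ and satisfies $|f(z)|\ll(1+|z|)^{-(1+\beta)}$ there, for some positive $\beta,\delta$ (which may depend on $\tau$); (2) $|\Phi(u)|\le e^{-G(|u|)}$ for all real $u$ with $|u|\ge u_0$, where $G(u)$ and $G'(u)$ are positive and unboundedly increasing, and, denoting by $g$ the inverse function of $G$, the functions $g'(v)$ and $g'(v)\ln g(v)$ are positive and decreasing for $v\ge v_0>0$; (3) $\widehat{\Phi}(\lambda)$ is real for real $\lambda$, strictly positive and monotonically decreasing on $[0,\alpha]$ for some $\alpha>0$, and $|\widehat{\Phi}(\lambda)|\le e^{-|\lambda|F(|\lambda|)}$ for all real $\lambda$ with $|\lambda|\ge\lambda_0$, for some increasing function $F$; (4) the inverse function $\varphi$ of $F$ is increasing for $v\ge v_0$ and satisfies $\ln v\le \ln\varphi(v)\le e^{0.5\alpha v}$. Let $\tau_0$ be the root of the equation \[ \alpha\tau_0+\ln\varphi\Bigl(\frac{\tau_0}{2}+1\Bigr)=\ln\ln H, \] which is unique for $H$ sufficiently large. Then there is $T_0(\Phi;\alpha)>0$ such that for $T\ge T_0(\Phi;\alpha)$ and $H\tau_0\ge g(\ln\ln T)$, \[ \max_{T-H\le t\le T+2H}\ln\bigl|\zeta(0.5+it)\bigr|\,\ge\,\mu^{*},\qquad \mu^{*}=\frac{1}{10\alpha}\,\frac{\widehat{\Phi}(\alpha)}{\widehat{\Phi}(0)}\sqrt{\frac{\ln\kappa}{\kappa}}\,\frac{e^{0.5\alpha\tau_0}}{\tau_0},\quad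 \kappa=\max(61,4\alpha^{-1}). \] If in addition $\ln\varphi(v)\le 0.5v$, and $\tau_1$ denotes the root of \[ \frac{\alpha\tau_1}{2}+\ln\varphi\Bigl(\frac{\tau_1}{2}+1\Bigr)=\ln\ln H, \] then there is $T_1(\Phi;\alpha)>0$ such that for $T\ge T_1(\Phi;\alpha)$ and $H\tau_1\ge g(\ln\ln T)$, \[ \max_{T-H\le t\le T+2H}\ln\bigl|\zeta(0.5+it)\bigr|\,\ge\,\mu^{**},\qquad \mu^{**}=\frac{1}{6\sqrt{\alpha\kappa}}\,\frac{\widehat{\Phi}(\alpha)}{\widehat{\Phi}(0)}\,\frac{e^{0.25\alpha\tau_1}}{\sqrt{\tau_1}},\quad\kappa=\max(0.5,4\alpha^{-1}). \]
   Context: $\zeta(s)$ is the Riemann zeta-function. $\widehat{\Phi}(\lambda)=\int_{-\infty}^{+\infty}\Phi(u)e^{-i\lambda u}\,du$ denotes the Fourier transform of $\Phi$. *)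

theory Defs
  imports "HOL-Complex_Analysis.Complex_Analysis"
begin

subsection \<open>The Riemann zeta function\<close>

text \<open>
  The analytic continuation to the complex plane without the point 1 of the Dirichlet series;
  the value at 1 is arbitrary.  Existence and uniqueness of the continuation are proved below.
\<close>

definition zeta_continuation :: "(complex \<Rightarrow> complex) \<Rightarrow> bool" where
  "zeta_continuation f \<longleftrightarrow>
     f holomorphic_on - {1} \<and>
     (\<forall>s. 1 < Re s \<longrightarrow> (\<lambda>n. of_nat (Suc n) powr (-s)) sums f s)"

definition zeta :: "complex \<Rightarrow> complex" where
  "zeta = (SOME f. zeta_continuation f)"

lemma zeta_continuation_unique:
  assumes "zeta_continuation f" "zeta_continuation h" "s \<noteq> 1"
  shows "f s = h s"
proof (rule analytic_continuation_open[where f = f and g = h and z = s and s = "{s. 1 < Re s}" and s' = "- {1}"])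
  show "open {s. 1 < Re s}" by (rule open_halfspace_Re_gt)
  show "open (- {1::complex})" by auto
  have "(2::complex) \<in> {s. 1 < Re s}" by simp
  then show "{s. 1 < Re s} \<noteq> {}" by blast
  show "connected (- {1::complex})" by (rule connected_punctured_universe) simp
  show "{s. 1 < Re s} \<subseteq> - {1}" by auto
  show "f holomorphic_on - {1}" "h holomorphic_on - {1}" "s \<in> - {1}"
    using assms by (auto simp: zeta_continuation_def)
  show "f z = h z" if "z \<in> {s. 1 < Re s}" for z
    using assms(1,2) that unfolding zeta_continuation_def mem_Collect_eq by (metis sums_unique2)
qed

definition falling :: "complex \<Rightarrow> nat \<Rightarrow> complex" where
  "falling w i = (\<Prod>j<i. w - of_nat j)"

lemma falling_Suc: "falling w (Suc i) = falling w i * (w - of_nat i)"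
  by (simp add: falling_def)

lemma binomial_Taylor_bound:
  fixes h W :: real
  assumes h: "0 \<le> h" "h \<le> 1" and W: "cmod w \<le> W"
  shows "cmod ((1 + of_real h) powr w - (\<Sum>i\<le>m. falling w i * of_real h ^ i / fact i))
           \<le> ((W + real m + 1) ^ Suc m * 2 powr W) * h ^ Suc m"
proof -
  define f where "f = (\<lambda>i z. falling w i * (1 + z) powr (w - of_nat i))"
  define B where "B = (W + real m + 1) ^ Suc m * 2 powr W"
  define S where "S = closed_segment (0::complex) 1"
  have W0: "0 \<le> W" using W norm_ge_zero order_trans by blast
  have S_re: "\<exists>u. 0 \<le> u \<and> u \<le> 1 \<and> z = of_real u" if "z \<in> S" for z
    using that by (auto simp: S_def closed_segment_def scaleR_conv_of_real)
  have B0: "0 \<le> B" using W0 unfolding B_def by (intro mult_nonneg_nonneg zero_le_power) auto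
  have "cmod (f 0 (of_real h) - (\<Sum>i\<le>m. f i 0 * (of_real h - 0) ^ i / fact i))
          \<le> B * cmod (of_real h - 0) ^ Suc m / fact m"
  proof (rule complex_Taylor)
    show "convex S" by (simp add: S_def)
    show "0 \<in> S" by (simp add: S_def)
    show "of_real h \<in> S" using h
      by (auto simp: S_def closed_segment_def scaleR_conv_of_real intro!: exI[of _ h])
    show "(f i has_field_derivative f (Suc i) x) (at x within S)" if xS: "x \<in> S" for i x
    proof -
      obtain u where u: "0 \<le> u" "x = of_real u" using S_re[OF xS] by metis
      have "0 < Re (1 + x)" using u by simp
      then have "1 + x \<notin> \<real>\<^sub>\<le>\<^sub>0" unfolding complex_nonpos_Reals_iff by linarith
      then have "((\<lambda>y. (1 + y) powr (w - of_nat i)) has_field_derivative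
          ((w - of_nat i) * (1 + x) powr (w - of_nat i - 1)) * (0 + 1)) (at x within S)"
        by (intro DERIV_chain2[OF has_field_derivative_powr] DERIV_add DERIV_const DERIV_ident)
      from DERIV_cmult[OF this, of "falling w i"]
      have "(f i has_field_derivative
          falling w i * (((w - of_nat i) * (1 + x) powr (w - of_nat i - 1)) * (0 + 1))) (at x within S)"
        by (simp only: f_def)
      moreover have "w - of_nat i - 1 = w - of_nat (Suc i)" by simp
      ultimately show ?thesis
        unfolding f_def falling_Suc by (simp only: mult.assoc add_0 mult_1_right)
    qed
    show "cmod (f (Suc m) x) \<le> B" if xS: "x \<in> S" for x
    proof -
      obtain u where u: "0 \<le> u" "u \<le> 1" "x = of_real u" using S_re[OF xS] by metis
      have "cmod (falling w (Suc m)) = (\<Prod>j<Suc m. cmod (w - of_nat j))"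
        unfolding falling_def by (simp only: prod_norm)
      also have "\<dots> \<le> (\<Prod>j<Suc m. W + real m + 1)"
      proof (rule prod_mono, safe)
        fix j assume "j < Suc m"
        have "cmod (w - of_nat j) \<le> cmod w + real j"
          using norm_triangle_ineq4[of w "of_nat j"] by simp
        then show "cmod (w - of_nat j) \<le> W + real m + 1" using W \<open>j < Suc m\<close> by linarith
      qed auto
      finally have 1: "cmod (falling w (Suc m)) \<le> (W + real m + 1) ^ Suc m" by simp
      have "cmod ((1 + x) powr (w - of_nat (Suc m))) = (1 + u) powr (Re w - real (Suc m))"
      proof -
        have "1 + x = of_real (1 + u)" using u by simp
        then show ?thesis using u norm_powr_real_powr'[of "1+u" "w - of_nat (Suc m)"]
          by (simp add: norm_powr_real_powr)
      qed
      also have "\<dots> \<le> (1 + u) powr W"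
        using u complex_Re_le_cmod[of w] W by (intro powr_mono) auto
      also have "\<dots> \<le> 2 powr W" using u W0 by (intro powr_mono2) auto
      finally have 2: "cmod ((1 + x) powr (w - of_nat (Suc m))) \<le> 2 powr W" .
      show ?thesis unfolding f_def B_def norm_mult
        using 1 2 W0 by (intro mult_mono) auto
    qed
  qed
  also have "\<dots> \<le> B * h ^ Suc m"
  proof -
    have "(1::real) \<le> fact m" by simp
    moreover have "0 \<le> B * h ^ Suc m" using B0 h by simp
    ultimately have "B * h ^ Suc m / fact m \<le> B * h ^ Suc m / 1" by (intro divide_left_mono) auto
    then show ?thesis using h by simp
  qed
  finally show ?thesis by (simp add: f_def B_def falling_def)
qed

lemma summable_Suc_powr:
  fixes a :: real
  assumes "a < -1"
  shows "summable (\<lambda>n. real (Suc n) powr a)"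
  using assms by (subst summable_Suc_iff) (simp add: summable_real_powr_iff)

lemma zeta_continuation_halfplane:
  "\<exists>g. g holomorphic_on {s. 1 - real K < Re s} \<and>
       (\<forall>s. 1 < Re s \<longrightarrow> (\<lambda>n. (s - 1) * of_nat (Suc n) powr (-s)) sums g s)"
proof (induction K)
  case 0
  define f where "f = (\<lambda>n s. (s - 1) * of_nat (Suc n) powr (- s) :: complex)"
  obtain g where g: "\<forall>s\<in>{s. 1 < Re s}. (\<lambda>n. f n s) sums g s \<and> g field_differentiable at s"
  proof (rule series_differentiable_comparison_complex[of "{s. 1 < Re s}" f])
    show "open {s. 1 < Re s}" by (rule open_halfspace_Re_gt)
    show "f n field_differentiable at x" for n x
    proof -
      have "(of_nat (Suc n) :: complex) \<noteq> 0" by (rule of_nat_neq_0)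
      then have "f n holomorphic_on UNIV"
        unfolding f_def by (intro holomorphic_intros)
      then show ?thesis by (simp add: holomorphic_on_def)
    qed
  next
    fix x :: complex assume x: "x \<in> {s. 1 < Re s}"
    define d where "d = (Re x - 1) / 2"
    define h where "h = (\<lambda>n. of_real ((cmod x + d + 1) * real (Suc n) powr (- (1 + d))) :: complex)"
    have d: "0 < d" using x by (simp add: d_def)
    have "summable (\<lambda>n. (cmod x + d + 1) * real (Suc n) powr (- (1 + d)))"
      using d by (intro summable_mult summable_Suc_powr) auto
    then have "summable h" unfolding h_def by (rule summable_of_real)
    moreover have "range h \<subseteq> \<real>\<^sub>\<ge>\<^sub>0"
      using d by (auto simp: h_def simp del: of_real_mult of_real_add)
    moreover have "cmod (f n y) \<le> cmod (h n)" if y: "y \<in> ball x d" for n y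
    proof -
      have n: "cmod (x - y) < d" using y by (simp add: dist_norm)
      have "cmod (y - 1) \<le> cmod (x - y) + cmod x + 1"
        using norm_triangle_ineq4[of y 1] norm_triangle_ineq4[of x "x - y"] by simp
      then have 1: "cmod (y - 1) \<le> cmod x + d + 1" using n by linarith
      have "Re x - Re y < d" using n complex_Re_le_cmod[of "x - y"] by simp
      then have "- Re y \<le> - (1 + d)" by (simp add: d_def field_simps)
      then have "real (Suc n) powr (- Re y) \<le> real (Suc n) powr (- (1 + d))"
        by (intro powr_mono) auto
      moreover have "cmod (of_nat (Suc n) powr (- y)) = real (Suc n) powr (- Re y)"
        using norm_powr_real_powr[of "of_nat (Suc n)" "- y"] by simp
      ultimately have "cmod (f n y) \<le> (cmod x + d + 1) * real (Suc n) powr (- (1 + d))"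
        unfolding f_def norm_mult using 1 d by (intro mult_mono) auto
      also have "\<dots> \<le> cmod (h n)" unfolding h_def norm_of_real by (rule abs_ge_self)
      finally show ?thesis .
    qed
    ultimately show "\<exists>d h. 0 < d \<and> summable h \<and> range h \<subseteq> \<real>\<^sub>\<ge>\<^sub>0 \<and>
      (\<forall>\<^sub>F n in sequentially. \<forall>y\<in>ball x d \<inter> {s. 1 < Re s}. cmod (f n y) \<le> cmod (h n))"
      using d by (intro exI[of _ d] exI[of _ h]) auto
  qed
  then show ?case
    by (intro exI[of _ g]) (auto simp: holomorphic_on_def f_def field_differentiable_at_within)
next
  case (Suc K)
  then obtain g where
    g_hol: "g holomorphic_on {s. 1 - real K < Re s}" and
    g_sums: "\<And>s. 1 < Re s \<Longrightarrow> (\<lambda>n. (s - 1) * of_nat (Suc n) powr (-s)) sums g s"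
    by blast
  define S where "S = {s. - real K < Re s}"
  define x where "x = (\<lambda>n. of_nat (Suc n) :: complex)"
  define r where "r = (\<lambda>n s. x (Suc n) powr (1 - s)
      - (\<Sum>i\<le>Suc K. falling (1 - s) i * x n powr (1 - s - of_nat i) / fact i))"
  have x0: "x n \<noteq> 0" for n
    unfolding x_def by (metis of_nat_neq_0)
  have fh: "(\<lambda>s. falling (1 - s) i) holomorphic_on A" for i A
    unfolding falling_def by (intro holomorphic_intros)
  have r_bound: "cmod (r n s) \<le> ((W + real (Suc K) + 1) ^ Suc (Suc K) * 2 powr W) *
      real (Suc n) powr (- 1 - Re s - real K)" if "cmod (1 - s) \<le> W" for n s W
  proof -
    define h where "h = 1 / real (Suc n)"
    define w where "w = 1 - s"
    have h: "0 \<le> h" "h \<le> 1" by (auto simp: h_def)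
    have hx: "of_real h = 1 / x n" by (simp add: h_def x_def)
    have "x (Suc n) = of_real (real (Suc n)) * (of_real (1 + h) :: complex)"
      by (simp add: x_def h_def field_simps del: of_nat_Suc)
         (simp add: algebra_simps)
    then have "x (Suc n) powr w = x n powr w * (1 + of_real h) powr w"
      using h by (simp add: powr_times_real x_def del: of_nat_Suc)
    moreover have "x n powr (w - of_nat i) = x n powr w * of_real h ^ i" for i
      using x0[of n] by (simp add: powr_diff powr_nat' hx power_divide)
    ultimately have "r n s = x n powr w *
        ((1 + of_real h) powr w - (\<Sum>i\<le>Suc K. falling w i * of_real h ^ i / fact i))"
      unfolding r_def w_def[symmetric] right_diff_distrib sum_distrib_left
      by (simp only: mult_ac times_divide_eq_right)
    then have "cmod (r n s) = real (Suc n) powr Re w *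
        cmod ((1 + of_real h) powr w - (\<Sum>i\<le>Suc K. falling w i * of_real h ^ i / fact i))"
      using norm_powr_real_powr[of "x n" w] by (simp add: norm_mult x_def)
    also have "\<dots> \<le> real (Suc n) powr Re w *
        (((W + real (Suc K) + 1) ^ Suc (Suc K) * 2 powr W) * h ^ Suc (Suc K))"
      using that h by (intro mult_left_mono binomial_Taylor_bound) (auto simp: w_def)
    also have "\<dots> = ((W + real (Suc K) + 1) ^ Suc (Suc K) * 2 powr W) *
        (real (Suc n) powr Re w * real (Suc n) powr (- real (Suc (Suc K))))"
    proof -
      have "h ^ Suc (Suc K) = real (Suc n) powr (- real (Suc (Suc K)))"
        unfolding powr_minus by (subst powr_realpow) (auto simp: h_def power_one_over inverse_eq_divide)
      then show ?thesis by (simp only: mult_ac)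
    qed
    also have "real (Suc n) powr Re w * real (Suc n) powr (- real (Suc (Suc K)))
                 = real (Suc n) powr (- 1 - Re s - real K)"
      unfolding powr_add[symmetric] by (simp add: w_def algebra_simps)
    finally show ?thesis .
  qed
  obtain R where R: "\<forall>s\<in>S. (\<lambda>n. r n s) sums R s \<and> R field_differentiable at s"
  proof (rule series_differentiable_comparison_complex[of S r])
    show "open S" unfolding S_def by (rule open_halfspace_Re_gt)
    show "r n field_differentiable at s" for n s
    proof -
      have "r n holomorphic_on UNIV"
        unfolding r_def using x0 by (intro holomorphic_intros fh) auto
      then show ?thesis by (simp add: holomorphic_on_def)
    qed
  next
    fix s0 assume s0: "s0 \<in> S"
    define d where "d = (Re s0 + real K) / 2"
    define W where "W = cmod s0 + d + 1"
    define C where "C = (W + real (Suc K) + 1) ^ Suc (Suc K) * 2 powr W"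
    define h where "h = (\<lambda>n. of_real (C * real (Suc n) powr (- 1 - d)) :: complex)"
    have d: "0 < d" using s0 by (simp add: d_def S_def)
    have C: "0 \<le> C" using d by (simp add: C_def W_def)
    have "summable (\<lambda>n. C * real (Suc n) powr (- 1 - d))"
      using d by (intro summable_mult summable_Suc_powr) auto
    then have "summable h" unfolding h_def by (rule summable_of_real)
    moreover have "range h \<subseteq> \<real>\<^sub>\<ge>\<^sub>0"
      using C by (auto simp: h_def simp del: of_real_mult)
    moreover have "cmod (r n y) \<le> cmod (h n)" if y: "y \<in> ball s0 d" for n y
    proof -
      have n: "cmod (s0 - y) < d" using y by (simp add: dist_norm)
      have "cmod (1 - y) \<le> cmod (s0 - y) + cmod s0 + 1"
        using norm_triangle_ineq4[of 1 y] norm_triangle_ineq4[of s0 "s0 - y"] by simp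
      then have "cmod (1 - y) \<le> W" using n unfolding W_def by linarith
      then have "cmod (r n y) \<le> C * real (Suc n) powr (- 1 - Re y - real K)"
        unfolding C_def by (rule r_bound)
      also have "Re s0 - Re y < d" using n complex_Re_le_cmod[of "s0 - y"] by simp
      then have "- 1 - Re y - real K \<le> - 1 - d" by (simp add: d_def field_simps)
      then have "C * real (Suc n) powr (- 1 - Re y - real K) \<le> C * real (Suc n) powr (- 1 - d)"
        using C by (intro mult_left_mono powr_mono) auto
      also have "\<dots> \<le> cmod (h n)" unfolding h_def norm_of_real by (rule abs_ge_self)
      finally show ?thesis .
    qed
    ultimately show "\<exists>d h. 0 < d \<and> summable h \<and> range h \<subseteq> \<real>\<^sub>\<ge>\<^sub>0 \<and>
      (\<forall>\<^sub>F n in sequentially. \<forall>y\<in>ball s0 d \<inter> S. cmod (r n y) \<le> cmod (h n))"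
      using d by (intro exI[of _ d] exI[of _ h]) auto
  qed
  define G where "G = (\<lambda>s. 1 + R s -
    (\<Sum>j<K. falling (1 - s) (Suc j) / fact (Suc (Suc j)) * g (s + of_nat (Suc j))))"
  have "G holomorphic_on S"
  proof -
    have "R holomorphic_on S"
      using R by (auto simp: holomorphic_on_def field_differentiable_at_within)
    moreover have "(\<lambda>s. g (s + of_nat (Suc j))) holomorphic_on S" for j
    proof -
      have "(g \<circ> (\<lambda>s. s + of_nat (Suc j))) holomorphic_on S"
        by (rule holomorphic_on_compose_gen[OF _ g_hol])
           (auto intro!: holomorphic_intros simp: S_def)
      then show ?thesis by (simp add: o_def)
    qed
    ultimately show ?thesis unfolding G_def by (intro holomorphic_intros fh) auto
  qed
  moreover have "(\<lambda>n. (s - 1) * of_nat (Suc n) powr (- s)) sums G s" if s: "1 < Re s" for s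
  proof -
    define w where "w = 1 - s"
    have "(\<lambda>n. x n powr w) \<longlonglongrightarrow> 0"
    proof (rule tendsto_norm_zero_cancel)
      have "(\<lambda>n. real (Suc n) powr Re w) \<longlonglongrightarrow> 0"
        using s unfolding w_def
        by (intro tendsto_neg_powr filterlim_compose[OF filterlim_real_sequentially filterlim_Suc]) auto
      moreover have "cmod (x n powr w) = real (Suc n) powr Re w" for n
        using norm_powr_real_powr[of "x n" w] by (simp add: x_def)
      ultimately show "(\<lambda>n. cmod (x n powr w)) \<longlonglongrightarrow> 0" by simp
    qed
    then have tel: "(\<lambda>n. x (Suc n) powr w - x n powr w) sums (0 - x 0 powr w)"
      by (rule telescope_sums)
    have x00: "x 0 powr w = 1" by (simp add: x_def)
    have term_sums: "(\<lambda>n. falling w (Suc (Suc j)) * x n powr (w - of_nat (Suc (Suc j))) / fact (Suc (Suc j)))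
        sums (- (falling w (Suc j) / fact (Suc (Suc j)) * g (s + of_nat (Suc j))))" for j
    proof -
      have "1 < Re (s + of_nat (Suc j))" using s by simp
      note sums = sums_mult[OF g_sums[OF this], of "- (falling w (Suc j) / fact (Suc (Suc j)))"]
      have e1: "w - of_nat (Suc j) = - (s + of_nat (Suc j) - 1)"
        and e2: "w - of_nat (Suc (Suc j)) = - (s + of_nat (Suc j))"
        by (simp_all add: w_def)
      have "falling w (Suc (Suc j)) * x n powr (w - of_nat (Suc (Suc j))) / fact (Suc (Suc j)) =
          - (falling w (Suc j) / fact (Suc (Suc j))) *
            ((s + of_nat (Suc j) - 1) * of_nat (Suc n) powr - (s + of_nat (Suc j)))" for n
        unfolding falling_Suc[of w "Suc j"] e1 e2 x_def
        by (simp only: mult_minus_left mult_minus_right minus_divide_left[symmetric]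
            times_divide_eq_left times_divide_eq_right mult.assoc)
      then show ?thesis using sums by simp
    qed
    have R': "(\<lambda>n. r n s) sums R s" using R s by (auto simp: S_def)
    have eq: "(s - 1) * of_nat (Suc n) powr (- s) =
        r n s - (x (Suc n) powr w - x n powr w) +
        (\<Sum>j<K. falling w (Suc (Suc j)) * x n powr (w - of_nat (Suc (Suc j))) / fact (Suc (Suc j)))" for n
    proof -
      have "(\<Sum>i\<le>Suc K. falling w i * x n powr (w - of_nat i) / fact i) =
        x n powr w + w * x n powr (w - 1) +
        (\<Sum>j<K. falling w (Suc (Suc j)) * x n powr (w - of_nat (Suc (Suc j))) / fact (Suc (Suc j)))"
        unfolding lessThan_Suc_atMost[symmetric] sum.lessThan_Suc_shift
        by (simp add: falling_def del: prod.lessThan_Suc)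
      then show ?thesis by (simp add: r_def w_def x_def algebra_simps)
    qed
    have "(\<lambda>n. r n s - (x (Suc n) powr w - x n powr w) +
        (\<Sum>j<K. falling w (Suc (Suc j)) * x n powr (w - of_nat (Suc (Suc j))) / fact (Suc (Suc j))))
        sums (R s - (0 - x 0 powr w) +
          (\<Sum>j<K. - (falling w (Suc j) / fact (Suc (Suc j)) * g (s + of_nat (Suc j)))))"
      by (intro sums_add sums_diff R' tel sums_sum term_sums)
    moreover have "R s - (0 - x 0 powr w) +
        (\<Sum>j<K. - (falling w (Suc j) / fact (Suc (Suc j)) * g (s + of_nat (Suc j)))) = G s"
      unfolding x00 G_def w_def[symmetric] sum_negf by simp
    ultimately show ?thesis by (simp only: eq)
  qed
  ultimately show ?case unfolding S_def by (intro exI[of _ G]) auto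
qed

lemma zeta_continuation_exists: "\<exists>f. zeta_continuation f"
proof -
  obtain g where
    g_hol: "\<And>K. g K holomorphic_on {s. 1 - real K < Re s}" and
    g_sums: "\<And>K s. 1 < Re s \<Longrightarrow> (\<lambda>n. (s - 1) * of_nat (Suc n) powr (-s)) sums g K s"
    using zeta_continuation_halfplane by metis
  have agree: "g K s = g L s" if "K \<le> L" "1 - real K < Re s" for K L s
  proof (rule analytic_continuation_open[where f = "g K" and g = "g L" and z = s
        and s = "{s. 1 < Re s}" and s' = "{s. 1 - real K < Re s}"])
    show "open {s. 1 < Re s}" "open {s. 1 - real K < Re s}" by (rule open_halfspace_Re_gt)+
    have "(2::complex) \<in> {s. 1 < Re s}" by simp
    then show "{s. 1 < Re s} \<noteq> {}" by blast
    show "connected {s. 1 - real K < Re s}"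
      by (intro convex_connected convex_halfspace_Re_gt)
    show "g L holomorphic_on {s. 1 - real K < Re s}"
      by (rule holomorphic_on_subset[OF g_hol[of L]]) (use that in auto)
    show "g K z = g L z" if "z \<in> {s. 1 < Re s}" for z
      using g_sums that sums_unique2 by blast
  qed (use that g_hol in auto)
  define k where "k = (\<lambda>s. nat \<lceil>2 - Re s\<rceil>)"
  define f where "f = (\<lambda>s. g (k s) s / (s - 1))"
  have k: "1 - real (k s) < Re s" for s
    unfolding k_def by linarith
  have f_eq: "f s = g K s / (s - 1)" if "1 - real K < Re s" for K s
    
  proof -
    have "g K s = g (k s) s"
      using agree[OF _ that] agree[OF _ k] by (metis nat_le_linear)
    then show ?thesis by (simp only: f_def)
  qed
  have "f holomorphic_on - {1}"
  proof (subst holomorphic_on_open)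
    show "\<forall>s\<in>- {1}. \<exists>f'. (f has_field_derivative f') (at s)"
    proof
      fix s :: complex assume s: "s \<in> - {1}"
      define A where "A = {z. 1 - real (k s) < Re z} - {1}"
      have A: "open A" unfolding A_def by (intro open_Diff open_halfspace_Re_gt) auto
      have "(\<lambda>z. g (k s) z / (z - 1)) holomorphic_on A"
        by (intro holomorphic_intros holomorphic_on_subset[OF g_hol[of "k s"]]) (auto simp: A_def)
      then have "f holomorphic_on A"
        by (rule holomorphic_transform) (auto simp: f_eq A_def)
      moreover have "s \<in> A" using s k by (auto simp: A_def)
      ultimately show "\<exists>f'. (f has_field_derivative f') (at s)"
        using A holomorphic_on_open by blast
    qed
  qed auto
  moreover have "(\<lambda>n. of_nat (Suc n) powr (- s)) sums f s" if s: "1 < Re s" for s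
  proof -
    have "s \<noteq> 1" using s by auto
    then show ?thesis
      using sums_divide[OF g_sums[OF s, of "k s"], of "s - 1"] by (simp add: f_def)
  qed
  ultimately show ?thesis unfolding zeta_continuation_def by blast
qed

lemma zeta_continuation_zeta: "zeta_continuation zeta"
  unfolding zeta_def by (rule someI_ex[OF zeta_continuation_exists])

definition riemann_hypothesis :: bool where
  "riemann_hypothesis \<longleftrightarrow> (\<forall>s. zeta s = 0 \<and> 0 < Re s \<and> Re s < 1 \<longrightarrow> Re s = 1 / 2)"

text \<open>
  Extended-real valued, so that a zero of zeta contributes minus infinity to a maximum rather
  than the conventional value \<open>ln 0 = 0\<close>.
\<close>

definition ln_abs_zeta_half :: "real \<Rightarrow> ereal" where
  "ln_abs_zeta_half t =
     (if zeta (Complex (1/2) t) = 0 then - \<infinity> else ereal (ln (cmod (zeta (Complex (1/2) t)))))"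

text \<open>
  The supremum is a maximum: zeta is continuous on the critical line, so \<open>ln_abs_zeta_half\<close> is
  continuous as an extended-real valued function.
\<close>

definition max_ln_abs_zeta_half :: "real \<Rightarrow> real \<Rightarrow> ereal" where
  "max_ln_abs_zeta_half a b = (SUP t\<in>{a..b}. ln_abs_zeta_half t)"

subsection \<open>The Fourier transform and the lower bounds\<close>

definition fourier :: "(complex \<Rightarrow> complex) \<Rightarrow> real \<Rightarrow> complex" where
  "fourier \<Phi> lam = (\<integral>u. \<Phi> (of_real u) * exp (- (\<i> * of_real lam * of_real u)) \<partial>lborel)"

text \<open>
  Below, the transform is assumed to be real on the real line, so \<open>Re\<close> loses nothing.
\<close>

definition mu_star :: "(complex \<Rightarrow> complex) \<Rightarrow> real \<Rightarrow> real \<Rightarrow> real" where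
  "mu_star \<Phi> \<alpha> \<tau> =
     (let \<kappa> = max 61 (4 / \<alpha>) in
      1 / (10 * \<alpha>) * (Re (fourier \<Phi> \<alpha>) / Re (fourier \<Phi> 0)) * sqrt (ln \<kappa> / \<kappa>) *
      (exp (0.5 * \<alpha> * \<tau>) / \<tau>))"

definition mu_star_star :: "(complex \<Rightarrow> complex) \<Rightarrow> real \<Rightarrow> real \<Rightarrow> real" where
  "mu_star_star \<Phi> \<alpha> \<tau> =
     (let \<kappa> = max 0.5 (4 / \<alpha>) in
      1 / (6 * sqrt (\<alpha> * \<kappa>)) * (Re (fourier \<Phi> \<alpha>) / Re (fourier \<Phi> 0)) *
      (exp (0.25 * \<alpha> * \<tau>) / sqrt \<tau>))"

end

theory Submission
  imports Defs "HOL-Number_Theory.Number_Theory" "HOL-Probability.Probability" "HOL-Real_Asymp.Real_Asymp"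
begin

text \<open>
  Under the Riemann hypothesis the logarithm of \<open>zeta\<close> is analytic to the right of the critical line, up
  to the cut at 1. Shifting the line of integration expresses the mean of \<open>ln \<bar>zeta (1/2 + i(t + u/\<tau>))\<bar>\<close>
  against \<open>\<Phi>(u)\<close> as a Dirichlet polynomial over prime powers with weights \<open>fourier \<Phi> (ln n / \<tau>)\<close>;
  the decay of the transform cuts it off and the decay of \<open>\<Phi>\<close> localises it. If \<open>ln \<bar>zeta\<bar>\<close> were below
  \<open>\<mu>\<close> on the interval, the polynomial would be at most \<open>\<mu> * fourier \<Phi> 0 + O(\<tau>\<^sup>2)\<close> for all \<open>t\<close>.
  Averaging over \<open>t\<close> against a resonator supported on products of \<open>k\<close> or \<open>k + 1\<close> primes up to
  \<open>exp (\<alpha> \<tau>)\<close>, where \<open>fourier \<Phi> \<ge> fourier \<Phi> \<alpha>\<close>, produces a larger value: equal weights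
  give \<open>mu_star\<close>, weights \<open>p powr (- 1/2)\<close> give \<open>mu_star_star\<close>.
\<close>

subsection \<open>Chebyshev bounds and reciprocals of primes\<close>

text \<open>The critical line may carry zeros, so every mean is taken on
  \<open>Re s = 1/2 + \<epsilon>\<close>, and \<epsilon> tends to 0 only in the finite Dirichlet
  polynomial. A bound for \<open>zeta\<close> on the critical line passes to nearby lines by uniform
  continuity, with \<mu> + 1 in place of \<mu>. The pole is removed by adding
  \<open>pole_log\<close>; its mean is controlled because \<Phi> stays bounded, uniformly in \<tau>,
  on the relevant strip far from the origin. The strip bounds do not yield this, as their constants
  depend on \<tau>; Fourier inversion does. The equation for \<tau> balances lengths. With L =
  \<phi>(\<tau>/2 + 1) and e = exp (\<gamma> \<alpha> \<tau>), where \<gamma> is 1 or 1/2, it says H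
  = exp (e L). The polynomial has about exp (\<tau> L) terms and the resonator uses integers up to
  exp (e L / 4), both small powers of H, so an interval of length H/2 separates all frequencies. The
  argument \<tau>/2 + 1 is the one that makes the discarded terms at most n powr (- 1 - 1/\<tau>),
  with sum O(\<tau>). All errors are O(\<open>\<tau>\<^sup>2\<close>), negligible against an
  exponential of \<tau>.\<close>

lemma ln_fact_mangoldt:
  "ln (fact n :: real) = (\<Sum>d=1..n. mangoldt d * real (n div d))"
proof (induction n)
  case (Suc n)
  have "d \<in> {1..Suc n}" if "d dvd Suc n" for d
    using dvd_imp_le[OF that] dvd_pos_nat[OF _ that] by simp
  then have "{d \<in> {1..Suc n}. d dvd Suc n} = {d. d dvd Suc n}"
    by (intro Collect_cong) blast
  then have "(\<Sum>d | d \<in> {1..Suc n} \<and> d dvd Suc n. mangoldt d) = ln (real (Suc n))"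
    using mangoldt_sum[of "Suc n", where 'a = real] by simp
  then have "(\<Sum>d=1..Suc n. if d dvd Suc n then mangoldt d else 0) = ln (real (Suc n))"
    by (subst sum.inter_filter[symmetric]) auto
  \<comment> \<open>\<open>Suc n div d\<close> exceeds \<open>n div d\<close>, by one, exactly for
    the divisors d of \<open>Suc n\<close>.\<close>
  moreover have "(\<Sum>d=1..Suc n. mangoldt d * real (Suc n div d)) =
      (\<Sum>d=1..Suc n. mangoldt d * real (n div d)) + (\<Sum>d=1..Suc n. if d dvd Suc n then mangoldt d else 0)"
    unfolding sum.distrib[symmetric]
    by (intro sum.cong) (auto simp: div_Suc dvd_eq_mod_eq_0 algebra_simps)
  moreover have "(\<Sum>d=1..Suc n. mangoldt d * real (n div d)) = ln (fact n)"
    using Suc by simp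
  moreover have "ln (fact (Suc n) :: real) = ln (real (Suc n)) + ln (fact n)"
    unfolding fact_Suc by (rule ln_mult_pos) auto
  ultimately show ?case by linarith
qed simp

text \<open>A bound for Chebyshev's psi function: a prime p has at most ln N / ln p powers up to N,
  each of weight ln p, so together they contribute at most ln N.\<close>

lemma sum_mangoldt_le:
  "(\<Sum>d=1..N. mangoldt d) \<le> real (card {p. prime p \<and> p \<le> N}) * ln (real N)"
proof -
  define P where "P = {p. prime p \<and> p \<le> N}"
  define A where "A = {d \<in> {1..N}. primepow d}"
  have finP: "finite P" by (simp add: P_def)
  have ap: "prime (aprimedivisor d)" "aprimedivisor d \<in> P" if "d \<in> A" for d
  proof -
    have d: "d > Suc 0" using that primepow_gt_Suc_0[of d] by (auto simp: A_def)
    then show pr: "prime (aprimedivisor d)"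
      by (intro prime_aprimedivisor') auto
    have "aprimedivisor d \<le> d" using d by (intro dvd_imp_le aprimedivisor_dvd') auto
    then show "aprimedivisor d \<in> P" using pr that by (auto simp: P_def A_def)
  qed
  have "(\<Sum>d=1..N. mangoldt d) = (\<Sum>d\<in>A. ln (real (aprimedivisor d)))"
    by (intro sum.mono_neutral_cong_right) (auto simp: A_def mangoldt_def)
  also have "\<dots> = (\<Sum>p\<in>P. \<Sum>d | d \<in> A \<and> aprimedivisor d = p. ln (real (aprimedivisor d)))"
    using ap finP by (intro sum.group[symmetric]) (auto simp: A_def)
  also have "\<dots> \<le> (\<Sum>p\<in>P. ln (real N))"
  proof (rule sum_mono)
    fix p assume p: "p \<in> P"
    then have p1: "prime p" "1 < real p" "p \<le> N" by (auto simp: P_def prime_gt_Suc_0_nat)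
    define K where "K = nat \<lfloor>ln (real N) / ln (real p)\<rfloor>"
    have lnp: "0 < ln (real p)" using p1 by simp
    have N0: "0 < N" using p1 by linarith
    have "{d. d \<in> A \<and> aprimedivisor d = p} \<subseteq> (\<lambda>k. p ^ k) ` {1..K}"
    proof safe
      fix d assume d: "d \<in> A" and pd: "p = aprimedivisor d"
      have pp: "primepow d" using d by (simp add: A_def)
      define k where "k = multiplicity p d"
      have dk: "d = p ^ k" using primepow_decompose[OF pp] pd by (simp add: k_def)
      have "d \<noteq> 1" using pp by auto
      then have "1 \<le> k" using dk by (cases k) auto
      have "ln (real d) \<le> ln (real N)" using d N0 by (auto simp: A_def)
      then have "real k * ln (real p) \<le> ln (real N)" using p1 by (simp add: dk ln_realpow)
      then have "real k \<le> ln (real N) / ln (real p)" using lnp by (simp add: pos_le_divide_eq)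
      then have "k \<le> K" unfolding K_def by (simp add: le_nat_floor)
      then show "d \<in> (\<lambda>k. aprimedivisor d ^ k) ` {1..K}" using dk \<open>1 \<le> k\<close> pd by auto
    qed
    then have "card {d. d \<in> A \<and> aprimedivisor d = p} \<le> card {1..K}"
      by (meson card_image_le card_mono finite_atLeastAtMost finite_imageI le_trans)
    then have "real (card {d. d \<in> A \<and> aprimedivisor d = p}) \<le> real K" by simp
    also have "\<dots> \<le> ln (real N) / ln (real p)"
      using lnp N0 unfolding K_def by (intro of_nat_floor) auto
    finally have "real (card {d. d \<in> A \<and> aprimedivisor d = p}) * ln (real p) \<le> ln (real N)"
      using lnp by (simp add: pos_le_divide_eq)
    then show "(\<Sum>d | d \<in> A \<and> aprimedivisor d = p. ln (real (aprimedivisor d))) \<le> ln (real N)"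
      by simp
  qed
  finally show ?thesis by (simp add: P_def)
qed

text \<open>Chebyshev's argument. The central binomial coefficient is at least 4^n / (2n), while in
  the expansion of its logarithm by \<open>ln_fact_mangoldt\<close> the weight of d is floor(2n/d) -
  2 floor(n/d), which is at most 1; so the logarithm is at most the psi function at 2n.\<close>

lemma card_primes_lower:
  assumes "n > 0"
  shows "real n * ln 4 - ln (2 * real n) \<le> real (card {p. prime p \<and> p \<le> 2 * n}) * ln (2 * real n)"
proof -
  have "4 ^ n / (2 * real n) \<le> real (2 * n choose n)"
    using central_binomial_lower_bound[OF assms] by simp
  moreover have "0 < 4 ^ n / (2 * real n)" using assms by simp
  ultimately have "ln (4 ^ n / (2 * real n)) \<le> ln (real (2 * n choose n))"
    by (subst ln_le_cancel_iff) linarith+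
  then have "real n * ln 4 - ln (2 * real n) \<le> ln (real (2 * n choose n))"
    using assms by (simp add: ln_div ln_realpow)
  also have "real (2 * n choose n) = fact (2 * n) / (fact n * fact n)"
    by (subst binomial_fact) auto
  also have "ln \<dots> = ln (fact (2 * n)) - 2 * ln (fact n)"
    by (simp add: ln_div ln_mult)
  also have "ln (fact n :: real) = (\<Sum>d=1..2*n. mangoldt d * real (n div d))"
    unfolding ln_fact_mangoldt by (intro sum.mono_neutral_left) auto
  also have "ln (fact (2*n)) - 2 * \<dots> = (\<Sum>d=1..2*n. mangoldt d * (real (2 * n div d) - 2 * real (n div d)))"
    unfolding ln_fact_mangoldt sum_distrib_left sum_subtractf[symmetric]
    by (intro sum.cong) (auto simp: algebra_simps)
  also have "\<dots> \<le> (\<Sum>d=1..2*n. mangoldt d * 1)"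
  proof (intro sum_mono mult_left_mono mangoldt_nonneg)
    fix d assume "d \<in> {1..2*n}"
    then have "n < (n div d + 1) * d" using dividend_less_div_times[of d n] by (simp add: algebra_simps)
    then have "2 * n < (2 * (n div d) + 2) * d" by (simp add: algebra_simps)
    then have "2 * n div d < 2 * (n div d) + 2"
      by (simp add: less_mult_imp_div_less)
    then have "2 * n div d \<le> 2 * (n div d) + 1" by linarith
    then have "real (2 * n div d) \<le> real (2 * (n div d) + 1)" by (simp only: of_nat_le_iff)
    then show "real (2 * n div d) - 2 * real (n div d) \<le> 1" by simp
  qed
  finally show ?thesis using sum_mangoldt_le[of "2 * n"] by simp
qed

definition primes_upto :: "real \<Rightarrow> nat set" where
  "primes_upto y = {p. prime p \<and> real p \<le> y}"

lemma finite_primes_upto [simp]: "finite (primes_upto y)"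
proof (rule finite_subset)
  show "primes_upto y \<subseteq> {..nat \<lfloor>y\<rfloor>}" by (auto simp: primes_upto_def le_nat_floor)
qed simp

lemma card_primes_upto_le: "0 \<le> y \<Longrightarrow> real (card (primes_upto y)) \<le> y"
proof -
  assume y: "0 \<le> y"
  have "primes_upto y \<subseteq> {1..nat \<lfloor>y\<rfloor>}"
    by (auto simp: primes_upto_def le_nat_floor Suc_le_eq prime_gt_0_nat)
  then have "card (primes_upto y) \<le> nat \<lfloor>y\<rfloor>" using card_mono[of "{1..nat \<lfloor>y\<rfloor>}"] by fastforce
  then show ?thesis using y by linarith
qed

text \<open>Since \<open>ln 4\<close> is at least 4/3, the previous bound at n = floor(y/2) has main
  term 2y/3; lowering the constant to 1/2 absorbs the rounding and the logarithm.\<close>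

lemma card_primes_upto_ge:
  "eventually (\<lambda>y. y / 2 \<le> real (card (primes_upto y)) * ln y) at_top"
proof -
  have "eventually (\<lambda>y::real. y / 2 \<le> (y / 2 - 1) * (4/3) - ln y) at_top"
    by real_asymp
  then show ?thesis using eventually_ge_at_top[of 4]
  proof eventually_elim
    case (elim y)
    define n where "n = nat \<lfloor>y / 2\<rfloor>"
    have n: "real n \<le> y / 2" "y / 2 - 1 \<le> real n" "n > 0" using elim by (auto simp: n_def le_nat_iff) linarith
    have ln4: "4 / 3 \<le> ln (4::real)"
      using ln2_ge_two_thirds ln_realpow[of 2 2] by simp
    have lnn: "ln (2 * real n) \<le> ln y" "0 \<le> ln (2 * real n)" using n by auto
    have "y / 2 \<le> (y / 2 - 1) * (4/3) - ln y" using elim by simp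
    also have "\<dots> \<le> real n * ln 4 - ln (2 * real n)"
      using n ln4 lnn elim by (intro diff_mono mult_mono) auto
    also have "\<dots> \<le> real (card {p. prime p \<and> p \<le> 2 * n}) * ln (2 * real n)"
      by (rule card_primes_lower) fact
    also have "\<dots> \<le> real (card (primes_upto y)) * ln y"
    proof (intro mult_mono lnn)
      have "{p. prime p \<and> p \<le> 2 * n} \<subseteq> primes_upto y"
      proof safe
        fix p assume "prime p" "p \<le> 2 * n"
        then have "real p \<le> real (2 * n)" by (simp only: of_nat_le_iff)
        then show "p \<in> primes_upto y" using n \<open>prime p\<close> by (simp add: primes_upto_def)
      qed
      then show "real (card {p. prime p \<and> p \<le> 2 * n}) \<le> real (card (primes_upto y))"
        by (simp add: card_mono)
    qed auto
    finally show ?case .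
  qed
qed

lemma ln_le_sum_inverse:
  assumes "0 < a" "a \<le> b"
  shows "ln (real (Suc b) / real (Suc a)) \<le> (\<Sum>m=a..<b. 1 / real (Suc m))"
  using assms(2)
proof (induction b rule: dec_induct)
  case (step n)
  have "ln (real (Suc (Suc n)) / real (Suc n)) \<le> real (Suc (Suc n)) / real (Suc n) - 1"
    by (intro ln_le_minus_one) auto
  also have "\<dots> = 1 / real (Suc n)" by (simp add: field_simps)
  finally have "ln (real (Suc (Suc n)) / real (Suc n)) \<le> 1 / real (Suc n)" .
  moreover have "ln (real (Suc (Suc n)) / real (Suc a)) =
      ln (real (Suc n) / real (Suc a)) + ln (real (Suc (Suc n)) / real (Suc n))"
    by (simp add: ln_div)
  moreover have "(\<Sum>m=a..<Suc n. 1 / real (Suc m)) = (\<Sum>m=a..<n. 1 / real (Suc m)) + 1 / real (Suc n)"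
    using step by (simp add: sum.atLeastLessThan_Suc)
  ultimately show ?case using step.IH by linarith
qed simp

lemma sum_telescope_inverse:
  assumes "0 < p" "p \<le> b"
  shows "(\<Sum>m=p..<b. 1 / (real m * real (Suc m))) = 1 / real p - 1 / real b"
  using assms(2)
proof (induction b rule: dec_induct)
  case (step n)
  then have "0 < n" using assms by linarith
  then have "1 / (real n * real (Suc n)) = 1 / real n - 1 / real (Suc n)"
    by (simp add: field_simps)
  moreover have "(\<Sum>m=p..<Suc n. 1 / (real m * real (Suc m))) =
      (\<Sum>m=p..<n. 1 / (real m * real (Suc m))) + 1 / (real n * real (Suc n))"
    using step by (simp add: sum.atLeastLessThan_Suc)
  ultimately show ?case using step.IH by linarith
qed simp

text \<open>Partial summation: \<open>1 / p \<ge> (\<Sum>m=p..n. 1 / (m (m + 1)))\<close> turns the lower bound for the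
  number of primes up to \<open>m\<close> into a lower bound for the sum of reciprocals.\<close>

lemma sum_inverse_primes_ge:
  "eventually (\<lambda>y. 1 / 16 \<le> (\<Sum>p\<in>primes_upto y - primes_upto (y powr (3/5)). 1 / real p)) at_top"
proof -
  obtain y0 where y0: "\<And>y. y \<ge> y0 \<Longrightarrow> y / 2 \<le> real (card (primes_upto y)) * ln y"
    using card_primes_upto_ge unfolding eventually_at_top_linorder by blast
  have e1: "eventually (\<lambda>y::real. y0 \<le> 8 * y powr (3/5) * ln y) at_top" by real_asymp
  have e2: "eventually (\<lambda>y::real. ln y / 4 \<le> ln (y / (8 * y powr (3/5) * ln y + 2))) at_top" by real_asymp
  have e3: "eventually (\<lambda>y::real. 1 \<le> 8 * y powr (3/5) * ln y) at_top" by real_asymp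
  have e4: "eventually (\<lambda>y::real. 8 * y powr (3/5) * ln y + 2 \<le> y) at_top" by real_asymp
  show ?thesis using e1 e2 e3 e4 eventually_ge_at_top[of 3]
  proof eventually_elim
    case (elim y)
    define x where "x = y powr (3/5)"
    define n where "n = nat \<lfloor>y\<rfloor>"
    \<comment> \<open>From m = a on, discarding the primes up to x costs at most m/8 of the m/2 in
      the Chebyshev bound, so Q keeps at least m / (4 ln y) primes up to m. The sum of 1/m from a to
      y is about 2/5 of ln y, of which 1/4 is used; hence 1/16.\<close>
    define a where "a = nat \<lceil>8 * x * ln y\<rceil>"
    define Q where "Q = primes_upto y - primes_upto x"
    have lny: "1 \<le> ln y"
    proof -
      have "exp 1 \<le> y" using exp_le elim by linarith
      then show ?thesis using ln_ge_iff[of y 1] elim by linarith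
    qed
    have ge1: "1 \<le> 8 * x * ln y" and le_y: "8 * x * ln y + 2 \<le> y" and x0: "0 < x"
      using elim by (auto simp: x_def)
    have n: "real n \<le> y" "y < real (Suc n)" using elim unfolding n_def by linarith+
    have a: "8 * x * ln y \<le> real a" "real a \<le> 8 * x * ln y + 1" "0 < a"
      using ge1 unfolding a_def by linarith+
    have "real a \<le> real n" using a n le_y by linarith
    then have an: "a \<le> Suc n" by simp
    have finQ: "finite Q" by (simp add: Q_def)
    have Qn: "0 < p" "p \<le> Suc n" if "p \<in> Q" for p
    proof -
      have "prime p" "real p \<le> y" using that by (auto simp: Q_def primes_upto_def)
      then show "0 < p" "p \<le> Suc n" using n prime_gt_0_nat[of p] by linarith+
    qed
    have "ln y / 4 \<le> ln (y / (8 * x * ln y + 2))" using elim by (simp add: x_def)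
    also have "\<dots> \<le> ln (real (Suc (Suc n)) / real (Suc a))"
      using n a le_y ge1 elim by (intro ln_mono frac_le) auto
    also have "\<dots> \<le> (\<Sum>m=a..<Suc n. 1 / real (Suc m))"
      using a an by (intro ln_le_sum_inverse) auto
    finally have "1 / 16 \<le> 1 / (4 * ln y) * (\<Sum>m=a..<Suc n. 1 / real (Suc m))"
      using lny by (simp add: field_simps)
    also have "\<dots> = (\<Sum>m=a..<Suc n. 1 / (4 * ln y) * (1 / real (Suc m)))"
      by (rule sum_distrib_left)
    also have "\<dots> \<le> (\<Sum>m=a..<Suc n. real (card {p \<in> Q. p \<le> m}) * (1 / (real m * real (Suc m))))"
    proof (rule sum_mono)
      fix m assume m: "m \<in> {a..<Suc n}"
      then have m': "real a \<le> real m" "real m \<le> y" "0 < real m" using n a by auto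
      have "primes_upto (real m) - primes_upto x \<subseteq> {p \<in> Q. p \<le> m}"
        using m' by (auto simp: primes_upto_def Q_def)
      then have "card (primes_upto (real m) - primes_upto x) \<le> card {p \<in> Q. p \<le> m}"
        using finQ by (intro card_mono) auto
      moreover have "card (primes_upto (real m)) - card (primes_upto x) \<le> card (primes_upto (real m) - primes_upto x)"
        by (rule diff_card_le_card_Diff) simp
      ultimately have c1: "real (card (primes_upto (real m))) - real (card (primes_upto x)) \<le> real (card {p \<in> Q. p \<le> m})"
        by linarith
      have "y0 \<le> real m" using elim a m' by (simp add: x_def)
      then have "real m / 2 \<le> real (card (primes_upto (real m))) * ln (real m)" by (rule y0)
      also have "\<dots> \<le> real (card (primes_upto (real m))) * ln y"
        using m' by (intro mult_left_mono ln_mono) auto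
      finally have c2: "real m / 2 \<le> real (card (primes_upto (real m))) * ln y" .
      have "real (card (primes_upto x)) * ln y \<le> x * ln y"
        using lny x0 by (intro mult_right_mono card_primes_upto_le) auto
      also have "\<dots> \<le> real m / 8" using a m' by simp
      finally have "real m / 4 \<le> (real (card (primes_upto (real m))) - real (card (primes_upto x))) * ln y"
        using c2 m' by (simp add: algebra_simps)
      also have "\<dots> \<le> real (card {p \<in> Q. p \<le> m}) * ln y"
        using c1 lny by (intro mult_right_mono) auto
      finally have "1 / (4 * ln y) \<le> real (card {p \<in> Q. p \<le> m}) / real m"
        using lny m' by (simp add: divide_simps)
      then have "1 / (4 * ln y) * (1 / real (Suc m)) \<le> real (card {p \<in> Q. p \<le> m}) / real m * (1 / real (Suc m))"
        by (intro mult_right_mono) auto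
      then show "1 / (4 * ln y) * (1 / real (Suc m)) \<le> real (card {p \<in> Q. p \<le> m}) * (1 / (real m * real (Suc m)))"
        by simp
    qed
    also have "\<dots> = (\<Sum>m=a..<Suc n. \<Sum>p\<in>Q. if p \<le> m then 1 / (real m * real (Suc m)) else 0)"
      unfolding sum.inter_filter[OF finQ, symmetric] by simp
    also have "\<dots> = (\<Sum>p\<in>Q. \<Sum>m=a..<Suc n. if p \<le> m then 1 / (real m * real (Suc m)) else 0)"
      by (rule sum.swap)
    also have "\<dots> \<le> (\<Sum>p\<in>Q. 1 / real p)"
    proof (rule sum_mono)
      fix p assume p: "p \<in> Q"
      have "(\<Sum>m=a..<Suc n. if p \<le> m then 1 / (real m * real (Suc m)) else 0)
          = (\<Sum>m\<in>{m\<in>{a..<Suc n}. p \<le> m}. 1 / (real m * real (Suc m)))"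
        by (rule sum.inter_filter[symmetric]) simp
      also have "\<dots> \<le> (\<Sum>m=p..<Suc n. 1 / (real m * real (Suc m)))"
        by (intro sum_mono2) auto
      also have "\<dots> \<le> 1 / real p" using Qn[OF p] by (subst sum_telescope_inverse) auto
      finally show "(\<Sum>m=a..<Suc n. if p \<le> m then 1 / (real m * real (Suc m)) else 0) \<le> 1 / real p" .
    qed
    finally show ?case by (simp add: Q_def x_def)
  qed
qed

subsection \<open>The zeta function and its logarithm to the right of the critical line\<close>

lemma zeta_holomorphic: "zeta holomorphic_on - {1}"
  using zeta_continuation_zeta by (simp add: zeta_continuation_def)

lemma zeta_sums: "1 < Re s \<Longrightarrow> (\<lambda>n. of_nat (Suc n) powr (-s)) sums zeta s"
  using zeta_continuation_zeta by (simp add: zeta_continuation_def)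

section \<open>Continuation of \<open>(s - 1) * zeta s\<close> to the half-plane
  \<open>Re s > 0\<close>\<close>

lemma norm_of_nat_powr: "cmod (of_nat n powr s) = real n powr Re s"
  using norm_powr_real_powr[of "of_nat n" s] by simp

text \<open>This is s - 1 times the difference between a term of the zeta series and the integral of
  x powr (- s) over the following unit interval. For \<open>Re s > 1\<close> the differences of
  powers telescope to -1, which \<open>xzeta\<close> compensates by adding 1.\<close>

definition zeta_remainder_term :: "nat \<Rightarrow> complex \<Rightarrow> complex" where
  "zeta_remainder_term n s = (s - 1) * of_nat (Suc n) powr (- s)
     + (of_nat (Suc (Suc n)) powr (1 - s) - of_nat (Suc n) powr (1 - s))"

text \<open>The term is the remainder of the first-order Taylor expansion of z powr (1 - s) at n + 1
  over a unit step, so it is governed by the second derivative (1 - s) (- s) z powr (- s -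
  1).\<close>

lemma zeta_remainder_term_bound:
  assumes "0 < Re s"
  shows "cmod (zeta_remainder_term n s) \<le> cmod (s - 1) * cmod s * real (Suc n) powr (- Re s - 1)"
proof -
  define w where "w = 1 - s"
  define f :: "nat \<Rightarrow> complex \<Rightarrow> complex"
    where "f = (\<lambda>i z. if i = 0 then z powr w else if i = 1 then w * z powr (w - 1)
       else w * (w - 1) * z powr (w - 2))"
  define X where "X = real (Suc n)"
  define S where "S = closed_segment (of_real X :: complex) (of_real (X + 1))"
  have X: "1 \<le> X" by (simp add: X_def)
  have Sre: "\<exists>u. X \<le> u \<and> z = of_real u" if zS: "z \<in> S" for z
  proof -
    obtain u where "0 \<le> u" "u \<le> 1" "z = (1 - u) *\<^sub>R of_real X + u *\<^sub>R of_real (X + 1)"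
      using zS by (auto simp: S_def closed_segment_def simp del: of_real_add)
    then have "z = of_real (X + u)" by (simp add: scaleR_conv_of_real algebra_simps)
    then show ?thesis using \<open>0 \<le> u\<close> by (intro exI[of _ "X + u"]) auto
  qed
  have "cmod (f 0 (of_real (X + 1)) - (\<Sum>i\<le>1. f i (of_real X) * (of_real (X + 1) - of_real X) ^ i / fact i))
      \<le> (cmod (s - 1) * cmod s * X powr (- Re s - 1)) * cmod (of_real (X + 1) - of_real X :: complex) ^ Suc 1 / fact 1"
  proof (rule complex_Taylor[where S = S])
    show "convex S" "complex_of_real X \<in> S" "complex_of_real (X + 1) \<in> S" by (simp_all add: S_def)
    fix z assume z: "z \<in> S"
    then obtain u where u: "X \<le> u" "z = of_real u" using Sre by blast
    have nz: "z \<notin> \<real>\<^sub>\<le>\<^sub>0" using u X by (simp add: complex_nonpos_Reals_iff)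
    show "(f i has_field_derivative f (Suc i) z) (at z within S)" if "i \<le> 1" for i
    proof (cases "i = 0")
      case True
      have "((\<lambda>z. z powr w) has_field_derivative w * z powr (w - 1)) (at z within S)"
        by (rule has_field_derivative_at_within[OF has_field_derivative_powr[OF nz]])
      then show ?thesis by (simp add: f_def True)
    next
      case False
      then have i: "i = 1" using that by simp
      have "((\<lambda>z. w * z powr (w - 1)) has_field_derivative w * ((w - 1) * z powr (w - 1 - 1))) (at z within S)"
        by (rule DERIV_cmult[OF has_field_derivative_at_within[OF has_field_derivative_powr[OF nz]]])
      then show ?thesis unfolding f_def i by (simp add: mult_ac)
    qed
    have "cmod (f (Suc 1) z) = cmod (s - 1) * cmod s * u powr (- Re s - 1)"
    proof -
      have e: "- 1 - Re s = - Re s - 1" by simp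
      show ?thesis
        using u X by (simp add: f_def w_def norm_mult norm_minus_commute norm_powr_real_powr e)
    qed
    also have "\<dots> \<le> cmod (s - 1) * cmod s * X powr (- Re s - 1)"
      using u X assms by (intro mult_left_mono powr_mono2') auto
    finally show "cmod (f (Suc 1) z) \<le> cmod (s - 1) * cmod s * X powr (- Re s - 1)" .
  qed
  moreover have "f 0 (of_real (X + 1)) - (\<Sum>i\<le>1. f i (of_real X) * (of_real (X + 1) - of_real X) ^ i / fact i)
      = zeta_remainder_term n s"
    by (simp add: f_def w_def X_def zeta_remainder_term_def algebra_simps)
  ultimately show ?thesis by (simp add: X_def)
qed

text \<open>The function \<open>(s - 1) zeta s\<close> without its removable singularity.\<close>

definition xzeta :: "complex \<Rightarrow> complex" where
  "xzeta s = 1 + (\<Sum>n. zeta_remainder_term n s)"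

lemma xzeta_holomorphic: "xzeta holomorphic_on {s. 0 < Re s}"
proof -
  obtain g where g: "\<forall>s\<in>{s. 0 < Re s}. (\<lambda>n. zeta_remainder_term n s) sums g s \<and> g field_differentiable at s"
  proof (rule series_differentiable_comparison_complex[of "{s. 0 < Re s}" zeta_remainder_term])
    show "open {s. 0 < Re s}" by (rule open_halfspace_Re_gt)
    show "zeta_remainder_term n field_differentiable at x" for n x
    proof -
      have "(of_nat (Suc n) :: complex) \<noteq> 0" "(of_nat (Suc (Suc n)) :: complex) \<noteq> 0" by (rule of_nat_neq_0)+
      then have "zeta_remainder_term n holomorphic_on UNIV"
        unfolding zeta_remainder_term_def by (intro holomorphic_intros)
      then show ?thesis by (simp add: holomorphic_on_def)
    qed
    fix x :: complex assume x: "x \<in> {s. 0 < Re s}"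
    define d where "d = Re x / 2"
    define K where "K = (cmod x + d + 1) * (cmod x + d)"
    define h where "h = (\<lambda>n. of_real (K * real (Suc n) powr (- (1 + d))) :: complex)"
    have d: "0 < d" using x by (simp add: d_def)
    have K: "0 \<le> K" using d by (simp add: K_def)
    have "summable (\<lambda>n. K * real (Suc n) powr (- (1 + d)))"
      using d by (intro summable_mult summable_Suc_powr) auto
    then have "summable h" unfolding h_def by (rule summable_of_real)
    moreover have "range h \<subseteq> \<real>\<^sub>\<ge>\<^sub>0" using K by (auto simp: h_def simp del: of_real_mult)
    moreover have "cmod (zeta_remainder_term n y) \<le> cmod (h n)" if y: "y \<in> ball x d" for n y
    proof -
      have n: "cmod (x - y) < d" using y by (simp add: dist_norm)
      have "cmod y \<le> cmod x + cmod (x - y)"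
        using norm_triangle_ineq4[of x "x - y"] by simp
      then have 1: "cmod y \<le> cmod x + d" using n by linarith
      then have 2: "cmod (y - 1) \<le> cmod x + d + 1" using norm_triangle_ineq4[of y 1] by simp
      have "Re x - Re y < d" using n complex_Re_le_cmod[of "x - y"] by simp
      then have Rey: "d < Re y" by (simp add: d_def)
      have "cmod (zeta_remainder_term n y) \<le> cmod (y - 1) * cmod y * real (Suc n) powr (- Re y - 1)"
        using Rey d by (intro zeta_remainder_term_bound) auto
      also have "\<dots> \<le> K * real (Suc n) powr (- (1 + d))"
        unfolding K_def using 1 2 Rey d by (intro mult_mono powr_mono) auto
      also have "\<dots> \<le> cmod (h n)" unfolding h_def norm_of_real by (rule abs_ge_self)
      finally show ?thesis .
    qed
    ultimately show "\<exists>d h. 0 < d \<and> summable h \<and> range h \<subseteq> \<real>\<^sub>\<ge>\<^sub>0 \<and>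
      (\<forall>\<^sub>F n in sequentially. \<forall>y\<in>ball x d \<inter> {s. 0 < Re s}. cmod (zeta_remainder_term n y) \<le> cmod (h n))"
      using d by (intro exI[of _ d] exI[of _ h]) auto
  qed
  then have "g holomorphic_on {s. 0 < Re s}"
    by (auto simp: holomorphic_on_def field_differentiable_at_within)
  then have "(\<lambda>s. 1 + g s) holomorphic_on {s. 0 < Re s}" by (intro holomorphic_intros)
  then show ?thesis
    by (rule holomorphic_transform) (use g in \<open>auto simp: xzeta_def sums_iff\<close>)
qed

lemma xzeta_eq_halfplane:
  assumes "1 < Re s"
  shows "xzeta s = (s - 1) * zeta s"
proof -
  have lim: "(\<lambda>n. of_nat (Suc n) powr (1 - s)) \<longlonglongrightarrow> 0"
  proof (rule tendsto_norm_zero_cancel)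
    have "(\<lambda>n. real (Suc n) powr (1 - Re s)) \<longlonglongrightarrow> 0"
      using assms by (intro tendsto_neg_powr filterlim_compose[OF filterlim_real_sequentially filterlim_Suc]) auto
    then show "(\<lambda>n. cmod (of_nat (Suc n) powr (1 - s))) \<longlonglongrightarrow> 0"
      unfolding norm_of_nat_powr by simp
  qed
  have "(\<lambda>n. of_nat (Suc (Suc n)) powr (1 - s) - of_nat (Suc n) powr (1 - s)) sums (0 - of_nat (Suc 0) powr (1 - s))"
    by (rule telescope_sums[OF lim])
  then have "(\<lambda>n. of_nat (Suc (Suc n)) powr (1 - s) - of_nat (Suc n) powr (1 - s)) sums (- 1)" by simp
  from sums_add[OF sums_mult[OF zeta_sums[OF assms], of "s - 1"] this]
  have "(\<lambda>n. zeta_remainder_term n s) sums ((s - 1) * zeta s - 1)"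
    by (simp add: zeta_remainder_term_def)
  then show ?thesis by (simp add: xzeta_def sums_iff)
qed

lemma xzeta_eq:
  assumes "0 < Re s" "s \<noteq> 1"
  shows "xzeta s = (s - 1) * zeta s"
proof (rule analytic_continuation_open[where f = xzeta and g = "\<lambda>s. (s - 1) * zeta s" and z = s
      and s = "{s. 1 < Re s}" and s' = "{s. 0 < Re s} - {1}"])
  show "open {s. 1 < Re s}" by (rule open_halfspace_Re_gt)
  show "open ({s. 0 < Re s} - {1::complex})" by (intro open_Diff open_halfspace_Re_gt) auto
  have "(2::complex) \<in> {s. 1 < Re s}" by simp
  then show "{s. 1 < Re s} \<noteq> {}" by blast
  show "connected ({s. 0 < Re s} - {1::complex})"
    by (intro connected_open_delete open_halfspace_Re_gt convex_connected convex_halfspace_Re_gt) simp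
  show "xzeta holomorphic_on {s. 0 < Re s} - {1}"
    by (rule holomorphic_on_subset[OF xzeta_holomorphic]) auto
  show "(\<lambda>s. (s - 1) * zeta s) holomorphic_on {s. 0 < Re s} - {1}"
    by (intro holomorphic_intros holomorphic_on_subset[OF zeta_holomorphic]) auto
qed (use assms xzeta_eq_halfplane in auto)

lemma xzeta_1 [simp]: "xzeta 1 = 1"
proof -
  have "(of_nat (Suc n) :: complex) \<noteq> 0" for n by (rule of_nat_neq_0)
  then have "zeta_remainder_term n 1 = 0" for n
    by (simp add: zeta_remainder_term_def del: of_nat_Suc)
  then show ?thesis by (simp add: xzeta_def)
qed

text \<open>The exponent - Re s - 1 is at most - 3/2, so one convergent series dominates. This
  polynomial growth, valid up to and on the critical line, feeds both the Borel-Caratheodory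
  estimate and the crude bound for ln |zeta| far from t.\<close>

lemma xzeta_bound:
  obtains K where "K > 0" "\<And>s. 1 / 2 \<le> Re s \<Longrightarrow> cmod (xzeta s - 1) \<le> K * cmod (s - 1) * cmod s"
proof
  define K where "K = (\<Sum>n. real (Suc n) powr (- 3 / 2)) + 1"
  have sumK: "summable (\<lambda>n. real (Suc n) powr (- 3 / 2))" by (rule summable_Suc_powr) simp
  have "0 \<le> (\<Sum>n. real (Suc n) powr (- 3 / 2))" by (intro suminf_nonneg sumK) auto
  then show "K > 0" by (simp add: K_def)
  fix s :: complex assume s: "1 / 2 \<le> Re s"
  have "cmod (xzeta s - 1) = cmod (\<Sum>n. zeta_remainder_term n s)" by (simp add: xzeta_def)
  also have "\<dots> \<le> (\<Sum>n. cmod (s - 1) * cmod s * real (Suc n) powr (- 3 / 2))"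
  proof (intro norm_suminf_le summable_mult sumK)
    fix n
    have "cmod (zeta_remainder_term n s) \<le> cmod (s - 1) * cmod s * real (Suc n) powr (- Re s - 1)"
      using s by (intro zeta_remainder_term_bound) auto
    also have "\<dots> \<le> cmod (s - 1) * cmod s * real (Suc n) powr (- 3 / 2)"
      using s by (intro mult_left_mono powr_mono) auto
    finally show "cmod (zeta_remainder_term n s) \<le> cmod (s - 1) * cmod s * real (Suc n) powr (- 3 / 2)" .
  qed
  also have "\<dots> = cmod (s - 1) * cmod s * (K - 1)"
    using sumK by (simp add: suminf_mult K_def)
  also have "\<dots> \<le> cmod (s - 1) * cmod s * K" by (intro mult_left_mono) auto
  finally show "cmod (xzeta s - 1) \<le> K * cmod (s - 1) * cmod s" by (simp add: mult_ac)
qed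

section \<open>The logarithm of zeta as a Dirichlet series\<close>

definition log_coeff :: "nat \<Rightarrow> real" where
  "log_coeff n = mangoldt n / ln (real n)"

lemma log_coeff_nonneg: "0 \<le> log_coeff n"
  by (cases "n = 0") (auto simp: log_coeff_def mangoldt_nonneg Suc_le_eq)

lemma log_coeff_le_1: "log_coeff n \<le> 1"
proof (cases "n \<le> 1")
  case True
  then have "n = 0 \<or> n = Suc 0" by auto
  then show ?thesis by (auto simp: log_coeff_def)
next
  case False
  then have "0 < ln (real n)" by simp
  then show ?thesis using mangoldt_le[of n] False by (simp add: log_coeff_def)
qed

lemma log_coeff_0 [simp]: "log_coeff 0 = 0" and log_coeff_1 [simp]: "log_coeff (Suc 0) = 0"
  by (simp_all add: log_coeff_def)

lemma log_coeff_prime [simp]: "prime p \<Longrightarrow> log_coeff p = 1"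
  using prime_gt_1_nat[of p] by (simp add: log_coeff_def)

lemma log_coeff_mult_ln: "log_coeff n * ln (real n) = mangoldt n"
  using mangoldt_0 mangoldt_Suc_0 by (cases "n = 0 \<or> n = Suc 0") (auto simp: log_coeff_def)

text \<open>The coefficients are 1/j at the prime powers p^j and 0 elsewhere, including n = 0 and n
  = 1. Only \<open>Re s > 1\<close> matters, where the series converges absolutely.\<close>

definition log_zeta :: "complex \<Rightarrow> complex" where
  "log_zeta s = (\<Sum>n. of_real (log_coeff n) * of_nat n powr (- s))"

lemma summable_powr_minus: "1 < a \<Longrightarrow> summable (\<lambda>n. real n powr (- a))"
  by (simp add: summable_real_powr_iff)

text \<open>Coefficients anywhere in [0, 1] are allowed so that the lemma serves \<open>zeta\<close>
  as well as \<open>log_zeta\<close>. On a ball of half the distance to the line Re s = 1 one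
  convergent series dominates, which permits termwise differentiation.\<close>

lemma dirichlet_series_derivative:
  fixes c :: "nat \<Rightarrow> real"
  assumes c: "\<And>n. 0 \<le> c n" "\<And>n. c n \<le> 1" and c0: "c 0 = 0"
  obtains g g' where "\<And>s. 1 < Re s \<Longrightarrow> (\<lambda>n. of_real (c n) * of_nat n powr (- s)) sums g s"
    and "\<And>s. 1 < Re s \<Longrightarrow> (\<lambda>n. - of_real (c n * ln (real n)) * of_nat n powr (- s)) sums g' s"
    and "\<And>s. 1 < Re s \<Longrightarrow> (g has_field_derivative g' s) (at s)"
proof -
  have "\<exists>g g'. \<forall>s\<in>{s. 1 < Re s}. (\<lambda>n. of_real (c n) * of_nat n powr (- s)) sums g s \<and>
     (\<lambda>n. - of_real (c n * ln (real n)) * of_nat n powr (- s)) sums g' s \<and>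
     (g has_field_derivative g' s) (at s)"
proof (rule series_and_derivative_comparison_complex)
  show "open {s. 1 < Re s}" by (rule open_halfspace_Re_gt)
  show "((\<lambda>s. of_real (c n) * of_nat n powr (- s)) has_field_derivative
      - of_real (c n * ln (real n)) * of_nat n powr (- s)) (at s)" for n and s :: complex
  proof (cases "n = 0")
    case False
    have "((\<lambda>s. of_nat n powr (- s)) has_field_derivative (Ln (of_nat n) * of_nat n powr (- s)) * (- 1)) (at s)"
      using False by (intro DERIV_chain2[OF has_field_derivative_powr_right] DERIV_minus DERIV_ident) auto
    from DERIV_cmult[OF this, of "of_real (c n)"] show ?thesis using False by (simp add: Ln_of_nat mult_ac)
  qed (simp add: c0)
  fix x :: complex assume x: "x \<in> {s. 1 < Re s}"
  define d where "d = (Re x - 1) / 2"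
  define h where "h = (\<lambda>n. of_real (real n powr (- (1 + d))) :: complex)"
  have d: "0 < d" using x by (simp add: d_def)
  have "summable h" unfolding h_def using d by (intro summable_of_real summable_powr_minus) auto
  moreover have "range h \<subseteq> \<real>\<^sub>\<ge>\<^sub>0" by (auto simp: h_def)
  moreover have "cmod (of_real (c n) * of_nat n powr (- y)) \<le> cmod (h n)" if y: "y \<in> ball x d" for n y
  proof -
    have "Re x - Re y < d" using y complex_Re_le_cmod[of "x - y"] by (simp add: dist_norm)
    then have Rey: "1 + d < Re y" by (simp add: d_def field_simps)
    have "cmod (of_real (c n) * of_nat n powr (- y)) = c n * real n powr (- Re y)"
      using c(1) by (simp add: norm_mult norm_of_nat_powr)
    also have "\<dots> \<le> 1 * real n powr (- (1 + d))"
    proof (cases "n = 0")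
      case False
      then show ?thesis using c Rey by (intro mult_mono powr_mono) auto
    qed simp
    finally show ?thesis by (simp add: h_def)
  qed
  ultimately show "\<exists>d h. 0 < d \<and> summable h \<and> range h \<subseteq> \<real>\<^sub>\<ge>\<^sub>0 \<and>
     (\<forall>\<^sub>F n in sequentially. \<forall>y\<in>ball x d \<inter> {s. 1 < Re s}. cmod (of_real (c n) * of_nat n powr (- y)) \<le> cmod (h n))"
    using d by (intro exI[of _ d] exI[of _ h]) auto
  qed
  then obtain g g' where "\<forall>s\<in>{s. 1 < Re s}. (\<lambda>n. of_real (c n) * of_nat n powr (- s)) sums g s \<and>
     (\<lambda>n. - of_real (c n * ln (real n)) * of_nat n powr (- s)) sums g' s \<and>
     (g has_field_derivative g' s) (at s)" by blast
  then show thesis by (intro that[of g g']) blast+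
qed

lemma zeta_sums_0:
  assumes "1 < Re s"
  shows "(\<lambda>n. of_nat n powr (- s)) sums zeta s"
  using zeta_sums[OF assms] by (subst (asm) sums_Suc_iff) simp

lemma log_zeta_derivative:
  assumes "1 < Re s"
  shows "\<exists>d. (\<lambda>n. - mangoldt n * of_nat n powr (- s)) sums d \<and> (log_zeta has_field_derivative d) (at s)"
    and "(\<lambda>n. of_real (log_coeff n) * of_nat n powr (- s)) sums log_zeta s"
proof -
  obtain g g' where g: "\<And>s. 1 < Re s \<Longrightarrow> (\<lambda>n. of_real (log_coeff n) * of_nat n powr (- s)) sums g s"
    "\<And>s. 1 < Re s \<Longrightarrow> (\<lambda>n. - of_real (log_coeff n * ln (real n)) * of_nat n powr (- s)) sums g' s"
    "\<And>s. 1 < Re s \<Longrightarrow> (g has_field_derivative g' s) (at s)"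
    using dirichlet_series_derivative[of log_coeff, OF log_coeff_nonneg log_coeff_le_1 log_coeff_0] by blast
  have eq: "log_zeta z = g z" if "1 < Re z" for z
    using g(1)[OF that] by (simp add: log_zeta_def sums_iff)
  have "eventually (\<lambda>z. z \<in> {s. 1 < Re s}) (nhds s)"
    using assms open_halfspace_Re_gt by (intro eventually_nhds_in_open) auto
  then have "eventually (\<lambda>z. log_zeta z = g z) (nhds s)"
    by (rule eventually_mono) (auto intro: eq)
  then have "(log_zeta has_field_derivative g' s) (at s)"
    using g(3)[OF assms] by (subst DERIV_cong_ev[OF refl _ refl]) auto
  moreover have "(\<lambda>n. - mangoldt n * of_nat n powr (- s)) sums g' s"
    using g(2)[OF assms] unfolding log_coeff_mult_ln by simp
  ultimately show "\<exists>d. (\<lambda>n. - mangoldt n * of_nat n powr (- s)) sums d \<and> (log_zeta has_field_derivative d) (at s)"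
    by blast
  show "(\<lambda>n. of_real (log_coeff n) * of_nat n powr (- s)) sums log_zeta s"
    using g(1)[OF assms] eq[OF assms] by simp
qed

lemma zeta_derivative_sums:
  assumes "1 < Re s"
  shows "\<exists>d. (\<lambda>n. - of_real (ln (real n)) * of_nat n powr (- s)) sums d \<and> (zeta has_field_derivative d) (at s)"
proof -
  define c where "c = (\<lambda>n::nat. if n = 0 then 0 else 1 :: real)"
  obtain g g' where g: "\<And>s. 1 < Re s \<Longrightarrow> (\<lambda>n. of_real (c n) * of_nat n powr (- s)) sums g s"
    "\<And>s. 1 < Re s \<Longrightarrow> (\<lambda>n. - of_real (c n * ln (real n)) * of_nat n powr (- s)) sums g' s"
    "\<And>s. 1 < Re s \<Longrightarrow> (g has_field_derivative g' s) (at s)"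
    by (rule dirichlet_series_derivative[of c]) (auto simp: c_def)
  have c1: "of_real (c n) * of_nat n powr (- z) = of_nat n powr (- z)" for n and z :: complex
    by (simp add: c_def)
  have c2: "c n * ln (real n) = ln (real n)" for n by (simp add: c_def)
  have eq: "zeta z = g z" if "1 < Re z" for z
    using g(1)[OF that] zeta_sums_0[OF that] unfolding c1 by (rule sums_unique2[symmetric])
  have "eventually (\<lambda>z. z \<in> {s. 1 < Re s}) (nhds s)"
    using assms open_halfspace_Re_gt by (intro eventually_nhds_in_open) auto
  then have "eventually (\<lambda>z. zeta z = g z) (nhds s)"
    by (rule eventually_mono) (auto intro: eq)
  then have "(zeta has_field_derivative g' s) (at s)"
    using g(3)[OF assms] by (subst DERIV_cong_ev[OF refl _ refl]) auto
  then show ?thesis using g(2)[OF assms] unfolding c2 by blast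
qed

lemma sum_powr_ln_bound: "1 < a \<Longrightarrow> summable (\<lambda>n. ln (real n) * real n powr (- a))"
proof -
  assume a: "1 < a"
  define b where "b = (a - 1) / 2"
  have b: "0 < b" "1 < a - b" using a by (auto simp: b_def field_simps)
  show ?thesis
  proof (rule summable_comparison_test')
    show "summable (\<lambda>n. 1 / b * real n powr (- (a - b)))"
      using b by (intro summable_mult summable_powr_minus) auto
    fix n :: nat assume n: "1 \<le> n"
    have "b * ln (real n) = ln (real n powr b)" using n by (simp add: ln_powr)
    also have "\<dots> \<le> real n powr b" using n ln_le_minus_one[of "real n powr b"] by simp
    finally have "ln (real n) \<le> 1 / b * real n powr b" using b by (simp add: field_simps)
    then have "ln (real n) * real n powr (- a) \<le> 1 / b * real n powr b * real n powr (- a)"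
      by (intro mult_right_mono) auto
    also have "\<dots> = 1 / b * real n powr (- (a - b))"
      by (simp add: powr_add[symmetric])
    finally show "norm (ln (real n) * real n powr (- a)) \<le> 1 / b * real n powr (- (a - b))"
      using n by simp
  qed
qed

text \<open>The product form of the formula for - zeta' / zeta. Absolute convergence allows the
  product of the two series to be regrouped by k = d * m, and \<open>mangoldt\<close> sums to ln k
  over the divisors of k.\<close>

lemma mangoldt_times_zeta:
  assumes s: "1 < Re s"
  assumes A: "(\<lambda>n. mangoldt n * of_nat n powr (- s)) sums A"
  assumes B: "(\<lambda>n. of_real (ln (real n)) * of_nat n powr (- s)) sums B"
  shows "A * zeta s = B"
proof -
  define a where "a = (\<lambda>n. mangoldt n * of_nat n powr (- s))"
  define b where "b = (\<lambda>n. of_nat n powr (- s) :: complex)"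
  have suma: "summable (\<lambda>n. cmod (a n))"
  proof (rule summable_comparison_test'[OF sum_powr_ln_bound[OF s]])
    fix n :: nat assume "1 \<le> n"
    then show "norm (cmod (a n)) \<le> ln (real n) * real n powr (- Re s)"
      unfolding a_def norm_mult norm_of_nat_powr norm_mangoldt
      using mangoldt_le[of n] by (simp add: mult_right_mono mangoldt_nonneg)
  qed
  have sumb: "summable (\<lambda>n. cmod (b n))"
    using summable_powr_minus[OF s] by (simp add: b_def norm_of_nat_powr)
  have ha: "(a has_sum A) UNIV" using suma A by (intro norm_summable_imp_has_sum) (auto simp: a_def)
  have hb: "(b has_sum zeta s) UNIV" using sumb zeta_sums_0[OF s] by (intro norm_summable_imp_has_sum) (auto simp: b_def)
  define f where "f = (\<lambda>(d,m). a d * b m)"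
  have "(\<lambda>x. norm (f x)) summable_on (UNIV \<times> UNIV)"
  proof (rule summable_on_SigmaI)
    have hb': "((\<lambda>m. cmod (b m)) has_sum (\<Sum>m. cmod (b m))) UNIV"
      using sumb by (intro norm_summable_imp_has_sum summable_sums) auto
    show "((\<lambda>m. cmod (f (d, m))) has_sum (cmod (a d) * (\<Sum>m. cmod (b m)))) UNIV" for d
      using has_sum_cmult_right[OF hb'] by (simp add: f_def norm_mult)
    have "(\<lambda>d. cmod (a d)) summable_on UNIV"
      using suma by (simp add: summable_on_UNIV_nonneg_real_iff)
    then show "(\<lambda>d. cmod (a d) * (\<Sum>m. cmod (b m))) summable_on UNIV"
      by (rule summable_on_cmult_left)
  qed auto
  then have summ: "f summable_on UNIV \<times> UNIV" by (rule abs_summable_summable)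
  have "(f has_sum (A * zeta s)) (UNIV \<times> UNIV)"
  proof (rule has_sum_SigmaI)
    show "((\<lambda>m. f (d, m)) has_sum (a d * zeta s)) UNIV" for d
      unfolding f_def using has_sum_cmult_right[OF hb] by simp
    show "((\<lambda>d. a d * zeta s) has_sum (A * zeta s)) UNIV"
      using has_sum_cmult_left[OF ha] by simp
    show "f summable_on Sigma UNIV (\<lambda>d. UNIV)" using summ by simp
  qed
  \<comment> \<open>Pairs containing 0 contribute nothing because \<open>0 powr z = 0\<close>; they
    are removed since 0 has infinitely many factorisations.\<close>
  then have "(f has_sum (A * zeta s)) ({1..} \<times> {1..})"
  proof (subst has_sum_cong_neutral[of _ _ _ f])
    show "f x = 0" if "x \<in> UNIV \<times> UNIV - {1..} \<times> {1..}" for x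
      using that by (cases x) (auto simp: f_def a_def b_def not_le)
  qed auto
  also have "?this \<longleftrightarrow> ((\<lambda>(k,d). a d * b (k div d)) has_sum (A * zeta s)) (SIGMA k:{1..}. {d. d dvd k})"
    by (rule has_sum_reindex_bij_witness[where i = "\<lambda>(k,d). (d, k div d)" and j = "\<lambda>(d,m). (d * m, d)"])
       (auto simp: f_def Suc_le_eq intro: Nat.gr0I elim!: dvdE)
  finally have "((\<lambda>(k,d). a d * b (k div d)) has_sum (A * zeta s)) (SIGMA k:{1..}. {d. d dvd k})" .
  then have "((\<lambda>k. \<Sum>d | d dvd k. a d * b (k div d)) has_sum (A * zeta s)) {1..}"
    by (rule has_sum_SigmaD) (auto intro!: has_sum_finiteI)
  also have "?this \<longleftrightarrow> ((\<lambda>k. of_real (ln (real k)) * of_nat k powr (- s)) has_sum (A * zeta s)) UNIV"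
  proof (rule has_sum_cong_neutral)
    fix k :: nat assume "k \<in> {1..} \<inter> UNIV"
    then have k: "0 < k" by auto
    have "(\<Sum>d | d dvd k. a d * b (k div d)) = (\<Sum>d | d dvd k. mangoldt d * of_nat k powr (- s))"
    proof (rule sum.cong[OF refl])
      fix d assume "d \<in> {d. d dvd k}"
      then obtain m where m: "k = d * m" by (auto elim: dvdE)
      then have "d > 0" "m > 0" using k by auto
      then have "of_nat d powr (- s) * of_nat m powr (- s) = (of_nat (d * m) powr (- s) :: complex)"
        by (simp add: powr_times_real)
      then show "a d * b (k div d) = mangoldt d * of_nat k powr (- s)"
        using \<open>d > 0\<close> by (simp add: a_def b_def m)
    qed
    also have "\<dots> = of_real (ln (real k)) * of_nat k powr (- s)"
      using mangoldt_sum[of k, where 'a = complex] k by (simp add: sum_distrib_right[symmetric])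
    finally show "(\<Sum>d | d dvd k. a d * b (k div d)) = of_real (ln (real k)) * of_nat k powr (- s)" .
  qed auto
  finally have "(\<lambda>k. of_real (ln (real k)) * of_nat k powr (- s)) sums (A * zeta s)"
    by (rule has_sum_imp_sums)
  with B show ?thesis by (rule sums_unique2[symmetric])
qed

text \<open>By \<open>mangoldt_times_zeta\<close> the quotient of both sides has derivative 0 and so
  is constant; the constant is found by letting s run to infinity through the integers k +
  2.\<close>

lemma exp_log_zeta:
  assumes "1 < Re s"
  shows "exp (log_zeta s) = zeta s"
proof -
  define f where "f = (\<lambda>s. zeta s * exp (- log_zeta s))"
  have "(f has_field_derivative 0) (at s within {s. 1 < Re s})" if "s \<in> {s. 1 < Re s}" for s
  proof -
    have s: "1 < Re s" using that by simp
    obtain d where d: "(\<lambda>n. - mangoldt n * of_nat n powr (- s)) sums d"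
      "(log_zeta has_field_derivative d) (at s)" using log_zeta_derivative(1)[OF s] by blast
    obtain d' where d': "(\<lambda>n. - of_real (ln (real n)) * of_nat n powr (- s)) sums d'"
      "(zeta has_field_derivative d') (at s)" using zeta_derivative_sums[OF s] by blast
    have 1: "(\<lambda>n. mangoldt n * of_nat n powr (- s)) sums (- d)"
      using sums_minus[OF d(1)] by simp
    have 2: "(\<lambda>n. of_real (ln (real n)) * of_nat n powr (- s)) sums (- d')"
      using sums_minus[OF d'(1)] by simp
    have eq: "- d * zeta s = - d'" by (rule mangoldt_times_zeta[OF s 1 2])
    have "(f has_field_derivative d' * exp (- log_zeta s) + zeta s * (exp (- log_zeta s) * (- d))) (at s)"
      unfolding f_def using d d' by (auto intro!: derivative_eq_intros)
    moreover have "d' * exp (- log_zeta s) + zeta s * (exp (- log_zeta s) * (- d)) = 0"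
      using eq by (simp add: algebra_simps)
    ultimately show ?thesis by (simp add: has_field_derivative_at_within)
  qed
  then obtain c where c: "\<And>s. s \<in> {s. 1 < Re s} \<Longrightarrow> f s = c"
    using has_field_derivative_zero_constant[OF convex_halfspace_Re_gt] by blast
  define M where "M = (\<Sum>n. real n powr (- 2))"
  \<comment> \<open>Every n >= 2 gains the factor 2 powr (- k) over n powr (- 2). With
    \<open>log_coeff\<close>, and with all coefficients 1 except at n = 1, this shows that
    \<open>log_zeta\<close> tends to 0 and \<open>zeta\<close> to 1 along k + 2.\<close>
  have bound: "cmod ((\<Sum>n. of_real (c n) * of_nat n powr (- of_real (real k + 2)) :: complex)) \<le> M * (1/2) ^ k"
    if c: "\<And>n. 0 \<le> c n" "\<And>n. c n \<le> 1" "c (Suc 0) = 0" for c :: "nat \<Rightarrow> real" and k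
  proof -
    have M: "summable (\<lambda>n. real n powr (- 2))" by (rule summable_powr_minus) simp
    have "cmod ((\<Sum>n. of_real (c n) * of_nat n powr (- of_real (real k + 2)))) \<le> (\<Sum>n. real n powr (- 2) * (1/2) ^ k)"
    proof (rule norm_suminf_le)
      fix n :: nat
      consider "n = 0" | "n = Suc 0" | "2 \<le> n" by linarith
      then show "cmod (of_real (c n) * of_nat n powr (- of_real (real k + 2))) \<le> real n powr (- 2) * (1/2) ^ k"
      proof cases
        case 3
        have "cmod (of_real (c n) * of_nat n powr (- of_real (real k + 2))) = c n * real n powr (- (real k + 2))"
          using c(1)[of n] by (simp add: norm_mult norm_of_nat_powr)
        also have "\<dots> \<le> 1 * real n powr (- (real k + 2))" using c by (intro mult_right_mono) auto
        also have "- (real k + 2) = - 2 + - real k" by simp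
        also have "1 * real n powr (- 2 + - real k) = real n powr (- 2) * real n powr (- real k)"
          by (simp only: powr_add mult_1)
        also have "\<dots> \<le> real n powr (- 2) * 2 powr (- real k)"
          using 3 by (intro mult_left_mono powr_mono2') auto
        also have "2 powr (- real k) = (1 / 2) ^ k" by (simp add: powr_minus powr_realpow power_one_over inverse_eq_divide)
        finally show ?thesis .
      qed (use c in auto)
    qed (intro summable_mult2 M)
    also have "\<dots> = M * (1/2) ^ k" using M by (simp add: suminf_mult2 M_def)
    finally show ?thesis .
  qed
  define \<sigma> where "\<sigma> = (\<lambda>k. of_real (real k + 2) :: complex)"
  have Re\<sigma>: "1 < Re (\<sigma> k)" for k by (simp add: \<sigma>_def)
  have lim0: "(\<lambda>k. M * (1/2::real) ^ k) \<longlonglongrightarrow> 0"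
    by (intro tendsto_mult_right_zero LIMSEQ_realpow_zero) auto
  have "(\<lambda>k. log_zeta (\<sigma> k)) \<longlonglongrightarrow> 0"
  proof (rule Lim_null_comparison[OF always_eventually lim0])
    show "\<forall>k. norm (log_zeta (\<sigma> k)) \<le> M * (1/2) ^ k"
      unfolding log_zeta_def \<sigma>_def using bound[of log_coeff] log_coeff_nonneg log_coeff_le_1 log_coeff_1 by blast
  qed
  moreover have "(\<lambda>k. zeta (\<sigma> k) - 1) \<longlonglongrightarrow> 0"
  proof (rule Lim_null_comparison[OF always_eventually lim0], rule allI)
    fix k
    define c where "c = (\<lambda>n. if n = Suc 0 then 0 else 1 :: real)"
    have "(\<lambda>n. of_nat n powr (- \<sigma> k) - (if n = Suc 0 then 1 else 0)) sums (zeta (\<sigma> k) - 1)"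
      using sums_diff[OF zeta_sums_0[OF Re\<sigma>] sums_single[of "Suc 0" "\<lambda>_. 1"]] by simp
    moreover have "(\<lambda>n. of_nat n powr (- \<sigma> k) - (if n = Suc 0 then 1 else 0)) = (\<lambda>n. of_real (c n) * of_nat n powr (- \<sigma> k))"
      by (auto simp: c_def)
    ultimately have "zeta (\<sigma> k) - 1 = (\<Sum>n. of_real (c n) * of_nat n powr (- \<sigma> k))" by (simp add: sums_iff)
    then show "norm (zeta (\<sigma> k) - 1) \<le> M * (1/2) ^ k" unfolding \<sigma>_def using bound[of c] by (simp add: c_def)
  qed
  then have "(\<lambda>k. zeta (\<sigma> k)) \<longlonglongrightarrow> 1" by (rule LIM_zero_cancel)
  ultimately have "(\<lambda>k. f (\<sigma> k)) \<longlonglongrightarrow> 1 * exp (- 0)" unfolding f_def by (intro tendsto_intros)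
  moreover have "f (\<sigma> k) = c" for k using c Re\<sigma> by simp
  ultimately have "c = 1" by (simp add: LIMSEQ_const_iff)
  then have "f s = 1" using c assms by simp
  then show ?thesis by (simp add: f_def exp_minus field_simps)
qed

text \<open>The logarithm of the product is a series with non-negative coefficients times 3 + 4 cos
  x + cos 2x = 2 (1 + cos x)^2.\<close>

lemma three_four_one:
  assumes "1 < \<sigma>"
  shows "1 \<le> cmod (zeta (of_real \<sigma>)) ^ 3 * cmod (zeta (Complex \<sigma> t)) ^ 4 * cmod (zeta (Complex \<sigma> (2 * t)))"
proof -
  have ReD: "(\<lambda>n. log_coeff n * (real n powr (- \<sigma>) * cos (v * ln (real n)))) sums Re (log_zeta (Complex \<sigma> v))" for v
  proof -
    have "(\<lambda>n. Re (of_real (log_coeff n) * of_nat n powr (- Complex \<sigma> v))) sums Re (log_zeta (Complex \<sigma> v))"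
      using assms by (intro sums_Re log_zeta_derivative(2)) auto
    moreover have "Re (of_real (log_coeff n) * of_nat n powr (- Complex \<sigma> v)) =
        log_coeff n * (real n powr (- \<sigma>) * cos (v * ln (real n)))" for n
    proof (cases "n = 0")
      case False
      then show ?thesis by (simp add: powr_def Ln_of_nat Re_exp)
    qed simp
    ultimately show ?thesis by (simp only:)
  qed
  have "0 \<le> 3 * Re (log_zeta (Complex \<sigma> 0)) + 4 * Re (log_zeta (Complex \<sigma> t)) + Re (log_zeta (Complex \<sigma> (2 * t)))"
  proof (rule sums_le[OF _ sums_zero])
    show "(\<lambda>n. 3 * (log_coeff n * (real n powr (- \<sigma>) * cos (0 * ln (real n)))) +
       4 * (log_coeff n * (real n powr (- \<sigma>) * cos (t * ln (real n)))) +
       log_coeff n * (real n powr (- \<sigma>) * cos (2 * t * ln (real n)))) sums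
      (3 * Re (log_zeta (Complex \<sigma> 0)) + 4 * Re (log_zeta (Complex \<sigma> t)) + Re (log_zeta (Complex \<sigma> (2 * t))))"
      by (intro sums_add sums_mult ReD)
    fix n
    have "0 \<le> log_coeff n * real n powr (- \<sigma>) * (2 * (1 + cos (t * ln (real n)))\<^sup>2)"
      using log_coeff_nonneg by (intro mult_nonneg_nonneg) auto
    also have "2 * (1 + cos (t * ln (real n)))\<^sup>2 = 3 + 4 * cos (t * ln (real n)) + cos (2 * t * ln (real n))"
      using cos_double_cos[of "t * ln (real n)"] by (simp add: power2_eq_square algebra_simps)
    finally show "0 \<le> 3 * (log_coeff n * (real n powr (- \<sigma>) * cos (0 * ln (real n)))) +
       4 * (log_coeff n * (real n powr (- \<sigma>) * cos (t * ln (real n)))) +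
       log_coeff n * (real n powr (- \<sigma>) * cos (2 * t * ln (real n)))"
      by (simp add: algebra_simps)
  qed
  then have "1 \<le> exp (3 * Re (log_zeta (Complex \<sigma> 0)) + 4 * Re (log_zeta (Complex \<sigma> t)) + Re (log_zeta (Complex \<sigma> (2 * t))))"
    by simp
  also have "\<dots> = exp (Re (log_zeta (Complex \<sigma> 0))) ^ 3 * exp (Re (log_zeta (Complex \<sigma> t))) ^ 4 * exp (Re (log_zeta (Complex \<sigma> (2 * t))))"
    by (simp add: exp_add exp_of_nat_mult[symmetric])
  finally have "1 \<le> exp (Re (log_zeta (Complex \<sigma> 0))) ^ 3 * exp (Re (log_zeta (Complex \<sigma> t))) ^ 4 *
    exp (Re (log_zeta (Complex \<sigma> (2 * t))))" .
  moreover have "exp (Re (log_zeta (Complex \<sigma> v))) = cmod (zeta (Complex \<sigma> v))" for v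
    using exp_log_zeta[of "Complex \<sigma> v"] assms by (metis complex.sel(1) norm_exp_eq_Re)
  ultimately show ?thesis by (simp only: complex_of_real_def)
qed

text \<open>\<open>riemann_hypothesis\<close> speaks of 0 < Re s < 1 only, so this line needs the
  classical argument. If 1 + it were a zero, then at abscissa 1 + r the three factors of
  \<open>three_four_one\<close> would be O(r^-3), O(r^4) and O(1), and their product O(r), below 1
  for small r.\<close>

lemma zeta_nonzero_line_1:
  assumes t: "t \<noteq> 0"
  shows "zeta (Complex 1 t) \<noteq> 0"
proof
  assume z0: "zeta (Complex 1 t) = 0"
  define r where "r = (\<lambda>n. 1 / real (Suc n))"
  have r: "r \<longlonglongrightarrow> 0" "0 < r n" for n
    unfolding r_def using lim_inverse_n' LIMSEQ_Suc[OF lim_1_over_n] by auto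
  have diff: "zeta field_differentiable (at z)" if "z \<noteq> 1" for z
    using holomorphic_on_imp_differentiable_at[OF zeta_holomorphic] that by auto
  have conv: "(\<lambda>n. Complex (1 + r n) v) \<longlonglongrightarrow> Complex 1 v" for v
    unfolding Complex_eq using r(1) by (auto intro!: tendsto_eq_intros)
  have c1: "(\<lambda>n. of_real (r n) * zeta (of_real (1 + r n))) \<longlonglongrightarrow> 1"
  proof -
    have "isCont xzeta 1"
      by (rule field_differentiable_imp_continuous_at[OF
            holomorphic_on_imp_differentiable_at[OF xzeta_holomorphic open_halfspace_Re_gt]]) simp
    moreover have "(\<lambda>n. of_real (1 + r n) :: complex) \<longlonglongrightarrow> of_real (1 + 0)" using r(1) by (intro tendsto_intros)
    then have "(\<lambda>n. of_real (1 + r n) :: complex) \<longlonglongrightarrow> 1" by simp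
    ultimately have "(\<lambda>n. xzeta (of_real (1 + r n))) \<longlonglongrightarrow> xzeta 1" by (rule isCont_tendsto_compose)
    moreover have "xzeta (of_real (1 + r n)) = of_real (r n) * zeta (of_real (1 + r n))" for n
      using r(2)[of n] by (subst xzeta_eq_halfplane) auto
    ultimately show ?thesis by simp
  qed
  have c2: "(\<lambda>n. zeta (Complex (1 + r n) (2 * t))) \<longlonglongrightarrow> zeta (Complex 1 (2 * t))"
  proof (rule isCont_tendsto_compose[OF _ conv])
    show "isCont zeta (Complex 1 (2 * t))"
      using t by (intro field_differentiable_imp_continuous_at[OF diff]) (auto simp: complex_eq_iff)
  qed
  obtain d where d: "(zeta has_field_derivative d) (at (Complex 1 t))"
    using diff[of "Complex 1 t"] t by (auto simp: field_differentiable_def complex_eq_iff)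
  have c3: "(\<lambda>n. zeta (Complex (1 + r n) t) / of_real (r n)) \<longlonglongrightarrow> d"
  proof -
    have "((\<lambda>h. zeta (Complex 1 t + h) / h) \<longlongrightarrow> d) (at 0)"
      using d z0 by (simp add: DERIV_def)
    moreover have "filterlim (\<lambda>n. of_real (r n) :: complex) (at 0) sequentially"
      unfolding filterlim_at using r(2) tendsto_of_real[OF r(1), where 'a = complex]
      by (auto simp: less_imp_neq[symmetric] intro!: always_eventually)
    ultimately have "(\<lambda>n. zeta (Complex 1 t + of_real (r n)) / of_real (r n)) \<longlonglongrightarrow> d"
      by (rule filterlim_compose)
    moreover have "Complex 1 t + of_real (r n) = Complex (1 + r n) t" for n by (simp add: complex_eq_iff)
    ultimately show ?thesis by simp
  qed
  have "(\<lambda>n. cmod (of_real (r n) * zeta (of_real (1 + r n))) ^ 3 *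
      cmod (zeta (Complex (1 + r n) t) / of_real (r n)) ^ 4 * r n * cmod (zeta (Complex (1 + r n) (2 * t))))
      \<longlonglongrightarrow> cmod 1 ^ 3 * cmod d ^ 4 * 0 * cmod (zeta (Complex 1 (2 * t)))"
    by (intro tendsto_mult tendsto_power tendsto_norm c1 c2 c3 r(1))
  moreover have "1 \<le> cmod (of_real (r n) * zeta (of_real (1 + r n))) ^ 3 *
      cmod (zeta (Complex (1 + r n) t) / of_real (r n)) ^ 4 * r n * cmod (zeta (Complex (1 + r n) (2 * t)))" for n
  proof -
    have "(r n) ^ 3 * (1 / r n) ^ 4 * r n = 1" using r(2)[of n] by (simp add: field_simps eval_nat_numeral)
    moreover have "1 \<le> cmod (zeta (of_real (1 + r n))) ^ 3 * cmod (zeta (Complex (1 + r n) t)) ^ 4 * cmod (zeta (Complex (1 + r n) (2 * t)))"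
      using r(2)[of n] by (intro three_four_one) auto
    ultimately have "1 \<le> ((r n) ^ 3 * (1 / r n) ^ 4 * r n) * (cmod (zeta (of_real (1 + r n))) ^ 3 * cmod (zeta (Complex (1 + r n) t)) ^ 4 * cmod (zeta (Complex (1 + r n) (2 * t))))"
      by simp
    also have "\<dots> = cmod (of_real (r n) * zeta (of_real (1 + r n))) ^ 3 *
      cmod (zeta (Complex (1 + r n) t) / of_real (r n)) ^ 4 * r n * cmod (zeta (Complex (1 + r n) (2 * t)))"
      using r(2)[of n] by (simp add: norm_mult norm_divide power_mult_distrib power_divide)
    finally show ?thesis .
  qed
  ultimately have "1 \<le> (0::real)" by (intro LIMSEQ_le_const) auto
  then show False by simp
qed

lemma xzeta_nonzero:
  assumes riemann_hypothesis "1 / 2 < Re s"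
  shows "xzeta s \<noteq> 0"
proof (cases "s = 1")
  case False
  consider "Re s < 1" | "Re s = 1" | "1 < Re s" by linarith
  then have "zeta s \<noteq> 0"
  proof cases
    case 1
    then show ?thesis using assms by (auto simp: riemann_hypothesis_def)
  next
    case 2
    then have "s = Complex 1 (Im s)" "Im s \<noteq> 0" using False by (auto simp: complex_eq_iff)
    then show ?thesis using zeta_nonzero_line_1 by metis
  next
    case 3
    then show ?thesis using exp_log_zeta exp_not_eq_zero by metis
  qed
  then show ?thesis using False assms by (subst xzeta_eq) auto
qed simp

text \<open>With w = f - f z0 and B = A - Re (f z0), the condition Re w < B says that w is closer to
  0 than to 2B; hence w / (2B - w) maps the rescaled disc into the unit disc and vanishes at the
  centre. The Schwarz lemma bounds it by r/R, and solving for w gives the claim.\<close>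

lemma borel_caratheodory:
  fixes f :: "complex \<Rightarrow> complex"
  assumes hol: "f holomorphic_on ball z0 R" and r: "0 < r" "r < R"
    and A: "\<And>z. z \<in> ball z0 R \<Longrightarrow> Re (f z) < A" and z: "cmod (z - z0) \<le> r"
  shows "cmod (f z) \<le> cmod (f z0) + 2 * r * (A - Re (f z0)) / (R - r)"
proof -
  define B where "B = A - Re (f z0)"
  define w where "w = (\<lambda>\<zeta>. f (z0 + of_real R * \<zeta>) - f z0)"
  define h where "h = (\<lambda>\<zeta>. w \<zeta> / (2 * of_real B - w \<zeta>))"
  have R: "0 < R" using r by simp
  have B: "0 < B" using A[of z0] R by (simp add: B_def)
  have inball: "z0 + of_real R * \<zeta> \<in> ball z0 R" if "cmod \<zeta> < 1" for \<zeta>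
    using that R by (simp add: dist_norm norm_mult)
  have Rew: "Re (w \<zeta>) < B" if "cmod \<zeta> < 1" for \<zeta>
    using A[OF inball[OF that]] by (simp add: w_def B_def)
  have nz: "2 * of_real B - w \<zeta> \<noteq> 0" if "cmod \<zeta> < 1" for \<zeta>
  proof
    assume "2 * of_real B - w \<zeta> = 0"
    then have "Re (w \<zeta>) = 2 * B" by (simp add: complex_eq_iff)
    then show False using Rew[OF that] B by simp
  qed
  have lin: "(\<lambda>\<zeta>. z0 + of_real R * \<zeta>) holomorphic_on ball 0 1" by (intro holomorphic_intros)
  have img: "(\<lambda>\<zeta>. z0 + of_real R * \<zeta>) ` ball 0 1 \<subseteq> ball z0 R"
    by (rule image_subsetI) (rule inball, simp)
  have "w holomorphic_on ball 0 1" unfolding w_def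
    by (rule holomorphic_on_diff[OF holomorphic_on_compose_gen[OF lin hol img, unfolded o_def] holomorphic_on_const])
  then have "h holomorphic_on ball 0 1" unfolding h_def
    using nz by (intro holomorphic_intros) (auto simp: dist_norm)
  moreover have "h 0 = 0" by (simp add: h_def w_def)
  moreover have "cmod (h \<zeta>) < 1" if "cmod \<zeta> < 1" for \<zeta>
  proof -
    have "(Re (w \<zeta>))\<^sup>2 < (2 * B - Re (w \<zeta>))\<^sup>2"
    proof -
      have "0 < 4 * B * (B - Re (w \<zeta>))" using B Rew[OF that] by simp
      then show ?thesis by (simp add: power2_eq_square algebra_simps)
    qed
    then have "cmod (w \<zeta>) < cmod (2 * of_real B - w \<zeta>)"
      unfolding cmod_def by simp
    then show ?thesis using nz[OF that] by (simp add: h_def norm_divide)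
  qed
  ultimately have Schwarz: "cmod (h \<zeta>) \<le> cmod \<zeta>" if "cmod \<zeta> < 1" for \<zeta>
    using Schwarz_Lemma(1) that by blast
  define \<zeta> where "\<zeta> = (z - z0) / of_real R"
  have \<zeta>: "cmod \<zeta> \<le> r / R" "cmod \<zeta> < 1" "r / R < 1"
    using z r R by (auto simp: \<zeta>_def norm_divide divide_right_mono field_simps)
  have wz: "w \<zeta> = f z - f z0" using R by (simp add: w_def \<zeta>_def)
  have "w \<zeta> = h \<zeta> * (2 * of_real B - w \<zeta>)" using nz[OF \<zeta>(2)] by (simp add: h_def)
  then have "cmod (w \<zeta>) = cmod (h \<zeta>) * cmod (2 * of_real B - w \<zeta>)" by (metis norm_mult)
  also have "\<dots> \<le> (r / R) * (2 * B + cmod (w \<zeta>))"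
  proof (intro mult_mono)
    show "cmod (h \<zeta>) \<le> r / R" using Schwarz[OF \<zeta>(2)] \<zeta>(1) by linarith
    show "cmod (2 * of_real B - w \<zeta>) \<le> 2 * B + cmod (w \<zeta>)"
      using norm_triangle_ineq4[of "2 * of_real B" "w \<zeta>"] B by (simp add: norm_mult)
  qed (use r R in auto)
  finally have "cmod (w \<zeta>) \<le> (r / R) * (2 * B + cmod (w \<zeta>))" .
  then have "cmod (w \<zeta>) * (R - r) \<le> 2 * r * B" using R by (simp add: field_simps)
  then have "cmod (w \<zeta>) \<le> 2 * r * B / (R - r)" using r by (simp add: pos_le_divide_eq)
  moreover have "cmod (f z) \<le> cmod (f z0) + cmod (w \<zeta>)"
    using norm_triangle_ineq[of "f z0" "w \<zeta>"] by (simp add: wz)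
  ultimately show ?thesis by (simp add: B_def)
qed

text \<open>A logarithm of s - 1 alone would be unbounded at infinity. Dividing by s + 1 keeps it
  bounded for \<open>Re s \<ge> 0\<close> away from 1, and introduces no zero or pole in that
  half-plane.\<close>

definition pole_log :: "complex \<Rightarrow> complex" where
  "pole_log s = Ln ((s - 1) / (s + 1))"

lemma pole_quotient_nonpos:
  assumes "(s - 1) / (s + 1) \<in> \<real>\<^sub>\<le>\<^sub>0" "s \<noteq> - 1"
  shows "Im s = 0 \<and> Re s \<le> 1"
proof -
  obtain x where x: "(s - 1) / (s + 1) = of_real x" "x \<le> 0"
    using assms(1) by (auto elim: nonpos_Reals_cases)
  have "s + 1 \<noteq> 0" using assms(2) by (simp add: add_eq_0_iff2)
  then have "s - 1 = of_real x * (s + 1)" using x by (simp add: field_simps)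
  then have "s * of_real (1 - x) = of_real (1 + x)" by (simp add: algebra_simps)
  moreover have "of_real (1 - x) \<noteq> (0::complex)" using x by (simp only: of_real_eq_0_iff)
  ultimately have "s = of_real (1 + x) / of_real (1 - x)"
    by (subst nonzero_eq_divide_eq)
  then have "s = of_real ((1 + x) / (1 - x))" by simp
  moreover have "(1 + x) / (1 - x) \<le> 1" using x by (simp add: divide_le_eq)
  ultimately show ?thesis by (simp del: of_real_divide)
qed

lemma pole_log_holomorphic:
  assumes "\<And>s. s \<in> S \<Longrightarrow> Re s > 1 \<or> Im s \<noteq> 0"
  shows "pole_log holomorphic_on S"
proof -
  have "s + 1 \<noteq> 0" "(s - 1) / (s + 1) \<notin> \<real>\<^sub>\<le>\<^sub>0" if "s \<in> S" for s
  proof -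
    have *: "s \<noteq> - 1" using assms[OF that] by auto
    then show "s + 1 \<noteq> 0" by (simp add: add_eq_0_iff2)
    show "(s - 1) / (s + 1) \<notin> \<real>\<^sub>\<le>\<^sub>0" using pole_quotient_nonpos[OF _ *] assms[OF that] by fastforce
  qed
  then show ?thesis unfolding pole_log_def by (intro holomorphic_intros) auto
qed

lemma exp_pole_log: "s \<noteq> 1 \<Longrightarrow> s \<noteq> - 1 \<Longrightarrow> exp (pole_log s) = (s - 1) / (s + 1)"
  unfolding pole_log_def by (intro exp_Ln) (auto simp: add_eq_0_iff2)

lemma norm_diff_one_le: "0 \<le> Re s \<Longrightarrow> cmod (s - 1) \<le> cmod (s + 1)"
  unfolding cmod_def by (simp add: power2_eq_square algebra_simps)

text \<open>The quotient has absolute value at most 1, and at least d/3 because |s + 1| <= |s - 1| +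
  2; the principal argument adds at most pi.\<close>

lemma pole_log_bound:
  assumes d: "0 < d" "d \<le> 1" "d \<le> cmod (s - 1)" and s: "0 \<le> Re s"
  shows "cmod (pole_log s) \<le> ln (3 / d) + pi"
proof -
  have nz: "s \<noteq> 1" "s \<noteq> - 1" using d s by auto
  then have s1: "s - 1 \<noteq> 0" "s + 1 \<noteq> 0" by (auto simp: add_eq_0_iff2)
  define w where "w = (s - 1) / (s + 1)"
  have w0: "w \<noteq> 0" using s1 by (simp add: w_def)
  have le: "cmod (s - 1) \<le> cmod (s + 1)" using s by (rule norm_diff_one_le)
  then have w1: "cmod w \<le> 1" using s1 by (simp add: w_def norm_divide)
  have "cmod (s + 1) \<le> cmod (s - 1) + 2" using norm_triangle_ineq[of "s - 1" 2] by (simp add: add.commute)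
  then have "d * cmod (s + 1) \<le> d * (cmod (s - 1) + 2)" using d by (intro mult_left_mono) auto
  also have "\<dots> = d * cmod (s - 1) + 2 * d" by (simp add: algebra_simps)
  also have "\<dots> \<le> 1 * cmod (s - 1) + 2 * cmod (s - 1)" using d by (intro add_mono mult_right_mono) auto
  finally have w2: "d / 3 \<le> cmod w" using s1 by (simp add: w_def norm_divide field_simps)
  have "ln (d / 3) \<le> ln (cmod w)" using w2 d w0 by (subst ln_le_cancel_iff) auto
  moreover have "ln (cmod w) \<le> 0" using w1 w0 by simp
  moreover have "ln (d / 3) = - ln (3 / d)" using d by (simp add: ln_div)
  ultimately have "\<bar>Re (Ln w)\<bar> \<le> ln (3 / d)" using w0 by simp
  moreover have "\<bar>Im (Ln w)\<bar> \<le> pi" using mpi_less_Im_Ln[OF w0] Im_Ln_le_pi[OF w0] by linarith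
  ultimately show ?thesis using cmod_le[of "Ln w"] by (simp add: pole_log_def w_def)
qed

lemma log_zeta_bound:
  assumes "1 < a" "a \<le> Re s"
  shows "cmod (log_zeta s) \<le> (\<Sum>n. real n powr (- a))"
  unfolding log_zeta_def
proof (intro norm_suminf_le summable_powr_minus assms)
  fix n :: nat
  show "cmod (of_real (log_coeff n) * of_nat n powr (- s)) \<le> real n powr (- a)"
  proof (cases "n = 0")
    case False
    have "cmod (of_real (log_coeff n) * of_nat n powr (- s)) = log_coeff n * real n powr (- Re s)"
      using log_coeff_nonneg by (simp add: norm_mult norm_of_nat_powr)
    also have "\<dots> \<le> 1 * real n powr (- a)"
      using log_coeff_nonneg log_coeff_le_1 assms False by (intro mult_mono powr_mono) auto
    finally show ?thesis by simp
  qed simp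
qed

lemma log_zeta_holomorphic: "log_zeta holomorphic_on {s. 1 < Re s}"
  unfolding holomorphic_on_open[OF open_halfspace_Re_gt] using log_zeta_derivative(1) by blast

text \<open>The half-plane is contractible and, under the Riemann hypothesis,
  \<open>xzeta s / (s + 1)\<close> has no zero there, so it has a holomorphic logarithm. For
  \<open>Re s > 1\<close> its difference from \<open>log_zeta + pole_log\<close> has exponential 1,
  hence is a constant, which is subtracted.\<close>

lemma ex_regularised_log_zeta:
  assumes RH: riemann_hypothesis
  obtains Z where "Z holomorphic_on {s. 1 / 2 < Re s}"
    and "\<And>s. 1 / 2 < Re s \<Longrightarrow> exp (Z s) = xzeta s / (s + 1)"
    and "\<And>s. 1 < Re s \<Longrightarrow> Z s = log_zeta s + pole_log s"
proof -
  have m1: "s + 1 \<noteq> 0" if "1 / 2 < Re s" for s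
    using that by (auto simp: add_eq_0_iff2)
  have "(\<lambda>s. xzeta s / (s + 1)) holomorphic_on {s. 1 / 2 < Re s}"
    using m1 by (intro holomorphic_intros holomorphic_on_subset[OF xzeta_holomorphic]) auto
  moreover have "contractible {s. 1 / 2 < Re s}"
    by (intro convex_imp_contractible convex_halfspace_Re_gt)
  moreover have "xzeta s / (s + 1) \<noteq> 0" if "s \<in> {s. 1 / 2 < Re s}" for s
    using that m1 xzeta_nonzero[OF RH] by auto
  ultimately obtain Z0 where Z0: "Z0 holomorphic_on {s. 1 / 2 < Re s}"
      "\<And>s. s \<in> {s. 1 / 2 < Re s} \<Longrightarrow> xzeta s / (s + 1) = exp (Z0 s)"
    by (rule contractible_imp_holomorphic_log) blast+
  define E where "E = (\<lambda>s. Z0 s - log_zeta s - pole_log s)"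
  have E1: "exp (E s) = 1" if "1 < Re s" for s
  proof -
    have nz: "s \<noteq> 1" "s \<noteq> - 1" using that by auto
    then have s1: "s - 1 \<noteq> 0" "s + 1 \<noteq> 0" by (auto simp: add_eq_0_iff2)
    have z: "zeta s \<noteq> 0" using exp_log_zeta[OF that] exp_not_eq_zero by metis
    have "exp (Z0 s) = (s - 1) * zeta s / (s + 1)"
      using Z0(2)[of s] xzeta_eq_halfplane[OF that] that by simp
    then show ?thesis unfolding E_def
      using exp_log_zeta[OF that] exp_pole_log[OF nz] s1 z by (simp add: exp_diff)
  qed
  have Ehol: "E holomorphic_on {s. 1 < Re s}"
    unfolding E_def
    by (intro holomorphic_intros log_zeta_holomorphic pole_log_holomorphic holomorphic_on_subset[OF Z0(1)]) auto
  have "(E has_field_derivative 0) (at s within {s. 1 < Re s})" if sS: "s \<in> {s. 1 < Re s}" for s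
  proof -
    obtain e where e: "(E has_field_derivative e) (at s)"
      using Ehol sS by (auto simp: holomorphic_on_open open_halfspace_Re_gt)
    then have "((\<lambda>s. exp (E s)) has_field_derivative exp (E s) * e) (at s)"
      by (rule DERIV_fun_exp)
    moreover have "eventually (\<lambda>z. exp (E z) = 1) (nhds s)"
      using E1 sS eventually_nhds_in_open[OF open_halfspace_Re_gt, of s 1] by (auto elim: eventually_mono)
    then have "((\<lambda>s. exp (E s)) has_field_derivative 0) (at s)"
      by (subst DERIV_cong_ev[OF refl _ refl, where g = "\<lambda>_. 1"]) auto
    ultimately have "exp (E s) * e = 0" by (rule DERIV_unique)
    then have "e = 0" by simp
    then show ?thesis using e by (simp add: has_field_derivative_at_within)
  qed
  then obtain c where c: "\<And>s. s \<in> {s. 1 < Re s} \<Longrightarrow> E s = c"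
    using has_field_derivative_zero_constant[OF convex_halfspace_Re_gt] by blast
  have expc: "exp c = 1" using c[of 2] E1[of 2] by simp
  show thesis
  proof (rule that[of "\<lambda>s. Z0 s - c"])
    show "(\<lambda>s. Z0 s - c) holomorphic_on {s. 1 / 2 < Re s}" by (intro holomorphic_intros Z0(1))
    show "exp (Z0 s - c) = xzeta s / (s + 1)" if "1 / 2 < Re s" for s
      using Z0(2)[of s] that expc by (simp add: exp_diff)
    show "Z0 s - c = log_zeta s + pole_log s" if "1 < Re s" for s
      using c[of s] that by (simp add: E_def algebra_simps)
  qed
qed

lemma xzeta_quotient_bound:
  obtains K where "K > 0" "\<And>s. 1 / 2 \<le> Re s \<Longrightarrow> cmod (xzeta s / (s + 1)) \<le> 1 + K * cmod s"
proof -
  obtain K where K: "K > 0" "\<And>s. 1 / 2 \<le> Re s \<Longrightarrow> cmod (xzeta s - 1) \<le> K * cmod (s - 1) * cmod s"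
    using xzeta_bound by blast
  show thesis
  proof (rule that[OF K(1)])
    fix s assume s: "1 / 2 \<le> Re s"
    have s1: "1 \<le> cmod (s + 1)" using s complex_Re_le_cmod[of "s + 1"] by simp
    have le: "cmod (s - 1) \<le> cmod (s + 1)" using s by (intro norm_diff_one_le) simp
    have "cmod (xzeta s) \<le> 1 + cmod (xzeta s - 1)" using norm_triangle_ineq[of 1 "xzeta s - 1"] by simp
    also have "\<dots> \<le> 1 * cmod (s + 1) + K * cmod (s + 1) * cmod s"
      using K(2)[OF s] s1 mult_right_mono[OF mult_left_mono[OF le less_imp_le[OF K(1)]] norm_ge_zero[of s]] by linarith
    also have "\<dots> = (1 + K * cmod s) * cmod (s + 1)" by (simp add: algebra_simps)
    finally have "cmod (xzeta s) \<le> (1 + K * cmod s) * cmod (s + 1)" .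
    moreover have "0 < cmod (s + 1)" using s1 by linarith
    ultimately show "cmod (xzeta s / (s + 1)) \<le> 1 + K * cmod s"
      by (simp add: norm_divide pos_divide_le_eq del: zero_less_norm_iff)
  qed
qed

text \<open>The real part of Z is the logarithm of the modulus of a function of polynomial growth.
  Borel-Caratheodory on a disc about 2 + i Im s turns this into a logarithmic bound for Z, stated as
  an arbitrarily small power so that products with a decaying kernel stay integrable.\<close>

lemma regularised_log_zeta_growth:
  assumes hol: "Z holomorphic_on {s. 1 / 2 < Re s}"
    and expZ: "\<And>s. 1 / 2 < Re s \<Longrightarrow> exp (Z s) = xzeta s / (s + 1)"
    and ZD: "\<And>s. 1 < Re s \<Longrightarrow> Z s = log_zeta s + pole_log s"
    and a: "1 / 2 < a" "a \<le> 1" and \<eta>: "0 < \<eta>"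
  obtains C where "C > 0" "\<And>s. a \<le> Re s \<Longrightarrow> Re s \<le> 2 \<Longrightarrow> cmod (Z s) \<le> C * (1 + \<bar>Im s\<bar>) powr \<eta>"
proof -
  obtain K where K: "K > 0" "\<And>s. 1 / 2 \<le> Re s \<Longrightarrow> cmod (xzeta s / (s + 1)) \<le> 1 + K * cmod s"
    using xzeta_quotient_bound by blast
  define M where "M = (\<Sum>n. real n powr (- 2)) + ln 3 + pi"
  \<comment> \<open>The midpoint between r = 2 - a, which reaches the given abscissae, and 3/2,
    which reaches the critical line.\<close>
  define R where "R = 7 / 4 - a / 2"
  define r where "r = 2 - a"
  define c where "c = 2 * r / (R - r)"
  have rR: "0 < r" "r < R" using a by (auto simp: r_def R_def)
  have c: "0 < c" using rR by (simp add: c_def)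
  have "0 \<le> (\<Sum>n. real n powr (- 2))" by (intro suminf_nonneg summable_powr_minus) auto
  then have M: "0 < M" by (simp add: M_def add_nonneg_pos)
  define C where "C = M + c * (ln (2 + 4 * K) + 1 / \<eta> + M)"
  have lnK: "0 \<le> ln (2 + 4 * K)" using K by simp
  have "C > 0" unfolding C_def using M c lnK \<eta> by (intro add_pos_nonneg) auto
  moreover have "cmod (Z s) \<le> C * (1 + \<bar>Im s\<bar>) powr \<eta>" if s: "a \<le> Re s" "Re s \<le> 2" for s
  proof -
    define s0 where "s0 = Complex 2 (Im s)"
    define A where "A = ln (2 + K * (4 + \<bar>Im s\<bar>))"
    have dist: "cmod (s - s0) \<le> r"
    proof -
      have "s - s0 = of_real (Re s - 2)" by (simp add: s0_def complex_eq_iff)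
      then have "cmod (s - s0) = \<bar>Re s - 2\<bar>" by (simp only: norm_of_real)
      then show ?thesis using s by (simp add: r_def)
    qed
    have Z0: "cmod (Z s0) \<le> M"
    proof -
      have "1 \<le> cmod (s0 - 1)" using complex_Re_le_cmod[of "s0 - 1"] by (simp add: s0_def)
      then have "cmod (pole_log s0) \<le> ln (3 / 1) + pi" by (intro pole_log_bound) (auto simp: s0_def)
      moreover have "cmod (log_zeta s0) \<le> (\<Sum>n. real n powr (- 2))" by (intro log_zeta_bound) (auto simp: s0_def)
      moreover have "Z s0 = log_zeta s0 + pole_log s0" by (intro ZD) (simp add: s0_def)
      ultimately show ?thesis using norm_triangle_ineq[of "log_zeta s0" "pole_log s0"] by (simp add: M_def)
    qed
    have half: "1 / 2 < Re z \<and> cmod z \<le> 4 + \<bar>Im s\<bar>" if "z \<in> ball s0 R" for z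
    proof -
      have d: "cmod (s0 - z) < R" using that by (simp add: dist_norm)
      then have "Re (s0 - z) < R" using complex_Re_le_cmod[of "s0 - z"] by linarith
      then have 1: "1 / 2 < Re z" using a by (simp add: s0_def R_def)
      have "cmod s0 \<le> 2 + \<bar>Im s\<bar>" using cmod_le[of s0] by (simp add: s0_def)
      moreover have "cmod z \<le> cmod s0 + cmod (s0 - z)" using norm_triangle_ineq4[of s0 "s0 - z"] by simp
      ultimately show ?thesis using 1 d a by (simp add: R_def)
    qed
    have "cmod (Z s) \<le> cmod (Z s0) + 2 * r * (A - Re (Z s0)) / (R - r)"
    proof (rule borel_caratheodory[OF _ rR _ dist])
      show "Z holomorphic_on ball s0 R" using half by (intro holomorphic_on_subset[OF hol]) auto
      fix z assume z: "z \<in> ball s0 R"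
      have "exp (Re (Z z)) = cmod (xzeta z / (z + 1))"
        using expZ[of z] half[OF z] by (metis norm_exp_eq_Re)
      also have "\<dots> \<le> 1 + K * cmod z" using half[OF z] by (intro K(2)) auto
      also have "\<dots> < 2 + K * (4 + \<bar>Im s\<bar>)" using half[OF z] K(1) by (intro add_less_le_mono mult_left_mono) auto
      finally have "exp (Re (Z z)) < 2 + K * (4 + \<bar>Im s\<bar>)" .
      then show "Re (Z z) < A" unfolding A_def
        by (metis exp_gt_zero exp_less_cancel_iff exp_ln less_trans)
    qed
    also have "\<dots> = cmod (Z s0) + c * (A - Re (Z s0))" by (simp add: c_def)
    also have "\<dots> \<le> M + c * (A + M)"
      using Z0 c abs_Re_le_cmod[of "Z s0"] by (intro add_mono mult_left_mono) auto
    also have "\<dots> \<le> C * (1 + \<bar>Im s\<bar>) powr \<eta>"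
    proof -
      define P where "P = (1 + \<bar>Im s\<bar>) powr \<eta>"
      have P: "1 \<le> P" unfolding P_def using \<eta> by (intro ge_one_powr_ge_zero) auto
      have "A \<le> ln ((2 + 4 * K) * (1 + \<bar>Im s\<bar>))" unfolding A_def
      proof (subst ln_le_cancel_iff)
        show "0 < 2 + K * (4 + \<bar>Im s\<bar>)" using K(1) by (intro add_pos_nonneg) auto
        show "2 + K * (4 + \<bar>Im s\<bar>) \<le> (2 + 4 * K) * (1 + \<bar>Im s\<bar>)" using K(1) by (simp add: algebra_simps)
      qed (use K(1) in auto)
      also have "\<dots> = ln (2 + 4 * K) + ln (1 + \<bar>Im s\<bar>)" using K(1) by (intro ln_mult_pos) auto
      also have "\<eta> * ln (1 + \<bar>Im s\<bar>) = ln P" by (simp add: P_def ln_powr)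
      then have "ln (1 + \<bar>Im s\<bar>) = ln P / \<eta>" using \<eta> by (simp add: field_simps)
      also have "ln P / \<eta> \<le> P / \<eta>" using \<eta> P ln_le_minus_one[of P] by (intro divide_right_mono) auto
      finally have A: "A \<le> ln (2 + 4 * K) + P / \<eta>" by simp
      have "M + c * (A + M) \<le> M * P + c * (ln (2 + 4 * K) * P + P / \<eta> + M * P)"
        using A P M lnK c by (intro add_mono mult_left_mono) (auto intro: order_trans[OF A] add_right_mono simp: mult_le_cancel_left1)
      also have "\<dots> = C * P" by (simp add: C_def algebra_simps)
      finally show ?thesis by (simp add: P_def)
    qed
    finally show ?thesis .
  qed
  ultimately show thesis by (rule that)
qed

text \<open>The restriction \<open>Re s \<le> 3 / 4\<close> keeps s at distance 1/4 from the pole,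
  so that the bound for \<open>xzeta\<close> may be divided by s - 1.\<close>

lemma zeta_bound_near_line:
  obtains C where "C \<ge> 1" "\<And>s. 1 / 2 \<le> Re s \<Longrightarrow> Re s \<le> 3 / 4 \<Longrightarrow> cmod (zeta s) \<le> C * (1 + \<bar>Im s\<bar>)"
proof -
  obtain K where K: "K > 0" "\<And>s. 1 / 2 \<le> Re s \<Longrightarrow> cmod (xzeta s - 1) \<le> K * cmod (s - 1) * cmod s"
    using xzeta_bound by blast
  show thesis
  proof (rule that[of "4 + K"])
    fix s assume s: "1 / 2 \<le> Re s" "Re s \<le> 3 / 4"
    have s1: "1 / 4 \<le> cmod (s - 1)" using s abs_Re_le_cmod[of "s - 1"] by simp
    then have nz: "s \<noteq> 1" by auto
    have "cmod (s - 1) * cmod (zeta s) = cmod (xzeta s)"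
      using nz s by (subst xzeta_eq) (auto simp: norm_mult)
    also have "\<dots> \<le> 1 + cmod (xzeta s - 1)" using norm_triangle_ineq[of 1 "xzeta s - 1"] by simp
    also have "\<dots> \<le> 4 * cmod (s - 1) + K * cmod (s - 1) * cmod s" using K(2)[OF s(1)] s1 by simp
    also have "\<dots> = cmod (s - 1) * (4 + K * cmod s)" by (simp add: algebra_simps)
    finally have "cmod (zeta s) \<le> 4 + K * cmod s" using nz by (simp add: mult_le_cancel_left)
    also have "cmod s \<le> 1 + \<bar>Im s\<bar>" using cmod_le[of s] s by simp
    then have "4 + K * cmod s \<le> 4 * (1 + \<bar>Im s\<bar>) + K * (1 + \<bar>Im s\<bar>)" using K(1) by (intro add_mono mult_left_mono) auto
    finally show "cmod (zeta s) \<le> (4 + K) * (1 + \<bar>Im s\<bar>)" by (simp add: algebra_simps)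
  qed (use K(1) in auto)
qed

subsection \<open>Integrals over vertical lines\<close>

lemma integrable_decay:
  fixes p :: real
  assumes p: "1 < p"
  shows "integrable lborel (\<lambda>y. (1 + \<bar>y\<bar>) powr (- p))"
proof -
  define f where "f = (\<lambda>y::real. (1 + \<bar>y\<bar>) powr (- p))"
  have [measurable]: "f \<in> borel_measurable borel" unfolding f_def by measurable
  define F where "F = (\<lambda>y::real. - ((1 + y) powr (1 - p)) / (p - 1))"
  have "(\<integral>\<^sup>+y. ennreal (f y) * indicator {0..} y \<partial>lborel) = ennreal (0 - F 0)"
  proof (rule nn_integral_FTC_atLeast)
    show "(F has_real_derivative f y) (at y)" if "0 \<le> y" for y
    proof -
      have "((\<lambda>y. (1 + y) powr (1 - p)) has_real_derivative ((1 - p) * (1 + y) powr (1 - p - 1)) * (0 + 1)) (at y)"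
        using that by (intro DERIV_chain2[OF has_real_derivative_powr] DERIV_add DERIV_const DERIV_ident) auto
      from DERIV_cmult[OF this, of "- 1 / (p - 1)"]
      have "(F has_real_derivative - 1 / (p - 1) * ((1 - p) * (1 + y) powr (- p))) (at y)"
        by (simp add: F_def)
      moreover have "- 1 / (p - 1) * ((1 - p) * (1 + y) powr (- p)) = f y"
        using that p by (simp add: f_def divide_simps) (simp add: algebra_simps)
      ultimately show ?thesis by simp
    qed
    have "((\<lambda>y. (1 + y) powr (1 - p)) \<longlongrightarrow> 0) at_top"
      using p by (intro tendsto_neg_powr filterlim_tendsto_add_at_top[OF tendsto_const] filterlim_ident) auto
    then have "((\<lambda>y. - ((1 + y) powr (1 - p)) / (p - 1)) \<longlongrightarrow> - 0 / (p - 1)) at_top"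
      using p by (intro tendsto_intros) auto
    then show "(F \<longlongrightarrow> 0) at_top" by (simp add: F_def)
  qed (auto simp: f_def)
  moreover have "ennreal (f y * indicator {0..} y) = ennreal (f y) * indicator {0..} y" for y
    by (simp add: indicator_def)
  ultimately have "(\<integral>\<^sup>+y. ennreal (f y * indicator {0..} y) \<partial>lborel) < \<infinity>"
    by simp
  then have 1: "integrable lborel (\<lambda>y. f y * indicator {0..} y)"
    by (intro integrableI_nonneg) (auto simp: f_def)
  have 2: "integrable lborel (\<lambda>y. f y * indicator {0..} (- y))"
    using lborel_integrable_real_affine[OF 1, of "-1" 0] by (simp add: f_def)
  show ?thesis
  proof (rule Bochner_Integration.integrable_bound[OF Bochner_Integration.integrable_add[OF 1 2]])
    show "AE x in lborel. norm ((1 + \<bar>x\<bar>) powr - p) \<le> norm (f x * indicator {0..} x + f x * indicator {0..} (- x))"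
      by (auto simp: f_def indicator_def)
  qed simp
qed

text \<open>Uniformity in the real part makes horizontal edges vanish at infinity, and an exponent
  above 1 makes vertical lines integrable; the exponent itself is left open because it changes with
  every product.\<close>

definition decays_on :: "complex set \<Rightarrow> (complex \<Rightarrow> complex) \<Rightarrow> bool" where
  "decays_on S f \<longleftrightarrow> (\<exists>p>1. \<exists>B. \<forall>s\<in>S. cmod (f s) \<le> B * (1 + \<bar>Im s\<bar>) powr (- p))"

lemma decays_on_subset: "decays_on S f \<Longrightarrow> T \<subseteq> S \<Longrightarrow> decays_on T f"
  unfolding decays_on_def by blast

lemma decays_on_line_integrable:
  assumes dec: "decays_on S f" and A: "A \<in> sets borel" "\<And>y. y \<in> A \<Longrightarrow> Complex x y \<in> S"
    and cont: "continuous_on A (\<lambda>y. f (Complex x y))"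
  shows "set_integrable lborel A (\<lambda>y. f (Complex x y))"
proof -
  obtain p B where p: "p > 1" and B: "\<And>s. s \<in> S \<Longrightarrow> cmod (f s) \<le> B * (1 + \<bar>Im s\<bar>) powr (- p)"
    using dec unfolding decays_on_def by blast
  have "integrable lborel (\<lambda>y. B * (1 + \<bar>y\<bar>) powr (- p))"
    using integrable_decay[OF p] by simp
  then have "set_integrable lborel A (\<lambda>y. B * (1 + \<bar>y\<bar>) powr (- p))"
    unfolding set_integrable_def using A(1) by (intro integrable_mult_indicator) simp_all
  then show ?thesis
  proof (rule set_integrable_bound)
    show "set_borel_measurable lborel A (\<lambda>y. f (Complex x y))"
      using borel_measurable_continuous_on_indicator[OF A(1) cont] by (simp add: set_borel_measurable_def)
    show "AE y in lborel. y \<in> A \<longrightarrow> norm (f (Complex x y)) \<le> norm (B * (1 + \<bar>y\<bar>) powr - p)"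
    proof (intro always_eventually allI impI)
      fix y assume y: "y \<in> A"
      have "norm (f (Complex x y)) \<le> B * (1 + \<bar>y\<bar>) powr - p" using B[OF A(2)[OF y]] by simp
      also have "\<dots> \<le> \<bar>\<dots>\<bar>" by simp
      finally show "norm (f (Complex x y)) \<le> norm (B * (1 + \<bar>y\<bar>) powr - p)" by simp
    qed
  qed
qed

lemma continuous_on_vertical:
  assumes "f holomorphic_on S" "\<And>y. y \<in> A \<Longrightarrow> Complex x y \<in> S"
  shows "continuous_on A (\<lambda>y. f (Complex x y))"
proof (rule continuous_on_compose2[OF holomorphic_on_imp_continuous_on[OF assms(1)]])
  show "continuous_on A (Complex x)" unfolding Complex_eq by (intro continuous_intros)
qed (use assms in auto)

lemma continuous_on_horizontal:
  assumes "f holomorphic_on S" "\<And>x. x \<in> A \<Longrightarrow> Complex x y \<in> S"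
  shows "continuous_on A (\<lambda>x. f (Complex x y))"
proof (rule continuous_on_compose2[OF holomorphic_on_imp_continuous_on[OF assms(1)]])
  show "continuous_on A (\<lambda>x. Complex x y)" unfolding Complex_eq by (intro continuous_intros)
qed (use assms in auto)

lemma rectangle_integral:
  fixes f :: "complex \<Rightarrow> complex"
  assumes hol: "f holomorphic_on {s. a \<le> Re s \<and> Re s \<le> c \<and> b \<le> Im s \<and> Im s \<le> d}"
    and ac: "a < c" and bd: "b < d"
  shows "\<i> * integral {b..d} (\<lambda>y. f (Complex c y)) - \<i> * integral {b..d} (\<lambda>y. f (Complex a y)) =
         integral {a..c} (\<lambda>x. f (Complex x d)) - integral {a..c} (\<lambda>x. f (Complex x b))"
proof -
  define S where "S = {s. a \<le> Re s \<and> Re s \<le> c \<and> b \<le> Im s \<and> Im s \<le> d}"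
  have S: "S = cbox (Complex a b) (Complex c d)"
    by (auto simp: S_def in_cbox_complex_iff)
  have convS: "convex S" unfolding S by (rule convex_box)
  define P where "P = Complex a b" define Q where "Q = Complex c b"
  define R where "R = Complex c d" define T where "T = Complex a d"
  have inS: "P \<in> S" "Q \<in> S" "R \<in> S" "T \<in> S" using ac bd by (auto simp: P_def Q_def R_def T_def S_def)
  have seg: "closed_segment u v \<subseteq> S" if "u \<in> S" "v \<in> S" for u v
    using that convS by (simp add: closed_segment_subset)
  have holS: "f holomorphic_on S" using hol by (simp add: S_def)
  have int: "f contour_integrable_on (linepath u v)" if "u \<in> S" "v \<in> S" for u v
    by (intro contour_integrable_continuous_linepath continuous_on_subset[OF holomorphic_on_imp_continuous_on[OF holS] seg] that)
  define g where "g = linepath P Q +++ linepath Q R +++ linepath R T +++ linepath T P"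
  have "(f has_contour_integral 0) g"
  proof (rule Cauchy_theorem_convex_simple[OF holS convS])
    show "path_image g \<subseteq> S" unfolding g_def using seg inS
      by (intro subset_path_image_join) auto
  qed (auto simp: g_def)
  moreover have "(f has_contour_integral (contour_integral (linepath P Q) f + (contour_integral (linepath Q R) f +
      (contour_integral (linepath R T) f + contour_integral (linepath T P) f)))) g"
    unfolding g_def using int inS
    by (intro has_contour_integral_join has_contour_integral_integral) auto
  ultimately have "contour_integral (linepath P Q) f + (contour_integral (linepath Q R) f +
      (contour_integral (linepath R T) f + contour_integral (linepath T P) f)) = 0"
    using has_contour_integral_unique by blast
  moreover have "contour_integral (linepath R T) f = - contour_integral (linepath T R) f"
    using contour_integral_reversepath[of "linepath T R" f] by simp
  moreover have "contour_integral (linepath T P) f = - contour_integral (linepath P T) f"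
    using contour_integral_reversepath[of "linepath P T" f] by simp
  moreover have hor: "contour_integral (linepath (Complex a y) (Complex c y)) f = integral {a..c} (\<lambda>x. f (Complex x y))"
    if "Complex a y \<in> S" "Complex c y \<in> S" for y
  proof -
    have eq: "linepath (Complex a y) (Complex c y) t = linepath (of_real a) (of_real c) t + Complex 0 y"
      "Complex c y - Complex a y = of_real c - of_real a" for t
      by (auto simp: linepath_def complex_eq_iff algebra_simps)
    have "(f has_contour_integral contour_integral (linepath (Complex a y) (Complex c y)) f)
        (linepath (Complex a y) (Complex c y))"
      by (rule has_contour_integral_integral[OF int[OF that]])
    then have "((\<lambda>z. f (z + Complex 0 y)) has_contour_integral contour_integral (linepath (Complex a y) (Complex c y)) f)
        (linepath (of_real a) (of_real c))"
      unfolding has_contour_integral_linepath eq .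
    then have "((\<lambda>x. f (of_real x + Complex 0 y)) has_integral contour_integral (linepath (Complex a y) (Complex c y)) f) {a..c}"
      using ac by (subst (asm) has_contour_integral_linepath_Reals_iff) auto
    moreover have "of_real x + Complex 0 y = Complex x y" for x by (simp add: complex_eq_iff)
    ultimately show ?thesis by (simp add: integral_unique)
  qed
  moreover have vert: "contour_integral (linepath (Complex x b) (Complex x d)) f = \<i> * integral {b..d} (\<lambda>y. f (Complex x y))"
    if "Complex x b \<in> S" "Complex x d \<in> S" for x
  proof -
    have "((\<lambda>y. f (Complex x y)) has_integral - \<i> * contour_integral (linepath (Complex x b) (Complex x d)) f) {b..d}"
      using has_contour_integral_linepath_same_Re_iff[of "Complex x b" x "Complex x d" b d f]
        has_contour_integral_integral[OF int[OF that]] bd by simp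
    then show ?thesis by (simp add: integral_unique)
  qed
  ultimately show ?thesis
    using hor[of b] hor[of d] vert[of a] vert[of c] inS
    unfolding P_def Q_def R_def T_def by (simp add: algebra_simps)
qed

text \<open>The limit of \<open>rectangle_integral\<close> as the top edge recedes and vanishes by
  decay; the edge at height b remains. Half-strips are needed besides full strips for
  \<open>pole_log\<close>, whose cut meets the full strip.\<close>

lemma half_strip_integral:
  fixes f :: "complex \<Rightarrow> complex"
  assumes hol: "f holomorphic_on {s. a \<le> Re s \<and> Re s \<le> c \<and> b \<le> Im s}" (is "_ holomorphic_on ?S")
    and dec: "decays_on {s. a \<le> Re s \<and> Re s \<le> c \<and> b \<le> Im s} f" and ac: "a < c"
  shows "\<i> * (LINT y:{b..}|lborel. f (Complex c y)) - \<i> * (LINT y:{b..}|lborel. f (Complex a y)) =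
         - integral {a..c} (\<lambda>x. f (Complex x b))"
proof -
  have int: "set_integrable lborel {b..} (\<lambda>y. f (Complex x y))" if "x \<in> {a..c}" for x
    using that by (intro decays_on_line_integrable[OF dec] continuous_on_vertical[OF hol]) auto
  have lim: "((\<lambda>d. integral {b..d} (\<lambda>y. f (Complex x y))) \<longlongrightarrow> (LINT y:{b..}|lborel. f (Complex x y))) at_top"
    if "x \<in> {a..c}" for x
  proof -
    have "((\<lambda>d. LINT y:{b..d}|lborel. f (Complex x y)) \<longlongrightarrow> (LINT y:{b..}|lborel. f (Complex x y))) at_top"
      by (rule tendsto_set_lebesgue_integral_at_top) (use int[OF that] in auto)
    moreover have "(LINT y:{b..d}|lborel. f (Complex x y)) = integral {b..d} (\<lambda>y. f (Complex x y))" for d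
      by (rule set_borel_integral_eq_integral(2)) (rule set_integrable_subset[OF int[OF that]], auto)
    ultimately show ?thesis by simp
  qed
  obtain p B where p: "p > 1" and B: "\<And>s. s \<in> ?S \<Longrightarrow> cmod (f s) \<le> B * (1 + \<bar>Im s\<bar>) powr (- p)"
    using dec unfolding decays_on_def by blast
  have hor: "((\<lambda>d. integral {a..c} (\<lambda>x. f (Complex x d))) \<longlongrightarrow> 0) at_top"
  proof (rule Lim_null_comparison)
    have "((\<lambda>d::real. (1 + d) powr (- p)) \<longlongrightarrow> 0) at_top"
      using p by (intro tendsto_neg_powr filterlim_tendsto_add_at_top[OF tendsto_const] filterlim_ident) auto
    then show "((\<lambda>d. B * (1 + d) powr (- p) * (c - a)) \<longlongrightarrow> 0) at_top"
      by (intro tendsto_mult_left_zero tendsto_mult_right_zero)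
    show "eventually (\<lambda>d. norm (integral {a..c} (\<lambda>x. f (Complex x d))) \<le> B * (1 + d) powr (- p) * (c - a)) at_top"
      using eventually_ge_at_top[of "max 0 b"]
    proof eventually_elim
      case (elim d)
      show ?case
      proof (rule integral_bound)
        show "continuous_on {a..c} (\<lambda>x. f (Complex x d))"
          using elim by (intro continuous_on_horizontal[OF hol]) auto
        fix x assume "x \<in> {a..c}"
        then show "norm (f (Complex x d)) \<le> B * (1 + d) powr - p"
          using B[of "Complex x d"] elim by simp
      qed (use ac in auto)
    qed
  qed
  have lim1: "((\<lambda>d. \<i> * integral {b..d} (\<lambda>y. f (Complex c y)) - \<i> * integral {b..d} (\<lambda>y. f (Complex a y))) \<longlongrightarrow>
      \<i> * (LINT y:{b..}|lborel. f (Complex c y)) - \<i> * (LINT y:{b..}|lborel. f (Complex a y))) at_top"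
    using ac by (intro tendsto_intros lim) auto
  have lim2: "((\<lambda>d. integral {a..c} (\<lambda>x. f (Complex x d)) - integral {a..c} (\<lambda>x. f (Complex x b))) \<longlongrightarrow>
      0 - integral {a..c} (\<lambda>x. f (Complex x b))) at_top"
    by (intro tendsto_intros hor)
  have ev: "eventually (\<lambda>d. integral {a..c} (\<lambda>x. f (Complex x d)) - integral {a..c} (\<lambda>x. f (Complex x b)) =
     \<i> * integral {b..d} (\<lambda>y. f (Complex c y)) - \<i> * integral {b..d} (\<lambda>y. f (Complex a y))) at_top"
    using eventually_gt_at_top[of b]
  proof eventually_elim
    case (elim d)
    have "f holomorphic_on {s. a \<le> Re s \<and> Re s \<le> c \<and> b \<le> Im s \<and> Im s \<le> d}"
      by (rule holomorphic_on_subset[OF hol]) auto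
    from rectangle_integral[OF this ac elim] show ?case by simp
  qed
  show ?thesis
    using tendsto_unique[OF trivial_limit_at_top_linorder lim1 Lim_transform_eventually[OF lim2 ev]] by simp
qed

text \<open>Obtained from the upper half-strip by s -> - s. The open ray \<open>{..<b}\<close> fits
  disjointly with \<open>{b..}\<close>; its missing end point is a null set.\<close>

lemma lower_half_strip_integral:
  fixes f :: "complex \<Rightarrow> complex"
  assumes hol: "f holomorphic_on {s. a \<le> Re s \<and> Re s \<le> c \<and> Im s \<le> b}"
    and dec: "decays_on {s. a \<le> Re s \<and> Re s \<le> c \<and> Im s \<le> b} f" and ac: "a < c"
  shows "\<i> * (LINT y:{..<b}|lborel. f (Complex c y)) - \<i> * (LINT y:{..<b}|lborel. f (Complex a y)) =
         integral {a..c} (\<lambda>x. f (Complex x b))"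
proof -
  define g where "g = (\<lambda>s. f (- s))"
  have neg: "uminus holomorphic_on {s. - c \<le> Re s \<and> Re s \<le> - a \<and> - b \<le> Im s}"
    by (intro holomorphic_intros)
  have "g holomorphic_on {s. - c \<le> Re s \<and> Re s \<le> - a \<and> - b \<le> Im s}"
    unfolding g_def by (rule holomorphic_on_compose_gen[OF neg hol, unfolded o_def]) auto
  moreover have "decays_on {s. - c \<le> Re s \<and> Re s \<le> - a \<and> - b \<le> Im s} g"
  proof -
    obtain p B where "p > 1" "\<And>s. s \<in> {s. a \<le> Re s \<and> Re s \<le> c \<and> Im s \<le> b} \<Longrightarrow> cmod (f s) \<le> B * (1 + \<bar>Im s\<bar>) powr (- p)"
      using dec unfolding decays_on_def by blast
    then have "\<forall>s\<in>{s. - c \<le> Re s \<and> Re s \<le> - a \<and> - b \<le> Im s}. cmod (g s) \<le> B * (1 + \<bar>Im s\<bar>) powr (- p)"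
      unfolding g_def by (metis (mono_tags, lifting) mem_Collect_eq uminus_complex.sel abs_minus neg_le_iff_le minus_le_iff)
    with \<open>p > 1\<close> show ?thesis unfolding decays_on_def by blast
  qed
  ultimately have *: "\<i> * (LINT y:{- b..}|lborel. g (Complex (- a) y)) - \<i> * (LINT y:{- b..}|lborel. g (Complex (- c) y)) =
         - integral {- c..- a} (\<lambda>x. g (Complex x (- b)))"
    using ac by (intro half_strip_integral) auto
  have line: "(LINT y:{- b..}|lborel. g (Complex (- x) y)) = (LINT y:{..<b}|lborel. f (Complex x y))"
    if "x \<in> {a..c}" for x
  proof -
    have "(LINT y:{- b..}|lborel. g (Complex (- x) y)) = (LINT y:{..b}|lborel. f (Complex x y))"
    proof -
      have "- Complex (- x) (- y) = Complex x y" for y by (simp add: complex_eq_iff)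
      then show ?thesis by (subst set_integral_reflect) (simp add: g_def atMost_def)
    qed
    also have "\<dots> = (LINT y:{..<b}|lborel. f (Complex x y))"
    proof (rule set_integral_cong_set)
      have c: "continuous_on {..b} (\<lambda>y. f (Complex x y))"
        using that by (intro continuous_on_vertical[OF hol]) auto
      show "set_borel_measurable lborel {..<b} (\<lambda>y. f (Complex x y))" "set_borel_measurable lborel {..b} (\<lambda>y. f (Complex x y))"
        using borel_measurable_continuous_on_indicator[OF _ c] borel_measurable_continuous_on_indicator[OF _ continuous_on_subset[OF c], of "{..<b}"]
        by (auto simp: set_borel_measurable_def less_imp_le subset_eq)
      show "AE y in lborel. (y \<in> {..<b}) = (y \<in> {..b})"
        using AE_lborel_singleton[of b] by eventually_elim auto
    qed
    finally show ?thesis .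
  qed
  have "integral {- c..- a} (\<lambda>x. g (Complex x (- b))) = integral {a..c} (\<lambda>x. f (Complex x b))"
  proof -
    have "- Complex x (- b) = Complex (- x) b" for x by (simp add: complex_eq_iff)
    then show ?thesis using Henstock_Kurzweil_Integration.integral_reflect_real[of c a "\<lambda>x. f (Complex x b)"] by (simp add: g_def)
  qed
  then show ?thesis using * line[of a] line[of c] ac by (simp add: algebra_simps)
qed

text \<open>Cutting at height 0 leaves the same edge integral with opposite signs in the two
  half-strips.\<close>

lemma strip_integral:
  fixes f :: "complex \<Rightarrow> complex"
  assumes hol: "f holomorphic_on {s. a \<le> Re s \<and> Re s \<le> c}"
    and dec: "decays_on {s. a \<le> Re s \<and> Re s \<le> c} f" and ac: "a < c"
  shows "(LINT y|lborel. f (Complex a y)) = (LINT y|lborel. f (Complex c y))"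
proof -
  have int: "set_integrable lborel A (\<lambda>y. f (Complex x y))" if "x \<in> {a..c}" "A \<in> sets borel" for x A
    using that by (intro decays_on_line_integrable[OF dec] continuous_on_vertical[OF hol]) auto
  have split: "(LINT y|lborel. f (Complex x y)) =
      (LINT y:{..<0}|lborel. f (Complex x y)) + (LINT y:{0..}|lborel. f (Complex x y))" if "x \<in> {a..c}" for x
  proof -
    have "{..<0::real} \<union> {0..} = UNIV" by auto
    then have "(LINT y|lborel. f (Complex x y)) = (LINT y:{..<0} \<union> {0..}|lborel. f (Complex x y))"
      by (simp add: set_lebesgue_integral_def)
    also have "\<dots> = (LINT y:{..<0}|lborel. f (Complex x y)) + (LINT y:{0..}|lborel. f (Complex x y))"
      by (rule set_integral_Un) (auto intro!: int that)
    finally show ?thesis .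
  qed
  have "\<i> * (LINT y:{0..}|lborel. f (Complex c y)) - \<i> * (LINT y:{0..}|lborel. f (Complex a y)) =
         - integral {a..c} (\<lambda>x. f (Complex x 0))"
    using ac by (intro half_strip_integral holomorphic_on_subset[OF hol] decays_on_subset[OF dec]) auto
  moreover have "\<i> * (LINT y:{..<0}|lborel. f (Complex c y)) - \<i> * (LINT y:{..<0}|lborel. f (Complex a y)) =
         integral {a..c} (\<lambda>x. f (Complex x 0))"
    using ac by (intro lower_half_strip_integral holomorphic_on_subset[OF hol] decays_on_subset[OF dec]) auto
  ultimately have "\<i> * (LINT y|lborel. f (Complex c y)) = \<i> * (LINT y|lborel. f (Complex a y))"
    using split[of a] split[of c] ac by (simp add: algebra_simps)
  then show ?thesis by simp
qed

subsection \<open>The kernel and its Fourier transform\<close>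

text \<open>For exchanging the integral over u with the one over the frequency l: integrability of f
  and k suffices because the exponential kernel has modulus at most 1.\<close>

lemma fubini_bounded_kernel:
  fixes f k :: "real \<Rightarrow> complex" and E :: "real \<Rightarrow> real \<Rightarrow> complex"
  assumes f: "integrable lborel f" and k: "integrable lborel k"
    and E[measurable]: "case_prod E \<in> borel_measurable (borel \<Otimes>\<^sub>M borel)"
    and bound: "\<And>u l. cmod (E u l) \<le> 1"
  shows "(LINT l|lborel. k l * (LINT u|lborel. f u * E u l)) = (LINT u|lborel. f u * (LINT l|lborel. k l * E u l))"
proof -
  have [measurable]: "f \<in> borel_measurable borel" "k \<in> borel_measurable borel"
    using f k by auto
  have int: "integrable (lborel \<Otimes>\<^sub>M lborel) (\<lambda>(u, l). f u * (k l * E u l))"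
  proof (rule lborel_pair.Fubini_integrable)
    show "(\<lambda>(u, l). f u * (k l * E u l)) \<in> borel_measurable (lborel \<Otimes>\<^sub>M lborel)"
      by measurable
    have inner: "integrable lborel (\<lambda>l. f u * (k l * E u l))" for u
    proof (rule Bochner_Integration.integrable_bound[OF integrable_mult_right[OF k, of "f u"]])
      show "AE l in lborel. norm (f u * (k l * E u l)) \<le> norm (f u * k l)"
        using bound by (auto simp: norm_mult mult_left_le intro!: mult_left_mono)
    qed measurable
    then show "AE u in lborel. integrable lborel (\<lambda>l. case (u, l) of (u, l) \<Rightarrow> f u * (k l * E u l))" by simp
    show "integrable lborel (\<lambda>u. LINT l|lborel. norm (case (u, l) of (u, l) \<Rightarrow> f u * (k l * E u l)))"
    proof (rule Bochner_Integration.integrable_bound[OF integrable_mult_left[OF integrable_norm[OF f], of "LINT l|lborel. norm (k l)"]])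
      show "AE u in lborel. norm (LINT l|lborel. norm (case (u, l) of (u, l) \<Rightarrow> f u * (k l * E u l))) \<le>
          norm (norm (f u) * (LINT l|lborel. norm (k l)))"
      proof (intro always_eventually allI)
        fix u
        have "(LINT l|lborel. norm (f u * (k l * E u l))) \<le> (LINT l|lborel. norm (f u) * norm (k l))"
        proof (rule integral_mono)
          show "integrable lborel (\<lambda>l. norm (f u * (k l * E u l)))" using inner[of u] by (rule integrable_norm)
          show "integrable lborel (\<lambda>l. norm (f u) * norm (k l))" using k by simp
          show "norm (f u * (k l * E u l)) \<le> norm (f u) * norm (k l)" for l
            using bound by (auto simp: norm_mult mult_left_le intro!: mult_left_mono)
        qed
        also have "\<dots> = norm (f u) * (LINT l|lborel. norm (k l))" by simp
        finally show "norm (LINT l|lborel. norm (case (u, l) of (u, l) \<Rightarrow> f u * (k l * E u l))) \<le>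
          norm (norm (f u) * (LINT l|lborel. norm (k l)))" by (simp add: integral_nonneg_AE)
      qed
    qed measurable
  qed
  have "(LINT l|lborel. k l * (LINT u|lborel. f u * E u l)) = (LINT l|lborel. LINT u|lborel. f u * (k l * E u l))"
    by (simp add: integral_mult_right_zero[symmetric] mult_ac del: integral_mult_right_zero)
  also have "\<dots> = (LINT u|lborel. LINT l|lborel. f u * (k l * E u l))"
    by (rule lborel_pair.Fubini_integral[OF int])
  also have "\<dots> = (LINT u|lborel. f u * (LINT l|lborel. k l * E u l))" by simp
  finally show ?thesis .
qed

lemma fourier_std_normal:
  "(LINT v|lborel. of_real (std_normal_density v) * exp (\<i> * of_real (t * v))) = of_real (exp (- t\<^sup>2 / 2))"
proof -
  have "char std_normal_distribution t = (LINT v|lborel. std_normal_density v *\<^sub>R iexp (t * v))"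
    unfolding char_def by (intro integral_density) auto
  then show ?thesis by (simp add: char_std_normal_distribution scaleR_conv_of_real)
qed

lemma fourier_gaussian:
  assumes e: "0 < e"
  shows "(LINT l|lborel. of_real (std_normal_density (e * l)) * exp (\<i> * of_real (s * l)))
    = of_real (sqrt (2 * pi) / e * std_normal_density (s / e))"
proof -
  have "(LINT v|lborel. of_real (std_normal_density v) * exp (\<i> * of_real (s / e * v)))
      = \<bar>e\<bar> *\<^sub>R (LINT l|lborel. of_real (std_normal_density (0 + e * l)) * exp (\<i> * of_real (s / e * (0 + e * l))))"
    using e by (intro lborel_integral_real_affine) auto
  also have "\<dots> = of_real e * (LINT l|lborel. of_real (std_normal_density (e * l)) * exp (\<i> * of_real (s * l)))"
    using e by (simp add: scaleR_conv_of_real)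
  finally have "of_real e * (LINT l|lborel. of_real (std_normal_density (e * l)) * exp (\<i> * of_real (s * l)))
      = of_real (exp (- (s / e)\<^sup>2 / 2))"
    unfolding fourier_std_normal by simp
  then have "(LINT l|lborel. of_real (std_normal_density (e * l)) * exp (\<i> * of_real (s * l)))
      = of_real (exp (- (s / e)\<^sup>2 / 2)) / of_real e"
    using e by (simp add: field_simps)
  also have "exp (- (s / e)\<^sup>2 / 2) = sqrt (2 * pi) * std_normal_density (s / e)"
    by (simp add: std_normal_density_def)
  finally show ?thesis by simp
qed

text \<open>Gauss summation. A factor exp (- (e l)^2 / 2) is inserted and the integrals are
  exchanged, which turns the left side into an average of f against a Gaussian of width e around x;
  both sides converge by dominated convergence as e tends to 0.\<close>

lemma fourier_inversion:
  fixes f :: "real \<Rightarrow> complex"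
  assumes f: "integrable lborel f" and cont: "continuous_on UNIV f" and bdd: "\<And>u. cmod (f u) \<le> B"
    and fhat: "integrable lborel fhat"
    and fhat_eq: "\<And>l. fhat l = (LINT u|lborel. f u * exp (- (\<i> * of_real l * of_real u)))"
  shows "(LINT l|lborel. fhat l * exp (\<i> * of_real l * of_real x)) = 2 * of_real pi * f x"
proof -
  define N where "N = std_normal_density"
  define e where "e = (\<lambda>n. 1 / real (Suc n))"
  have e: "0 < e n" "e \<longlonglongrightarrow> 0" for n
    unfolding e_def using LIMSEQ_Suc[OF lim_1_over_n] by auto
  have N0: "0 \<le> N v" for v by (simp add: N_def)
  have [measurable]: "f \<in> borel_measurable borel" "fhat \<in> borel_measurable borel" "N \<in> borel_measurable borel"
    using f fhat by (auto simp: N_def)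
  have Nint: "integrable lborel N" unfolding N_def by simp
  have key: "(LINT l|lborel. fhat l * exp (\<i> * of_real l * of_real x) * of_real (sqrt (2 * pi) * N (e n * l)))
      = 2 * of_real pi * (LINT v|lborel. f (x + (- e n) * v) * of_real (N v))" for n
  proof -
    define k where "k = (\<lambda>l. exp (\<i> * of_real l * of_real x) * of_real (sqrt (2 * pi) * N (e n * l)))"
    have [measurable]: "k \<in> borel_measurable borel" unfolding k_def by measurable
    have "integrable lborel (\<lambda>l. sqrt (2 * pi) * N (0 + e n * l))"
      using e(1)[of n] by (intro integrable_mult_right lborel_integrable_real_affine[OF Nint]) auto
    then have kint: "integrable lborel k"
      by (rule Bochner_Integration.integrable_bound) (auto simp: k_def norm_mult N0)
    have "(LINT l|lborel. fhat l * exp (\<i> * of_real l * of_real x) * of_real (sqrt (2 * pi) * N (e n * l)))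
        = (LINT l|lborel. k l * (LINT u|lborel. f u * exp (- (\<i> * of_real l * of_real u))))"
      unfolding fhat_eq k_def by (simp add: mult_ac)
    also have "\<dots> = (LINT u|lborel. f u * (LINT l|lborel. k l * exp (- (\<i> * of_real l * of_real u))))"
      by (intro fubini_bounded_kernel f kint) auto
    also have "\<dots> = (LINT u|lborel. f u * of_real (2 * pi / e n * N ((x - u) / e n)))"
    proof (intro Bochner_Integration.integral_cong refl)
      fix u
      have "k l * exp (- (\<i> * of_real l * of_real u)) = of_real (sqrt (2 * pi)) * (of_real (N (e n * l)) * exp (\<i> * of_real ((x - u) * l)))" for l
        by (simp add: k_def exp_add[symmetric] exp_diff algebra_simps exp_minus field_simps)
      then have "(LINT l|lborel. k l * exp (- (\<i> * of_real l * of_real u)))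
          = of_real (sqrt (2 * pi)) * (LINT l|lborel. of_real (N (e n * l)) * exp (\<i> * of_real ((x - u) * l)))"
        by simp
      also have "\<dots> = of_real (sqrt (2 * pi) * (sqrt (2 * pi) / e n * N ((x - u) / e n)))"
        unfolding N_def fourier_gaussian[OF e(1)] by simp
      also have "sqrt (2 * pi) * (sqrt (2 * pi) / e n * N ((x - u) / e n)) = 2 * pi / e n * N ((x - u) / e n)"
        by simp
      finally show "f u * (LINT l|lborel. k l * exp (- (\<i> * of_real l * of_real u))) = f u * of_real (2 * pi / e n * N ((x - u) / e n))"
        by simp
    qed
    \<comment> \<open>The substitution u = x - e v replaces the Gaussian of width e by the fixed
      density N.\<close>
    also have "\<dots> = \<bar>- e n\<bar> *\<^sub>R (LINT v|lborel. f (x + (- e n) * v) * of_real (2 * pi / e n * N ((x - (x + (- e n) * v)) / e n)))"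
      using e(1)[of n] by (intro lborel_integral_real_affine) auto
    also have "(\<lambda>v. f (x + (- e n) * v) * of_real (2 * pi / e n * N ((x - (x + (- e n) * v)) / e n))) =
        (\<lambda>v. of_real (2 * pi / e n) * (f (x + (- e n) * v) * of_real (N v)))"
      using e(1)[of n] by (intro ext) (simp add: mult_ac)
    also have "\<bar>- e n\<bar> *\<^sub>R (LINT v|lborel. of_real (2 * pi / e n) * (f (x + (- e n) * v) * of_real (N v))) =
        2 * of_real pi * (LINT v|lborel. f (x + (- e n) * v) * of_real (N v))"
      using e(1)[of n] by (simp only: integral_mult_right_zero) (simp add: scaleR_conv_of_real)
    finally show ?thesis .
  qed
  have lim1: "(\<lambda>n. LINT l|lborel. fhat l * exp (\<i> * of_real l * of_real x) * of_real (sqrt (2 * pi) * N (e n * l)))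
     \<longlonglongrightarrow> (LINT l|lborel. fhat l * exp (\<i> * of_real l * of_real x))"
  proof (rule integral_dominated_convergence[where w = "\<lambda>l. cmod (fhat l)"])
    show "integrable lborel (\<lambda>l. cmod (fhat l))" using fhat by simp
    show "AE l in lborel. (\<lambda>n. fhat l * exp (\<i> * of_real l * of_real x) * of_real (sqrt (2 * pi) * N (e n * l)))
        \<longlonglongrightarrow> fhat l * exp (\<i> * of_real l * of_real x)"
    proof (intro always_eventually allI)
      fix l
      have "(\<lambda>n. fhat l * exp (\<i> * of_real l * of_real x) * of_real (exp (- (e n * l)\<^sup>2 / 2)))
        \<longlonglongrightarrow> fhat l * exp (\<i> * of_real l * of_real x) * of_real (exp (- (0 * l)\<^sup>2 / 2))"
        by (intro tendsto_intros e(2)) auto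
      then show "(\<lambda>n. fhat l * exp (\<i> * of_real l * of_real x) * of_real (sqrt (2 * pi) * N (e n * l)))
        \<longlonglongrightarrow> fhat l * exp (\<i> * of_real l * of_real x)"
        by (simp add: N_def std_normal_density_def)
    qed
    show "AE l in lborel. norm (fhat l * exp (\<i> * of_real l * of_real x) * of_real (sqrt (2 * pi) * N (e n * l))) \<le> cmod (fhat l)" for n
      by (auto simp: norm_mult N_def std_normal_density_def mult_left_le)
  qed measurable
  have lim2: "(\<lambda>n. LINT v|lborel. f (x + (- e n) * v) * of_real (N v)) \<longlonglongrightarrow> (LINT v|lborel. f x * of_real (N v))"
  proof (rule integral_dominated_convergence[where w = "\<lambda>v. B * N v"])
    show "integrable lborel (\<lambda>v. B * N v)" using Nint by simp
    show "AE v in lborel. (\<lambda>n. f (x + - e n * v) * of_real (N v)) \<longlonglongrightarrow> f x * of_real (N v)"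
    proof (intro always_eventually allI)
      fix v
      have "(\<lambda>n. x + - e n * v) \<longlonglongrightarrow> x + - 0 * v" by (intro tendsto_intros e(2))
      then have "(\<lambda>n. x + - e n * v) \<longlonglongrightarrow> x" by simp
      moreover have "isCont f x" using cont by (simp add: continuous_on_eq_continuous_at)
      ultimately have "(\<lambda>n. f (x + - e n * v)) \<longlonglongrightarrow> f x" using isCont_tendsto_compose by blast
      then show "(\<lambda>n. f (x + - e n * v) * of_real (N v)) \<longlonglongrightarrow> f x * of_real (N v)" by (intro tendsto_intros)
    qed
    show "AE v in lborel. norm (f (x + - e n * v) * of_real (N v)) \<le> B * N v" for n
      using bdd N0 by (auto simp: norm_mult intro!: mult_right_mono)
  qed measurable
  have "(LINT v|lborel. N v) = 1" by (simp add: N_def)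
  then have "(\<lambda>n. 2 * of_real pi * (LINT v|lborel. f (x + (- e n) * v) * of_real (N v))) \<longlonglongrightarrow> 2 * of_real pi * f x"
    using tendsto_mult_left[OF lim2, of "2 * of_real pi"] by simp
  then show ?thesis using lim1 unfolding key by (rule LIMSEQ_unique[rotated])
qed

lemma integrable_indicator_Icc: "integrable lborel (indicator {a..b :: real} :: real \<Rightarrow> real)"
  using borel_integrable_atLeastAtMost'[OF continuous_on_const[of "{a..b}" "1::real"]]
  by (simp add: set_integrable_def)

text \<open>If f fails to be integrable, its integral is 0 by convention and the bound follows from
  g >= 0.\<close>

lemma norm_integral_le:
  fixes f :: "'a \<Rightarrow> 'b :: {banach, second_countable_topology}"
  assumes g: "integrable M g" and le: "\<And>x. norm (f x) \<le> g x"
  shows "norm (LINT x|M. f x) \<le> (LINT x|M. g x)"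
proof (cases "integrable M f")
  case True
  then show ?thesis
    using integral_mono[OF integrable_norm g le] integral_norm_bound[of M f] by (blast intro: order_trans)
next
  case False
  have "0 \<le> g x" for x using le[of x] norm_ge_zero[of "f x"] by linarith
  then show ?thesis using False by (simp add: not_integrable_integral_eq)
qed

text \<open>Converts exponential decay into the shape of \<open>integrable_decay\<close>; 16 comes
  from squaring (1 + |l|) / 4 <= exp (|l| / 4).\<close>

lemma exp_neg_half_le: "exp (- \<bar>l\<bar> / 2) \<le> 16 * (1 + \<bar>l\<bar>) powr (- 2)" for l :: real
proof -
  have "(1 + \<bar>l\<bar>) / 4 \<le> 1 + \<bar>l\<bar> / 4" by simp
  also have "\<dots> \<le> exp (\<bar>l\<bar> / 4)" by (rule exp_ge_add_one_self)
  finally have "((1 + \<bar>l\<bar>) / 4)\<^sup>2 \<le> exp (\<bar>l\<bar> / 4) ^ 2" by (intro power_mono) auto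
  also have "\<dots> = exp (\<bar>l\<bar> / 2)" by (simp add: exp_of_nat_mult[symmetric])
  finally have "(1 + \<bar>l\<bar>)\<^sup>2 \<le> 16 * exp (\<bar>l\<bar> / 2)" by (simp add: power_divide)
  moreover have "0 < (1 + \<bar>l\<bar>)\<^sup>2" by (simp add: add_pos_nonneg)
  ultimately have "1 / exp (\<bar>l\<bar> / 2) \<le> 16 * (1 / (1 + \<bar>l\<bar>)\<^sup>2)" by (simp add: divide_simps)
  moreover have "(1 + \<bar>l\<bar>) powr (- 2) = 1 / (1 + \<bar>l\<bar>)\<^sup>2"
    by (simp add: powr_minus powr_numeral inverse_eq_divide)
  ultimately show ?thesis by (simp add: exp_minus inverse_eq_divide)
qed

text \<open>The strip condition for every \<tau> covers strips of every width, which makes \<Phi>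
  entire. The moment condition is later derived from the growth of G in
  \<open>integrable_first_moment\<close>.\<close>

locale entire_kernel =
  fixes \<Phi> :: "complex \<Rightarrow> complex"
  assumes strip: "\<forall>\<tau>>0. \<exists>\<beta>>0. \<exists>\<delta>>0.
        (\<lambda>z. \<Phi> (of_real \<tau> * z)) analytic_on {z. \<bar>Im z\<bar> \<le> 0.5 + \<delta>} \<and>
        (\<exists>C. \<forall>z. \<bar>Im z\<bar> \<le> 0.5 + \<delta> \<longrightarrow>
               cmod (\<Phi> (of_real \<tau> * z)) \<le> C * (1 + cmod z) powr (- (1 + \<beta>)))"
    and moment: "integrable lborel (\<lambda>u. (1 + \<bar>u\<bar>) * cmod (\<Phi> (of_real u)))"
begin

text \<open>Each z is reached by the strip condition for \<tau> = 2 |Im z| + 2, because z / \<tau>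
  then has imaginary part at most 1/2 in absolute value.\<close>

lemma entire: "\<Phi> holomorphic_on UNIV"
proof -
  have "\<Phi> field_differentiable (at z)" for z
  proof -
    define \<tau> where "\<tau> = 2 * \<bar>Im z\<bar> + 2"
    have \<tau>: "0 < \<tau>" by (simp add: \<tau>_def)
    obtain \<delta> where \<delta>: "\<delta> > 0" "(\<lambda>z. \<Phi> (of_real \<tau> * z)) analytic_on {z. \<bar>Im z\<bar> \<le> 0.5 + \<delta>}"
      using strip \<tau> by blast
    have "\<bar>Im z\<bar> / \<tau> \<le> 1 / 2" using \<tau> by (simp add: \<tau>_def field_simps)
    moreover have "\<bar>Im (z / of_real \<tau>)\<bar> = \<bar>Im z\<bar> / \<tau>" using \<tau> by simp
    ultimately have "\<bar>Im (z / of_real \<tau>)\<bar> \<le> 0.5 + \<delta>" using \<delta>(1) by linarith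
    then have "z / of_real \<tau> \<in> {z. \<bar>Im z\<bar> \<le> 0.5 + \<delta>}" by blast
    then have "(\<lambda>z. \<Phi> (of_real \<tau> * z)) field_differentiable (at (z / of_real \<tau>))"
      by (rule analytic_on_imp_differentiable_at[OF \<delta>(2)])
    moreover have "(\<lambda>z. z / of_real \<tau>) field_differentiable (at z)"
      using \<tau> by (intro derivative_intros) auto
    ultimately have "((\<lambda>z. \<Phi> (of_real \<tau> * z)) \<circ> (\<lambda>z. z / of_real \<tau>)) field_differentiable (at z)"
      by (intro field_differentiable_compose)
    then show ?thesis using \<tau> by (simp add: o_def)
  qed
  then show ?thesis by (simp add: holomorphic_on_def)
qed

lemma continuous_kernel: "continuous_on UNIV \<Phi>"
  using entire by (rule holomorphic_on_imp_continuous_on)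

lemma kernel_measurable [measurable]: "\<Phi> \<in> borel_measurable borel"
  using continuous_kernel by (rule borel_measurable_continuous_onI)

text \<open>Dilation by 2A carries |Im z| <= A into the strip of half-width 1/2; the factor m
  compares 1 + |z| / (2A) with 1 + |z|.\<close>

lemma strip_bound:
  assumes A: "0 < A"
  obtains p C where "p > 1" "C \<ge> 0" "\<And>z. \<bar>Im z\<bar> \<le> A \<Longrightarrow> cmod (\<Phi> z) \<le> C * (1 + cmod z) powr (- p)"
proof -
  obtain \<beta> \<delta> C where \<beta>: "\<beta> > 0" "\<delta> > 0"
    and C: "\<And>z. \<bar>Im z\<bar> \<le> 0.5 + \<delta> \<Longrightarrow> cmod (\<Phi> (of_real (2 * A) * z)) \<le> C * (1 + cmod z) powr (- (1 + \<beta>))"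
    using strip A by (metis mult_pos_pos zero_less_numeral)
  define m where "m = min 1 (1 / (2 * A))"
  have m: "0 < m" "m \<le> 1" "m \<le> 1 / (2 * A)" using A by (auto simp: m_def)
  have C0: "0 \<le> C" using C[of 0] \<beta> by (simp add: order_trans[OF norm_ge_zero])
  show thesis
  proof (rule that[of "1 + \<beta>" "C * m powr (- (1 + \<beta>))"])
    fix z assume z: "\<bar>Im z\<bar> \<le> A"
    have "cmod (\<Phi> z) = cmod (\<Phi> (of_real (2 * A) * (z / of_real (2 * A))))" using A by simp
    also have "\<dots> \<le> C * (1 + cmod (z / of_real (2 * A))) powr (- (1 + \<beta>))"
      using z A mult_pos_pos[OF A \<beta>(2)] by (intro C) (simp add: field_simps)
    also have "\<dots> \<le> C * (m * (1 + cmod z)) powr (- (1 + \<beta>))"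
    proof (intro mult_left_mono powr_mono2' C0)
      have "m * cmod z \<le> 1 / (2 * A) * cmod z" using m by (intro mult_right_mono) auto
      then show "m * (1 + cmod z) \<le> 1 + cmod (z / of_real (2 * A))"
        using m A by (simp add: norm_divide norm_mult algebra_simps)
      show "0 < m * (1 + cmod z)" using m by (simp add: add_pos_nonneg)
    qed (use \<beta> in auto)
    also have "\<dots> = C * m powr (- (1 + \<beta>)) * (1 + cmod z) powr (- (1 + \<beta>))"
      using m by (simp add: powr_mult)
    finally show "cmod (\<Phi> z) \<le> C * m powr (- (1 + \<beta>)) * (1 + cmod z) powr (- (1 + \<beta>))" .
  qed (use \<beta> C0 in auto)
qed

text \<open>Arguments of this shape are those of \<Phi> over vertical lines of the s-plane. The
  constant depends on \<tau>, t and A, which is harmless because it serves only integrability and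
  vanishing edges, never a final estimate.\<close>

lemma shifted_strip_bound:
  assumes \<tau>: "0 < \<tau>"
  obtains p C where "p > 1" "C \<ge> 0"
    "\<And>x y. \<bar>x\<bar> \<le> A \<Longrightarrow> cmod (\<Phi> (Complex (\<tau> * (y - t)) (\<tau> * x))) \<le> C * (1 + \<bar>y\<bar>) powr (- p)"
proof -
  have "0 < \<tau> * \<bar>A\<bar> + 1" using \<tau> by (simp add: add_nonneg_pos)
  then obtain p C where p: "p > 1" "C \<ge> 0"
    and C: "\<And>z. \<bar>Im z\<bar> \<le> \<tau> * \<bar>A\<bar> + 1 \<Longrightarrow> cmod (\<Phi> z) \<le> C * (1 + cmod z) powr (- p)"
    using strip_bound by blast
  define m where "m = min 1 \<tau> / (1 + \<bar>t\<bar>)"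
  have m: "0 < m" using \<tau> by (simp add: m_def)
  show thesis
  proof (rule that[of p "C * m powr (- p)"])
    fix x y assume x: "\<bar>x\<bar> \<le> A"
    have "\<tau> * \<bar>x\<bar> \<le> \<tau> * \<bar>A\<bar>" using x \<tau> by (intro mult_left_mono) auto
    moreover have "\<bar>Im (Complex (\<tau> * (y - t)) (\<tau> * x))\<bar> = \<tau> * \<bar>x\<bar>" using \<tau> by (simp add: abs_mult)
    ultimately have "cmod (\<Phi> (Complex (\<tau> * (y - t)) (\<tau> * x))) \<le> C * (1 + cmod (Complex (\<tau> * (y - t)) (\<tau> * x))) powr (- p)"
      by (intro C) linarith
    also have "\<dots> \<le> C * (m * (1 + \<bar>y\<bar>)) powr (- p)"
    proof (intro mult_left_mono powr_mono2' p(2))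
      have "min 1 \<tau> * \<bar>y - t\<bar> \<le> \<tau> * \<bar>y - t\<bar>" by (intro mult_right_mono) auto
      then have 1: "min 1 \<tau> * (1 + \<bar>y - t\<bar>) \<le> 1 + \<tau> * \<bar>y - t\<bar>" by (simp add: algebra_simps)
      have "1 + \<bar>y\<bar> \<le> 1 + (\<bar>y - t\<bar> + \<bar>t\<bar>) + \<bar>y - t\<bar> * \<bar>t\<bar>"
        using mult_nonneg_nonneg[OF abs_ge_zero[of "y - t"] abs_ge_zero[of t]] by linarith
      also have "\<dots> = (1 + \<bar>y - t\<bar>) * (1 + \<bar>t\<bar>)" by (simp add: algebra_simps)
      finally have "m * (1 + \<bar>y\<bar>) \<le> m * ((1 + \<bar>y - t\<bar>) * (1 + \<bar>t\<bar>))" using m by (intro mult_left_mono) auto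
      also have "\<dots> = min 1 \<tau> * (1 + \<bar>y - t\<bar>)" by (simp add: m_def)
      also note 1
      also have "1 + \<tau> * \<bar>y - t\<bar> \<le> 1 + cmod (Complex (\<tau> * (y - t)) (\<tau> * x))"
        using abs_Re_le_cmod[of "Complex (\<tau> * (y - t)) (\<tau> * x)"] \<tau> by (simp add: abs_mult)
      finally show "m * (1 + \<bar>y\<bar>) \<le> 1 + cmod (Complex (\<tau> * (y - t)) (\<tau> * x))" .
      show "0 < m * (1 + \<bar>y\<bar>)" using m by (simp add: add_pos_nonneg)
    qed (use p in auto)
    also have "\<dots> = C * m powr (- p) * (1 + \<bar>y\<bar>) powr (- p)"
      using m by (simp add: powr_mult)
    finally show "cmod (\<Phi> (Complex (\<tau> * (y - t)) (\<tau> * x))) \<le> C * m powr (- p) * (1 + \<bar>y\<bar>) powr (- p)" .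
  qed (use p in auto)
qed

lemma kernel_integrable: "integrable lborel (\<lambda>u. \<Phi> (of_real u))"
  by (rule Bochner_Integration.integrable_bound[OF moment]) (auto simp: mult_le_cancel_right1)

lemma fourier_bound: "cmod (fourier \<Phi> l) \<le> (LINT u|lborel. (1 + \<bar>u\<bar>) * cmod (\<Phi> (of_real u)))"
proof -
  have "cmod (fourier \<Phi> l) \<le> (LINT u|lborel. cmod (\<Phi> (of_real u) * exp (- (\<i> * of_real l * of_real u))))"
    unfolding fourier_def by (rule integral_norm_bound)
  also have "\<dots> \<le> (LINT u|lborel. (1 + \<bar>u\<bar>) * cmod (\<Phi> (of_real u)))"
  proof (rule integral_mono)
    show "integrable lborel (\<lambda>u. cmod (\<Phi> (of_real u) * exp (- (\<i> * of_real l * of_real u))))"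
      using integrable_norm[OF kernel_integrable] by (simp add: norm_mult)
  qed (auto simp: moment norm_mult mult_le_cancel_right1)
  finally show ?thesis .
qed

lemma fourier_measurable [measurable]: "fourier \<Phi> \<in> borel_measurable borel"
proof -
  have "(\<lambda>l. LINT u|lborel. \<Phi> (of_real u) * exp (- (\<i> * of_real l * of_real u))) \<in> borel_measurable borel"
    by (intro lborel.borel_measurable_lebesgue_integral) measurable
  then show ?thesis by (simp add: fourier_def[abs_def])
qed

lemma kernel_line_integrable: "integrable lborel (\<lambda>u. \<Phi> (Complex u \<eta>))"
proof -
  obtain p C where p: "p > 1" "C \<ge> 0"
    and C: "\<And>x y. \<bar>x\<bar> \<le> \<bar>\<eta>\<bar> \<Longrightarrow> cmod (\<Phi> (Complex (1 * (y - 0)) (1 * x))) \<le> C * (1 + \<bar>y\<bar>) powr (- p)"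
    using shifted_strip_bound[of 1 "\<bar>\<eta>\<bar>" 0] by (metis zero_less_one)
  have [measurable]: "(\<lambda>u. Complex u \<eta>) \<in> borel_measurable borel" unfolding Complex_eq by measurable
  have "integrable lborel (\<lambda>u. C * (1 + \<bar>u\<bar>) powr (- p))" using integrable_decay[OF p(1)] by simp
  then show ?thesis
    by (rule Bochner_Integration.integrable_bound) (use C[of \<eta>] p in auto)
qed

text \<open>By Cauchy's theorem \<Phi>(z) exp (- i l z) has the same integral over Im z = \<eta> as
  over the real axis; on the shifted line the exponential contributes exp (l \<eta>), which is moved
  to the right.\<close>

lemma fourier_shift:
  "(LINT u|lborel. \<Phi> (Complex u \<eta>) * exp (- (\<i> * of_real l * of_real u))) = of_real (exp (- l * \<eta>)) * fourier \<Phi> l"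
proof -
  \<comment> \<open>The rotation s = i z turns horizontal lines into vertical ones, for which
    \<open>strip_integral\<close> is stated.\<close>
  define f where "f = (\<lambda>s. \<Phi> (- \<i> * s) * exp (- of_real l * s))"
  define A where "A = \<bar>\<eta>\<bar> + 1"
  have f_line: "f (Complex x y) = \<Phi> (Complex y (- x)) * (of_real (exp (- l * x)) * exp (- (\<i> * of_real l * of_real y)))" for x y
  proof -
    have "- \<i> * Complex x y = Complex y (- x)" by (simp add: complex_eq_iff)
    moreover have "- of_real l * Complex x y = of_real (- l * x) + - (\<i> * of_real l * of_real y)" by (simp add: complex_eq_iff)
    ultimately show ?thesis unfolding f_def by (simp only: exp_add exp_of_real)
  qed
  have lin: "(\<lambda>s. - \<i> * s) holomorphic_on UNIV" by (intro holomorphic_intros)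
  have "(\<lambda>s. \<Phi> (- \<i> * s)) holomorphic_on UNIV"
    using holomorphic_on_compose_gen[OF lin entire] by (simp add: o_def)
  then have hol: "f holomorphic_on UNIV" unfolding f_def by (intro holomorphic_intros)
  obtain p C where p: "p > 1" "C \<ge> 0"
    and C: "\<And>x y. \<bar>x\<bar> \<le> A \<Longrightarrow> cmod (\<Phi> (Complex (1 * (y - 0)) (1 * x))) \<le> C * (1 + \<bar>y\<bar>) powr (- p)"
    using shifted_strip_bound[of 1 A 0] by (metis zero_less_one)
  have "\<forall>s\<in>{s. - A \<le> Re s \<and> Re s \<le> A}. cmod (f s) \<le> C * exp (\<bar>l\<bar> * A) * (1 + \<bar>Im s\<bar>) powr - p"
  proof
    fix s assume s: "s \<in> {s. - A \<le> Re s \<and> Re s \<le> A}"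
    have "- l * Re s \<le> \<bar>l\<bar> * A"
      using s abs_mult[of l "Re s"] mult_left_mono[of "\<bar>Re s\<bar>" A "\<bar>l\<bar>"] by (simp add: abs_le_iff)
    then have "exp (- l * Re s) \<le> exp (\<bar>l\<bar> * A)" by simp
    moreover have "cmod (\<Phi> (Complex (Im s) (- Re s))) \<le> C * (1 + \<bar>Im s\<bar>) powr (- p)"
      using C[of "- Re s" "Im s"] s by (simp add: abs_le_iff)
    ultimately have "cmod (\<Phi> (Complex (Im s) (- Re s))) * exp (- l * Re s) \<le> C * (1 + \<bar>Im s\<bar>) powr (- p) * exp (\<bar>l\<bar> * A)"
      using p by (intro mult_mono) auto
    then show "cmod (f s) \<le> C * exp (\<bar>l\<bar> * A) * (1 + \<bar>Im s\<bar>) powr - p"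
      using f_line[of "Re s" "Im s"] by (simp add: norm_mult mult_ac)
  qed
  then have dec: "decays_on {s. - A \<le> Re s \<and> Re s \<le> A} f"
    unfolding decays_on_def using p(1) by blast
  have int: "(LINT y|lborel. f (Complex x y)) = (LINT y|lborel. f (Complex A y))" if "- A \<le> x" "x < A" for x
    using that by (intro strip_integral holomorphic_on_subset[OF hol] decays_on_subset[OF dec]) auto
  have "(LINT y|lborel. f (Complex (- \<eta>) y)) = (LINT y|lborel. f (Complex 0 y))"
    using int[of "- \<eta>"] int[of 0] by (simp add: A_def)
  also have "(LINT y|lborel. f (Complex 0 y)) = fourier \<Phi> l"
  proof -
    have "Complex y 0 = of_real y" for y by (simp add: complex_eq_iff)
    then show ?thesis unfolding f_line fourier_def by simp
  qed
  also have "(LINT y|lborel. f (Complex (- \<eta>) y)) = of_real (exp (l * \<eta>)) * (LINT u|lborel. \<Phi> (Complex u \<eta>) * exp (- (\<i> * of_real l * of_real u)))"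
  proof -
    have "f (Complex (- \<eta>) y) = of_real (exp (l * \<eta>)) * (\<Phi> (Complex y \<eta>) * exp (- (\<i> * of_real l * of_real y)))" for y
      unfolding f_line by (simp add: mult_ac)
    then show ?thesis by (simp only: integral_mult_right_zero)
  qed
  finally show ?thesis by (simp add: exp_minus field_simps exp_of_real[symmetric] del: of_real_exp)
qed

text \<open>The first bound is the trivial one. The integral is (exp (i L w) - exp (- i L w)) / (i
  w); multiplying by w instead of dividing keeps the second bound meaningful at w = 0.\<close>

lemma truncated_exponential_bound:
  fixes w :: complex
  assumes L: "0 \<le> L" and Y: "\<bar>Im w\<bar> \<le> Y"
  defines "K \<equiv> (LINT l|lborel. indicator {-L..L} l *\<^sub>R exp (\<i> * of_real l * w))"
  shows "cmod K \<le> 2 * L * exp (L * Y)" "cmod w * cmod K \<le> 2 * exp (L * Y)"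
proof -
  have Y0: "0 \<le> Y" using Y by linarith
  have nrm: "cmod (exp (\<i> * of_real l * w)) \<le> exp (L * Y)" if "l \<in> {-L..L}" for l
  proof -
    have "- (l * Im w) \<le> \<bar>l\<bar> * \<bar>Im w\<bar>" using abs_mult[of l "Im w"] by (simp add: abs_le_iff)
    also have "\<dots> \<le> L * Y" using that Y L by (intro mult_mono) auto
    finally show ?thesis by simp
  qed
  have cont: "continuous_on {-L..L} (\<lambda>l. exp (\<i> * of_real l * w))" by (intro continuous_intros)
  have int: "integrable lborel (\<lambda>l. indicator {-L..L} l *\<^sub>R exp (\<i> * of_real l * w))"
    using borel_integrable_atLeastAtMost'[OF cont] by (simp add: set_integrable_def)
  have "cmod K \<le> (LINT l|lborel. cmod (indicator {-L..L} l *\<^sub>R exp (\<i> * of_real l * w)))"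
    unfolding K_def by (rule integral_norm_bound)
  also have "\<dots> \<le> (LINT l|lborel. indicator {-L..L} l * exp (L * Y))"
  proof (rule integral_mono[OF integrable_norm[OF int]])
    show "integrable lborel (\<lambda>l. indicator {-L..L} l * exp (L * Y))" by (intro integrable_mult_left integrable_indicator_Icc)
    show "cmod (indicator {-L..L} l *\<^sub>R exp (\<i> * of_real l * w)) \<le> indicator {-L..L} l * exp (L * Y)" for l
      using nrm[of l] by (simp add: indicator_def)
  qed
  also have "\<dots> = 2 * L * exp (L * Y)" using L by simp
  finally show "cmod K \<le> 2 * L * exp (L * Y)" .
  have "(LINT l|lborel. indicator {-L..L} l *\<^sub>R (w * exp (\<i> * of_real l * w)))
      = - \<i> * exp (\<i> * of_real L * w) - (- \<i> * exp (\<i> * of_real (- L) * w))"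
  proof (rule integral_FTC_Icc)
    show "((\<lambda>l. - \<i> * exp (\<i> * of_real l * w)) has_vector_derivative w * exp (\<i> * of_real l * w)) (at l within {-L..L})" for l
      by (rule has_vector_derivative_at_within, rule has_vector_derivative_real_field)
         (auto intro!: derivative_eq_intros simp: mult_ac)
    show "continuous_on {-L..L} (\<lambda>l. w * exp (\<i> * of_real l * w))" by (intro continuous_intros)
  qed (use L in auto)
  also have "(LINT l|lborel. indicator {-L..L} l *\<^sub>R (w * exp (\<i> * of_real l * w))) = w * K"
    unfolding K_def by (simp add: mult_scaleR_right[symmetric] del: mult_scaleR_right)
  finally have "w * K = - \<i> * exp (\<i> * of_real L * w) - (- \<i> * exp (\<i> * of_real (- L) * w))" .
  then have "cmod w * cmod K = cmod (- \<i> * exp (\<i> * of_real L * w) - (- \<i> * exp (\<i> * of_real (- L) * w)))"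
    by (metis norm_mult)
  also have "\<dots> \<le> cmod (exp (\<i> * of_real L * w)) + cmod (exp (\<i> * of_real (- L) * w))"
    using norm_triangle_ineq4[of "- \<i> * exp (\<i> * of_real L * w)" "- \<i> * exp (\<i> * of_real (- L) * w)"]
    by (simp only: norm_mult norm_minus_cancel norm_ii mult_1)
  also have "\<dots> \<le> exp (L * Y) + exp (L * Y)" using L by (intro add_mono nrm) auto
  also have "\<dots> = 2 * exp (L * Y)" by simp
  finally show "cmod w * cmod K \<le> 2 * exp (L * Y)" .
qed

text \<open>C is independent of L, Y, x and \<eta>, which matters because Y will be about \<tau>/2.
  Fourier inversion on the line Im z = \<eta> is split at |l| = L. Frequencies beyond L contribute
  O(1). For the others the transform is written as an integral over u and the order exchanged: the
  inner integral is a truncated exponential in w = x - u + i \<eta>, of size 1/|w|, and passing from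
  |w| to |x| costs a first moment.\<close>

lemma kernel_off_axis_bound:
  obtains C where "C > 0" "\<And>L Y x \<eta>. \<lbrakk>0 \<le> L; \<bar>\<eta>\<bar> \<le> Y; x \<noteq> 0;
      \<forall>l. L \<le> \<bar>l\<bar> \<longrightarrow> cmod (fourier \<Phi> l) \<le> exp (- (\<bar>l\<bar> * (Y + 1 / 2)))\<rbrakk>
    \<Longrightarrow> cmod (\<Phi> (Complex x \<eta>)) \<le> C * (1 + exp (L * Y) * (1 + L) / \<bar>x\<bar>)"
proof -
  define M where "M = (LINT u|lborel. (1 + \<bar>u\<bar>) * cmod (\<Phi> (of_real u)))"
  define J where "J = (LINT l|lborel. 16 * (1 + \<bar>l::real\<bar>) powr (- 2))"
  have Jint: "integrable lborel (\<lambda>l::real. 16 * (1 + \<bar>l\<bar>) powr (- 2))" using integrable_decay[of 2] by simp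
  have M0: "0 \<le> M" unfolding M_def by (intro integral_nonneg_AE) auto
  have J0: "0 \<le> J" unfolding J_def by (intro integral_nonneg_AE) auto
  define C where "C = 2 * M + J + 1"
  have bound: "cmod (\<Phi> (Complex x \<eta>)) \<le> C * (1 + exp (L * Y) * (1 + L) / \<bar>x\<bar>)"
    if L: "0 \<le> L" and \<eta>: "\<bar>\<eta>\<bar> \<le> Y" and x: "x \<noteq> 0"
      and tail: "\<forall>l. L \<le> \<bar>l\<bar> \<longrightarrow> cmod (fourier \<Phi> l) \<le> exp (- (\<bar>l\<bar> * (Y + 1 / 2)))" for L Y x \<eta>
  proof -
    define fh where "fh = (\<lambda>l. of_real (exp (- l * \<eta>)) * fourier \<Phi> l)"
    have [measurable]: "fh \<in> borel_measurable borel" unfolding fh_def by measurable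
    have expb: "exp (- l * \<eta>) \<le> exp (\<bar>l\<bar> * Y)" for l
    proof -
      have "- l * \<eta> \<le> \<bar>l\<bar> * \<bar>\<eta>\<bar>" using abs_mult[of l \<eta>] by (simp add: abs_le_iff)
      also have "\<dots> \<le> \<bar>l\<bar> * Y" using \<eta> by (intro mult_left_mono) auto
      finally show ?thesis by simp
    qed
    \<comment> \<open>The extra 1/2 in the assumed decay leaves exp (- |l| / 2) after the growth exp
      (|l| Y) caused by leaving the real axis.\<close>
    have far: "cmod (fh l) \<le> 16 * (1 + \<bar>l\<bar>) powr (- 2)" if "L \<le> \<bar>l\<bar>" for l
    proof -
      have "cmod (fh l) \<le> exp (\<bar>l\<bar> * Y) * exp (- (\<bar>l\<bar> * (Y + 1 / 2)))"
        unfolding fh_def norm_mult using tail that expb by (intro mult_mono) auto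
      also have "\<dots> = exp (- \<bar>l\<bar> / 2)" by (simp add: exp_add[symmetric] algebra_simps)
      also have "\<dots> \<le> 16 * (1 + \<bar>l\<bar>) powr (- 2)" by (rule exp_neg_half_le)
      finally show ?thesis .
    qed
    have near: "cmod (fh l) \<le> exp (L * Y) * M" if "\<bar>l\<bar> \<le> L" for l
    proof -
      have "exp (\<bar>l\<bar> * Y) \<le> exp (L * Y)" using that \<eta> by (simp add: mult_right_mono)
      then have "exp (- l * \<eta>) \<le> exp (L * Y)" using expb[of l] by linarith
      then show ?thesis unfolding fh_def norm_mult using fourier_bound[of l]
        by (intro mult_mono) (auto simp: M_def)
    qed
    have fint: "integrable lborel fh"
    proof (rule Bochner_Integration.integrable_bound)
      show "integrable lborel (\<lambda>l. indicator {-L..L} l * (exp (L * Y) * M) + 16 * (1 + \<bar>l\<bar>) powr (- 2))"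
        by (intro Bochner_Integration.integrable_add Jint integrable_mult_left integrable_indicator_Icc)
      show "AE l in lborel. norm (fh l) \<le> norm (indicator {-L..L} l * (exp (L * Y) * M) + 16 * (1 + \<bar>l\<bar>) powr (- 2))"
      proof (intro always_eventually allI)
        fix l
        have "norm (fh l) \<le> indicator {-L..L} l * (exp (L * Y) * M) + 16 * (1 + \<bar>l\<bar>) powr (- 2)"
        proof (cases "\<bar>l\<bar> \<le> L")
          case True
          then have "l \<in> {-L..L}" by auto
          then show ?thesis using near[OF True] by (simp add: add_increasing2)
        next
          case False
          then show ?thesis using far[of l] M0 by (simp add: add_increasing)
        qed
        then show "norm (fh l) \<le> norm (indicator {-L..L} l * (exp (L * Y) * M) + 16 * (1 + \<bar>l\<bar>) powr (- 2))" by simp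
      qed
    qed measurable
    obtain p B where B: "p > 1" "B \<ge> 0"
      "\<And>x y. \<bar>x\<bar> \<le> \<bar>\<eta>\<bar> \<Longrightarrow> cmod (\<Phi> (Complex (1 * (y - 0)) (1 * x))) \<le> B * (1 + \<bar>y\<bar>) powr (- p)"
      using shifted_strip_bound[of 1 "\<bar>\<eta>\<bar>" 0] by (metis zero_less_one)
    have inv: "(LINT l|lborel. fh l * exp (\<i> * of_real l * of_real x)) = 2 * of_real pi * \<Phi> (Complex x \<eta>)"
    proof (rule fourier_inversion[where B = B])
      show "continuous_on UNIV (\<lambda>u. \<Phi> (Complex u \<eta>))"
        unfolding Complex_eq by (intro continuous_on_compose2[OF continuous_kernel] continuous_intros) auto
      show "cmod (\<Phi> (Complex u \<eta>)) \<le> B" for u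
      proof -
        have "(1 + \<bar>u\<bar>) powr (- p) \<le> 1" using B(1) by (simp add: powr_minus ge_one_powr_ge_zero inverse_le_1_iff)
        then have "B * (1 + \<bar>u\<bar>) powr (- p) \<le> B" using B(2) by (simp add: mult_left_le)
        then show ?thesis using B(3)[of \<eta> u] by simp
      qed
    qed (use fint in \<open>auto simp: fh_def fourier_shift kernel_line_integrable\<close>)
    define k where "k = (\<lambda>l. indicator {-L..L} l *\<^sub>R (of_real (exp (- l * \<eta>)) * exp (\<i> * of_real l * of_real x)))"
    have kint: "integrable lborel k"
    proof -
      have "continuous_on {-L..L} (\<lambda>l. of_real (exp (- l * \<eta>)) * exp (\<i> * of_real l * of_real x) :: complex)"
        by (intro continuous_intros)
      from borel_integrable_atLeastAtMost'[OF this] show ?thesis by (simp add: set_integrable_def k_def)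
    qed
    define I1 where "I1 = (LINT l|lborel. indicator {-L..L} l *\<^sub>R (fh l * exp (\<i> * of_real l * of_real x)))"
    define I2 where "I2 = (LINT l|lborel. indicator (- {-L..L}) l *\<^sub>R (fh l * exp (\<i> * of_real l * of_real x)))"
    have fxint: "integrable lborel (\<lambda>l. fh l * exp (\<i> * of_real l * of_real x))"
      by (rule Bochner_Integration.integrable_bound[OF fint]) (auto simp: norm_mult)
    have split: "2 * of_real pi * \<Phi> (Complex x \<eta>) = I1 + I2"
    proof -
      have "I1 + I2 = (LINT l|lborel. indicator {-L..L} l *\<^sub>R (fh l * exp (\<i> * of_real l * of_real x)) +
          indicator (- {-L..L}) l *\<^sub>R (fh l * exp (\<i> * of_real l * of_real x)))"
        unfolding I1_def I2_def
        by (intro Bochner_Integration.integral_add[symmetric] integrable_mult_indicator fxint) auto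
      also have "\<dots> = (LINT l|lborel. fh l * exp (\<i> * of_real l * of_real x))"
        by (intro Bochner_Integration.integral_cong) (auto simp: indicator_def)
      finally show ?thesis using inv by simp
    qed
    have I2: "cmod I2 \<le> J"
    proof -
      have "cmod I2 \<le> (LINT l|lborel. cmod (indicator (- {-L..L}) l *\<^sub>R (fh l * exp (\<i> * of_real l * of_real x))))"
        unfolding I2_def by (rule integral_norm_bound)
      also have "\<dots> \<le> J" unfolding J_def
      proof (rule integral_mono[OF _ Jint])
        show "integrable lborel (\<lambda>l. cmod (indicator (- {-L..L}) l *\<^sub>R (fh l * exp (\<i> * of_real l * of_real x))))"
          by (intro integrable_norm integrable_mult_indicator fxint) auto
        fix l
        show "cmod (indicator (- {-L..L}) l *\<^sub>R (fh l * exp (\<i> * of_real l * of_real x))) \<le> 16 * (1 + \<bar>l\<bar>) powr (- 2)"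
          using far[of l] by (auto simp: indicator_def norm_mult)
      qed
      finally show ?thesis .
    qed
    have "I1 = (LINT l|lborel. k l * (LINT u|lborel. \<Phi> (of_real u) * exp (- (\<i> * of_real l * of_real u))))"
      unfolding I1_def k_def fh_def fourier_def by (intro Bochner_Integration.integral_cong) (auto simp: mult_ac)
    also have "\<dots> = (LINT u|lborel. \<Phi> (of_real u) * (LINT l|lborel. k l * exp (- (\<i> * of_real l * of_real u))))"
      by (intro fubini_bounded_kernel kernel_integrable kint) auto
    finally have I1: "I1 = (LINT u|lborel. \<Phi> (of_real u) * (LINT l|lborel. k l * exp (- (\<i> * of_real l * of_real u))))" .
    have inner: "\<bar>x\<bar> * cmod (LINT l|lborel. k l * exp (- (\<i> * of_real l * of_real u))) \<le> 2 * exp (L * Y) * (1 + L) * (1 + \<bar>u\<bar>)" for u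
    proof -
      define w where "w = Complex (x - u) \<eta>"
      define K where "K = (LINT l|lborel. indicator {-L..L} l *\<^sub>R exp (\<i> * of_real l * w))"
      have "k l * exp (- (\<i> * of_real l * of_real u)) = indicator {-L..L} l *\<^sub>R exp (\<i> * of_real l * w)" for l
      proof -
        have "of_real (exp (- l * \<eta>)) * exp (\<i> * of_real l * of_real x) * exp (- (\<i> * of_real l * of_real u))
            = exp (of_real (- l * \<eta>) + \<i> * of_real l * of_real x + - (\<i> * of_real l * of_real u))"
          by (simp only: exp_add exp_of_real)
        also have "of_real (- l * \<eta>) + \<i> * of_real l * of_real x + - (\<i> * of_real l * of_real u) = \<i> * of_real l * w"
          by (simp add: w_def complex_eq_iff algebra_simps)
        finally show ?thesis by (simp add: k_def)
      qed
      then have eq: "(LINT l|lborel. k l * exp (- (\<i> * of_real l * of_real u))) = K" by (simp add: K_def)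
      have Kb: "cmod K \<le> 2 * L * exp (L * Y)" "cmod w * cmod K \<le> 2 * exp (L * Y)"
        unfolding K_def using \<eta> by (auto intro!: truncated_exponential_bound L simp: w_def)
      \<comment> \<open>The inner integral gains 1/|w| but 1/|x| is wanted; the difference is paid
        with |u|, hence the weight 1 + |u| in \<open>moment\<close>.\<close>
      have "\<bar>x\<bar> \<le> cmod w + \<bar>u\<bar>" using abs_Re_le_cmod[of w] by (simp add: w_def)
      then have "\<bar>x\<bar> * cmod K \<le> (cmod w + \<bar>u\<bar>) * cmod K" by (intro mult_right_mono) auto
      also have "\<dots> = cmod w * cmod K + \<bar>u\<bar> * cmod K" by (simp add: algebra_simps)
      also have "\<dots> \<le> 2 * exp (L * Y) + \<bar>u\<bar> * (2 * L * exp (L * Y))" using Kb by (intro add_mono mult_left_mono) auto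
      also have "\<dots> \<le> 2 * exp (L * Y) * (1 + L) * (1 + \<bar>u\<bar>)" using L by (simp add: algebra_simps)
      finally show ?thesis by (simp add: eq)
    qed
    have "\<bar>x\<bar> * cmod I1 \<le> 2 * exp (L * Y) * (1 + L) * M"
    proof -
      have "\<bar>x\<bar> * cmod I1 = cmod (LINT u|lborel. of_real \<bar>x\<bar> * (\<Phi> (of_real u) * (LINT l|lborel. k l * exp (- (\<i> * of_real l * of_real u)))))"
        unfolding I1 by (simp add: norm_mult)
      also have "\<dots> \<le> (LINT u|lborel. 2 * exp (L * Y) * (1 + L) * ((1 + \<bar>u\<bar>) * cmod (\<Phi> (of_real u))))"
      proof (rule norm_integral_le)
        show "integrable lborel (\<lambda>u. 2 * exp (L * Y) * (1 + L) * ((1 + \<bar>u\<bar>) * cmod (\<Phi> (of_real u))))"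
          using moment by (intro integrable_mult_right)
        fix u
        show "norm (of_real \<bar>x\<bar> * (\<Phi> (of_real u) * (LINT l|lborel. k l * exp (- (\<i> * of_real l * of_real u)))))
            \<le> 2 * exp (L * Y) * (1 + L) * ((1 + \<bar>u\<bar>) * cmod (\<Phi> (of_real u)))"
          using mult_right_mono[OF inner[of u] norm_ge_zero[of "\<Phi> (of_real u)"]] by (simp add: norm_mult mult_ac)
      qed
      also have "\<dots> = 2 * exp (L * Y) * (1 + L) * M" by (simp add: M_def)
      finally show ?thesis .
    qed
    then have I1b: "cmod I1 \<le> 2 * M * (exp (L * Y) * (1 + L) / \<bar>x\<bar>)" using x by (simp add: field_simps)
    have "cmod (\<Phi> (Complex x \<eta>)) \<le> 2 * pi * cmod (\<Phi> (Complex x \<eta>))"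
      using pi_ge_two mult_right_mono[of 1 "2 * pi" "cmod (\<Phi> (Complex x \<eta>))"] by simp
    also have "\<dots> = cmod (I1 + I2)" unfolding split[symmetric] by (simp add: norm_mult)
    also have "\<dots> \<le> 2 * M * (exp (L * Y) * (1 + L) / \<bar>x\<bar>) + J" using norm_triangle_ineq[of I1 I2] I1b I2 by linarith
    also have "\<dots> \<le> C * (exp (L * Y) * (1 + L) / \<bar>x\<bar>) + C"
      using M0 J0 L unfolding C_def by (intro add_mono mult_right_mono) auto
    finally show ?thesis by (simp add: algebra_simps)
  qed
  moreover have "C > 0" using M0 J0 by (simp add: C_def)
  ultimately show thesis using that by blast
qed

end

subsection \<open>The convolution formula\<close>

text \<open>The excess p - 1 of the decay exponent is shared: half of it pays for the growth of g,
  and (p + 1) / 2 > 1 remains.\<close>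

lemma decays_on_mult:
  assumes p: "1 < p"
    and h: "\<And>s. s \<in> S \<Longrightarrow> cmod (h s) \<le> C * (1 + \<bar>Im s\<bar>) powr (- p)"
    and g: "\<And>s. s \<in> S \<Longrightarrow> cmod (g s) \<le> K * (1 + \<bar>Im s\<bar>) powr ((p - 1) / 2)" and K: "0 \<le> K"
  shows "decays_on S (\<lambda>s. g s * h s)"
proof -
  have "cmod (g s * h s) \<le> K * C * (1 + \<bar>Im s\<bar>) powr (- ((p + 1) / 2))" if "s \<in> S" for s
  proof -
    have "cmod (g s * h s) \<le> (K * (1 + \<bar>Im s\<bar>) powr ((p - 1) / 2)) * (C * (1 + \<bar>Im s\<bar>) powr (- p))"
      unfolding norm_mult using h[OF that] g[OF that] K by (intro mult_mono) auto
    also have "\<dots> = K * C * ((1 + \<bar>Im s\<bar>) powr ((p - 1) / 2) * (1 + \<bar>Im s\<bar>) powr (- p))" by (simp add: mult_ac)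
    also have "(1 + \<bar>Im s\<bar>) powr ((p - 1) / 2) * (1 + \<bar>Im s\<bar>) powr (- p) = (1 + \<bar>Im s\<bar>) powr (- ((p + 1) / 2))"
    proof -
      have "(p - 1) / 2 + - p = - ((p + 1) / 2)" by (simp add: field_simps)
      then show ?thesis by (simp only: powr_add[symmetric])
    qed
    finally show ?thesis .
  qed
  moreover have "(p + 1) / 2 > 1" using p by simp
  ultimately show ?thesis unfolding decays_on_def by blast
qed

context entire_kernel
begin

text \<open>The kernel transported to the s-plane: a + i y corresponds to the real argument \<tau>
  (y - t), and a step x to the right moves the argument of \<Phi> down by \<tau> x.\<close>

definition on_line :: "real \<Rightarrow> real \<Rightarrow> real \<Rightarrow> complex \<Rightarrow> complex" where
  "on_line a t \<tau> s = \<Phi> (- \<i> * of_real \<tau> * (s - Complex a t))"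

lemma on_line_Complex: "on_line a t \<tau> (Complex x y) = \<Phi> (Complex (\<tau> * (y - t)) (\<tau> * (a - x)))"
proof -
  have "- \<i> * of_real \<tau> * (Complex x y - Complex a t) = Complex (\<tau> * (y - t)) (\<tau> * (a - x))"
    by (simp add: complex_eq_iff algebra_simps)
  then show ?thesis by (simp add: on_line_def)
qed

lemma on_line_holomorphic: "on_line a t \<tau> holomorphic_on S"
proof -
  have lin: "(\<lambda>s. - \<i> * of_real \<tau> * (s - Complex a t)) holomorphic_on S" by (intro holomorphic_intros)
  show ?thesis
    using holomorphic_on_compose_gen[OF lin entire] by (simp add: o_def on_line_def[abs_def])
qed

lemma on_line_bound:
  assumes "0 < \<tau>"
  obtains p C where "p > 1" "C \<ge> 0"
    "\<And>s. a \<le> Re s \<Longrightarrow> Re s \<le> a + 2 \<Longrightarrow> cmod (on_line a t \<tau> s) \<le> C * (1 + \<bar>Im s\<bar>) powr (- p)"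
proof -
  obtain p C where p: "p > 1" "C \<ge> 0"
    and C: "\<And>x y. \<bar>x\<bar> \<le> 2 \<Longrightarrow> cmod (\<Phi> (Complex (\<tau> * (y - t)) (\<tau> * x))) \<le> C * (1 + \<bar>y\<bar>) powr (- p)"
    using shifted_strip_bound[OF assms] by blast
  show thesis
  proof (rule that[OF p])
    fix s assume s: "a \<le> Re s" "Re s \<le> a + 2"
    have "cmod (on_line a t \<tau> (Complex (Re s) (Im s))) \<le> C * (1 + \<bar>Im s\<bar>) powr (- p)"
      unfolding on_line_Complex using s by (intro C) auto
    then show "cmod (on_line a t \<tau> s) \<le> C * (1 + \<bar>Im s\<bar>) powr (- p)" by simp
  qed
qed

lemma on_line_integrable:
  assumes "0 < \<tau>" "a \<le> x" "x \<le> a + 2"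
  shows "integrable lborel (\<lambda>y. on_line a t \<tau> (Complex x y))"
proof -
  obtain p C where p: "p > 1" "C \<ge> 0"
    "\<And>s. a \<le> Re s \<Longrightarrow> Re s \<le> a + 2 \<Longrightarrow> cmod (on_line a t \<tau> s) \<le> C * (1 + \<bar>Im s\<bar>) powr (- p)"
    using on_line_bound[OF assms(1)] by blast
  then have "decays_on {s. a \<le> Re s \<and> Re s \<le> a + 2} (on_line a t \<tau>)"
    unfolding decays_on_def by blast
  then have "set_integrable lborel UNIV (\<lambda>y. on_line a t \<tau> (Complex x y))"
    using assms by (intro decays_on_line_integrable continuous_on_vertical[OF on_line_holomorphic[of a t \<tau> UNIV]]) auto
  then show ?thesis by (simp add: set_integrable_def)
qed

text \<open>The line is moved from c back to a, where \<Phi> has real argument; there the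
  substitution u = \<tau> (y - t) produces the Fourier transform at ln n / \<tau>.\<close>

lemma integral_dirichlet_term:
  assumes \<tau>: "0 < \<tau>" and a: "0 < a" and c: "a < c" "c \<le> a + 2" and n: "0 < n"
  shows "(LINT y|lborel. of_nat n powr (- Complex c y) * on_line a t \<tau> (Complex c y)) =
    of_nat n powr (- Complex a t) * fourier \<Phi> (ln (real n) / \<tau>) / of_real \<tau>"
proof -
  obtain p C where p: "p > 1" "C \<ge> 0"
    and C: "\<And>s. a \<le> Re s \<Longrightarrow> Re s \<le> a + 2 \<Longrightarrow> cmod (on_line a t \<tau> s) \<le> C * (1 + \<bar>Im s\<bar>) powr (- p)"
    using on_line_bound[OF \<tau>] by blast
  have n0: "(of_nat n :: complex) \<noteq> 0" using n by simp
  have e1: "(LINT y|lborel. of_nat n powr (- Complex a y) * on_line a t \<tau> (Complex a y)) =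
      (LINT y|lborel. of_nat n powr (- Complex c y) * on_line a t \<tau> (Complex c y))"
  proof (rule strip_integral[OF _ _ c(1)])
    show "(\<lambda>s. of_nat n powr (- s) * on_line a t \<tau> s) holomorphic_on {s. a \<le> Re s \<and> Re s \<le> c}"
      using n0 by (intro holomorphic_intros on_line_holomorphic)
    show "decays_on {s. a \<le> Re s \<and> Re s \<le> c} (\<lambda>s. of_nat n powr (- s) * on_line a t \<tau> s)"
    proof (rule decays_on_mult[OF p(1), where K = 1])
      fix s assume s: "s \<in> {s. a \<le> Re s \<and> Re s \<le> c}"
      then show "cmod (on_line a t \<tau> s) \<le> C * (1 + \<bar>Im s\<bar>) powr (- p)" using c by (intro C) auto
      have "real n powr (- Re s) \<le> 1" using powr_mono[of "- Re s" 0 "real n"] s a n by simp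
      also have "1 \<le> 1 * (1 + \<bar>Im s\<bar>) powr ((p - 1) / 2)" using p by (simp add: ge_one_powr_ge_zero)
      finally show "cmod (of_nat n powr (- s)) \<le> 1 * (1 + \<bar>Im s\<bar>) powr ((p - 1) / 2)" by (simp add: norm_of_nat_powr)
    qed simp
  qed
  have e2: "(LINT y|lborel. of_nat n powr (- Complex a y) * on_line a t \<tau> (Complex a y)) =
      \<bar>1 / \<tau>\<bar> *\<^sub>R (LINT u|lborel. of_nat n powr (- Complex a (t + 1 / \<tau> * u)) * on_line a t \<tau> (Complex a (t + 1 / \<tau> * u)))"
    using \<tau> by (intro lborel_integral_real_affine) auto
  have e3: "of_nat n powr (- Complex a (t + 1 / \<tau> * u)) * on_line a t \<tau> (Complex a (t + 1 / \<tau> * u)) =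
      of_nat n powr (- Complex a t) * (\<Phi> (of_real u) * exp (- (\<i> * of_real (ln (real n) / \<tau>) * of_real u)))" for u
  proof -
    have "- Complex a (t + 1 / \<tau> * u) = - Complex a t + - (\<i> * of_real (u / \<tau>))" by (simp add: complex_eq_iff)
    then have "(of_nat n :: complex) powr (- Complex a (t + 1 / \<tau> * u)) = of_nat n powr (- Complex a t) * of_nat n powr (- (\<i> * of_real (u / \<tau>)))"
      by (simp only: powr_add)
    moreover have "(of_nat n :: complex) powr (- (\<i> * of_real (u / \<tau>))) = exp (- (\<i> * of_real (ln (real n) / \<tau>) * of_real u))"
      using n by (simp add: powr_def Ln_of_nat field_simps)
    moreover have "on_line a t \<tau> (Complex a (t + 1 / \<tau> * u)) = \<Phi> (of_real u)"
      using \<tau> by (simp add: on_line_Complex complex_of_real_def)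
    ultimately show ?thesis by (simp only: mult_ac)
  qed
  have "(LINT y|lborel. of_nat n powr (- Complex c y) * on_line a t \<tau> (Complex c y)) =
      \<bar>1 / \<tau>\<bar> *\<^sub>R (of_nat n powr (- Complex a t) * fourier \<Phi> (ln (real n) / \<tau>))"
    unfolding e1[symmetric] e2 e3 fourier_def by (simp only: integral_mult_right_zero)
  then show ?thesis using \<tau> by (simp add: scaleR_conv_of_real)
qed

text \<open>On Re s = c > 1 the series of \<open>log_zeta\<close> converges absolutely with a bound
  independent of y, so it may be integrated term by term; \<open>integral_dirichlet_term\<close>
  evaluates the terms.\<close>

lemma integral_log_zeta:
  assumes \<tau>: "0 < \<tau>" and a: "0 < a" and c: "a < c" "c \<le> a + 2" "1 < c"
  shows "integrable lborel (\<lambda>y. log_zeta (Complex c y) * on_line a t \<tau> (Complex c y))"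
    and "(\<lambda>n. of_real (log_coeff n) * (of_nat n powr (- Complex a t) * fourier \<Phi> (ln (real n) / \<tau>) / of_real \<tau>))
       sums (LINT y|lborel. log_zeta (Complex c y) * on_line a t \<tau> (Complex c y))"
proof -
  define h where "h = (\<lambda>y. on_line a t \<tau> (Complex c y))"
  have hint: "integrable lborel h" unfolding h_def using \<tau> c by (intro on_line_integrable) auto
  have [measurable]: "h \<in> borel_measurable borel" using hint by auto
  have [measurable]: "(\<lambda>y. Complex c y) \<in> borel_measurable borel" unfolding Complex_eq by measurable
  define f where "f = (\<lambda>n y. of_real (log_coeff n) * of_nat n powr (- Complex c y) * h y)"
  have nf: "cmod (f n y) = log_coeff n * real n powr (- c) * cmod (h y)" for n y
    using log_coeff_nonneg by (simp add: f_def norm_mult norm_of_nat_powr)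
  have meas: "f n \<in> borel_measurable borel" for n
  proof (cases "n = 0")
    case True
    then show ?thesis by (simp add: f_def)
  next
    case False
    have "continuous_on UNIV (\<lambda>y. of_nat n powr (- Complex c y) :: complex)"
      using False unfolding Complex_eq by (intro continuous_intros) auto
    then have "(\<lambda>y. of_nat n powr (- Complex c y) :: complex) \<in> borel_measurable borel"
      by (rule borel_measurable_continuous_onI)
    then show ?thesis unfolding f_def by measurable
  qed
  have int: "integrable lborel (f n)" for n
  proof (rule Bochner_Integration.integrable_bound[OF integrable_mult_right[OF hint, of "of_real (log_coeff n * real n powr (- c))"]])
    show "AE y in lborel. norm (f n y) \<le> norm (of_real (log_coeff n * real n powr (- c)) * h y)"
      unfolding nf using log_coeff_nonneg by (simp add: norm_mult)
  qed (use meas in simp)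
  have summ: "summable (\<lambda>n. log_coeff n * real n powr (- c))"
  proof (rule summable_comparison_test'[OF summable_powr_minus[OF c(3)]])
    show "norm (log_coeff n * real n powr (- c)) \<le> real n powr (- c)" for n
      using log_coeff_nonneg[of n] log_coeff_le_1[of n] by (simp add: mult_left_le_one_le)
  qed
  have s1: "AE y in lborel. summable (\<lambda>n. norm (f n y))"
    unfolding nf using summable_mult2[OF summ] by simp
  have s2: "summable (\<lambda>n. LINT y|lborel. norm (f n y))"
    unfolding nf using summable_mult2[OF summ] by simp
  have eq: "(\<Sum>n. f n y) = log_zeta (Complex c y) * h y" for y
  proof -
    have "(\<lambda>n. of_real (log_coeff n) * of_nat n powr (- Complex c y)) sums log_zeta (Complex c y)"
      using c by (intro log_zeta_derivative(2)) simp
    from sums_mult2[OF this, of "h y"] show ?thesis by (simp add: f_def sums_iff)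
  qed
  show "integrable lborel (\<lambda>y. log_zeta (Complex c y) * on_line a t \<tau> (Complex c y))"
    using integrable_suminf[OF int s1 s2] unfolding eq h_def .
  have "(\<lambda>n. LINT y|lborel. f n y) sums (LINT y|lborel. (\<Sum>n. f n y))"
    by (rule sums_integral[OF int s1 s2])
  moreover have "(LINT y|lborel. f n y) = of_real (log_coeff n) * (of_nat n powr (- Complex a t) * fourier \<Phi> (ln (real n) / \<tau>) / of_real \<tau>)" for n
  proof (cases "n = 0")
    case False
    then have "0 < n" by simp
    from integral_dirichlet_term[OF \<tau> a c(1,2) this, of t] show ?thesis
      unfolding f_def h_def by (simp only: mult.assoc integral_mult_right_zero)
  qed (simp add: f_def)
  ultimately show "(\<lambda>n. of_real (log_coeff n) * (of_nat n powr (- Complex a t) * fourier \<Phi> (ln (real n) / \<tau>) / of_real \<tau>))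
       sums (LINT y|lborel. log_zeta (Complex c y) * on_line a t \<tau> (Complex c y))"
    unfolding eq h_def by simp
qed

text \<open>The cut of \<open>pole_log\<close> along \<open>[-1, 1]\<close> is avoided by moving only the parts of the line with
  imaginary part at least 1 in absolute value.\<close>

lemma integral_pole_log:
  assumes \<tau>: "0 < \<tau>" and a: "0 < a" and c: "a < c" "c \<le> a + 1" "1 < c"
    and d: "0 < d" "d \<le> c - 1" "d \<le> 1"
    and S: "\<And>x y. a \<le> x \<Longrightarrow> x \<le> c \<Longrightarrow> \<bar>y\<bar> \<le> 1 \<Longrightarrow> cmod (on_line a t \<tau> (Complex x y)) \<le> S"
  shows "set_integrable lborel {..<- 1} (\<lambda>y. pole_log (Complex a y) * on_line a t \<tau> (Complex a y))"
    and "set_integrable lborel {1..} (\<lambda>y. pole_log (Complex a y) * on_line a t \<tau> (Complex a y))"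
    and "cmod ((LINT y|lborel. pole_log (Complex c y) * on_line a t \<tau> (Complex c y)) -
       (LINT y:{..<- 1}|lborel. pole_log (Complex a y) * on_line a t \<tau> (Complex a y)) -
       (LINT y:{1..}|lborel. pole_log (Complex a y) * on_line a t \<tau> (Complex a y))) \<le>
       2 * (ln (3 / d) + pi) * S + 2 * (ln 3 + pi) * S"
    and "integrable lborel (\<lambda>y. pole_log (Complex c y) * on_line a t \<tau> (Complex c y))"
proof -
  obtain p C where p: "p > 1" "C \<ge> 0"
    and C: "\<And>s. a \<le> Re s \<Longrightarrow> Re s \<le> a + 2 \<Longrightarrow> cmod (on_line a t \<tau> s) \<le> C * (1 + \<bar>Im s\<bar>) powr (- p)"
    using on_line_bound[OF \<tau>] by blast
  define f where "f = (\<lambda>s. pole_log s * on_line a t \<tau> s)"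
  have S0: "0 \<le> S" using order_trans[OF norm_ge_zero S[of a 0]] c by simp
  have lnd: "0 \<le> ln (3 / d)" using d by simp
  have hol: "f holomorphic_on T" if "\<And>s. s \<in> T \<Longrightarrow> Re s > 1 \<or> Im s \<noteq> 0" for T
    unfolding f_def by (rule holomorphic_on_mult[OF pole_log_holomorphic on_line_holomorphic]) (rule that)
  have dec: "decays_on T f" if T: "\<And>s. s \<in> T \<Longrightarrow> a \<le> Re s \<and> Re s \<le> c \<and> d \<le> cmod (s - 1)" for T
    unfolding f_def
  proof (rule decays_on_mult[OF p(1), where K = "ln (3 / d) + pi"])
    fix s assume s: "s \<in> T"
    show "cmod (on_line a t \<tau> s) \<le> C * (1 + \<bar>Im s\<bar>) powr (- p)" using c T[OF s] by (intro C) auto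
    have "cmod (pole_log s) \<le> ln (3 / d) + pi" using d a T[OF s] by (intro pole_log_bound) auto
    also have "\<dots> = (ln (3 / d) + pi) * 1" by simp
    also have "\<dots> \<le> (ln (3 / d) + pi) * (1 + \<bar>Im s\<bar>) powr ((p - 1) / 2)"
      using p lnd pi_ge_zero by (intro mult_left_mono) (auto simp: ge_one_powr_ge_zero)
    finally show "cmod (pole_log s) \<le> (ln (3 / d) + pi) * (1 + \<bar>Im s\<bar>) powr ((p - 1) / 2)" .
  qed (use lnd in auto)
  have far: "1 \<le> cmod (s - 1)" if "1 \<le> \<bar>Im s\<bar>" for s
    using that abs_Im_le_cmod[of "s - 1"] by simp
  have right: "c - 1 \<le> cmod (Complex c y - 1)" for y
    using abs_Re_le_cmod[of "Complex c y - 1"] by simp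
  have intc: "set_integrable lborel A (\<lambda>y. f (Complex c y))" if "A \<in> sets borel" for A
  proof (rule decays_on_line_integrable[where S = "{s. Re s = c}"])
    show "decays_on {s. Re s = c} f"
    proof (rule dec)
      fix s assume "s \<in> {s. Re s = c}"
      then have "s = Complex c (Im s)" by (simp add: complex_eq_iff)
      then have "c - 1 \<le> cmod (s - 1)" using right by metis
      then show "a \<le> Re s \<and> Re s \<le> c \<and> d \<le> cmod (s - 1)" using \<open>s \<in> _\<close> c d by auto
    qed
    show "continuous_on A (\<lambda>y. f (Complex c y))"
      by (rule continuous_on_vertical[OF hol[of "{s. Re s = c}"]]) (use c in auto)
  qed (use that in auto)
  have inta: "set_integrable lborel A (\<lambda>y. f (Complex a y))" if "A \<in> sets borel" "\<And>y. y \<in> A \<Longrightarrow> 1 \<le> \<bar>y\<bar>" for A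
  proof (rule decays_on_line_integrable[where S = "{s. Re s = a \<and> 1 \<le> \<bar>Im s\<bar>}"])
    show "decays_on {s. Re s = a \<and> 1 \<le> \<bar>Im s\<bar>} f"
      using c d far by (intro dec) (auto intro: order_trans[OF d(3)])
    show "continuous_on A (\<lambda>y. f (Complex a y))"
      by (rule continuous_on_vertical[OF hol[of "{s. Re s = a \<and> 1 \<le> \<bar>Im s\<bar>}"]]) (use that in auto)
  qed (use that in auto)
  show ia: "set_integrable lborel {..<- 1} (\<lambda>y. pole_log (Complex a y) * on_line a t \<tau> (Complex a y))"
    "set_integrable lborel {1..} (\<lambda>y. pole_log (Complex a y) * on_line a t \<tau> (Complex a y))"
    using inta[of "{..<- 1}"] inta[of "{1..}"] by (auto simp: f_def)
  show "integrable lborel (\<lambda>y. pole_log (Complex c y) * on_line a t \<tau> (Complex c y))"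
    using intc[of UNIV] by (simp add: f_def set_integrable_def)
  have up: "\<i> * (LINT y:{1..}|lborel. f (Complex c y)) - \<i> * (LINT y:{1..}|lborel. f (Complex a y)) =
      - integral {a..c} (\<lambda>x. f (Complex x 1))"
  proof (rule half_strip_integral[OF _ _ c(1)])
    show "f holomorphic_on {s. a \<le> Re s \<and> Re s \<le> c \<and> 1 \<le> Im s}" by (rule hol) auto
    show "decays_on {s. a \<le> Re s \<and> Re s \<le> c \<and> 1 \<le> Im s} f"
      using far by (intro dec) (auto intro: order_trans[OF d(3)])
  qed
  have down: "\<i> * (LINT y:{..<- 1}|lborel. f (Complex c y)) - \<i> * (LINT y:{..<- 1}|lborel. f (Complex a y)) =
      integral {a..c} (\<lambda>x. f (Complex x (- 1)))"
  proof (rule lower_half_strip_integral[OF _ _ c(1)])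
    show "f holomorphic_on {s. a \<le> Re s \<and> Re s \<le> c \<and> Im s \<le> - 1}" by (rule hol) auto
    show "decays_on {s. a \<le> Re s \<and> Re s \<le> c \<and> Im s \<le> - 1} f"
      using far by (intro dec) (auto intro: order_trans[OF d(3)])
  qed
  have edge: "cmod (integral {a..c} (\<lambda>x. f (Complex x y))) \<le> (ln 3 + pi) * S" if "\<bar>y\<bar> = 1" for y
  proof -
    have "cmod (integral {a..c} (\<lambda>x. f (Complex x y))) \<le> (ln 3 + pi) * S * (c - a)"
    proof (rule integral_bound)
      show "continuous_on {a..c} (\<lambda>x. f (Complex x y))"
        by (rule continuous_on_horizontal[OF hol[of "{s. Im s = y}"]]) (use that in auto)
      fix x assume x: "x \<in> {a..c}"
      have "cmod (pole_log (Complex x y)) \<le> ln (3 / 1) + pi"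
        using x a that far[of "Complex x y"] by (intro pole_log_bound) auto
      then show "cmod (f (Complex x y)) \<le> (ln 3 + pi) * S"
        unfolding f_def norm_mult using x that S by (intro mult_mono) auto
    qed (use c in auto)
    also have "\<dots> \<le> (ln 3 + pi) * S * 1" using c S0 by (intro mult_left_mono) auto
    finally show ?thesis by simp
  qed
  \<comment> \<open>This piece stays on Re s = c, at distance at least d from the pole, so
    \<open>pole_log\<close> is at most ln (3 / d) + pi there.\<close>
  have mid: "cmod (LINT y:{- 1..<1}|lborel. f (Complex c y)) \<le> 2 * (ln (3 / d) + pi) * S"
  proof -
    have "cmod (LINT y:{- 1..<1}|lborel. f (Complex c y)) \<le> (LINT y|lborel. indicator {-1..1::real} y * ((ln (3 / d) + pi) * S))"
      unfolding set_lebesgue_integral_def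
    proof (rule norm_integral_le)
      show "integrable lborel (\<lambda>y. indicator {-1..1::real} y * ((ln (3 / d) + pi) * S))"
        by (intro integrable_mult_left integrable_indicator_Icc)
      fix y :: real
      show "cmod (indicator {- 1..<1} y *\<^sub>R f (Complex c y)) \<le> indicator {-1..1} y * ((ln (3 / d) + pi) * S)"
      proof (cases "y \<in> {- 1..<1}")
        case True
        have "cmod (pole_log (Complex c y)) \<le> ln (3 / d) + pi"
          using d right[of y] c a by (intro pole_log_bound) auto
        then have "cmod (f (Complex c y)) \<le> (ln (3 / d) + pi) * S"
          unfolding f_def norm_mult using True c S lnd pi_ge_zero by (intro mult_mono) auto
        then show ?thesis using True by simp
      next
        case False
        then show ?thesis using S0 lnd by (simp add: indicator_def add_nonneg_nonneg)
      qed
    qed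
    also have "\<dots> = 2 * (ln (3 / d) + pi) * S" by simp
    finally show ?thesis .
  qed
  have split: "(LINT y|lborel. f (Complex c y)) = (LINT y:{..<- 1}|lborel. f (Complex c y)) +
      ((LINT y:{- 1..<1}|lborel. f (Complex c y)) + (LINT y:{1..}|lborel. f (Complex c y)))"
  proof -
    have U: "{..<- 1} \<union> ({- 1..<1} \<union> {1..}) = (UNIV :: real set)" by auto
    have "(LINT y|lborel. f (Complex c y)) = (LINT y:{..<- 1} \<union> ({- 1..<1} \<union> {1..})|lborel. f (Complex c y))"
      unfolding U by (simp add: set_lebesgue_integral_def)
    also have "\<dots> = (LINT y:{..<- 1}|lborel. f (Complex c y)) + (LINT y:{- 1..<1} \<union> {1..}|lborel. f (Complex c y))"
      by (intro set_integral_Un intc) auto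
    also have "(LINT y:{- 1..<1} \<union> {1..}|lborel. f (Complex c y)) = (LINT y:{- 1..<1}|lborel. f (Complex c y)) + (LINT y:{1..}|lborel. f (Complex c y))"
      by (intro set_integral_Un intc) auto
    finally show ?thesis .
  qed
  define E1 where "E1 = integral {a..c} (\<lambda>x. f (Complex x 1))"
  define E2 where "E2 = integral {a..c} (\<lambda>x. f (Complex x (- 1)))"
  have u: "(LINT y:{1..}|lborel. f (Complex c y)) - (LINT y:{1..}|lborel. f (Complex a y)) = \<i> * E1"
    using arg_cong[OF up, of "\<lambda>z. - \<i> * z"] by (simp add: E1_def algebra_simps)
  have l: "(LINT y:{..<- 1}|lborel. f (Complex c y)) - (LINT y:{..<- 1}|lborel. f (Complex a y)) = - \<i> * E2"
    using arg_cong[OF down, of "\<lambda>z. - \<i> * z"] by (simp add: E2_def algebra_simps)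
  have "(LINT y|lborel. f (Complex c y)) - (LINT y:{..<- 1}|lborel. f (Complex a y)) - (LINT y:{1..}|lborel. f (Complex a y))
      = (LINT y:{- 1..<1}|lborel. f (Complex c y)) + (\<i> * E1 + - \<i> * E2)"
    unfolding split u[symmetric] l[symmetric] by simp
  also have "cmod \<dots> \<le> cmod (LINT y:{- 1..<1}|lborel. f (Complex c y)) + (cmod E1 + cmod E2)"
    by (intro order_trans[OF norm_triangle_ineq] add_mono order_refl) (auto simp: norm_mult)
  also have "\<dots> \<le> 2 * (ln (3 / d) + pi) * S + ((ln 3 + pi) * S + (ln 3 + pi) * S)"
    unfolding E1_def E2_def by (intro add_mono mid edge) auto
  also have "\<dots> = 2 * (ln (3 / d) + pi) * S + 2 * (ln 3 + pi) * S" by (simp add: algebra_simps)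
  finally show "cmod ((LINT y|lborel. pole_log (Complex c y) * on_line a t \<tau> (Complex c y)) -
       (LINT y:{..<- 1}|lborel. pole_log (Complex a y) * on_line a t \<tau> (Complex a y)) -
       (LINT y:{1..}|lborel. pole_log (Complex a y) * on_line a t \<tau> (Complex a y))) \<le>
       2 * (ln (3 / d) + pi) * S + 2 * (ln 3 + pi) * S"
    by (simp add: f_def)
qed

end

context entire_kernel
begin

text \<open>Z times the kernel has the same integral over Re s = a and Re s = c. On the right line Z
  is \<open>log_zeta + pole_log\<close>, giving D plus a term Q; on the left line Re Z is ln |zeta|
  plus the real part of \<open>pole_log\<close>. The two \<open>pole_log\<close> integrals agree up
  to horizontal edges and the segments |y| <= 1, where the kernel is at most S: an error O(\<tau>
  S), as ln (6 \<tau>) <= 6 \<tau>.\<close>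

lemma convolution_formula:
  assumes RH: riemann_hypothesis and pos: "\<forall>u::real. \<Phi> (of_real u) \<in> \<real>\<^sub>\<ge>\<^sub>0"
    and \<tau>: "1 \<le> \<tau>" and a: "1 / 2 < a" "a \<le> 3 / 4" and t: "1 \<le> t"
    and S: "\<And>x \<eta>. \<tau> * (t - 1) \<le> \<bar>x\<bar> \<Longrightarrow> \<bar>\<eta>\<bar> \<le> \<tau> / 2 + 1 / 2 \<Longrightarrow> cmod (\<Phi> (Complex x \<eta>)) \<le> S"
  obtains D where
    "(\<lambda>n. of_real (log_coeff n) * (of_nat n powr (- Complex a t) * fourier \<Phi> (ln (real n) / \<tau>) / of_real \<tau>)) sums D"
    "integrable lborel (\<lambda>y. ln (cmod (zeta (Complex a y))) * Re (\<Phi> (of_real (\<tau> * (y - t)))))"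
    "\<bar>(LINT y|lborel. ln (cmod (zeta (Complex a y))) * Re (\<Phi> (of_real (\<tau> * (y - t))))) - Re D\<bar> \<le> 100 * \<tau> * S"
proof -
  \<comment> \<open>Barely to the right of 1: c - 1 is at least d, while \<tau> (c - a) = \<tau>/2 +
    1/2 is the largest distance of the kernel's argument from the real axis.\<close>
  define c where "c = a + 1 / 2 + 1 / (2 * \<tau>)"
  define d where "d = 1 / (2 * \<tau>)"
  define h where "h = on_line a t \<tau>"
  define w where "w = (\<lambda>y. Re (\<Phi> (of_real (\<tau> * (y - t)))))"
  have \<tau>0: "0 < \<tau>" using \<tau> by simp
  have d: "0 < d" "d \<le> 1 / 2" using \<tau> by (auto simp: d_def field_simps)
  have c: "a < c" "c \<le> a + 1" "1 < c" "c \<le> 2" "d \<le> c - 1" "c - a = 1 / 2 + d" using d a by (auto simp: c_def d_def[symmetric])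
  have S': "cmod (h (Complex x y)) \<le> S" if x: "a \<le> x" "x \<le> c" and y: "\<bar>y\<bar> \<le> 1" for x y
    unfolding h_def on_line_Complex
  proof (rule S)
    have "\<tau> * (t - 1) \<le> \<tau> * (t - y)" using y \<tau> by (intro mult_left_mono) auto
    then show "\<tau> * (t - 1) \<le> \<bar>\<tau> * (y - t)\<bar>" by (simp add: algebra_simps)
    have "\<tau> * (x - a) \<le> \<tau> * (1 / 2 + d)" using x c(6) \<tau> by (intro mult_left_mono) auto
    also have "\<dots> = \<tau> / 2 + 1 / 2" using \<tau> by (simp add: d_def algebra_simps)
    finally have "\<tau> * (x - a) \<le> \<tau> / 2 + 1 / 2" .
    moreover have "\<bar>\<tau> * (a - x)\<bar> = \<tau> * (x - a)" using x \<tau> by (simp add: abs_mult)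
    ultimately show "\<bar>\<tau> * (a - x)\<bar> \<le> \<tau> / 2 + 1 / 2" by simp
  qed
  have S0: "0 \<le> S" using order_trans[OF norm_ge_zero S'[of a 0]] c by simp
  have w_eq: "h (Complex a y) = of_real (w y)" for y
  proof -
    have "\<Phi> (of_real (\<tau> * (y - t))) \<in> \<real>" using pos nonneg_Reals_subset_Reals by blast
    then have "\<Phi> (of_real (\<tau> * (y - t))) = of_real (w y)" by (simp add: w_def)
    then show ?thesis by (simp add: h_def on_line_Complex complex_of_real_def)
  qed
  obtain p C where p: "p > 1" "C \<ge> 0"
    and C: "\<And>s. a \<le> Re s \<Longrightarrow> Re s \<le> a + 2 \<Longrightarrow> cmod (h s) \<le> C * (1 + \<bar>Im s\<bar>) powr (- p)"
    unfolding h_def using on_line_bound[OF \<tau>0] by blast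
  obtain Z where Z: "Z holomorphic_on {s. 1 / 2 < Re s}"
    and expZ: "\<And>s. 1 / 2 < Re s \<Longrightarrow> exp (Z s) = xzeta s / (s + 1)"
    and ZD: "\<And>s. 1 < Re s \<Longrightarrow> Z s = log_zeta s + pole_log s"
    using ex_regularised_log_zeta[OF RH] by blast
  \<comment> \<open>The growth exponent allowed for Z is half of the kernel's excess p - 1, as
    \<open>decays_on_mult\<close> requires.\<close>
  have "0 < (p - 1) / 2" "a \<le> 1" using p a by auto
  then obtain K where K: "K > 0" "\<And>s. a \<le> Re s \<Longrightarrow> Re s \<le> 2 \<Longrightarrow> cmod (Z s) \<le> K * (1 + \<bar>Im s\<bar>) powr ((p - 1) / 2)"
    using regularised_log_zeta_growth[OF Z expZ ZD a(1)] by blast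
  define f where "f = (\<lambda>s. Z s * h s)"
  have fhol: "f holomorphic_on {s. a \<le> Re s \<and> Re s \<le> c}"
    unfolding f_def h_def
    by (rule holomorphic_on_mult[OF holomorphic_on_subset[OF Z] on_line_holomorphic]) (use a in auto)
  have fdec: "decays_on {s. a \<le> Re s \<and> Re s \<le> c} f"
    unfolding f_def by (rule decays_on_mult[OF p(1), where K = K and C = C]) (use C K c in auto)
  have "set_integrable lborel UNIV (\<lambda>y. f (Complex a y))"
    using c by (intro decays_on_line_integrable[OF fdec] continuous_on_vertical[OF fhol]) auto
  then have fa_int: "integrable lborel (\<lambda>y. f (Complex a y))" by (simp add: set_integrable_def)
  have shift: "(LINT y|lborel. f (Complex a y)) = (LINT y|lborel. f (Complex c y))"
    by (rule strip_integral[OF fhol fdec c(1)])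
  define D where "D = (LINT y|lborel. log_zeta (Complex c y) * h (Complex c y))"
  define Q where "Q = (LINT y|lborel. pole_log (Complex c y) * h (Complex c y))"
  have D1: "(\<lambda>n. of_real (log_coeff n) * (of_nat n powr (- Complex a t) * fourier \<Phi> (ln (real n) / \<tau>) / of_real \<tau>)) sums D"
    unfolding D_def h_def by (rule integral_log_zeta(2)[OF \<tau>0]) (use a c in auto)
  have D2: "integrable lborel (\<lambda>y. log_zeta (Complex c y) * h (Complex c y))"
    unfolding h_def by (rule integral_log_zeta(1)[OF \<tau>0]) (use a c in auto)
  note D = D1 D2
  have "d \<le> 1" using d by simp
  have a0: "0 < a" using a by simp
  note Q_facts = integral_pole_log[OF \<tau>0 a0 c(1,2,3) d(1) c(5) \<open>d \<le> 1\<close> S'[unfolded h_def], folded h_def]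
  have fc: "(LINT y|lborel. f (Complex c y)) = D + Q"
  proof -
    have "(LINT y|lborel. f (Complex c y)) = (LINT y|lborel. log_zeta (Complex c y) * h (Complex c y) + pole_log (Complex c y) * h (Complex c y))"
      unfolding f_def using c ZD by (intro Bochner_Integration.integral_cong) (auto simp: algebra_simps)
    also have "\<dots> = D + Q" unfolding D_def Q_def by (rule Bochner_Integration.integral_add[OF D(2) Q_facts(4)])
    finally show ?thesis .
  qed
  define V where "V = (\<lambda>y. Re (pole_log (Complex a y)) * w y)"
  have ReV: "Re (pole_log (Complex a y) * h (Complex a y)) = V y" for y by (simp add: V_def w_eq)
  have nz: "Complex a y \<noteq> 1" "Complex a y \<noteq> - 1" "Complex a y - 1 \<noteq> 0" "Complex a y + 1 \<noteq> 0" for y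
    using a by (auto simp: complex_eq_iff)
  have U_eq: "ln (cmod (zeta (Complex a y))) * w y = Re (f (Complex a y)) - V y" for y
  proof -
    have ha: "1 / 2 < Re (Complex a y)" using a by simp
    have x0: "xzeta (Complex a y) \<noteq> 0" by (rule xzeta_nonzero[OF RH ha])
    have x: "xzeta (Complex a y) = (Complex a y - 1) * zeta (Complex a y)"
      using nz a by (intro xzeta_eq) auto
    then have z0: "zeta (Complex a y) \<noteq> 0" using x0 by auto
    have "Re (Z (Complex a y)) = ln (cmod (exp (Z (Complex a y))))" by simp
    also have "exp (Z (Complex a y)) = (Complex a y - 1) / (Complex a y + 1) * zeta (Complex a y)"
      using expZ[OF ha] x by simp
    also have "ln (cmod \<dots>) = ln (cmod ((Complex a y - 1) / (Complex a y + 1))) + ln (cmod (zeta (Complex a y)))"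
      unfolding norm_mult using nz z0 by (intro ln_mult_pos) auto
    also have "ln (cmod ((Complex a y - 1) / (Complex a y + 1))) = Re (pole_log (Complex a y))"
      unfolding pole_log_def using nz by simp
    finally show ?thesis by (simp add: f_def V_def w_eq algebra_simps)
  qed
  have [measurable]: "(\<lambda>y. Complex a y) \<in> borel_measurable borel" unfolding Complex_eq by measurable
  have [measurable]: "w \<in> borel_measurable borel" unfolding w_def by measurable
  have Vmeas: "V \<in> borel_measurable borel"
  proof -
    have "Re (pole_log (Complex a y)) = ln (cmod ((Complex a y - 1) / (Complex a y + 1)))" for y
      unfolding pole_log_def using nz by simp
    then show ?thesis unfolding V_def by simp
  qed
  \<comment> \<open>Here a <= 3/4 keeps the segment at distance 1/4 from the pole, and 12 = 3 /
    (1/4).\<close>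
  have Vmid: "\<bar>V y\<bar> \<le> (ln 12 + pi) * S" if "\<bar>y\<bar> \<le> 1" for y
  proof -
    have "1 / 4 \<le> cmod (Complex a y - 1)" using a abs_Re_le_cmod[of "Complex a y - 1"] by simp
    then have "cmod (pole_log (Complex a y)) \<le> ln (3 / (1 / 4)) + pi" using a by (intro pole_log_bound) auto
    then have "\<bar>Re (pole_log (Complex a y))\<bar> \<le> ln 12 + pi" using abs_Re_le_cmod order_trans by fastforce
    moreover have "\<bar>w y\<bar> \<le> S" using S'[of a y] that c w_eq[of y] by simp
    ultimately show ?thesis unfolding V_def abs_mult by (intro mult_mono) auto
  qed
  have V_on: "set_integrable lborel A V" if "set_integrable lborel A (\<lambda>y. pole_log (Complex a y) * h (Complex a y))" for A
    using integrable_Re[OF that[unfolded set_integrable_def]] unfolding set_integrable_def ReV[symmetric] by simp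
  have V1: "set_integrable lborel {..<- 1} V" "set_integrable lborel {1..} V"
    using V_on[OF Q_facts(1)] V_on[OF Q_facts(2)] by auto
  have cst: "integrable lborel (\<lambda>y. indicator {-1..1::real} y * ((ln 12 + pi) * S))"
    by (intro integrable_mult_left integrable_indicator_Icc)
  have Vb: "norm (indicator {- 1..<1} y *\<^sub>R V y) \<le> indicator {-1..1::real} y * ((ln 12 + pi) * S)" for y
    using Vmid[of y] S0 by (auto simp: indicator_def add_nonneg_nonneg)
  have V2: "set_integrable lborel {- 1..<1} V"
    unfolding set_integrable_def
  proof (rule Bochner_Integration.integrable_bound[OF cst])
    show "AE y in lborel. norm (indicator {- 1..<1} y *\<^sub>R V y) \<le> norm (indicator {-1..1::real} y * ((ln 12 + pi) * S))"
    proof (intro always_eventually allI)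
      fix y
      show "norm (indicator {- 1..<1} y *\<^sub>R V y) \<le> norm (indicator {-1..1::real} y * ((ln 12 + pi) * S))"
        unfolding real_norm_def[of "indicator {-1..1::real} y * ((ln 12 + pi) * S)"]
        by (rule order_trans[OF Vb abs_ge_self])
    qed
  qed (use Vmeas in simp)
  have U: "{..<- 1} \<union> ({- 1..<1} \<union> {1..}) = (UNIV :: real set)" by auto
  have "set_integrable lborel ({..<- 1} \<union> ({- 1..<1} \<union> {1..})) V"
    by (intro set_integrable_Un V1 V2) auto
  then have Vint: "integrable lborel V" unfolding U by (simp add: set_integrable_def)
  have Vsplit: "(LINT y|lborel. V y) = (LINT y:{..<- 1}|lborel. V y) + ((LINT y:{- 1..<1}|lborel. V y) + (LINT y:{1..}|lborel. V y))"
  proof -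
    have "(LINT y|lborel. V y) = (LINT y:{..<- 1} \<union> ({- 1..<1} \<union> {1..})|lborel. V y)"
      unfolding U by (simp add: set_lebesgue_integral_def)
    also have "\<dots> = (LINT y:{..<- 1}|lborel. V y) + (LINT y:{- 1..<1} \<union> {1..}|lborel. V y)"
      by (intro set_integral_Un set_integrable_Un V1 V2) auto
    also have "(LINT y:{- 1..<1} \<union> {1..}|lborel. V y) = (LINT y:{- 1..<1}|lborel. V y) + (LINT y:{1..}|lborel. V y)"
      by (intro set_integral_Un V1 V2) auto
    finally show ?thesis .
  qed
  have ReA: "(LINT y:A|lborel. V y) = Re (LINT y:A|lborel. pole_log (Complex a y) * h (Complex a y))"
    if "set_integrable lborel A (\<lambda>y. pole_log (Complex a y) * h (Complex a y))" for A
  proof -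
    have "(LINT y:A|lborel. V y) = (LINT y|lborel. Re (indicator A y *\<^sub>R (pole_log (Complex a y) * h (Complex a y))))"
      unfolding set_lebesgue_integral_def ReV[symmetric] by simp
    also have "\<dots> = Re (LINT y:A|lborel. pole_log (Complex a y) * h (Complex a y))"
      using that unfolding set_lebesgue_integral_def set_integrable_def by (rule integral_Re)
    finally show ?thesis .
  qed
  have U_int: "integrable lborel (\<lambda>y. ln (cmod (zeta (Complex a y))) * w y)"
    unfolding U_eq using fa_int Vint by (intro Bochner_Integration.integrable_diff) auto
  have "(LINT y|lborel. ln (cmod (zeta (Complex a y))) * w y) = Re (D + Q) - (LINT y|lborel. V y)"
    unfolding U_eq fc[symmetric] shift[symmetric] using fa_int Vint
    by (subst Bochner_Integration.integral_diff) (auto simp: integral_Re)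
  also have "\<dots> = Re D + Re (Q - (LINT y:{..<- 1}|lborel. pole_log (Complex a y) * h (Complex a y)) -
      (LINT y:{1..}|lborel. pole_log (Complex a y) * h (Complex a y))) - (LINT y:{- 1..<1}|lborel. V y)"
    using ReA[OF Q_facts(1)] ReA[OF Q_facts(2)] Vsplit by simp
  finally have "\<bar>(LINT y|lborel. ln (cmod (zeta (Complex a y))) * w y) - Re D\<bar> \<le>
      cmod (Q - (LINT y:{..<- 1}|lborel. pole_log (Complex a y) * h (Complex a y)) -
      (LINT y:{1..}|lborel. pole_log (Complex a y) * h (Complex a y))) + \<bar>LINT y:{- 1..<1}|lborel. V y\<bar>"
    using abs_Re_le_cmod[of "Q - (LINT y:{..<- 1}|lborel. pole_log (Complex a y) * h (Complex a y)) -
      (LINT y:{1..}|lborel. pole_log (Complex a y) * h (Complex a y))"] by linarith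
  also have "\<dots> \<le> (2 * (ln (3 / d) + pi) * S + 2 * (ln 3 + pi) * S) + 2 * (ln 12 + pi) * S"
  proof (intro add_mono)
    show "cmod (Q - (LINT y:{..<- 1}|lborel. pole_log (Complex a y) * h (Complex a y)) -
      (LINT y:{1..}|lborel. pole_log (Complex a y) * h (Complex a y))) \<le> 2 * (ln (3 / d) + pi) * S + 2 * (ln 3 + pi) * S"
      unfolding Q_def by (rule Q_facts(3))
    have "norm (LINT y:{- 1..<1}|lborel. V y) \<le> (LINT y|lborel. indicator {-1..1::real} y * ((ln 12 + pi) * S))"
      unfolding set_lebesgue_integral_def by (rule norm_integral_le[OF cst Vb])
    then show "\<bar>LINT y:{- 1..<1}|lborel. V y\<bar> \<le> 2 * (ln 12 + pi) * S" by (simp add: algebra_simps)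
  qed
  also have "\<dots> = (2 * (ln (6 * \<tau>) + pi) + 2 * (ln 3 + pi) + 2 * (ln 12 + pi)) * S"
    by (simp add: d_def algebra_simps)
  also have "\<dots> \<le> (100 * \<tau>) * S"
  proof (intro mult_right_mono S0)
    have "ln (6 * \<tau>) \<le> 6 * \<tau> - 1" using \<tau> by (intro ln_le_minus_one) auto
    moreover have "ln (3::real) \<le> 2" "ln (12::real) \<le> 11" using ln_le_minus_one[of "3::real"] ln_le_minus_one[of "12::real"] by auto
    moreover have "2 * (A + p) + 2 * (B + p) + 2 * (E + p) \<le> 100 * x"
      if "A \<le> 6 * x - 1" "B \<le> 2" "E \<le> 11" "p < 4" "1 \<le> x" for A B E p x :: real
      using that by argo
    ultimately show "2 * (ln (6 * \<tau>) + pi) + 2 * (ln 3 + pi) + 2 * (ln 12 + pi) \<le> 100 * \<tau>"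
      using pi_less_4 \<tau> by blast
  qed
  finally show thesis using that D(1) U_int by (simp add: w_def)
qed

end

section \<open>Upper bound for the Dirichlet polynomial\<close>

lemma sum_powr_le:
  obtains K where "K > 0" "\<And>\<tau>. 1 \<le> \<tau> \<Longrightarrow> (\<Sum>n. real n powr (- (1 + 1 / \<tau>))) \<le> K * \<tau>"
proof -
  obtain K where K: "K > 0" "\<And>s. 1 / 2 \<le> Re s \<Longrightarrow> cmod (xzeta s - 1) \<le> K * cmod (s - 1) * cmod s"
    using xzeta_bound by blast
  show thesis
  proof (rule that[of "1 + 2 * K"])
    fix \<tau> :: real assume \<tau>: "1 \<le> \<tau>"
    define x where "x = 1 + 1 / \<tau>"
    have x: "1 < x" "x \<le> 2" "x - 1 = 1 / \<tau>" using \<tau> by (auto simp: x_def)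
    have "(\<lambda>n. of_nat n powr (- of_real x)) sums zeta (of_real x)"
      using x by (intro zeta_sums_0) simp
    then have "(\<lambda>n. Re (of_nat n powr (- of_real x))) sums Re (zeta (of_real x))" by (rule sums_Re)
    moreover have "Re (of_nat n powr (- of_real x)) = real n powr (- x)" for n
      using powr_of_real[of "real n" "- x"] by simp
    ultimately have "(\<Sum>n. real n powr (- x)) = Re (zeta (of_real x))" by (simp add: sums_iff)
    also have "\<dots> \<le> cmod (zeta (of_real x))" by (rule complex_Re_le_cmod)
    \<comment> \<open>The sum is \<open>zeta\<close> at 1 + 1/\<tau>; the simple pole at 1 accounts
      for the factor \<tau>, and \<open>xzeta\<close> is bounded on [1, 2].\<close>
    also have "\<dots> = \<tau> * cmod (xzeta (of_real x))"
    proof -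
      have "of_real x - 1 = (of_real (1 / \<tau>) :: complex)" unfolding x(3)[symmetric] by simp
      then have "xzeta (of_real x) = of_real (1 / \<tau>) * zeta (of_real x)" using x by (subst xzeta_eq_halfplane) auto
      then show ?thesis using \<tau> by (simp add: norm_divide)
    qed
    also have "cmod (xzeta (of_real x)) \<le> 1 + cmod (xzeta (of_real x) - 1)"
      using norm_triangle_ineq[of 1 "xzeta (of_real x) - 1"] by simp
    also have "cmod (xzeta (of_real x) - 1) \<le> K * cmod (of_real x - 1) * cmod (of_real x)"
      using x by (intro K(2)) auto
    also have "cmod (of_real x - 1) = 1 / \<tau>"
    proof -
      have "of_real x - 1 = (of_real (1 / \<tau>) :: complex)" unfolding x(3)[symmetric] by simp
      then show ?thesis using \<tau> by (simp add: norm_divide)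
    qed
    also have "K * (1 / \<tau>) * cmod (of_real x) \<le> K * 1 * 2"
      using x \<tau> K(1) by (intro mult_mono) auto
    finally show "(\<Sum>n. real n powr (- (1 + 1 / \<tau>))) \<le> (1 + 2 * K) * \<tau>"
      using \<tau> by (simp add: x_def mult_ac)
  qed (use K(1) in auto)
qed

text \<open>From t <= T + H and H <= |y - t| follows |y| <= T + 2 |y - t|, which separates the bound
  into ln T, to be paired with the tail of \<Phi>, and a part linear in |y - t|, to be paired with
  its first moment.\<close>

lemma ln_zeta_le:
  obtains C where "C \<ge> 0" "\<And>a y t T H. \<lbrakk>1 / 2 \<le> a; a \<le> 3 / 4; 1 \<le> T; T \<le> t; t \<le> T + H; H \<le> \<bar>y - t\<bar>\<rbrakk> \<Longrightarrow>
     ln (cmod (zeta (Complex a y))) \<le> C * (1 + \<bar>y - t\<bar>) + ln T"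
proof -
  obtain C where C: "C \<ge> 1" "\<And>s. 1 / 2 \<le> Re s \<Longrightarrow> Re s \<le> 3 / 4 \<Longrightarrow> cmod (zeta s) \<le> C * (1 + \<bar>Im s\<bar>)"
    using zeta_bound_near_line by blast
  show thesis
  proof (rule that[of "ln C + 2"])
    fix a y t T H :: real
    assume a: "1 / 2 \<le> a" "a \<le> 3 / 4" and T: "1 \<le> T" "T \<le> t" "t \<le> T + H" and H: "H \<le> \<bar>y - t\<bar>"
    have lnC: "0 \<le> ln C" using C(1) by simp
    have "ln (cmod (zeta (Complex a y))) \<le> ln C + ln T + (1 + 2 * \<bar>y - t\<bar>)"
    proof (cases "zeta (Complex a y) = 0")
      case True
      then show ?thesis using lnC T by simp
    next
      case False
      have "cmod (zeta (Complex a y)) \<le> C * (1 + \<bar>y\<bar>)" using C(2)[of "Complex a y"] a by simp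
      also have "\<bar>y\<bar> \<le> T + 2 * \<bar>y - t\<bar>" using abs_triangle_ineq[of t "y - t"] T H by simp
      also have "1 + (T + 2 * \<bar>y - t\<bar>) \<le> T * (2 + 2 * \<bar>y - t\<bar>)"
        using T mult_right_mono[OF T(1), of "2 * \<bar>y - t\<bar>"] by (simp add: algebra_simps)
      finally have "cmod (zeta (Complex a y)) \<le> C * (T * (2 + 2 * \<bar>y - t\<bar>))" using C(1) by simp
      then have "ln (cmod (zeta (Complex a y))) \<le> ln (C * (T * (2 + 2 * \<bar>y - t\<bar>)))"
        using False by (intro ln_mono) auto
      also have "\<dots> = ln C + (ln T + ln (2 + 2 * \<bar>y - t\<bar>))"
      proof -
        have p: "0 < C" "0 < T" "0 < 2 + 2 * \<bar>y - t\<bar>" using C(1) T by (auto simp: add_pos_nonneg)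
        show ?thesis by (simp only: ln_mult_pos[OF p(1) mult_pos_pos[OF p(2,3)]] ln_mult_pos[OF p(2,3)])
      qed
      also have "ln (2 + 2 * \<bar>y - t\<bar>) \<le> (2 + 2 * \<bar>y - t\<bar>) - 1"
        by (intro ln_le_minus_one add_pos_nonneg) auto
      finally show ?thesis by simp
    qed
    also have "\<dots> \<le> (ln C + 2) * (1 + \<bar>y - t\<bar>) + ln T" using lnC by (simp add: algebra_simps)
    finally show "ln (cmod (zeta (Complex a y))) \<le> (ln C + 2) * (1 + \<bar>y - t\<bar>) + ln T" .
  qed (use C(1) in auto)
qed

context entire_kernel
begin

text \<open>The upper half of the argument, with C independent of \<tau>, H, T, t, L and \<mu>. For
  |y - t| < H the point y lies in [T - H, T + 2H], where ln |zeta| <= \<mu> + 1; further out the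
  crude bound \<open>ln_zeta_le\<close> applies, its ln T being compensated by the tail of \<Phi>.
  The mean is, up to the error of \<open>convolution_formula\<close>, the real part of the Dirichlet
  series, whose terms beyond exp (\<tau> L) sum to O(\<tau>).\<close>

lemma dirichlet_polynomial_upper_bound:
  assumes RH: riemann_hypothesis and pos: "\<forall>u::real. \<Phi> (of_real u) \<in> \<real>\<^sub>\<ge>\<^sub>0" and K1: "0 \<le> K1"
  obtains C where "C > 0" "\<And>\<tau> H T t L \<mu> \<epsilon>0. \<lbrakk>1 \<le> \<tau>; 4 \<le> H; 1 \<le> T; T + H / 2 \<le> t; t \<le> T + H; 0 \<le> L;
     \<forall>l. L \<le> \<bar>l\<bar> \<longrightarrow> cmod (fourier \<Phi> l) \<le> exp (- (\<bar>l\<bar> * (\<tau> / 2 + 1)));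
     exp (L * (\<tau> / 2 + 1 / 2)) * (1 + L) \<le> \<tau> * (H / 2 - 1);
     ln T * (LINT v|lborel. indicator {v. \<tau> * H \<le> \<bar>v\<bar>} v * cmod (\<Phi> (of_real v))) \<le> K1;
     0 \<le> \<mu>; 0 < \<epsilon>0;
     \<And>\<epsilon> v. 0 < \<epsilon> \<Longrightarrow> \<epsilon> < \<epsilon>0 \<Longrightarrow> T - H \<le> v \<Longrightarrow> v \<le> T + 2 * H \<Longrightarrow> cmod (zeta (Complex (1 / 2 + \<epsilon>) v)) \<le> exp (\<mu> + 1)\<rbrakk>
   \<Longrightarrow> (\<Sum>n<Suc (nat \<lfloor>exp (\<tau> * L)\<rfloor>). log_coeff n * Re (of_nat n powr (- Complex (1 / 2) t) * fourier \<Phi> (ln (real n) / \<tau>)))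
       \<le> Re (fourier \<Phi> 0) * \<mu> + C * \<tau>\<^sup>2"
proof -
  obtain C1 where C1: "C1 > 0" "\<And>L Y x \<eta>. \<lbrakk>0 \<le> L; \<bar>\<eta>\<bar> \<le> Y; x \<noteq> 0;
      \<forall>l. L \<le> \<bar>l\<bar> \<longrightarrow> cmod (fourier \<Phi> l) \<le> exp (- (\<bar>l\<bar> * (Y + 1 / 2)))\<rbrakk>
    \<Longrightarrow> cmod (\<Phi> (Complex x \<eta>)) \<le> C1 * (1 + exp (L * Y) * (1 + L) / \<bar>x\<bar>)"
    using kernel_off_axis_bound by blast
  obtain K where K: "K > 0" "\<And>\<tau>. 1 \<le> \<tau> \<Longrightarrow> (\<Sum>n. real n powr (- (1 + 1 / \<tau>))) \<le> K * \<tau>"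
    using sum_powr_le by blast
  obtain C2 where C2: "C2 \<ge> 0" "\<And>a y t T H. \<lbrakk>1 / 2 \<le> a; a \<le> 3 / 4; 1 \<le> T; T \<le> t; t \<le> T + H; H \<le> \<bar>y - t\<bar>\<rbrakk> \<Longrightarrow>
     ln (cmod (zeta (Complex a y))) \<le> C2 * (1 + \<bar>y - t\<bar>) + ln T"
    using ln_zeta_le by blast
  define M where "M = (LINT u|lborel. (1 + \<bar>u\<bar>) * cmod (\<Phi> (of_real u)))"
  define m where "m = Re (fourier \<Phi> 0)"
  have Phi_eq: "\<Phi> (of_real u) = of_real (cmod (\<Phi> (of_real u)))" for u
    using pos[rule_format, of u] by (auto elim!: nonneg_Reals_cases)
  have Phi_Re: "Re (\<Phi> (of_real u)) = cmod (\<Phi> (of_real u))" for u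
    using arg_cong[OF Phi_eq[of u], of Re] by simp
  have m_eq: "m = (LINT u|lborel. cmod (\<Phi> (of_real u)))"
    unfolding m_def fourier_def Phi_Re[symmetric] by (simp add: integral_Re[OF kernel_integrable])
  have nint: "integrable lborel (\<lambda>u. cmod (\<Phi> (of_real u)))" using integrable_norm[OF kernel_integrable] .
  have m0: "0 \<le> m" unfolding m_eq by (intro integral_nonneg_AE) auto
  have M0: "0 \<le> M" unfolding M_def by (intro integral_nonneg_AE) auto
  define C where "C = m + C2 * M + K1 + 200 * C1 + K"
  have C0: "C > 0" using m0 M0 K1 C2(1) C1(1) K(1) by (simp add: C_def add_nonneg_pos add_pos_nonneg)
  have main: "(\<Sum>n<Suc (nat \<lfloor>exp (\<tau> * L)\<rfloor>). log_coeff n * Re (of_nat n powr (- Complex (1 / 2) t) * fourier \<Phi> (ln (real n) / \<tau>)))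
       \<le> m * \<mu> + C * \<tau>\<^sup>2"
    if \<tau>: "1 \<le> \<tau>" and H: "4 \<le> H" and T: "1 \<le> T" and t: "T + H / 2 \<le> t" "t \<le> T + H" and L: "0 \<le> L"
      and tail: "\<forall>l. L \<le> \<bar>l\<bar> \<longrightarrow> cmod (fourier \<Phi> l) \<le> exp (- (\<bar>l\<bar> * (\<tau> / 2 + 1)))"
      and size: "exp (L * (\<tau> / 2 + 1 / 2)) * (1 + L) \<le> \<tau> * (H / 2 - 1)"
      and decay: "ln T * (LINT v|lborel. indicator {v. \<tau> * H \<le> \<bar>v\<bar>} v * cmod (\<Phi> (of_real v))) \<le> K1"
      and \<mu>: "0 \<le> \<mu>" and \<epsilon>0: "0 < \<epsilon>0"
      and zb: "\<And>\<epsilon> v. 0 < \<epsilon> \<Longrightarrow> \<epsilon> < \<epsilon>0 \<Longrightarrow> T - H \<le> v \<Longrightarrow> v \<le> T + 2 * H \<Longrightarrow> cmod (zeta (Complex (1 / 2 + \<epsilon>) v)) \<le> exp (\<mu> + 1)"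
    for \<tau> H T t L \<mu> \<epsilon>0
  proof -
    define N where "N = Suc (nat \<lfloor>exp (\<tau> * L)\<rfloor>)"
    define V where "V = (\<lambda>a. \<Sum>n<N. log_coeff n * Re (of_nat n powr (- Complex a t) * fourier \<Phi> (ln (real n) / \<tau>)))"
    have \<tau>0: "0 < \<tau>" using \<tau> by simp
    \<comment> \<open>The size hypothesis makes the second term of the off-axis bound at most 1,
      since t - 1 is at least H/2 and hence |x| is large.\<close>
    have Sb: "cmod (\<Phi> (Complex x \<eta>)) \<le> 2 * C1" if x: "\<tau> * (t - 1) \<le> \<bar>x\<bar>" and \<eta>: "\<bar>\<eta>\<bar> \<le> \<tau> / 2 + 1 / 2" for x \<eta>
    proof -
      have "\<tau> * (H / 2 - 1) \<le> \<tau> * (t - 1)" using t T \<tau> by (intro mult_left_mono) auto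
      then have x1: "\<tau> * (H / 2 - 1) \<le> \<bar>x\<bar>" using x by linarith
      have "0 < \<tau> * (H / 2 - 1)" using \<tau> H by simp
      then have x0: "x \<noteq> 0" using x1 by auto
      have tail': "\<forall>l. L \<le> \<bar>l\<bar> \<longrightarrow> cmod (fourier \<Phi> l) \<le> exp (- (\<bar>l\<bar> * (\<tau> / 2 + 1 / 2 + 1 / 2)))"
        using tail by (simp add: add.assoc)
      have "exp (L * (\<tau> / 2 + 1 / 2)) * (1 + L) / \<bar>x\<bar> \<le> 1" using size x1 x0 by (simp add: divide_le_eq)
      then have "C1 * (1 + exp (L * (\<tau> / 2 + 1 / 2)) * (1 + L) / \<bar>x\<bar>) \<le> C1 * (1 + 1)"
        using C1(1) by (intro mult_left_mono) auto
      then show ?thesis using C1(2)[OF L \<eta> x0 tail'] by simp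
    qed
    have step: "V (1 / 2 + \<epsilon>) \<le> m * \<mu> + C * \<tau>\<^sup>2" if e: "0 < \<epsilon>" "\<epsilon> < \<epsilon>0" "\<epsilon> \<le> 1 / 4" for \<epsilon>
    proof -
      define a where "a = 1 / 2 + \<epsilon>"
      have a: "1 / 2 < a" "a \<le> 3 / 4" using e by (auto simp: a_def)
      have "1 \<le> t" using t T H by linarith
      from convolution_formula[OF RH pos \<tau> a this Sb]
      obtain D where D: "(\<lambda>n. of_real (log_coeff n) * (of_nat n powr (- Complex a t) * fourier \<Phi> (ln (real n) / \<tau>) / of_real \<tau>)) sums D"
        and Uint: "integrable lborel (\<lambda>y. ln (cmod (zeta (Complex a y))) * Re (\<Phi> (of_real (\<tau> * (y - t)))))"
        and diff: "\<bar>(LINT y|lborel. ln (cmod (zeta (Complex a y))) * Re (\<Phi> (of_real (\<tau> * (y - t))))) - Re D\<bar> \<le> 100 * \<tau> * (2 * C1)"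
        by blast
      \<comment> \<open>A majorant for ln |zeta| times the kernel in the scaled variable; its three
        parts integrate to (\<mu> + 1) m, to C2 times the first moment, and to the quantity bounded
        by K1.\<close>
      define R where "R = (\<lambda>u. (\<mu> + 1) * cmod (\<Phi> (of_real u)) + C2 * ((1 + \<bar>u\<bar>) * cmod (\<Phi> (of_real u))) +
          ln T * (indicator {v. \<tau> * H \<le> \<bar>v\<bar>} u * cmod (\<Phi> (of_real u))))"
      have ind_int: "integrable lborel (\<lambda>u. indicator {v. \<tau> * H \<le> \<bar>v\<bar>} u * cmod (\<Phi> (of_real u)))"
        by (rule Bochner_Integration.integrable_bound[OF nint]) (auto simp: indicator_def)
      have Rint: "integrable lborel R" unfolding R_def
        using moment nint ind_int by (intro Bochner_Integration.integrable_add integrable_mult_right) auto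
      have R_val: "(LINT u|lborel. R u) \<le> (\<mu> + 1) * m + C2 * M + K1"
      proof -
        have "(LINT u|lborel. R u) = (\<mu> + 1) * m + C2 * M + ln T * (LINT v|lborel. indicator {v. \<tau> * H \<le> \<bar>v\<bar>} v * cmod (\<Phi> (of_real v)))"
          unfolding R_def M_def m_eq using moment nint ind_int
          by (subst Bochner_Integration.integral_add) auto
        then show ?thesis using decay by simp
      qed
      have "(LINT y|lborel. ln (cmod (zeta (Complex a y))) * Re (\<Phi> (of_real (\<tau> * (y - t))))) \<le> (LINT y|lborel. R (- \<tau> * t + \<tau> * y))"
      proof (rule integral_mono[OF Uint lborel_integrable_real_affine[OF Rint]])
        fix y
        define z where "z = \<bar>y - t\<bar>"
        define P where "P = cmod (\<Phi> (of_real (\<tau> * (y - t))))"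
        have arg: "- \<tau> * t + \<tau> * y = \<tau> * (y - t)" by (simp add: algebra_simps)
        have abs: "\<bar>\<tau> * (y - t)\<bar> = \<tau> * z" using \<tau> by (simp add: z_def abs_mult)
        have lnz: "ln (cmod (zeta (Complex a y))) \<le> (\<mu> + 1) + C2 * (1 + \<tau> * z) + ln T * indicator {v. \<tau> * H \<le> \<bar>v\<bar>} (\<tau> * (y - t))"
        proof (cases "H \<le> z")
          case True
          have "ln (cmod (zeta (Complex a y))) \<le> C2 * (1 + z) + ln T"
            unfolding z_def using a T t H True by (intro C2(2)) (auto simp: z_def)
          also have "C2 * (1 + z) \<le> C2 * (1 + \<tau> * z)"
            using C2(1) \<tau> by (intro mult_left_mono add_left_mono) (auto simp: z_def mult_le_cancel_right1)
          finally show ?thesis using True \<mu> \<tau> abs by (simp add: indicator_def mult_left_mono)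
        next
          case False
          then have "T - H \<le> y" "y \<le> T + 2 * H" using t by (auto simp: z_def)
          then have "cmod (zeta (Complex a y)) \<le> exp (\<mu> + 1)" unfolding a_def using e by (intro zb) auto
          then have "ln (cmod (zeta (Complex a y))) \<le> \<mu> + 1"
          proof (cases "zeta (Complex a y) = 0")
            case nz: False
            assume "cmod (zeta (Complex a y)) \<le> exp (\<mu> + 1)"
            then have "ln (cmod (zeta (Complex a y))) \<le> ln (exp (\<mu> + 1))" using nz by (intro ln_mono) auto
            then show ?thesis by simp
          qed (use \<mu> in auto)
          moreover have "0 \<le> C2 * (1 + \<tau> * z)" using C2(1) \<tau> by (simp add: z_def)
          moreover have "0 \<le> ln T * indicator {v. \<tau> * H \<le> \<bar>v\<bar>} (\<tau> * (y - t))" using T by (simp add: indicator_def)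
          ultimately show ?thesis by linarith
        qed
        have "ln (cmod (zeta (Complex a y))) * P \<le> ((\<mu> + 1) + C2 * (1 + \<tau> * z) + ln T * indicator {v. \<tau> * H \<le> \<bar>v\<bar>} (\<tau> * (y - t))) * P"
          using lnz by (intro mult_right_mono) (auto simp: P_def)
        also have "\<dots> = R (\<tau> * (y - t))" unfolding R_def abs P_def by (simp add: algebra_simps)
        finally show "ln (cmod (zeta (Complex a y))) * Re (\<Phi> (of_real (\<tau> * (y - t)))) \<le> R (- \<tau> * t + \<tau> * y)"
          unfolding arg Phi_Re P_def .
      qed (use \<tau> in auto)
      also have "\<dots> = (LINT u|lborel. R u) / \<tau>"
        using lborel_integral_real_affine[of \<tau> R "- \<tau> * t"] \<tau> by (simp add: field_simps)
      also have "\<dots> \<le> ((\<mu> + 1) * m + C2 * M + K1) / \<tau>" using R_val \<tau> by (intro divide_right_mono) auto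
      finally have "Re D \<le> ((\<mu> + 1) * m + C2 * M + K1) / \<tau> + 100 * \<tau> * (2 * C1)" using diff by linarith
      then have "\<tau> * Re D \<le> \<tau> * (((\<mu> + 1) * m + C2 * M + K1) / \<tau> + 100 * \<tau> * (2 * C1))" using \<tau> by (intro mult_left_mono) auto
      also have "\<dots> = (\<mu> + 1) * m + C2 * M + K1 + 200 * C1 * \<tau>\<^sup>2"
      proof -
        have "\<tau> * (X / \<tau> + 100 * \<tau> * (2 * C1)) = X + 200 * C1 * \<tau>\<^sup>2" for X
          using \<tau> by (simp add: field_simps power2_eq_square)
        then show ?thesis .
      qed
      finally have ReD: "\<tau> * Re D \<le> (\<mu> + 1) * m + C2 * M + K1 + 200 * C1 * \<tau>\<^sup>2" .
      define b where "b = (\<lambda>n. log_coeff n * Re (of_nat n powr (- Complex a t) * fourier \<Phi> (ln (real n) / \<tau>)))"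
      have bsums: "b sums (\<tau> * Re D)"
      proof -
        have "(\<lambda>n. Re (of_real (log_coeff n) * (of_nat n powr (- Complex a t) * fourier \<Phi> (ln (real n) / \<tau>) / of_real \<tau>))) sums Re D"
          by (rule sums_Re[OF D])
        from sums_mult[OF this, of \<tau>] show ?thesis using \<tau> by (simp add: b_def)
      qed
      have psum: "summable (\<lambda>n. real n powr (- (1 + 1 / \<tau>)))" using \<tau> by (intro summable_powr_minus) simp
      \<comment> \<open>At frequency ln k / \<tau> the assumed decay at rate \<tau>/2 + 1 reads k
        powr (- (1/2 + 1/\<tau>)); together with k powr (- 1/2) this is just summable, with sum
        O(\<tau>).\<close>
      have tl: "\<bar>b (n + N)\<bar> \<le> real (n + N) powr (- (1 + 1 / \<tau>))" for n
      proof -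
        define k where "k = n + N"
        have "exp (\<tau> * L) \<le> real k" unfolding k_def N_def by linarith
        then have "ln (exp (\<tau> * L)) \<le> ln (real k)" by (intro ln_mono) auto
        then have Lk: "L \<le> ln (real k) / \<tau>" using \<tau> by (simp add: pos_le_divide_eq mult.commute)
        have k1: "1 \<le> k" by (simp add: k_def N_def)
        have "cmod (fourier \<Phi> (ln (real k) / \<tau>)) \<le> exp (- (\<bar>ln (real k) / \<tau>\<bar> * (\<tau> / 2 + 1)))"
          by (rule tail[rule_format, OF order_trans[OF Lk abs_ge_self]])
        also have "\<bar>ln (real k) / \<tau>\<bar> * (\<tau> / 2 + 1) = ln (real k) * (1 / 2 + 1 / \<tau>)"
          using \<tau> k1 by (simp add: field_simps)
        also have "exp (- (ln (real k) * (1 / 2 + 1 / \<tau>))) = real k powr (- (1 / 2 + 1 / \<tau>))"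
        proof -
          have "exp (- (ln (real k) * x)) = real k powr (- x)" for x
            using k1 by (simp add: powr_def mult.commute)
          then show ?thesis .
        qed
        finally have f: "cmod (fourier \<Phi> (ln (real k) / \<tau>)) \<le> real k powr (- (1 / 2 + 1 / \<tau>))" .
        have "\<bar>b k\<bar> \<le> log_coeff k * cmod (of_nat k powr (- Complex a t) * fourier \<Phi> (ln (real k) / \<tau>))"
          unfolding b_def abs_mult using log_coeff_nonneg[of k] by (intro mult_mono abs_Re_le_cmod) auto
        also have "\<dots> \<le> 1 * (real k powr (- (1 / 2)) * real k powr (- (1 / 2 + 1 / \<tau>)))"
          unfolding norm_mult norm_of_nat_powr using log_coeff_le_1 f a k1 by (intro mult_mono powr_mono) auto
        also have "\<dots> = real k powr (- (1 + 1 / \<tau>))" unfolding powr_add[symmetric] mult_1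
        proof -
          have "- (1 / 2) + - (1 / 2 + 1 / \<tau>) = - (1 + 1 / \<tau>)" by simp
          then show "real k powr (- (1 / 2) + - (1 / 2 + 1 / \<tau>)) = real k powr (- (1 + 1 / \<tau>))" by (simp only:)
        qed
        finally show ?thesis by (simp add: k_def)
      qed
      have "\<tau> * Re D = (\<Sum>n. b (n + N)) + sum b {..<N}"
        using suminf_split_initial_segment[of b N] bsums by (simp add: sums_iff)
      moreover have "\<bar>\<Sum>n. b (n + N)\<bar> \<le> K * \<tau>"
      proof -
        have "norm (\<Sum>n. b (n + N)) \<le> (\<Sum>n. real (n + N) powr (- (1 + 1 / \<tau>)))"
          by (rule norm_suminf_le) (use tl psum summable_iff_shift[of "\<lambda>n. real n powr (- (1 + 1 / \<tau>))" N] in auto)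
        also have "\<dots> \<le> (\<Sum>n. real n powr (- (1 + 1 / \<tau>)))"
        proof -
          have "0 \<le> (\<Sum>n<N. real n powr (- (1 + 1 / \<tau>)))" by (intro sum_nonneg) auto
          then show ?thesis using suminf_split_initial_segment[OF psum, of N] by linarith
        qed
        also have "\<dots> \<le> K * \<tau>" by (rule K(2)[OF \<tau>])
        finally show ?thesis by simp
      qed
      ultimately have "sum b {..<N} \<le> (\<mu> + 1) * m + C2 * M + K1 + 200 * C1 * \<tau>\<^sup>2 + K * \<tau>" using ReD by linarith
      also have "\<dots> \<le> m * \<mu> + C * \<tau>\<^sup>2"
      proof -
        have t2: "1 \<le> \<tau>\<^sup>2" "\<tau> \<le> \<tau>\<^sup>2" using \<tau> by (auto simp: power2_eq_square mult_le_cancel_left1 intro: order_trans[OF \<tau>])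
        have "(m + C2 * M + K1) * 1 \<le> (m + C2 * M + K1) * \<tau>\<^sup>2" using t2 m0 M0 K1 C2(1) by (intro mult_left_mono) auto
        moreover have "K * \<tau> \<le> K * \<tau>\<^sup>2" using t2 K(1) by simp
        ultimately show ?thesis by (simp add: C_def algebra_simps)
      qed
      finally show ?thesis by (simp add: V_def b_def a_def)
    qed
    \<comment> \<open>Only the finite sum V is carried to the critical line; its bound does not
      involve \<epsilon>.\<close>
    define e where "e = (\<lambda>k. min \<epsilon>0 (1 / 4) / real (k + 2))"
    have e: "0 < e k" "e k < \<epsilon>0" "e k \<le> 1 / 4" for k
    proof -
      show "0 < e k" using \<epsilon>0 by (simp add: e_def)
      have "min \<epsilon>0 (1 / 4) / real (k + 2) < min \<epsilon>0 (1 / 4)"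
      proof -
        have *: "q / r < q" if "0 < q" "1 < r" for q r :: real using that by (simp add: divide_less_eq)
        show ?thesis by (rule *) (use \<epsilon>0 in auto)
      qed
      then show "e k < \<epsilon>0" "e k \<le> 1 / 4" by (auto simp: e_def)
    qed
    have e_lim: "e \<longlonglongrightarrow> 0" unfolding e_def by real_asymp
    have "(\<lambda>k. V (1 / 2 + e k)) \<longlonglongrightarrow> V (1 / 2 + 0)"
      unfolding V_def
    proof (intro tendsto_sum tendsto_mult tendsto_const tendsto_Re)
      fix n
      show "(\<lambda>k. of_nat n powr (- Complex (1 / 2 + e k) t) :: complex) \<longlonglongrightarrow> of_nat n powr (- Complex (1 / 2 + 0) t)"
      proof (cases "n = 0")
        case False
        have "(\<lambda>k. - Complex (1 / 2 + e k) t) \<longlonglongrightarrow> - Complex (1 / 2 + 0) t"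
          unfolding Complex_eq by (intro tendsto_intros e_lim)
        then have "(\<lambda>k. exp (- Complex (1 / 2 + e k) t * Ln (of_nat n))) \<longlonglongrightarrow> exp (- Complex (1 / 2 + 0) t * Ln (of_nat n))"
          by (intro tendsto_exp tendsto_mult_right)
        moreover have "of_nat n powr z = exp (z * Ln (of_nat n))" for z :: complex
          using False by (simp add: powr_def)
        ultimately show ?thesis by (simp only:)
      qed simp
    qed
    then have "V (1 / 2 + 0) \<le> m * \<mu> + C * \<tau>\<^sup>2"
      by (rule LIMSEQ_le_const2) (use step[OF e] in auto)
    then show ?thesis by (simp add: V_def N_def)
  qed
  show thesis by (rule that[OF C0]) (rule main[unfolded m_def], assumption+)
qed

end

subsection \<open>The resonator\<close>

lemma integral_cos:
  fixes \<delta> A B :: real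
  assumes "A \<le> B"
  shows "(\<lambda>t. cos (t * \<delta>)) integrable_on {A..B}"
    and "\<delta> = 0 \<Longrightarrow> integral {A..B} (\<lambda>t. cos (t * \<delta>)) = B - A"
    and "\<delta> \<noteq> 0 \<Longrightarrow> \<bar>integral {A..B} (\<lambda>t. cos (t * \<delta>))\<bar> \<le> 2 / \<bar>\<delta>\<bar>"
proof -
  show "(\<lambda>t. cos (t * \<delta>)) integrable_on {A..B}"
    by (intro integrable_continuous_interval continuous_intros)
  show "integral {A..B} (\<lambda>t. cos (t * \<delta>)) = B - A" if "\<delta> = 0"
    using that assms by simp
  show "\<bar>integral {A..B} (\<lambda>t. cos (t * \<delta>))\<bar> \<le> 2 / \<bar>\<delta>\<bar>" if \<delta>: "\<delta> \<noteq> 0"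
  proof -
    have "((\<lambda>t. cos (t * \<delta>)) has_integral (sin (B * \<delta>) / \<delta> - sin (A * \<delta>) / \<delta>)) {A..B}"
    proof (rule fundamental_theorem_of_calculus[OF assms])
      fix t
      have "((\<lambda>t. sin (t * \<delta>) / \<delta>) has_real_derivative cos (t * \<delta>)) (at t within {A..B})"
        using \<delta> by (auto intro!: derivative_eq_intros)
      then show "((\<lambda>t. sin (t * \<delta>) / \<delta>) has_vector_derivative cos (t * \<delta>)) (at t within {A..B})"
        by (simp add: has_real_derivative_iff_has_vector_derivative)
    qed
    then have "integral {A..B} (\<lambda>t. cos (t * \<delta>)) = (sin (B * \<delta>) - sin (A * \<delta>)) / \<delta>"
      by (simp add: integral_unique diff_divide_distrib)
    moreover have "\<bar>sin (B * \<delta>) - sin (A * \<delta>)\<bar> \<le> 2"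
      using abs_triangle_ineq4[of "sin (B * \<delta>)" "sin (A * \<delta>)"] abs_sin_le_one[of "B * \<delta>"] abs_sin_le_one[of "A * \<delta>"] by linarith
    ultimately show ?thesis by (simp add: divide_right_mono)
  qed
qed

text \<open>The ratio of the smaller to the larger integer is at most 1 - 1/M. In
  \<open>resonance\<close> this spacing of frequencies bounds the off-diagonal integrals.\<close>

lemma abs_ln_ratio_ge:
  fixes a b :: nat
  assumes "0 < a" "0 < b" "a \<noteq> b" "real a \<le> M" "real b \<le> M"
  shows "1 / M \<le> \<bar>ln (real a) - ln (real b)\<bar>"
proof -
  have *: "1 / M \<le> ln (real b) - ln (real a)" if ab: "0 < a" "a < b" "real b \<le> M" for a b
  proof -
    have "1 / M \<le> 1 / real b" using ab by (intro divide_left_mono) auto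
    also have "real a / real b \<le> (real b - 1) / real b" using ab by (intro divide_right_mono) linarith+
    then have "1 / real b \<le> 1 - real a / real b" using ab by (simp add: diff_divide_distrib)
    also have "ln (real a / real b) \<le> real a / real b - 1" using ab by (intro ln_le_minus_one) auto
    then have "1 - real a / real b \<le> - ln (real a / real b)" by simp
    also have "\<dots> = ln (real b) - ln (real a)" using ab by (simp add: ln_div)
    finally show ?thesis .
  qed
  show ?thesis
    using *[of a b] *[of b a] assms by (cases "a < b") (auto simp: not_less)
qed

text \<open>The resonator is \<open>\<bar>\<Sum>I. r I * m_I powr (- \<i> t)\<bar>\<^sup>2\<close> with \<open>m_I = \<Prod>I\<close>, where \<open>I\<close> runs over the sets of
  \<open>k\<close> or \<open>k + 1\<close> primes of \<open>Q\<close>.  Since \<open>V\<close> has its frequencies at logarithms of prime powers,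
  its mean against the resonator comes from the pairs \<open>(I, insert p I)\<close>.\<close>

lemma resonance:
  fixes Q :: "nat set" and w \<beta> :: "nat \<Rightarrow> real" and k N :: nat
  assumes finQ: "finite Q" and Q: "\<And>p. p \<in> Q \<Longrightarrow> prime p \<and> real p \<le> y \<and> p < N"
    and w: "\<And>p. p \<in> Q \<Longrightarrow> 0 < w p \<and> (w p)\<^sup>2 \<le> W" and W: "0 < W" and kW: "real k * W < (\<Sum>p\<in>Q. (w p)\<^sup>2)"
    and \<beta>: "\<And>n. n < N \<Longrightarrow> \<bar>\<beta> n\<bar> \<le> B" "\<And>n. \<not> primepow n \<Longrightarrow> \<beta> n = 0"
    and \<beta>Q: "\<And>p. p \<in> Q \<Longrightarrow> c * w p \<le> \<beta> p" and c: "0 \<le> c"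
    and y: "1 \<le> y" and N: "real N \<le> X" and len: "8 * (y ^ Suc k * X)\<^sup>2 \<le> L" and N1: "1 \<le> N"
    and V: "\<And>t. A \<le> t \<Longrightarrow> t \<le> A + L \<Longrightarrow> (\<Sum>n<N. \<beta> n * cos (t * ln (real n))) \<le> U" and U: "0 \<le> U"
  shows "c * sqrt ((real k + 1) / (\<Sum>p\<in>Q. (w p)\<^sup>2)) * ((\<Sum>p\<in>Q. (w p)\<^sup>2) - real k * W) \<le> 5 / 2 * U + B / 2"
proof -
  define e1 where "e1 = (\<Sum>p\<in>Q. (w p)\<^sup>2)"
  define M where "M = y ^ Suc k"
  define S where "S = (\<lambda>j. {I. I \<subseteq> Q \<and> card I = j})"
  define T where "T = S k \<union> S (Suc k)"
  define P where "P = (\<lambda>I. \<Prod>p\<in>I. w p)"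
  define e where "e = (\<lambda>j. \<Sum>I\<in>S j. (P I)\<^sup>2)"
  \<comment> \<open>With this ratio the sets of size k + 1 carry at most as much squared weight as
    those of size k, so that \<open>\<rho> \<le> 2 * e k\<close>.\<close>
  define b where "b = sqrt ((real k + 1) / e1)"
  define r where "r = (\<lambda>I. if card I = k then P I else b * P I)"
  define m where "m = (\<lambda>I :: nat set. \<Prod>I)"
  define l where "l = (\<lambda>I. ln (real (m I)))"
  define \<rho> where "\<rho> = (\<Sum>I\<in>T. (r I)\<^sup>2)"
  have finI: "finite I" if "I \<subseteq> Q" for I using that finQ finite_subset by blast
  have finS: "finite (S j)" for j using finQ by (auto simp: S_def)
  have finT: "finite T" using finS by (simp add: T_def)
  have ST: "S k \<inter> S (Suc k) = {}" by (auto simp: S_def)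
  have TQ: "I \<subseteq> Q" if "I \<in> T" for I using that by (auto simp: T_def S_def)
  have Ppos: "0 < P I" if "I \<subseteq> Q" for I using that w by (auto simp: P_def intro!: prod_pos)
  have e1pos: "0 < e1" using kW W by (metis e1_def mult_nonneg_nonneg of_nat_0_le_iff less_imp_le order_le_less_trans)
  have kQ: "k < card Q"
  proof -
    have "e1 \<le> (\<Sum>p\<in>Q. W)" unfolding e1_def using w by (intro sum_mono) auto
    then have "real k * W < real (card Q) * W" using kW by (simp add: e1_def)
    then show ?thesis using W by simp
  qed
  have ek: "0 < e k"
  proof -
    obtain I where "I \<subseteq> Q" "card I = k" using obtain_subset_with_card_n[of k Q] kQ by (metis less_imp_le)
    then have "I \<in> S k" by (simp add: S_def)
    moreover have "0 < (P J)\<^sup>2" if "J \<in> S k" for J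
      using Ppos[of J] that by (simp add: S_def)
    ultimately show ?thesis unfolding e_def using finS by (intro sum_pos) auto
  qed
  have bpos: "0 \<le> b" "b\<^sup>2 = (real k + 1) / e1" using e1pos by (auto simp: b_def)
  have rpos: "0 \<le> r I" if "I \<in> T" for I using Ppos[OF TQ[OF that]] bpos by (simp add: r_def)
  have insP: "P (insert p I) = w p * P I" if "p \<notin> I" "I \<subseteq> Q" for p I
    using that finI by (simp add: P_def)
  \<comment> \<open>Double counting of the pairs (J, p) with p in J: removing p from J leaves a set
    of k primes that does not contain p.\<close>
  have double: "(\<Sum>J\<in>S (Suc k). (real k + 1) * (P J)\<^sup>2) = (\<Sum>I\<in>S k. \<Sum>p\<in>Q - I. (w p)\<^sup>2 * (P I)\<^sup>2)"
  proof -
    have "(\<Sum>J\<in>S (Suc k). (real k + 1) * (P J)\<^sup>2) = (\<Sum>J\<in>S (Suc k). \<Sum>p\<in>J. (P J)\<^sup>2)"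
      by (intro sum.cong) (auto simp: S_def)
    also have "\<dots> = (\<Sum>(J, p)\<in>Sigma (S (Suc k)) (\<lambda>J. J). (P J)\<^sup>2)"
      using finS finI by (intro sum.Sigma) (auto simp: S_def)
    also have "\<dots> = (\<Sum>(I, p)\<in>Sigma (S k) (\<lambda>I. Q - I). (w p)\<^sup>2 * (P I)\<^sup>2)"
    proof (rule sum.reindex_bij_witness[where i = "\<lambda>(I, p). (insert p I, p)" and j = "\<lambda>(J, p). (J - {p}, p)"])
      fix x assume x: "x \<in> Sigma (S (Suc k)) (\<lambda>J. J)"
      then obtain J p where xp: "x = (J, p)" "J \<subseteq> Q" "card J = Suc k" "p \<in> J" by (auto simp: S_def)
      show "(case case x of (J, p) \<Rightarrow> (J - {p}, p) of (I, p) \<Rightarrow> (insert p I, p)) = x" using xp by auto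
      show "(case x of (J, p) \<Rightarrow> (J - {p}, p)) \<in> Sigma (S k) (\<lambda>I. Q - I)"
        using xp finI[of J] by (auto simp: S_def)
      have "P J = w p * P (J - {p})" using insP[of p "J - {p}"] xp by (auto simp: insert_absorb)
      then show "(case case x of (J, p) \<Rightarrow> (J - {p}, p) of (I, p) \<Rightarrow> (w p)\<^sup>2 * (P I)\<^sup>2) = (case x of (J, p) \<Rightarrow> (P J)\<^sup>2)"
        using xp by (simp add: power_mult_distrib)
    next
      fix x assume x: "x \<in> Sigma (S k) (\<lambda>I. Q - I)"
      then obtain I p where xp: "x = (I, p)" "I \<subseteq> Q" "card I = k" "p \<in> Q" "p \<notin> I" by (auto simp: S_def)
      show "(case case x of (I, p) \<Rightarrow> (insert p I, p) of (J, p) \<Rightarrow> (J - {p}, p)) = x" using xp by auto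
      show "(case x of (I, p) \<Rightarrow> (insert p I, p)) \<in> Sigma (S (Suc k)) (\<lambda>J. J)"
        using xp finI[of I] by (auto simp: S_def)
    qed
    also have "\<dots> = (\<Sum>I\<in>S k. \<Sum>p\<in>Q - I. (w p)\<^sup>2 * (P I)\<^sup>2)"
      using finS finQ by (intro sum.Sigma[symmetric]) auto
    finally show ?thesis .
  qed
  \<comment> \<open>Excluding k primes from Q costs at most k W of the total e1; \<open>kW\<close>
    keeps what is left positive.\<close>
  have outer: "e1 - real k * W \<le> (\<Sum>p\<in>Q - I. (w p)\<^sup>2)" "(\<Sum>p\<in>Q - I. (w p)\<^sup>2) \<le> e1" if "I \<in> S k" for I
  proof -
    have I: "I \<subseteq> Q" "card I = k" using that by (auto simp: S_def)
    have "(\<Sum>p\<in>I. (w p)\<^sup>2) \<le> (\<Sum>p\<in>I. W)" using I w by (intro sum_mono) auto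
    moreover have "e1 = (\<Sum>p\<in>Q - I. (w p)\<^sup>2) + (\<Sum>p\<in>I. (w p)\<^sup>2)"
      unfolding e1_def using I finQ by (intro sum.subset_diff) auto
    moreover have "0 \<le> (\<Sum>p\<in>I. (w p)\<^sup>2)" by (intro sum_nonneg) auto
    ultimately show "e1 - real k * W \<le> (\<Sum>p\<in>Q - I. (w p)\<^sup>2)" "(\<Sum>p\<in>Q - I. (w p)\<^sup>2) \<le> e1"
      using I by auto
  qed
  have rho: "\<rho> \<le> 2 * e k"
  proof -
    have "\<rho> = (\<Sum>I\<in>S k. (r I)\<^sup>2) + (\<Sum>I\<in>S (Suc k). (r I)\<^sup>2)"
      unfolding \<rho>_def T_def using finS ST by (intro sum.union_disjoint) auto
    also have "(\<Sum>I\<in>S k. (r I)\<^sup>2) = e k" unfolding e_def by (intro sum.cong) (auto simp: r_def S_def)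
    also have "(\<Sum>I\<in>S (Suc k). (r I)\<^sup>2) = (\<Sum>J\<in>S (Suc k). (real k + 1) * (P J)\<^sup>2) / e1"
      unfolding sum_divide_distrib by (intro sum.cong) (auto simp: r_def S_def power_mult_distrib bpos)
    also have "(\<Sum>J\<in>S (Suc k). (real k + 1) * (P J)\<^sup>2) \<le> e1 * e k"
      unfolding double e_def sum_distrib_left sum_distrib_right[symmetric]
      using outer by (intro sum_mono mult_right_mono) auto
    then have "(\<Sum>J\<in>S (Suc k). (real k + 1) * (P J)\<^sup>2) / e1 \<le> e k"
      using e1pos by (simp add: divide_le_eq mult.commute)
    finally show ?thesis by simp
  qed
  have rho0: "0 \<le> \<rho>" unfolding \<rho>_def by (intro sum_nonneg) auto
  have mpos: "0 < m I" if "I \<subseteq> Q" for I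
    unfolding m_def using that Q by (auto intro!: prod_pos simp: prime_gt_0_nat)
  have mM: "real (m I) \<le> M" if "I \<in> T" for I
  proof -
    have I: "I \<subseteq> Q" "card I \<le> Suc k" using that by (auto simp: T_def S_def)
    have "real (m I) = (\<Prod>p\<in>I. real p)" by (simp add: m_def)
    also have "\<dots> \<le> (\<Prod>p\<in>I. y)" using I Q by (intro prod_mono) auto
    also have "\<dots> = y ^ card I" by simp
    also have "\<dots> \<le> M" unfolding M_def using I y by (intro power_increasing) auto
    finally show ?thesis .
  qed
  have pm: "p dvd m I \<longleftrightarrow> p \<in> I" if pr: "prime p" and IQ: "I \<subseteq> Q" for p I
  proof
    assume "p dvd m I"
    then obtain q where "q \<in> I" "p dvd q" unfolding m_def using prime_dvd_prod_iff[OF finI[OF IQ] pr, of "\<lambda>x. x"] by auto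
    moreover have "prime q" using Q IQ \<open>q \<in> I\<close> by blast
    ultimately show "p \<in> I" using pr primes_dvd_imp_eq by metis
  next
    assume "p \<in> I"
    then show "p dvd m I" unfolding m_def using finI[OF IQ] by (intro dvd_prodI) auto
  qed
  have m_inj: "I = J" if "m I = m J" "I \<subseteq> Q" "J \<subseteq> Q" for I J
  proof (rule Set.set_eqI)
    fix x
    have *: "x \<in> J'" if "x \<in> I'" "m I' = m J'" "I' \<subseteq> Q" "J' \<subseteq> Q" for I' J'
    proof -
      have "prime x" using Q that by blast
      then show ?thesis using pm[of x I'] pm[of x J'] that by simp
    qed
    show "x \<in> I \<longleftrightarrow> x \<in> J" using *[of I J] *[of J I] that by auto
  qed
  \<comment> \<open>By unique factorisation the sets in T give distinct integers up to M. The
    resulting bound for the number of sets enters the Cauchy-Schwarz estimate of the sum of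
    r.\<close>
  have cardT: "real (card T) \<le> M"
  proof -
    have "inj_on m T" using m_inj TQ by (intro inj_onI) blast
    moreover have "m ` T \<subseteq> {1..nat \<lfloor>M\<rfloor>}" using mpos TQ mM by (auto simp: Suc_le_eq le_nat_floor)
    ultimately have "card T \<le> nat \<lfloor>M\<rfloor>" using card_inj_on_le[of m T "{1..nat \<lfloor>M\<rfloor>}"] by simp
    moreover have "0 \<le> M" using y by (simp add: M_def)
    ultimately show ?thesis by linarith
  qed
  have M1: "1 \<le> M" unfolding M_def using y by (rule one_le_power)
  have X1: "1 \<le> X" using N N1 by linarith
  have sumr: "(\<Sum>I\<in>T. r I)\<^sup>2 \<le> M * \<rho>"
  proof -
    have "(\<Sum>I\<in>T. r I)\<^sup>2 \<le> real (card T) * \<rho>"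
      using Cauchy_Schwarz_ineq_sum[of "\<lambda>_. 1" r T] by (simp add: \<rho>_def)
    also have "\<dots> \<le> M * \<rho>" using cardT rho0 by (intro mult_right_mono)
    finally show ?thesis .
  qed
  have square_sum: "(\<Sum>I\<in>T. \<Sum>J\<in>T. r I * r J * x) = (\<Sum>I\<in>T. r I)\<^sup>2 * x" for x
  proof -
    have e: "(\<Sum>I\<in>T. r I)\<^sup>2 = (\<Sum>I\<in>T. \<Sum>J\<in>T. r I * r J)" by (simp only: power2_eq_square sum_product)
    show ?thesis by (simp only: e sum_distrib_right)
  qed
  have L0: "0 \<le> L" using len by (rule order_trans[rotated]) simp
  then have AL: "A \<le> A + L" by simp
  define R where "R = (\<lambda>t. (\<Sum>I\<in>T. r I * cos (t * l I))\<^sup>2 + (\<Sum>I\<in>T. r I * sin (t * l I))\<^sup>2)"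
  have R0: "0 \<le> R t" for t by (simp add: R_def)
  have R_eq: "R t * cos x = (\<Sum>I\<in>T. \<Sum>J\<in>T. r I * r J * cos (x + t * (l I - l J)))" for t x
  proof -
    \<comment> \<open>The summand changes sign when I and J are exchanged.\<close>
    have sin0: "(\<Sum>I\<in>T. \<Sum>J\<in>T. r I * r J * sin (t * (l I - l J))) = 0"
    proof -
      have "(\<Sum>I\<in>T. \<Sum>J\<in>T. r I * r J * sin (t * (l I - l J))) = (\<Sum>J\<in>T. \<Sum>I\<in>T. r I * r J * sin (t * (l I - l J)))"
        by (rule sum.swap)
      also have "\<dots> = (\<Sum>J\<in>T. \<Sum>I\<in>T. - (r J * r I * sin (t * (l J - l I))))"
      proof (intro sum.cong refl)
        fix I J
        have "t * (l I - l J) = - (t * (l J - l I))" by (simp add: algebra_simps)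
        then show "r I * r J * sin (t * (l I - l J)) = - (r J * r I * sin (t * (l J - l I)))" by (simp only: sin_minus) simp
      qed
      finally show ?thesis by (simp add: sum_negf)
    qed
    have "R t = (\<Sum>I\<in>T. \<Sum>J\<in>T. r I * r J * cos (t * (l I - l J)))"
      unfolding R_def power2_eq_square sum_product sum.distrib[symmetric]
      by (intro sum.cong refl) (simp add: right_diff_distrib cos_diff algebra_simps)
    then have "R t * cos x = (\<Sum>I\<in>T. \<Sum>J\<in>T. r I * r J * cos (t * (l I - l J))) * cos x
        - (\<Sum>I\<in>T. \<Sum>J\<in>T. r I * r J * sin (t * (l I - l J))) * sin x" by (simp add: sin0)
    also have "\<dots> = (\<Sum>I\<in>T. \<Sum>J\<in>T. r I * r J * cos (x + t * (l I - l J)))"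
      unfolding sum_distrib_right sum_subtractf[symmetric]
      by (intro sum.cong refl) (simp only: cos_add, simp add: algebra_simps)
    finally show ?thesis .
  qed
  define F where "F = (\<lambda>\<delta>. integral {A..A + L} (\<lambda>t. cos (t * \<delta>)))"
  have F0: "F 0 = L" by (simp add: F_def L0)
  have hasF: "((\<lambda>t. cos (t * \<delta>)) has_integral F \<delta>) {A..A + L}" for \<delta>
    unfolding F_def by (rule integrable_integral[OF integral_cos(1)[OF AL]])
  have Foff: "\<bar>F (ln (real a) - ln (real b))\<bar> \<le> 2 * Y"
    if "0 < a" "0 < b" "a \<noteq> b" "real a \<le> Y" "real b \<le> Y" for a b :: nat and Y
  proof -
    have Y: "0 < Y" using that by linarith
    have g: "1 / Y \<le> \<bar>ln (real a) - ln (real b)\<bar>" by (rule abs_ln_ratio_ge) (use that in auto)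
    have "0 < 1 / Y" using Y by simp
    then have nz: "0 < \<bar>ln (real a) - ln (real b)\<bar>" using g by linarith
    then have "\<bar>F (ln (real a) - ln (real b))\<bar> \<le> 2 / \<bar>ln (real a) - ln (real b)\<bar>"
      unfolding F_def by (intro integral_cos(3)[OF AL]) auto
    also have "\<dots> \<le> 2 / (1 / Y)" using g nz Y by (intro divide_left_mono) auto
    finally show ?thesis by simp
  qed
  have hasR: "(R has_integral (\<Sum>I\<in>T. \<Sum>J\<in>T. r I * r J * F (l I - l J))) {A..A + L}"
  proof -
    have "R = (\<lambda>t. \<Sum>I\<in>T. \<Sum>J\<in>T. r I * r J * cos (t * (l I - l J)))"
      by (rule ext) (use R_eq[of _ 0] in simp)
    then show ?thesis by (simp only:) (intro has_integral_sum finT has_integral_mult_right hasF)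
  qed
  have hasVR: "((\<lambda>t. (\<Sum>n<N. \<beta> n * cos (t * ln (real n))) * R t) has_integral
      (\<Sum>n<N. \<beta> n * (\<Sum>I\<in>T. \<Sum>J\<in>T. r I * r J * F (ln (real n) + (l I - l J))))) {A..A + L}"
  proof -
    have "((\<lambda>t. \<Sum>n<N. \<beta> n * (\<Sum>I\<in>T. \<Sum>J\<in>T. r I * r J * cos (t * (ln (real n) + (l I - l J))))) has_integral
      (\<Sum>n<N. \<beta> n * (\<Sum>I\<in>T. \<Sum>J\<in>T. r I * r J * F (ln (real n) + (l I - l J))))) {A..A + L}"
      by (intro has_integral_sum finT finite_lessThan has_integral_mult_right hasF)
    moreover have "(\<Sum>n<N. \<beta> n * (\<Sum>I\<in>T. \<Sum>J\<in>T. r I * r J * cos (t * (ln (real n) + (l I - l J))))) =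
        (\<Sum>n<N. \<beta> n * cos (t * ln (real n))) * R t" for t
      unfolding distrib_left R_eq[symmetric] sum_distrib_right by (intro sum.cong) (auto simp: mult_ac)
    ultimately show ?thesis by simp
  qed
  \<comment> \<open>R is non-negative, so the pointwise upper bound for the polynomial survives
    multiplication by R and integration.\<close>
  have "(\<Sum>n<N. \<beta> n * (\<Sum>I\<in>T. \<Sum>J\<in>T. r I * r J * F (ln (real n) + (l I - l J)))) \<le>
      U * (\<Sum>I\<in>T. \<Sum>J\<in>T. r I * r J * F (l I - l J))"
    using V R0 by (intro has_integral_le[OF hasVR has_integral_mult_right[OF hasR]] mult_right_mono) auto
  also have "\<dots> \<le> U * (\<rho> * (L + 2 * M\<^sup>2))"
  proof (intro mult_left_mono U)
    have "(\<Sum>I\<in>T. \<Sum>J\<in>T. r I * r J * F (l I - l J)) \<le> (\<Sum>I\<in>T. \<Sum>J\<in>T. (if I = J then (r I)\<^sup>2 * L else 0) + r I * r J * (2 * M))"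
    proof (intro sum_mono)
      fix I J assume IJ: "I \<in> T" "J \<in> T"
      show "r I * r J * F (l I - l J) \<le> (if I = J then (r I)\<^sup>2 * L else 0) + r I * r J * (2 * M)"
      proof (cases "I = J")
        case True
        then show ?thesis using rpos[OF IJ(1)] M1 by (simp add: F0 power2_eq_square)
      next
        case False
        then have neq: "m I \<noteq> m J" using m_inj[of I J] TQ[OF IJ(1)] TQ[OF IJ(2)] by blast
        have "\<bar>F (l I - l J)\<bar> \<le> 2 * M"
          unfolding l_def by (rule Foff) (use mpos[OF TQ[OF IJ(1)]] mpos[OF TQ[OF IJ(2)]] mM IJ neq in auto)
        then have "r I * r J * F (l I - l J) \<le> r I * r J * (2 * M)"
          using rpos IJ by (intro mult_left_mono) auto
        then show ?thesis using False by simp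
      qed
    qed
    also have "\<dots> = \<rho> * L + (\<Sum>I\<in>T. r I)\<^sup>2 * (2 * M)"
    proof -
      have "(\<Sum>I\<in>T. \<Sum>J\<in>T. if I = J then (r I)\<^sup>2 * L else 0) = \<rho> * L"
        by (simp add: finT \<rho>_def sum_distrib_right)
      then show ?thesis by (simp only: sum.distrib square_sum)
    qed
    also have "\<dots> \<le> \<rho> * L + M * \<rho> * (2 * M)" using sumr M1 by (intro add_left_mono mult_right_mono) auto
    also have "\<dots> = \<rho> * (L + 2 * M\<^sup>2)" by (simp add: algebra_simps power2_eq_square)
    finally show "(\<Sum>I\<in>T. \<Sum>J\<in>T. r I * r J * F (l I - l J)) \<le> \<rho> * (L + 2 * M\<^sup>2)" .
  qed
  finally have upper: "(\<Sum>n<N. \<beta> n * (\<Sum>I\<in>T. \<Sum>J\<in>T. r I * r J * F (ln (real n) + (l I - l J)))) \<le> U * (\<rho> * (L + 2 * M\<^sup>2))" .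
  \<comment> \<open>The resonant part: n * m I = m J gives frequency 0 and the full length L; every
    other frequency is at least 1 / (M X) in absolute value and is treated as error.\<close>
  define d where "d = (\<lambda>n. \<Sum>I\<in>T. \<Sum>J\<in>T. if n * m I = m J then r I * r J * L else 0)"
  have B0: "0 \<le> B" using \<beta>(1)[of 0] N1 by simp
  have lower: "\<beta> n * d n - B * (M * \<rho>) * (2 * (M * X)) \<le> \<beta> n * (\<Sum>I\<in>T. \<Sum>J\<in>T. r I * r J * F (ln (real n) + (l I - l J)))"
    if n: "n < N" for n
  proof (cases "n = 0")
    case True
    then have "\<beta> n = 0" using \<beta>(2) by simp
    then show ?thesis using B0 M1 rho0 X1 by simp
  next
    case False
    define G where "G = (\<Sum>I\<in>T. \<Sum>J\<in>T. r I * r J * F (ln (real n) + (l I - l J)))"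
    have "\<bar>G - d n\<bar> \<le> (\<Sum>I\<in>T. \<Sum>J\<in>T. r I * r J * (2 * (M * X)))"
      unfolding G_def d_def sum_subtractf[symmetric]
    proof (intro order_trans[OF sum_abs] sum_mono)
      fix I J assume IJ: "I \<in> T" "J \<in> T"
      have mI: "0 < m I" "0 < m J" using mpos TQ IJ by auto
      have eq: "ln (real n) + (l I - l J) = ln (real (n * m I)) - ln (real (m J))"
        using False mI by (simp add: l_def ln_mult)
      have nX: "real n \<le> X" using n N by linarith
      have b1: "real (n * m I) \<le> M * X" using mult_mono[OF nX mM[OF IJ(1)]] X1 by (simp add: mult.commute)
      have b2: "real (m J) \<le> M * X" using mult_mono[OF mM[OF IJ(2)] X1] M1 by simp
      have rr: "0 \<le> r I * r J" using rpos IJ by simp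
      show "\<bar>r I * r J * F (ln (real n) + (l I - l J)) - (if n * m I = m J then r I * r J * L else 0)\<bar> \<le> r I * r J * (2 * (M * X))"
      proof (cases "n * m I = m J")
        case True
        then show ?thesis unfolding eq using rr M1 X1 by (simp add: F0)
      next
        case neq: False
        have "\<bar>F (ln (real n) + (l I - l J))\<bar> \<le> 2 * (M * X)"
          unfolding eq by (rule Foff) (use False mI neq b1 b2 in auto)
        then have "\<bar>r I * r J\<bar> * \<bar>F (ln (real n) + (l I - l J))\<bar> \<le> r I * r J * (2 * (M * X))"
          unfolding abs_of_nonneg[OF rr] by (intro mult_left_mono rr)
        then show ?thesis using neq by (simp only: abs_mult[symmetric] if_False diff_zero)
      qed
    qed
    also have "\<dots> = (\<Sum>I\<in>T. r I)\<^sup>2 * (2 * (M * X))" by (rule square_sum)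
    also have "\<dots> \<le> M * \<rho> * (2 * (M * X))" using sumr M1 X1 by (intro mult_right_mono) auto
    finally have "\<bar>G - d n\<bar> \<le> M * \<rho> * (2 * (M * X))" .
    then have "\<bar>\<beta> n\<bar> * \<bar>G - d n\<bar> \<le> B * (M * \<rho> * (2 * (M * X)))" using \<beta>(1)[OF n] B0 by (intro mult_mono) auto
    then have "\<beta> n * d n - \<beta> n * G \<le> B * (M * \<rho> * (2 * (M * X)))"
      unfolding abs_mult[symmetric] by (simp add: right_diff_distrib abs_le_iff)
    then show ?thesis by (simp add: G_def mult_ac)
  qed
  have d0: "0 \<le> d n" for n
    unfolding d_def using rpos L0 by (intro sum_nonneg) auto
  \<comment> \<open>m J is squarefree with prime factors in Q, so a prime power dividing it is one
    of these primes; at all other n outside Q the coefficient \<beta> n is 0.\<close>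
  have dQ: "\<beta> n * d n = 0" if "n \<notin> Q" for n
  proof (cases "primepow n")
    case True
    have "n * m I \<noteq> m J" if IJ: "I \<in> T" "J \<in> T" for I J
    proof
      assume eq: "n * m I = m J"
      define p where "p = aprimedivisor n"
      define j where "j = multiplicity p n"
      have n: "n = p ^ j" "prime p"
        using primepow_decompose[OF True] prime_aprimedivisor'[of n] True primepow_gt_Suc_0[OF True] by (auto simp: p_def j_def)
      have "n \<noteq> 1" using True by auto
      then have "j \<noteq> 0" using n by auto
      then have pn: "p dvd n" using n by (simp add: dvd_power)
      then have "p dvd m J" using eq by (metis dvd_mult2)
      then have pJ: "p \<in> J" using pm n TQ IJ by blast
      have "j \<noteq> 1" using \<open>n \<notin> Q\<close> n pJ TQ[OF IJ(2)] by auto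
      then have "2 \<le> j" using \<open>j \<noteq> 0\<close> by simp
      then have "p ^ 2 dvd n" using n by (simp add: le_imp_power_dvd)
      then have "p ^ 2 dvd m J" using eq by (metis dvd_mult2)
      moreover have "m J = p * m (J - {p})"
        unfolding m_def using pJ finI[OF TQ[OF IJ(2)]] by (simp add: prod.remove)
      ultimately have "p dvd m (J - {p})" using n(2) prime_gt_0_nat[OF n(2)] by (simp add: power2_eq_square)
      then have "p \<in> J - {p}" using pm[OF n(2), of "J - {p}"] TQ[OF IJ(2)] by blast
      then show False by simp
    qed
    then show ?thesis by (simp add: d_def)
  qed (simp add: \<beta>(2))
  \<comment> \<open>All terms of d p are non-negative, so keeping only the pairs (I, insert p I)
    gives a lower bound.\<close>
  have dp: "L * b * w p * (\<Sum>I | I \<in> S k \<and> p \<notin> I. (P I)\<^sup>2) \<le> d p" if p: "p \<in> Q" for p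
  proof -
    have pr: "prime p" using Q p by blast
    have "L * b * w p * (\<Sum>I | I \<in> S k \<and> p \<notin> I. (P I)\<^sup>2) = (\<Sum>I | I \<in> S k \<and> p \<notin> I. r I * r (insert p I) * L)"
      unfolding sum_distrib_left
    proof (intro sum.cong refl)
      fix I assume "I \<in> {I. I \<in> S k \<and> p \<notin> I}"
      then have I: "I \<subseteq> Q" "card I = k" "p \<notin> I" by (auto simp: S_def)
      have "card (insert p I) = Suc k" using I finI by simp
      then show "L * b * w p * (P I)\<^sup>2 = r I * r (insert p I) * L"
        using I insP[of p I] by (simp add: r_def power2_eq_square)
    qed
    also have "\<dots> \<le> (\<Sum>I | I \<in> S k \<and> p \<notin> I. \<Sum>J\<in>T. if p * m I = m J then r I * r J * L else 0)"
    proof (rule sum_mono)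
      fix I assume "I \<in> {I. I \<in> S k \<and> p \<notin> I}"
      then have I: "I \<subseteq> Q" "card I = k" "p \<notin> I" "I \<in> T" by (auto simp: S_def T_def)
      have J: "insert p I \<in> T" using I p finI[OF I(1)] by (auto simp: T_def S_def)
      have "p * m I = m (insert p I)" unfolding m_def using I finI[OF I(1)] by simp
      then have "r I * r (insert p I) * L = (if p * m I = m (insert p I) then r I * r (insert p I) * L else 0)" by simp
      also have "\<dots> \<le> (\<Sum>J\<in>T. if p * m I = m J then r I * r J * L else 0)"
        using J finT rpos I L0 by (intro member_le_sum) auto
      finally show "r I * r (insert p I) * L \<le> (\<Sum>J\<in>T. if p * m I = m J then r I * r J * L else 0)" .
    qed
    also have "\<dots> \<le> d p" unfolding d_def
      using finT rpos L0 by (intro sum_mono2 sum_nonneg) (auto simp: T_def)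
    finally show ?thesis .
  qed
  have cross: "L * (c * b * (e1 - real k * W) * e k) \<le> (\<Sum>n<N. \<beta> n * d n)"
  proof -
    have "(e1 - real k * W) * e k \<le> (\<Sum>I\<in>S k. \<Sum>p\<in>Q - I. (w p)\<^sup>2 * (P I)\<^sup>2)"
      unfolding e_def sum_distrib_left sum_distrib_right[symmetric]
      using outer by (intro sum_mono mult_right_mono) auto
    also have "\<dots> = (\<Sum>I\<in>S k. \<Sum>p\<in>Q. if p \<notin> I then (w p)\<^sup>2 * (P I)\<^sup>2 else 0)"
      unfolding sum.inter_filter[OF finQ, symmetric] set_diff_eq by simp
    also have "\<dots> = (\<Sum>p\<in>Q. \<Sum>I\<in>S k. if p \<notin> I then (w p)\<^sup>2 * (P I)\<^sup>2 else 0)" by (rule sum.swap)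
    also have "\<dots> = (\<Sum>p\<in>Q. (w p)\<^sup>2 * (\<Sum>I | I \<in> S k \<and> p \<notin> I. (P I)\<^sup>2))"
      unfolding sum_distrib_left sum.inter_filter[OF finS, symmetric] by simp
    finally have "L * c * b * ((e1 - real k * W) * e k) \<le> L * c * b * (\<Sum>p\<in>Q. (w p)\<^sup>2 * (\<Sum>I | I \<in> S k \<and> p \<notin> I. (P I)\<^sup>2))"
      using L0 c bpos by (intro mult_left_mono) auto
    also have "\<dots> = (\<Sum>p\<in>Q. c * w p * (L * b * w p * (\<Sum>I | I \<in> S k \<and> p \<notin> I. (P I)\<^sup>2)))"
      unfolding sum_distrib_left by (intro sum.cong refl) (simp add: power2_eq_square mult_ac)
    also have "\<dots> \<le> (\<Sum>p\<in>Q. \<beta> p * d p)"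
    proof (intro sum_mono mult_mono)
      fix p assume p: "p \<in> Q"
      show "c * w p \<le> \<beta> p" using \<beta>Q p .
      show "L * b * w p * (\<Sum>I | I \<in> S k \<and> p \<notin> I. (P I)\<^sup>2) \<le> d p" using dp p .
      have "0 \<le> c * w p" using c w[OF p] by simp
      then show "0 \<le> \<beta> p" using \<beta>Q[OF p] by linarith
      show "0 \<le> L * b * w p * (\<Sum>I | I \<in> S k \<and> p \<notin> I. (P I)\<^sup>2)"
        using L0 bpos w[OF p] by (intro mult_nonneg_nonneg sum_nonneg) auto
    qed
    also have "\<dots> = (\<Sum>n<N. \<beta> n * d n)"
      using Q dQ by (intro sum.mono_neutral_left) auto
    finally show ?thesis by (simp add: mult_ac)
  qed
  have len1: "2 * M\<^sup>2 \<le> L / 4"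
  proof -
    have "8 * M\<^sup>2 * 1 \<le> 8 * M\<^sup>2 * X\<^sup>2" using X1 by (intro mult_left_mono) auto
    also have "\<dots> \<le> L" using len by (simp add: M_def power_mult_distrib)
    finally show ?thesis by simp
  qed
  have off: "real N * (B * (M * \<rho>) * (2 * (M * X))) \<le> L / 4 * (B * (2 * e k))"
  proof -
    have "real N * (B * (M * \<rho>) * (2 * (M * X))) \<le> X * (B * (M * \<rho>) * (2 * (M * X)))"
      using N B0 M1 rho0 X1 by (intro mult_right_mono) auto
    also have "\<dots> = 2 * (M * X)\<^sup>2 * (B * \<rho>)" by (simp add: power2_eq_square)
    also have "\<dots> \<le> L / 4 * (B * (2 * e k))"
      using len B0 rho rho0 L0 by (intro mult_mono mult_left_mono) (auto simp: M_def)
    finally show ?thesis .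
  qed
  have "L * (c * b * (e1 - real k * W) * e k) - real N * (B * (M * \<rho>) * (2 * (M * X))) \<le> (\<Sum>n<N. \<beta> n * d n - B * (M * \<rho>) * (2 * (M * X)))"
    using cross by (simp add: sum_subtractf)
  also have "\<dots> \<le> U * (\<rho> * (L + 2 * M\<^sup>2))"
    using lower by (intro order_trans[OF sum_mono upper]) auto
  finally have "L * (c * b * (e1 - real k * W) * e k) \<le> U * (\<rho> * (L + 2 * M\<^sup>2)) + real N * (B * (M * \<rho>) * (2 * (M * X)))" by simp
  \<comment> \<open>By \<open>len\<close> the off-diagonal errors are a quarter of L each; with
    \<open>\<rho> \<le> 2 * e k\<close> this gives the constants 5/2 = 2 (1 + 1/4) and 1/2 = 2/4 of
    the conclusion.\<close>
  also have "\<dots> \<le> U * (2 * e k * (L + L / 4)) + L / 4 * (B * (2 * e k))"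
    using U rho rho0 L0 ek len1 by (intro add_mono[OF _ off] mult_left_mono mult_mono add_left_mono) auto
  also have "\<dots> = L * ((5 / 2 * U + B / 2) * e k)" by (simp add: field_simps)
  finally have "L * (c * b * (e1 - real k * W) * e k) \<le> L * ((5 / 2 * U + B / 2) * e k)" .
  moreover have "0 < L"
  proof -
    have "1 \<le> (M * X)\<^sup>2" using mult_mono[OF M1 X1] M1 by (simp add: one_le_power)
    then show ?thesis using len by (simp add: M_def)
  qed
  ultimately have "c * b * (e1 - real k * W) * e k \<le> (5 / 2 * U + B / 2) * e k" by simp
  then have "c * b * (e1 - real k * W) \<le> 5 / 2 * U + B / 2" using ek by simp
  then show ?thesis by (simp add: b_def e1_def)
qed

subsection \<open>Lower bounds for the maximum\<close>

text \<open>Uniform continuity of \<open>zeta\<close> on a compact rectangle that ends at Re s =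
  3/4, before the pole. The width \<open>\<epsilon>0\<close> depends on the interval, which does no
  harm because \<epsilon> tends to 0 while the interval is fixed.\<close>

lemma zeta_near_line_le:
  assumes le: "\<And>v. v \<in> {A..B} \<Longrightarrow> cmod (zeta (Complex (1 / 2) v)) \<le> exp \<mu>"
  obtains \<epsilon>0 where "0 < \<epsilon>0"
    "\<And>\<epsilon> v. 0 < \<epsilon> \<Longrightarrow> \<epsilon> < \<epsilon>0 \<Longrightarrow> v \<in> {A..B} \<Longrightarrow> cmod (zeta (Complex (1 / 2 + \<epsilon>) v)) \<le> exp (\<mu> + 1)"
proof -
  define S where "S = cbox (Complex (1 / 2) A) (Complex (3 / 4) B)"
  have mem: "Complex (1 / 2 + \<epsilon>) v \<in> S" if "0 \<le> \<epsilon>" "\<epsilon> \<le> 1 / 4" "v \<in> {A..B}" for \<epsilon> v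
    using that by (auto simp: S_def in_cbox_complex_iff)
  have "continuous_on S zeta"
    by (rule continuous_on_subset[OF holomorphic_on_imp_continuous_on[OF zeta_holomorphic]])
       (auto simp: S_def in_cbox_complex_iff)
  then have "uniformly_continuous_on S zeta"
    by (rule compact_uniformly_continuous) (simp add: S_def)
  moreover have "0 < exp (\<mu> + 1) - exp \<mu>" by simp
  ultimately obtain d where d: "0 < d"
    "\<And>x x'. x \<in> S \<Longrightarrow> x' \<in> S \<Longrightarrow> dist x' x < d \<Longrightarrow> dist (zeta x') (zeta x) < exp (\<mu> + 1) - exp \<mu>"
    unfolding uniformly_continuous_on_def by metis
  show thesis
  proof (rule that[of "min d (1 / 4)"])
    fix \<epsilon> v assume e: "0 < \<epsilon>" "\<epsilon> < min d (1 / 4)" and v: "v \<in> {A..B}"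
    have "Complex (1 / 2 + \<epsilon>) v - Complex (1 / 2 + 0) v = of_real \<epsilon>" by (simp add: complex_eq_iff)
    then have "dist (Complex (1 / 2 + \<epsilon>) v) (Complex (1 / 2 + 0) v) = \<epsilon>"
      unfolding dist_norm using e by simp
    then have "dist (zeta (Complex (1 / 2 + \<epsilon>) v)) (zeta (Complex (1 / 2 + 0) v)) < exp (\<mu> + 1) - exp \<mu>"
      using e v by (intro d mem) auto
    moreover have "cmod (zeta (Complex (1 / 2 + \<epsilon>) v)) \<le> cmod (zeta (Complex (1 / 2 + 0) v)) + dist (zeta (Complex (1 / 2 + \<epsilon>) v)) (zeta (Complex (1 / 2 + 0) v))"
      unfolding dist_norm using norm_triangle_ineq[of "zeta (Complex (1 / 2 + 0) v)" "zeta (Complex (1 / 2 + \<epsilon>) v) - zeta (Complex (1 / 2 + 0) v)"] by simp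
    moreover have "cmod (zeta (Complex (1 / 2 + 0) v)) \<le> exp \<mu>" using le[OF v] by simp
    ultimately show "cmod (zeta (Complex (1 / 2 + \<epsilon>) v)) \<le> exp (\<mu> + 1)" by linarith
  qed (use d in auto)
qed

section \<open>Combination of the upper bound and the resonator for admissible H and \<tau>\<close>

lemma eventually_exp_large:
  fixes \<kappa> \<alpha> :: real
  assumes \<kappa>: "0 < \<kappa>"
  shows "eventually (\<lambda>\<tau>. 20 \<le> exp (\<kappa> * \<tau>) \<and> 8 * \<tau> \<le> exp (\<kappa> * \<tau>) \<and>
      4 * (\<tau> / 2 + 1 / 2) \<le> exp (\<kappa> * \<tau>) \<and> 1 \<le> \<tau> \<and> \<alpha> \<le> \<tau> / 2 + 1) at_top"
proof (intro eventually_conj)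
  show "eventually (\<lambda>\<tau>. 20 \<le> exp (\<kappa> * \<tau>)) at_top" using \<kappa> by real_asymp
  show "eventually (\<lambda>\<tau>. 8 * \<tau> \<le> exp (\<kappa> * \<tau>)) at_top" using \<kappa> by real_asymp
  show "eventually (\<lambda>\<tau>. 4 * (\<tau> / 2 + 1 / 2) \<le> exp (\<kappa> * \<tau>)) at_top" using \<kappa> by real_asymp
  show "eventually (\<lambda>\<tau>. \<alpha> \<le> \<tau> / 2 + 1) at_top" by real_asymp
qed (rule eventually_ge_at_top)

text \<open>The hypotheses in the form in which the argument uses them. G enters through
  \<open>kernel_tail\<close>: beyond g v the mass of \<Phi> is O(exp (- v)). F enters through
  \<open>fourier_tail\<close>: beyond \<phi> v the transform decays at rate at least v.\<close>

locale large_value_kernel = entire_kernel \<Phi> for \<Phi> +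
  fixes \<alpha> v0 :: real and \<phi> g :: "real \<Rightarrow> real"
  assumes RH: riemann_hypothesis
    and pos: "\<forall>u::real. \<Phi> (of_real u) \<in> \<real>\<^sub>\<ge>\<^sub>0"
    and \<alpha>: "0 < \<alpha>"
    and real_fourier: "\<And>l. fourier \<Phi> l \<in> \<real>"
    and fourier_pos: "0 < Re (fourier \<Phi> \<alpha>)" "0 < Re (fourier \<Phi> 0)"
    and fourier_ge: "\<And>l. 0 \<le> l \<Longrightarrow> l \<le> \<alpha> \<Longrightarrow> Re (fourier \<Phi> \<alpha>) \<le> Re (fourier \<Phi> l)"
    and fourier_tail: "\<And>v l. v0 \<le> v \<Longrightarrow> \<phi> v \<le> \<bar>l\<bar> \<Longrightarrow> cmod (fourier \<Phi> l) \<le> exp (- (\<bar>l\<bar> * v))"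
    and \<phi>_ge: "\<And>v. v0 \<le> v \<Longrightarrow> v \<le> \<phi> v" and \<phi>_pos: "\<And>v. v0 \<le> v \<Longrightarrow> 0 < \<phi> v"
    and \<phi>_mono: "\<And>v w. v0 \<le> v \<Longrightarrow> v \<le> w \<Longrightarrow> \<phi> v \<le> \<phi> w"
    and g_tendsto: "filterlim g at_top at_top"
    and kernel_tail: "\<exists>K v1. 0 \<le> K \<and> (\<forall>v\<ge>v1. \<forall>w\<ge>g v.
          (LINT u|lborel. indicator {u. w \<le> \<bar>u\<bar>} u * cmod (\<Phi> (of_real u))) \<le> K * exp (- v))"
begin

text \<open>The relation between \<open>\<tau>\<close> and \<open>H\<close>: \<open>\<gamma> = 1\<close> for \<open>\<mu>\<^sup>*\<close> and \<open>\<gamma> = 1/2\<close> for \<open>\<mu>\<^sup>*\<^sup>*\<close>.\<close>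

definition admissible :: "real \<Rightarrow> real \<Rightarrow> real \<Rightarrow> real \<Rightarrow> bool" where
  "admissible \<gamma> T H \<tau> \<longleftrightarrow> 1 < H \<and> v0 \<le> \<tau> / 2 + 1 \<and>
     \<gamma> * \<alpha> * \<tau> + ln (\<phi> (\<tau> / 2 + 1)) = ln (ln H) \<and> g (ln (ln T)) \<le> H * \<tau>"

text \<open>If \<tau> stayed below \<kappa>, the equation would bound H by E, and H \<tau> could not
  reach g (ln (ln T)), which tends to infinity with T. Thus a threshold for T alone makes \<tau> as
  large as desired.\<close>

lemma admissible_large:
  assumes \<gamma>: "0 < \<gamma>"
  obtains T0 where "0 < T0" "\<And>T H \<tau>. T0 \<le> T \<Longrightarrow> admissible \<gamma> T H \<tau> \<Longrightarrow> K \<le> \<tau>"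
proof -
  define \<kappa> where "\<kappa> = max \<bar>K\<bar> (2 * \<bar>v0\<bar>)"
  define E where "E = exp (exp (\<gamma> * \<alpha> * \<kappa> + ln (\<phi> (\<kappa> / 2 + 1))))"
  have \<kappa>: "0 \<le> \<kappa>" "K \<le> \<kappa>" "v0 \<le> \<kappa> / 2 + 1" by (auto simp: \<kappa>_def)
  have "filterlim (\<lambda>T::real. ln (ln T)) at_top at_top" by real_asymp
  then have "filterlim (\<lambda>T. g (ln (ln T))) at_top at_top" by (rule filterlim_compose[OF g_tendsto])
  then have "eventually (\<lambda>T. E * \<kappa> + 1 \<le> g (ln (ln T))) at_top" by (simp add: filterlim_at_top)
  then obtain T0 where T0: "\<And>T. T0 \<le> T \<Longrightarrow> E * \<kappa> + 1 \<le> g (ln (ln T))"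
    unfolding eventually_at_top_linorder by blast
  show thesis
  proof (rule that[of "max 1 T0"])
    fix T H \<tau> assume T: "max 1 T0 \<le> T" and ad: "admissible \<gamma> T H \<tau>"
    show "K \<le> \<tau>"
    proof (rule ccontr)
      assume "\<not> K \<le> \<tau>"
      then have \<tau>: "\<tau> \<le> \<kappa>" using \<kappa> by linarith
      have ad': "1 < H" "v0 \<le> \<tau> / 2 + 1" "\<gamma> * \<alpha> * \<tau> + ln (\<phi> (\<tau> / 2 + 1)) = ln (ln H)" "g (ln (ln T)) \<le> H * \<tau>"
        using ad by (auto simp: admissible_def)
      have "\<phi> (\<tau> / 2 + 1) \<le> \<phi> (\<kappa> / 2 + 1)" using ad' \<tau> by (intro \<phi>_mono) auto
      then have "ln (\<phi> (\<tau> / 2 + 1)) \<le> ln (\<phi> (\<kappa> / 2 + 1))" using \<phi>_pos[OF ad'(2)] by (intro ln_mono) auto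
      moreover have "\<gamma> * \<alpha> * \<tau> \<le> \<gamma> * \<alpha> * \<kappa>" using \<tau> \<gamma> \<alpha> by (intro mult_left_mono) auto
      ultimately have "ln (ln H) \<le> \<gamma> * \<alpha> * \<kappa> + ln (\<phi> (\<kappa> / 2 + 1))" using ad' by linarith
      moreover have "0 < ln H" using ad' by simp
      ultimately have "ln H \<le> exp (\<gamma> * \<alpha> * \<kappa> + ln (\<phi> (\<kappa> / 2 + 1)))" by (metis exp_le_cancel_iff exp_ln)
      then have "H \<le> E" unfolding E_def using ad' by (metis exp_le_cancel_iff exp_ln less_trans zero_less_one)
      \<comment> \<open>\<open>admissible\<close> does not make \<tau> positive, hence the case
        distinction; for negative \<tau> the left side is negative.\<close>
      then have "H * \<tau> \<le> E * \<kappa>"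
        using ad' \<kappa> \<tau> mult_mono[of H E \<tau> \<kappa>] mult_nonneg_nonneg[of E \<kappa>]
        by (cases "0 \<le> \<tau>") (auto simp: E_def intro: order_trans[OF mult_nonneg_nonpos])
      then show False using T0[of T] T ad' by simp
    qed
  qed simp
qed

text \<open>The two halves meet: the polynomial is bounded above for t in [T + H/2, T + H], and
  \<open>resonance\<close> is applied on this interval of length H/2. C and T0 do not depend on the
  primes, the weights, k or \<mu>, so both lower bounds can use the lemma; the last hypothesis is
  the length budget for products of k + 1 primes.\<close>

lemma resonance_bound:
  assumes \<gamma>: "0 < \<gamma>"
  obtains C T0 where "0 < C" "0 < T0"
    "\<And>T H \<tau> \<mu> Q w W c k. \<lbrakk>T0 \<le> T; admissible \<gamma> T H \<tau>; 0 \<le> \<mu>;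
       \<And>v. v \<in> {T - H..T + 2 * H} \<Longrightarrow> cmod (zeta (Complex (1 / 2) v)) \<le> exp \<mu>;
       Q \<subseteq> primes_upto (exp (\<alpha> * \<tau>)); 0 < W; 0 \<le> c;
       \<And>p. p \<in> Q \<Longrightarrow> 0 < w p \<and> (w p)\<^sup>2 \<le> W \<and> c * w p \<le> Re (fourier \<Phi> \<alpha>) * real p powr (- 1 / 2);
       real k * W < (\<Sum>p\<in>Q. (w p)\<^sup>2); 2 * (real k + 1) * \<alpha> * \<tau> \<le> exp (\<gamma> * \<alpha> * \<tau>) * (\<tau> / 2 + 1) / 2\<rbrakk>
     \<Longrightarrow> c * sqrt ((real k + 1) / (\<Sum>p\<in>Q. (w p)\<^sup>2)) * ((\<Sum>p\<in>Q. (w p)\<^sup>2) - real k * W)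
       \<le> 5 / 2 * (Re (fourier \<Phi> 0) * \<mu>) + C * \<tau>\<^sup>2"
proof -
  obtain K v1 where K: "0 \<le> K" "\<And>v w. v1 \<le> v \<Longrightarrow> g v \<le> w \<Longrightarrow>
      (LINT u|lborel. indicator {u. w \<le> \<bar>u\<bar>} u * cmod (\<Phi> (of_real u))) \<le> K * exp (- v)"
    using kernel_tail by blast
  obtain C1 where C1: "C1 > 0" "\<And>\<tau> H T t L \<mu> \<epsilon>0. \<lbrakk>1 \<le> \<tau>; 4 \<le> H; 1 \<le> T; T + H / 2 \<le> t; t \<le> T + H; 0 \<le> L;
     \<forall>l. L \<le> \<bar>l\<bar> \<longrightarrow> cmod (fourier \<Phi> l) \<le> exp (- (\<bar>l\<bar> * (\<tau> / 2 + 1)));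
     exp (L * (\<tau> / 2 + 1 / 2)) * (1 + L) \<le> \<tau> * (H / 2 - 1);
     ln T * (LINT v|lborel. indicator {v. \<tau> * H \<le> \<bar>v\<bar>} v * cmod (\<Phi> (of_real v))) \<le> K;
     0 \<le> \<mu>; 0 < \<epsilon>0;
     \<And>\<epsilon> v. 0 < \<epsilon> \<Longrightarrow> \<epsilon> < \<epsilon>0 \<Longrightarrow> T - H \<le> v \<Longrightarrow> v \<le> T + 2 * H \<Longrightarrow> cmod (zeta (Complex (1 / 2 + \<epsilon>) v)) \<le> exp (\<mu> + 1)\<rbrakk>
   \<Longrightarrow> (\<Sum>n<Suc (nat \<lfloor>exp (\<tau> * L)\<rfloor>). log_coeff n * Re (of_nat n powr (- Complex (1 / 2) t) * fourier \<Phi> (ln (real n) / \<tau>)))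
       \<le> Re (fourier \<Phi> 0) * \<mu> + C1 * \<tau>\<^sup>2"
    using dirichlet_polynomial_upper_bound[OF RH pos K(1)] by blast
  define B where "B = (LINT u|lborel. (1 + \<bar>u\<bar>) * cmod (\<Phi> (of_real u)))"
  have B0: "0 \<le> B" unfolding B_def by (intro integral_nonneg_AE) auto
  have "0 < \<gamma> * \<alpha>" using \<gamma> \<alpha> by simp
  from eventually_exp_large[OF this, of \<alpha>]
  obtain \<tau>1 where \<tau>1: "\<And>\<tau>. \<tau>1 \<le> \<tau> \<Longrightarrow> 20 \<le> exp (\<gamma> * \<alpha> * \<tau>) \<and> 8 * \<tau> \<le> exp (\<gamma> * \<alpha> * \<tau>) \<and>
      4 * (\<tau> / 2 + 1 / 2) \<le> exp (\<gamma> * \<alpha> * \<tau>) \<and> 1 \<le> \<tau> \<and> \<alpha> \<le> \<tau> / 2 + 1"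
    unfolding eventually_at_top_linorder by blast
  obtain T1 where T1: "0 < T1" "\<And>T H \<tau>. T1 \<le> T \<Longrightarrow> admissible \<gamma> T H \<tau> \<Longrightarrow> \<tau>1 \<le> \<tau>"
    using admissible_large[OF \<gamma>] by blast
  have "eventually (\<lambda>T::real. v1 \<le> ln (ln T)) at_top" by real_asymp
  then obtain T2 where T2: "\<And>T. T2 \<le> T \<Longrightarrow> v1 \<le> ln (ln T)"
    unfolding eventually_at_top_linorder by blast
  show thesis
  proof (rule that[of "5 / 2 * C1 + B / 2" "max (max T1 T2) 3"])
    fix T H \<tau> \<mu> :: real and Q w W c and k :: nat
    assume T: "max (max T1 T2) 3 \<le> T" and ad: "admissible \<gamma> T H \<tau>" and \<mu>: "0 \<le> \<mu>"
      and zb: "\<And>v. v \<in> {T - H..T + 2 * H} \<Longrightarrow> cmod (zeta (Complex (1 / 2) v)) \<le> exp \<mu>"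
      and Q: "Q \<subseteq> primes_upto (exp (\<alpha> * \<tau>))" and W: "0 < W" and c: "0 \<le> c"
      and w: "\<And>p. p \<in> Q \<Longrightarrow> 0 < w p \<and> (w p)\<^sup>2 \<le> W \<and> c * w p \<le> Re (fourier \<Phi> \<alpha>) * real p powr (- 1 / 2)"
      and kW: "real k * W < (\<Sum>p\<in>Q. (w p)\<^sup>2)"
      and size: "2 * (real k + 1) * \<alpha> * \<tau> \<le> exp (\<gamma> * \<alpha> * \<tau>) * (\<tau> / 2 + 1) / 2"
    define e where "e = exp (\<gamma> * \<alpha> * \<tau>)"
    define L where "L = \<phi> (\<tau> / 2 + 1)"
    have "\<tau>1 \<le> \<tau>" using T1(2)[OF _ ad] T by simp
    then have \<tau>: "20 \<le> e" "8 * \<tau> \<le> e" "4 * (\<tau> / 2 + 1 / 2) \<le> e" "1 \<le> \<tau>" "\<alpha> \<le> \<tau> / 2 + 1"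
      using \<tau>1 by (auto simp: e_def)
    have ad': "1 < H" "v0 \<le> \<tau> / 2 + 1" "\<gamma> * \<alpha> * \<tau> + ln L = ln (ln H)" "g (ln (ln T)) \<le> H * \<tau>"
      using ad by (auto simp: admissible_def L_def)
    have Lge: "\<tau> / 2 + 1 \<le> L" unfolding L_def using ad' by (intro \<phi>_ge)
    then have L1: "1 \<le> L" using \<tau> by linarith
    \<comment> \<open>The equation for \<tau>, exponentiated once; all lengths below are compared
      with exp (e L) = H.\<close>
    have lnH: "ln H = e * L"
    proof -
      have "0 < ln H" using ad' by simp
      then have "ln H = exp (\<gamma> * \<alpha> * \<tau> + ln L)" using ad' by simp
      also have "\<dots> = e * L" using L1 by (simp add: exp_add e_def)
      finally show ?thesis .
    qed
    then have Hexp: "H = exp (e * L)" using ad' by (metis exp_ln less_trans zero_less_one)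
    have eL: "20 \<le> e * L" using mult_mono[OF \<tau>(1) L1] \<tau> by simp
    have H16: "16 \<le> H"
    proof -
      have "16 \<le> 1 + e * L" using eL by simp
      also have "\<dots> \<le> H" unfolding Hexp by (rule exp_ge_add_one_self)
      finally show ?thesis .
    qed
    have tail: "\<forall>l. L \<le> \<bar>l\<bar> \<longrightarrow> cmod (fourier \<Phi> l) \<le> exp (- (\<bar>l\<bar> * (\<tau> / 2 + 1)))"
      unfolding L_def using fourier_tail ad' by blast
    \<comment> \<open>The left side is at most exp (e L / 2), the square root of H, because 1 + L <=
      exp L and both L (\<tau>/2 + 1/2) and L are at most e L / 4.\<close>
    have size1: "exp (L * (\<tau> / 2 + 1 / 2)) * (1 + L) \<le> \<tau> * (H / 2 - 1)"
    proof -
      have "L * (\<tau> / 2 + 1 / 2) \<le> L * (e / 4)" using \<tau> L1 by (intro mult_left_mono) auto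
      moreover have "L \<le> L * (e / 4)" using \<tau> L1 by (simp add: mult_le_cancel_left1)
      ultimately have "L * (\<tau> / 2 + 1 / 2) + L \<le> e * L / 2" by (simp add: field_simps)
      have "exp (L * (\<tau> / 2 + 1 / 2)) * (1 + L) \<le> exp (L * (\<tau> / 2 + 1 / 2)) * exp L"
        by (intro mult_left_mono exp_ge_add_one_self) auto
      also have "\<dots> = exp (L * (\<tau> / 2 + 1 / 2) + L)" by (simp add: exp_add)
      also have "\<dots> \<le> exp (e * L / 2)" using \<open>L * (\<tau> / 2 + 1 / 2) + L \<le> e * L / 2\<close> by simp
      also have "exp (e * L / 2) = sqrt H"
      proof -
        have "H = (exp (e * L / 2))\<^sup>2" unfolding Hexp by (simp add: exp_of_nat_mult[symmetric])
        then show ?thesis by simp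
      qed
      also have "sqrt H \<le> H / 2 - 1"
      proof -
        have s: "4 \<le> sqrt H" using H16 real_le_rsqrt[of 4 H] by simp
        have "4 * sqrt H \<le> sqrt H * sqrt H" using s H16 by (intro mult_right_mono) auto
        moreover have "sqrt H * sqrt H = H" using H16 by simp
        ultimately have "4 * sqrt H \<le> H" by simp
        then show ?thesis using s by simp
      qed
      also have "\<dots> \<le> \<tau> * (H / 2 - 1)" using \<tau> H16 by (simp add: mult_le_cancel_right1)
      finally show ?thesis .
    qed
    \<comment> \<open>With v = ln (ln T) the tail of the kernel is at most K / ln T, which cancels
      the factor ln T from the crude bound for zeta.\<close>
    have decay: "ln T * (LINT v|lborel. indicator {v. \<tau> * H \<le> \<bar>v\<bar>} v * cmod (\<Phi> (of_real v))) \<le> K"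
    proof -
      have "exp 1 \<le> T" using exp_le T by linarith
      then have lnT: "1 \<le> ln T" using T by (subst ln_ge_iff) auto
      have "(LINT v|lborel. indicator {v. \<tau> * H \<le> \<bar>v\<bar>} v * cmod (\<Phi> (of_real v))) \<le> K * exp (- ln (ln T))"
        using T2[of T] T ad' by (intro K(2)) (auto simp: mult.commute)
      also have "\<dots> = K / ln T" using lnT by (simp add: exp_minus inverse_eq_divide)
      finally show ?thesis using lnT by (simp add: field_simps)
    qed
    obtain \<epsilon>0 where e0: "0 < \<epsilon>0" "\<And>\<epsilon> v. 0 < \<epsilon> \<Longrightarrow> \<epsilon> < \<epsilon>0 \<Longrightarrow> v \<in> {T - H..T + 2 * H} \<Longrightarrow>
        cmod (zeta (Complex (1 / 2 + \<epsilon>) v)) \<le> exp (\<mu> + 1)"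
      using zeta_near_line_le[OF zb] by blast
    define N where "N = Suc (nat \<lfloor>exp (\<tau> * L)\<rfloor>)"
    define \<beta> where "\<beta> = (\<lambda>n. log_coeff n * (real n powr (- 1 / 2) * Re (fourier \<Phi> (ln (real n) / \<tau>))))"
    have V: "(\<Sum>n<N. \<beta> n * cos (t * ln (real n))) \<le> Re (fourier \<Phi> 0) * \<mu> + C1 * \<tau>\<^sup>2"
      if t: "T + H / 2 \<le> t" "t \<le> (T + H / 2) + H / 2" for t
    proof -
      have "(\<Sum>n<N. \<beta> n * cos (t * ln (real n))) =
          (\<Sum>n<N. log_coeff n * Re (of_nat n powr (- Complex (1 / 2) t) * fourier \<Phi> (ln (real n) / \<tau>)))"
      proof (intro sum.cong refl)
        fix n
        show "\<beta> n * cos (t * ln (real n)) = log_coeff n * Re (of_nat n powr (- Complex (1 / 2) t) * fourier \<Phi> (ln (real n) / \<tau>))"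
        proof (cases "n = 0")
          case False
          have "fourier \<Phi> (ln (real n) / \<tau>) = of_real (Re (fourier \<Phi> (ln (real n) / \<tau>)))"
            using real_fourier by simp
          then have "Re (of_nat n powr (- Complex (1 / 2) t) * fourier \<Phi> (ln (real n) / \<tau>)) =
              Re (of_nat n powr (- Complex (1 / 2) t)) * Re (fourier \<Phi> (ln (real n) / \<tau>))"
            by (metis Re_complex_of_real Im_complex_of_real mult_zero_right diff_zero times_complex.sel(1))
          also have "Re (of_nat n powr (- Complex (1 / 2) t)) = real n powr (- 1 / 2) * cos (t * ln (real n))"
            using False by (simp add: powr_def Ln_of_nat Re_exp)
          finally show ?thesis by (simp add: \<beta>_def)
        qed (simp add: \<beta>_def)
      qed
      also have "\<dots> \<le> Re (fourier \<Phi> 0) * \<mu> + C1 * \<tau>\<^sup>2"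
        unfolding N_def
      proof (rule C1(2)[OF \<tau>(4) _ _ t(1) _ _ tail size1 decay \<mu> e0(1)])
        show "4 \<le> H" "1 \<le> T" "t \<le> T + H" "0 \<le> L" using H16 T t L1 by auto
        fix \<epsilon> v assume "0 < \<epsilon>" "\<epsilon> < \<epsilon>0" "T - H \<le> v" "v \<le> T + 2 * H"
        then show "cmod (zeta (Complex (1 / 2 + \<epsilon>) v)) \<le> exp (\<mu> + 1)" by (intro e0(2)) auto
      qed
      finally show ?thesis .
    qed
    define X where "X = 2 * exp (\<tau> * L)"
    define y where "y = exp (\<alpha> * \<tau>)"
    have y1: "1 \<le> y" unfolding y_def using \<alpha> \<tau> by simp
    have "c * sqrt ((real k + 1) / (\<Sum>p\<in>Q. (w p)\<^sup>2)) * ((\<Sum>p\<in>Q. (w p)\<^sup>2) - real k * W)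
       \<le> 5 / 2 * (Re (fourier \<Phi> 0) * \<mu> + C1 * \<tau>\<^sup>2) + B / 2"
    proof (rule resonance[where \<beta> = \<beta> and y = y and X = X and N = N and A = "T + H / 2" and L = "H / 2"])
      show "finite Q" using Q finite_primes_upto finite_subset by blast
      fix p assume p: "p \<in> Q"
      then have pr: "prime p" "real p \<le> y" using Q by (auto simp: primes_upto_def y_def)
      have lnp: "0 \<le> ln (real p)" "ln (real p) \<le> \<alpha> * \<tau>"
      proof -
        have p1: "1 \<le> real p" using prime_gt_0_nat[OF pr(1)] by linarith
        then show "0 \<le> ln (real p)" by simp
        have "ln (real p) \<le> ln y" using pr p1 by (intro ln_mono) auto
        then show "ln (real p) \<le> \<alpha> * \<tau>" by (simp add: y_def)
      qed
      \<comment> \<open>The polynomial, cut at exp (\<tau> L), contains all primes up to y = exp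
        (\<alpha> \<tau>), because \<alpha> <= \<tau>/2 + 1 <= L.\<close>
      have "\<alpha> * \<tau> \<le> \<tau> * L" using \<tau> Lge by (simp add: mult.commute)
      then have "real p \<le> exp (\<tau> * L)" using pr(2) unfolding y_def by (meson exp_le_cancel_iff order_trans)
      then have "p < N" unfolding N_def by linarith
      then show "prime p \<and> real p \<le> y \<and> p < N" using pr by blast
      show "0 < w p \<and> (w p)\<^sup>2 \<le> W" using w[OF p] by blast
      have "c * w p \<le> Re (fourier \<Phi> \<alpha>) * real p powr (- 1 / 2)" using w[OF p] by blast
      also have "\<dots> \<le> Re (fourier \<Phi> (ln (real p) / \<tau>)) * real p powr (- 1 / 2)"
        using lnp \<tau> by (intro mult_right_mono fourier_ge) (auto simp: divide_le_eq)
      also have "\<dots> = \<beta> p" using pr by (simp add: \<beta>_def)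
      finally show "c * w p \<le> \<beta> p" .
    next
      fix n assume "n < N"
      show "\<bar>\<beta> n\<bar> \<le> B"
      proof (cases "n = 0")
        case False
        have "real n powr (- 1 / 2) \<le> real n powr 0" using False by (intro powr_mono) auto
        then have "real n powr (- 1 / 2) \<le> 1" using False by simp
        moreover have "\<bar>Re (fourier \<Phi> (ln (real n) / \<tau>))\<bar> \<le> B"
          unfolding B_def by (rule order_trans[OF abs_Re_le_cmod fourier_bound])
        ultimately have "\<bar>log_coeff n\<bar> * (\<bar>real n powr (- 1 / 2)\<bar> * \<bar>Re (fourier \<Phi> (ln (real n) / \<tau>))\<bar>) \<le> 1 * (1 * B)"
          using log_coeff_nonneg[of n] log_coeff_le_1[of n] by (intro mult_mono) auto
        then show ?thesis by (simp add: \<beta>_def abs_mult)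
      qed (simp add: \<beta>_def B0)
    next
      fix n :: nat assume "\<not> primepow n"
      then show "\<beta> n = 0" by (simp add: \<beta>_def log_coeff_def mangoldt_def)
    next
      have "real N \<le> exp (\<tau> * L) + 1" unfolding N_def by (simp add: of_nat_floor)
      moreover have "0 \<le> \<tau> * L" using L1 \<tau> by (intro mult_nonneg_nonneg) auto
      then have "1 \<le> exp (\<tau> * L)" by simp
      ultimately show "real N \<le> X" unfolding X_def by linarith
      show "1 \<le> N" by (simp add: N_def)
      \<comment> \<open>The length budget: of the exponent in H = exp (e L), one half goes to the
        square of the resonator's integers, a quarter to exp (2 \<tau> L), and the last quarter,
        worth at least exp 5 >= 64, to the constants.\<close>
      show "8 * (y ^ Suc k * X)\<^sup>2 \<le> H / 2"
      proof -
        have 1: "2 * (real k + 1) * \<alpha> * \<tau> \<le> e * L / 2"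
        proof -
          have "e * (\<tau> / 2 + 1) \<le> e * L" using Lge by (intro mult_left_mono) (auto simp: e_def)
          then have "e * (\<tau> / 2 + 1) / 2 \<le> e * L / 2" by (rule divide_right_mono) simp
          with size[folded e_def] show ?thesis by (rule order_trans)
        qed
        have 2: "2 * (\<tau> * L) \<le> e * L / 4" using mult_right_mono[OF \<tau>(2), of L] L1 by simp
        have "64 \<le> exp (5 :: real)"
        proof -
          have "(5/2::real) \<le> exp 1" using exp_lower_Taylor_quadratic[of 1] by simp
          then have "(5/2::real) ^ 5 \<le> exp 1 ^ 5" by (intro power_mono) auto
          also have "exp (1::real) ^ 5 = exp 5" by (simp add: exp_of_nat_mult[symmetric])
          finally show ?thesis by (simp add: power_divide eval_nat_numeral)
        qed
        moreover have "exp (5::real) \<le> exp (e * L / 4)" using eL by simp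
        ultimately have 64: "64 \<le> exp (e * L / 4)" by linarith
        have yk: "(y ^ Suc k)\<^sup>2 = exp (2 * (real k + 1) * \<alpha> * \<tau>)"
          by (simp add: y_def exp_of_nat_mult[symmetric] power_mult[symmetric] exp_add[symmetric] algebra_simps)
        have "8 * (y ^ Suc k * X)\<^sup>2 = 32 * ((y ^ Suc k)\<^sup>2 * exp (2 * (\<tau> * L)))"
          by (simp add: X_def power_mult_distrib exp_of_nat_mult[symmetric])
        also have "\<dots> \<le> 32 * (exp (e * L / 2) * exp (e * L / 4))"
          unfolding yk using 1 2 by (intro mult_left_mono mult_mono) auto
        also have "\<dots> = 64 * (exp (e * L / 2) * exp (e * L / 4)) / 2" by simp
        also have "\<dots> \<le> exp (e * L / 4) * (exp (e * L / 2) * exp (e * L / 4)) / 2"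
          using 64 by (intro divide_right_mono mult_right_mono) auto
        also have "\<dots> = H / 2" unfolding Hexp by (simp add: exp_add[symmetric])
        finally show ?thesis .
      qed
      show "0 \<le> Re (fourier \<Phi> 0) * \<mu> + C1 * \<tau>\<^sup>2" using fourier_pos \<mu> C1(1) by simp
    qed (use W c y1 V kW in auto)
    also have "\<dots> = 5 / 2 * (Re (fourier \<Phi> 0) * \<mu>) + (5 / 2 * C1 * \<tau>\<^sup>2 + B / 2)" by (simp add: algebra_simps)
    also have "5 / 2 * C1 * \<tau>\<^sup>2 + B / 2 \<le> (5 / 2 * C1 + B / 2) * \<tau>\<^sup>2"
    proof -
      have "1 \<le> \<tau>\<^sup>2" using \<tau> by (simp add: one_le_power)
      then have "B / 2 * 1 \<le> B / 2 * \<tau>\<^sup>2" using B0 by (intro mult_left_mono) auto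
      then show ?thesis by (simp add: algebra_simps)
    qed
    finally show "c * sqrt ((real k + 1) / (\<Sum>p\<in>Q. (w p)\<^sup>2)) * ((\<Sum>p\<in>Q. (w p)\<^sup>2) - real k * W)
       \<le> 5 / 2 * (Re (fourier \<Phi> 0) * \<mu>) + (5 / 2 * C1 + B / 2) * \<tau>\<^sup>2" by simp
  qed (use C1 B0 in auto)
qed

end

section \<open>Choice of primes and weights for \<open>mu_star\<close> and
  \<open>mu_star_star\<close>\<close>

lemma zeta_le_of_max_less:
  assumes "max_ln_abs_zeta_half a b < ereal \<mu>" "v \<in> {a..b}"
  shows "cmod (zeta (Complex (1 / 2) v)) \<le> exp \<mu>"
proof (cases "zeta (Complex (1 / 2) v) = 0")
  case False
  have "ln_abs_zeta_half v \<le> max_ln_abs_zeta_half a b"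
    unfolding max_ln_abs_zeta_half_def using assms(2) by (rule SUP_upper)
  then have "ln_abs_zeta_half v < ereal \<mu>" using assms(1) by (rule order_le_less_trans)
  then have "ln (cmod (zeta (Complex (1 / 2) v))) < \<mu>" using False by (simp add: ln_abs_zeta_half_def)
  then have "exp (ln (cmod (zeta (Complex (1 / 2) v)))) \<le> exp \<mu>" by simp
  then show ?thesis using False by simp
qed simp

lemma eventually_star:
  fixes \<alpha> a C :: real
  assumes \<alpha>: "0 < \<alpha>" and a: "0 < a" and C: "0 < C"
  shows "eventually (\<lambda>\<tau>. 1 \<le> \<tau> \<and> exp (\<alpha> * \<tau>) / 2 + 3 * (\<alpha> * \<tau>) \<le> exp (\<alpha> * \<tau>) * (\<tau> / 2 + 1) / 2 \<and>
     C * \<tau>\<^sup>2 < a * (exp (0.5 * (\<alpha> * \<tau>)) / \<tau>)) at_top"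
proof (intro eventually_conj)
  show "eventually (\<lambda>\<tau>. exp (\<alpha> * \<tau>) / 2 + 3 * (\<alpha> * \<tau>) \<le> exp (\<alpha> * \<tau>) * (\<tau> / 2 + 1) / 2) at_top"
    using \<alpha> by real_asymp
  show "eventually (\<lambda>\<tau>. C * \<tau>\<^sup>2 < a * (exp (0.5 * (\<alpha> * \<tau>)) / \<tau>)) at_top"
    using \<alpha> a C by real_asymp
qed (rule eventually_ge_at_top)

lemma eventually_star_star:
  fixes \<alpha> a b C :: real
  assumes \<alpha>: "0 < \<alpha>" and a: "0 < a" and b: "0 < b" and C: "0 < C"
  shows "eventually (\<lambda>\<tau>. 1 \<le> \<tau> \<and> exp (- 0.1 * (\<alpha> * \<tau>)) / (64 * \<alpha>) \<le> 1 / 32 \<and>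
     2 * (exp (0.5 * (\<alpha> * \<tau>)) / (64 * \<alpha>) + 1) * (\<alpha> * \<tau>) \<le> exp (0.5 * (\<alpha> * \<tau>)) * (\<tau> / 2 + 1) / 2 \<and>
     b * (exp (0.25 * (\<alpha> * \<tau>)) / sqrt \<tau>) + C * \<tau>\<^sup>2 < a * exp (0.25 * (\<alpha> * \<tau>))) at_top"
proof (intro eventually_conj)
  show "eventually (\<lambda>\<tau>. exp (- 0.1 * (\<alpha> * \<tau>)) / (64 * \<alpha>) \<le> 1 / 32) at_top"
    using \<alpha> by real_asymp
  show "eventually (\<lambda>\<tau>. 2 * (exp (0.5 * (\<alpha> * \<tau>)) / (64 * \<alpha>) + 1) * (\<alpha> * \<tau>) \<le> exp (0.5 * (\<alpha> * \<tau>)) * (\<tau> / 2 + 1) / 2) at_top"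
    using \<alpha> by real_asymp
  show "eventually (\<lambda>\<tau>. b * (exp (0.25 * (\<alpha> * \<tau>)) / sqrt \<tau>) + C * \<tau>\<^sup>2 < a * exp (0.25 * (\<alpha> * \<tau>))) at_top"
    using \<alpha> a b C by real_asymp
qed (rule eventually_ge_at_top)

text \<open>The crude ln x <= x at the square root of \<kappa> is enough for the constant in
  \<open>mu_star\<close>: 7.4^2 <= 61 and 2/7.4 <= 0.52^2.\<close>

lemma sqrt_ln_quotient_le:
  assumes "61 \<le> \<kappa>"
  shows "sqrt (ln \<kappa> / \<kappa>) \<le> 13 / 25"
proof -
  have s: "37 / 5 \<le> sqrt \<kappa>" using assms by (intro real_le_rsqrt) (simp add: power2_eq_square)
  have "ln \<kappa> = 2 * ln (sqrt \<kappa>)" using assms by (simp add: ln_sqrt)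
  also have "\<dots> \<le> 2 * sqrt \<kappa>" using ln_le_minus_one[of "sqrt \<kappa>"] assms by simp
  finally have "ln \<kappa> / \<kappa> \<le> 2 * sqrt \<kappa> / (sqrt \<kappa> * sqrt \<kappa>)" using assms by (simp add: divide_right_mono)
  also have "\<dots> = 2 / sqrt \<kappa>" using s assms by (simp del: real_sqrt_mult_self)
  also have "\<dots> \<le> 2 / (37 / 5)" using s assms by (intro divide_left_mono) auto
  also have "\<dots> \<le> (13 / 25)\<^sup>2" by (simp add: power2_eq_square)
  finally show ?thesis by (intro real_le_lsqrt) auto
qed

context large_value_kernel
begin

text \<open>Equal weights on q primes, about y / (2 \<alpha> \<tau>) of those up to y =
  \<open>E\<^sup>2\<close>, with c = D / E because p powr (- 1/2) >= 1/E, and k about q/2. Writing P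
  for D E / (\<alpha> \<tau>), the resonance is at least 7/40 P, whereas 5/2 m \<mu> is at most
  13/100 P; the gap 9/200 P exceeds C \<open>\<tau>\<^sup>2\<close> for large \<tau>.\<close>

lemma mu_star_lower_bound:
  "\<exists>T0>0. \<forall>T\<ge>T0. \<forall>H \<tau>. admissible 1 T H \<tau> \<longrightarrow>
     ereal (mu_star \<Phi> \<alpha> \<tau>) \<le> max_ln_abs_zeta_half (T - H) (T + 2 * H)"
proof -
  define D where "D = Re (fourier \<Phi> \<alpha>)"
  define m where "m = Re (fourier \<Phi> 0)"
  have D: "0 < D" and m: "0 < m" using fourier_pos by (auto simp: D_def m_def)
  obtain C T0 where C: "0 < C" "0 < T0" and res: "\<And>T H \<tau> \<mu> Q w W c k. \<lbrakk>T0 \<le> T; admissible 1 T H \<tau>; 0 \<le> \<mu>;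
       \<And>v. v \<in> {T - H..T + 2 * H} \<Longrightarrow> cmod (zeta (Complex (1 / 2) v)) \<le> exp \<mu>;
       Q \<subseteq> primes_upto (exp (\<alpha> * \<tau>)); 0 < W; 0 \<le> c;
       \<And>p. p \<in> Q \<Longrightarrow> 0 < w p \<and> (w p)\<^sup>2 \<le> W \<and> c * w p \<le> D * real p powr (- 1 / 2);
       real k * W < (\<Sum>p\<in>Q. (w p)\<^sup>2); 2 * (real k + 1) * \<alpha> * \<tau> \<le> exp (1 * \<alpha> * \<tau>) * (\<tau> / 2 + 1) / 2\<rbrakk>
     \<Longrightarrow> c * sqrt ((real k + 1) / (\<Sum>p\<in>Q. (w p)\<^sup>2)) * ((\<Sum>p\<in>Q. (w p)\<^sup>2) - real k * W)
       \<le> 5 / 2 * (m * \<mu>) + C * \<tau>\<^sup>2"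
    unfolding D_def m_def by (rule resonance_bound[OF zero_less_one]) blast
  have expinf: "filterlim (\<lambda>\<tau>. exp (\<alpha> * \<tau>)) at_top at_top" using \<alpha> by real_asymp
  have a: "0 < 9 / 200 * D / \<alpha>" using D \<alpha> by simp
  have ev: "eventually (\<lambda>\<tau>. exp (\<alpha> * \<tau>) / 2 \<le> real (card (primes_upto (exp (\<alpha> * \<tau>)))) * ln (exp (\<alpha> * \<tau>))) at_top"
    using expinf card_primes_upto_ge by (rule eventually_compose_filterlim[rotated])
  obtain \<tau>1 where \<tau>1: "\<forall>\<tau>\<ge>\<tau>1. (1 \<le> \<tau> \<and> exp (\<alpha> * \<tau>) / 2 + 3 * (\<alpha> * \<tau>) \<le> exp (\<alpha> * \<tau>) * (\<tau> / 2 + 1) / 2 \<and>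
     C * \<tau>\<^sup>2 < 9 / 200 * D / \<alpha> * (exp (0.5 * (\<alpha> * \<tau>)) / \<tau>)) \<and> exp (\<alpha> * \<tau>) / 2 \<le> real (card (primes_upto (exp (\<alpha> * \<tau>)))) * ln (exp (\<alpha> * \<tau>))"
    using eventually_conj[OF eventually_star[OF \<alpha> a C(1)] ev] unfolding eventually_at_top_linorder
    by - (erule exE, erule that)
  obtain T1 where "0 < T1" and T1: "\<And>T H \<tau>. T1 \<le> T \<Longrightarrow> admissible 1 T H \<tau> \<Longrightarrow> \<tau>1 \<le> \<tau>"
    by (rule admissible_large[OF zero_less_one, where K = \<tau>1]) blast
  show ?thesis
  proof (intro exI[of _ "max T0 T1"] conjI allI impI)
    fix T H \<tau> assume T: "max T0 T1 \<le> T" and ad: "admissible 1 T H \<tau>"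
    define \<mu> where "\<mu> = mu_star \<Phi> \<alpha> \<tau>"
    define E where "E = exp (0.5 * (\<alpha> * \<tau>))"
    define y where "y = exp (\<alpha> * \<tau>)"
    have "\<tau>1 \<le> \<tau>" using T1[OF _ ad] T by simp
    then have \<tau>: "1 \<le> \<tau>" "y / 2 + 3 * (\<alpha> * \<tau>) \<le> y * (\<tau> / 2 + 1) / 2" "C * \<tau>\<^sup>2 < 9 / 200 * D / \<alpha> * (E / \<tau>)"
      "y / 2 \<le> real (card (primes_upto y)) * (\<alpha> * \<tau>)"
      using \<tau>1[rule_format, of \<tau>] by (simp_all add: E_def y_def)
    have at: "0 < \<alpha> * \<tau>" using \<alpha> \<tau> by simp
    have yE: "y = E * E" "0 < E" "0 < y" by (auto simp: E_def y_def exp_add[symmetric])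
    define s where "s = sqrt (ln (max 61 (4 / \<alpha>)) / max 61 (4 / \<alpha>))"
    have s: "0 \<le> s" "s \<le> 13 / 25" using sqrt_ln_quotient_le[of "max 61 (4 / \<alpha>)"] by (simp_all add: s_def)
    have m\<mu>: "m * \<mu> = 1 / 10 * s * (D * E / (\<alpha> * \<tau>))"
      using m \<alpha> \<tau> by (simp add: \<mu>_def mu_star_def Let_def m_def D_def s_def E_def field_simps)
    have DE: "0 < D * E / (\<alpha> * \<tau>)" using D yE at by simp
    have "0 \<le> m * \<mu>" unfolding m\<mu> using s DE by (intro mult_nonneg_nonneg) auto
    then have \<mu>0: "0 \<le> \<mu>" using m by (simp add: zero_le_mult_iff)
    have m\<mu>_le: "m * \<mu> \<le> 13 / 250 * (D * E / (\<alpha> * \<tau>))"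
      unfolding m\<mu> using s DE by (intro mult_right_mono) auto
    show "ereal (mu_star \<Phi> \<alpha> \<tau>) \<le> max_ln_abs_zeta_half (T - H) (T + 2 * H)"
    proof (rule ccontr)
      assume "\<not> ?thesis"
      then have less: "max_ln_abs_zeta_half (T - H) (T + 2 * H) < ereal \<mu>" by (simp add: \<mu>_def)
      \<comment> \<open>A prescribed number of primes instead of all up to y: the lower Chebyshev
        bound provides them, and the fixed number keeps k within the length budget.\<close>
      define q where "q = nat \<lceil>y / (2 * (\<alpha> * \<tau>))\<rceil>"
      have q: "y / (2 * (\<alpha> * \<tau>)) \<le> real q" "real q \<le> y / (2 * (\<alpha> * \<tau>)) + 1"
        using yE at by (auto simp: q_def)
      have q0: "0 < real q" using q(1) yE at by (intro less_le_trans[OF _ q(1)]) auto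
      have "y / (2 * (\<alpha> * \<tau>)) \<le> real (card (primes_upto y))" using \<tau>(4) at by (simp add: field_simps)
      then have "q \<le> card (primes_upto y)" unfolding q_def by (simp add: ceiling_le_iff nat_le_iff)
      then obtain Q where Q: "Q \<subseteq> primes_upto y" "card Q = q" using obtain_subset_with_card_n by metis
      \<comment> \<open>sqrt k (q - k) is largest at k = q/3; halving is simpler and loses
        little.\<close>
      define k where "k = q div 2"
      have "q = 2 * k \<or> q = 2 * k + 1" unfolding k_def by presburger
      then have kr: "2 * real k \<le> real q" "real q \<le> 2 * (real k + 1)" by auto
      have e1: "(\<Sum>p\<in>Q. (1::real)\<^sup>2) = real q" using Q by simp
      have "D / E * sqrt ((real k + 1) / (\<Sum>p\<in>Q. (1::real)\<^sup>2)) * ((\<Sum>p\<in>Q. (1::real)\<^sup>2) - real k * 1) \<le> 5 / 2 * (m * \<mu>) + C * \<tau>\<^sup>2"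
      proof (rule res[OF _ ad \<mu>0])
        show "T0 \<le> T" using T by simp
        show "cmod (zeta (Complex (1 / 2) v)) \<le> exp \<mu>" if "v \<in> {T - H..T + 2 * H}" for v
          by (rule zeta_le_of_max_less[OF less that])
        show "Q \<subseteq> primes_upto (exp (\<alpha> * \<tau>))" using Q by (simp add: y_def)
        show "0 \<le> D / E" using D yE by simp
        show "real k * 1 < (\<Sum>p\<in>Q. (1::real)\<^sup>2)" unfolding e1 using kr q0 by linarith
        show "0 < (1::real) \<and> (1::real)\<^sup>2 \<le> 1 \<and> D / E * 1 \<le> D * real p powr (- 1 / 2)" if "p \<in> Q" for p
        proof -
          have p: "prime p" "real p \<le> y" using that Q by (auto simp: primes_upto_def)
          then have p0: "0 < real p" using prime_gt_0_nat by simp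
          have "1 / E = y powr (- 1 / 2)"
            unfolding y_def E_def by (simp add: powr_def exp_minus inverse_eq_divide)
          also have "\<dots> \<le> real p powr (- 1 / 2)" using p p0 by (intro powr_mono2') auto
          finally show ?thesis using mult_left_mono[of "1 / E" "real p powr (- 1 / 2)" D] D by simp
        qed
        have "2 * (real k + 1) * (\<alpha> * \<tau>) \<le> (y / (2 * (\<alpha> * \<tau>)) + 3) * (\<alpha> * \<tau>)"
          using kr q at by (intro mult_right_mono) auto
        also have "\<dots> = y / 2 + 3 * (\<alpha> * \<tau>)" using \<alpha> \<tau>(1) by (simp add: field_simps)
        finally have "2 * (real k + 1) * (\<alpha> * \<tau>) \<le> y * (\<tau> / 2 + 1) / 2" using \<tau>(2) by linarith
        then show "2 * (real k + 1) * \<alpha> * \<tau> \<le> exp (1 * \<alpha> * \<tau>) * (\<tau> / 2 + 1) / 2"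
          by (simp add: y_def mult.assoc)
      qed simp
      moreover have "7 / 40 * (D * E / (\<alpha> * \<tau>)) \<le> D / E * sqrt ((real k + 1) / real q) * (real q - real k * 1)"
      proof -
        have "7 / 10 \<le> sqrt ((real k + 1) / real q)"
        proof (rule real_le_rsqrt)
          have "1 / 2 \<le> (real k + 1) / real q" using kr q0 by (simp add: field_simps)
          moreover have "(7 / 10)\<^sup>2 \<le> (1 / 2 :: real)" by (simp add: power2_eq_square)
          ultimately show "(7 / 10)\<^sup>2 \<le> (real k + 1) / real q" by linarith
        qed
        moreover have "y / (2 * (\<alpha> * \<tau>)) / 2 \<le> real q - real k * 1"
        proof -
          have "y / (2 * (\<alpha> * \<tau>)) / 2 \<le> real q / 2" using q(1) by (rule divide_right_mono) simp
          also have "\<dots> \<le> real q - real k * 1" using kr by simp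
          finally show ?thesis .
        qed
        ultimately have "D / E * (7 / 10) * (y / (2 * (\<alpha> * \<tau>)) / 2) \<le> D / E * sqrt ((real k + 1) / real q) * (real q - real k * 1)"
          using D yE at by (intro mult_mono mult_left_mono) auto
        moreover have "D / E * (7 / 10) * (y / (2 * (\<alpha> * \<tau>)) / 2) = 7 / 40 * (D * E / (\<alpha> * \<tau>))"
          unfolding yE(1) using yE(2) at by (simp add: field_simps)
        ultimately show ?thesis by simp
      qed
      ultimately have "7 / 40 * (D * E / (\<alpha> * \<tau>)) \<le> 5 / 2 * (m * \<mu>) + C * \<tau>\<^sup>2" unfolding e1 by linarith
      moreover have "9 / 200 * D / \<alpha> * (E / \<tau>) = 9 / 200 * (D * E / (\<alpha> * \<tau>))" by simp
      ultimately show False using m\<mu>_le \<tau>(3) by linarith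
    qed
  qed (use C in auto)
qed

text \<open>The weights p powr (- 1/2) on the primes from y powr (3/5) to y allow c = D. Their
  squares sum to e1 >= 1/16 and are at most W = y powr (- 3/5), so k of order sqrt y costs at most
  half of e1. The resonance is then at least D E / (64 sqrt \<alpha>) with E = y powr (1/4), which
  exceeds the wanted multiple of E / sqrt \<tau> by a factor of order sqrt \<tau>.\<close>

lemma mu_star_star_lower_bound:
  "\<exists>T0>0. \<forall>T\<ge>T0. \<forall>H \<tau>. admissible (1 / 2) T H \<tau> \<longrightarrow>
     ereal (mu_star_star \<Phi> \<alpha> \<tau>) \<le> max_ln_abs_zeta_half (T - H) (T + 2 * H)"
proof -
  define D where "D = Re (fourier \<Phi> \<alpha>)"
  define m where "m = Re (fourier \<Phi> 0)"
  define \<kappa> where "\<kappa> = max 0.5 (4 / \<alpha>)"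
  define b where "b = D / (6 * sqrt (\<alpha> * \<kappa>))"
  have D: "0 < D" and m: "0 < m" using fourier_pos by (auto simp: D_def m_def)
  have "0 < \<kappa>" by (simp add: \<kappa>_def)
  then have b: "0 < b" using D \<alpha> by (simp add: b_def)
  have half: "0 < (1 / 2 :: real)" by simp
  obtain C T0 where C: "0 < C" "0 < T0" and res: "\<And>T H \<tau> \<mu> Q w W c k. \<lbrakk>T0 \<le> T; admissible (1 / 2) T H \<tau>; 0 \<le> \<mu>;
       \<And>v. v \<in> {T - H..T + 2 * H} \<Longrightarrow> cmod (zeta (Complex (1 / 2) v)) \<le> exp \<mu>;
       Q \<subseteq> primes_upto (exp (\<alpha> * \<tau>)); 0 < W; 0 \<le> c;
       \<And>p. p \<in> Q \<Longrightarrow> 0 < w p \<and> (w p)\<^sup>2 \<le> W \<and> c * w p \<le> D * real p powr (- 1 / 2);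
       real k * W < (\<Sum>p\<in>Q. (w p)\<^sup>2); 2 * (real k + 1) * \<alpha> * \<tau> \<le> exp (1 / 2 * \<alpha> * \<tau>) * (\<tau> / 2 + 1) / 2\<rbrakk>
     \<Longrightarrow> c * sqrt ((real k + 1) / (\<Sum>p\<in>Q. (w p)\<^sup>2)) * ((\<Sum>p\<in>Q. (w p)\<^sup>2) - real k * W)
       \<le> 5 / 2 * (m * \<mu>) + C * \<tau>\<^sup>2"
    unfolding D_def m_def by (rule resonance_bound[OF half]) blast
  have expinf: "filterlim (\<lambda>\<tau>. exp (\<alpha> * \<tau>)) at_top at_top" using \<alpha> by real_asymp
  have ev: "eventually (\<lambda>\<tau>. 1 / 16 \<le> (\<Sum>p\<in>primes_upto (exp (\<alpha> * \<tau>)) - primes_upto (exp (\<alpha> * \<tau>) powr (3/5)). 1 / real p)) at_top"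
    using expinf sum_inverse_primes_ge by (rule eventually_compose_filterlim[rotated])
  have a: "0 < D / (64 * sqrt \<alpha>)" and b': "0 < 5 / 2 * b" using D \<alpha> b by auto
  obtain \<tau>1 where \<tau>1: "\<forall>\<tau>\<ge>\<tau>1. (1 \<le> \<tau> \<and> exp (- 0.1 * (\<alpha> * \<tau>)) / (64 * \<alpha>) \<le> 1 / 32 \<and>
     2 * (exp (0.5 * (\<alpha> * \<tau>)) / (64 * \<alpha>) + 1) * (\<alpha> * \<tau>) \<le> exp (0.5 * (\<alpha> * \<tau>)) * (\<tau> / 2 + 1) / 2 \<and>
     5 / 2 * b * (exp (0.25 * (\<alpha> * \<tau>)) / sqrt \<tau>) + C * \<tau>\<^sup>2 < D / (64 * sqrt \<alpha>) * exp (0.25 * (\<alpha> * \<tau>))) \<and>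
     1 / 16 \<le> (\<Sum>p\<in>primes_upto (exp (\<alpha> * \<tau>)) - primes_upto (exp (\<alpha> * \<tau>) powr (3/5)). 1 / real p)"
    using eventually_conj[OF eventually_star_star[OF \<alpha> a b' C(1)] ev] unfolding eventually_at_top_linorder
    by - (erule exE, erule that)
  obtain T1 where "0 < T1" and T1: "\<And>T H \<tau>. T1 \<le> T \<Longrightarrow> admissible (1 / 2) T H \<tau> \<Longrightarrow> \<tau>1 \<le> \<tau>"
    by (rule admissible_large[OF half, where K = \<tau>1]) blast
  show ?thesis
  proof (intro exI[of _ "max T0 T1"] conjI allI impI)
    fix T H \<tau> assume T: "max T0 T1 \<le> T" and ad: "admissible (1 / 2) T H \<tau>"
    define \<mu> where "\<mu> = mu_star_star \<Phi> \<alpha> \<tau>"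
    define E where "E = exp (0.25 * (\<alpha> * \<tau>))"
    define y where "y = exp (\<alpha> * \<tau>)"
    define Q where "Q = primes_upto y - primes_upto (y powr (3/5))"
    define e1 where "e1 = (\<Sum>p\<in>Q. 1 / real p)"
    have EE: "exp (0.5 * (\<alpha> * \<tau>)) = E\<^sup>2" "0 < E" by (auto simp: E_def exp_of_nat_mult[symmetric])
    have "\<tau>1 \<le> \<tau>" using T1[OF _ ad] T by simp
    then have \<tau>: "1 \<le> \<tau>" "exp (- 0.1 * (\<alpha> * \<tau>)) / (64 * \<alpha>) \<le> 1 / 32"
      "2 * (E\<^sup>2 / (64 * \<alpha>) + 1) * (\<alpha> * \<tau>) \<le> E\<^sup>2 * (\<tau> / 2 + 1) / 2"
      "5 / 2 * b * (E / sqrt \<tau>) + C * \<tau>\<^sup>2 < D / (64 * sqrt \<alpha>) * E" "1 / 16 \<le> e1"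
      using \<tau>1[rule_format, of \<tau>] unfolding EE(1) y_def[symmetric] E_def[symmetric] Q_def[symmetric] e1_def[symmetric] by auto
    have m\<mu>: "m * \<mu> = b * (E / sqrt \<tau>)"
      using m by (simp add: \<mu>_def mu_star_star_def Let_def m_def D_def b_def \<kappa>_def E_def field_simps)
    have "0 \<le> m * \<mu>" unfolding m\<mu> using b EE \<tau> by simp
    then have \<mu>0: "0 \<le> \<mu>" using m by (simp add: zero_le_mult_iff)
    show "ereal (mu_star_star \<Phi> \<alpha> \<tau>) \<le> max_ln_abs_zeta_half (T - H) (T + 2 * H)"
    proof (rule ccontr)
      assume "\<not> ?thesis"
      then have less: "max_ln_abs_zeta_half (T - H) (T + 2 * H) < ereal \<mu>" by (simp add: \<mu>_def)
      \<comment> \<open>The 64 fits the length budget with room to spare and makes 64 * 16 = 32^2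
        under the root below.\<close>
      define k where "k = nat \<lfloor>E\<^sup>2 / (64 * \<alpha>)\<rfloor>"
      define W where "W = exp (- 0.6 * (\<alpha> * \<tau>))"
      have Ea: "0 \<le> E\<^sup>2 / (64 * \<alpha>)" using \<alpha> by simp
      have k: "real k \<le> E\<^sup>2 / (64 * \<alpha>)" "E\<^sup>2 / (64 * \<alpha>) \<le> real k + 1"
        unfolding k_def using Ea by (auto intro: of_nat_floor)
      \<comment> \<open>The loss has order y powr (1/2 - 3/5); any exponent above 1/2 as lower cut
        of Q would make it tend to 0.\<close>
      have "real k * W \<le> E\<^sup>2 / (64 * \<alpha>) * W" using k by (intro mult_right_mono) (auto simp: W_def)
      also have "\<dots> = exp (- 0.1 * (\<alpha> * \<tau>)) / (64 * \<alpha>)"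
        unfolding EE(1)[symmetric] W_def by (simp add: exp_add[symmetric])
      finally have kW: "real k * W \<le> e1 / 2" using \<tau> by linarith
      have wp: "(real p powr (- 1 / 2))\<^sup>2 = 1 / real p" if "p \<in> Q" for p
      proof -
        have "0 < real p" using that prime_gt_0_nat by (auto simp: Q_def primes_upto_def)
        then have "real p powr (- 1 / 2) * real p powr (- 1 / 2) = real p powr (- 1)"
          by (simp only: powr_add[symmetric]) simp
        then show ?thesis using \<open>0 < real p\<close> by (simp add: power2_eq_square powr_minus inverse_eq_divide)
      qed
      have sq: "(\<Sum>p\<in>Q. (real p powr (- 1 / 2))\<^sup>2) = e1"
        unfolding e1_def by (intro sum.cong refl wp)
      have "D * sqrt ((real k + 1) / (\<Sum>p\<in>Q. (real p powr (- 1 / 2))\<^sup>2)) * ((\<Sum>p\<in>Q. (real p powr (- 1 / 2))\<^sup>2) - real k * W)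
         \<le> 5 / 2 * (m * \<mu>) + C * \<tau>\<^sup>2"
      proof (rule res[OF _ ad \<mu>0])
        show "T0 \<le> T" using T by simp
        show "cmod (zeta (Complex (1 / 2) v)) \<le> exp \<mu>" if "v \<in> {T - H..T + 2 * H}" for v
          by (rule zeta_le_of_max_less[OF less that])
        show "Q \<subseteq> primes_upto (exp (\<alpha> * \<tau>))" by (auto simp: Q_def y_def)
        show "0 \<le> D" "0 < W" using D by (auto simp: W_def)
        show "real k * W < (\<Sum>p\<in>Q. (real p powr (- 1 / 2))\<^sup>2)" unfolding sq using kW \<tau> by linarith
        show "0 < real p powr (- 1 / 2) \<and> (real p powr (- 1 / 2))\<^sup>2 \<le> W \<and>
            D * real p powr (- 1 / 2) \<le> D * real p powr (- 1 / 2)" if p: "p \<in> Q" for p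
        proof -
          have "prime p" "y powr (3/5) < real p" using p by (auto simp: Q_def primes_upto_def)
          then have p0: "0 < real p" and "1 / real p \<le> 1 / y powr (3/5)"
            using prime_gt_0_nat by (auto intro!: divide_left_mono simp: y_def)
          moreover have "1 / y powr (3/5) = W" by (simp add: y_def W_def powr_def exp_minus inverse_eq_divide)
          ultimately show ?thesis using wp[OF p] by simp
        qed
        have "2 * (real k + 1) * (\<alpha> * \<tau>) \<le> 2 * (E\<^sup>2 / (64 * \<alpha>) + 1) * (\<alpha> * \<tau>)"
          using k \<alpha> \<tau> by (intro mult_right_mono) auto
        also note \<tau>(3)
        also have "E\<^sup>2 = exp (1 / 2 * \<alpha> * \<tau>)" unfolding EE(1)[symmetric] by (simp add: mult.assoc)
        finally show "2 * (real k + 1) * \<alpha> * \<tau> \<le> exp (1 / 2 * \<alpha> * \<tau>) * (\<tau> / 2 + 1) / 2"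
          by (simp add: mult.assoc)
      qed
      moreover have "D / (64 * sqrt \<alpha>) * E \<le> D * sqrt ((real k + 1) / e1) * (e1 - real k * W)"
      proof -
        have e1: "0 < e1" using \<tau> by linarith
        have "E / (32 * sqrt \<alpha>) = sqrt (E\<^sup>2 / (64 * \<alpha>) * (1 / 16))"
        proof -
          have "sqrt (1024 :: real) = 32" using real_sqrt_unique[of 32 1024] by simp
          then show ?thesis using EE(2) by (simp add: real_sqrt_divide real_sqrt_mult)
        qed
        also have "\<dots> \<le> sqrt ((real k + 1) * e1)"
          using k \<tau> Ea by (intro real_sqrt_le_mono mult_mono) auto
        also have "\<dots> = sqrt ((real k + 1) / e1 * (e1 * e1))" using e1 by simp
        also have "\<dots> = sqrt ((real k + 1) / e1) * e1" using e1 by (simp only: real_sqrt_mult real_sqrt_abs2) simp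
        finally have "E / (32 * sqrt \<alpha>) \<le> sqrt ((real k + 1) / e1) * e1" .
        then have "D * (E / (32 * sqrt \<alpha>)) \<le> D * (sqrt ((real k + 1) / e1) * e1)" using D by (intro mult_left_mono) auto
        moreover have "D * sqrt ((real k + 1) / e1) * (e1 / 2) \<le> D * sqrt ((real k + 1) / e1) * (e1 - real k * W)"
          using kW D e1 by (intro mult_left_mono) auto
        ultimately show ?thesis by simp
      qed
      ultimately have "D / (64 * sqrt \<alpha>) * E \<le> 5 / 2 * (m * \<mu>) + C * \<tau>\<^sup>2" unfolding sq by linarith
      then show False using \<tau>(4) unfolding m\<mu> by simp
    qed
  qed (use C in auto)
qed

end

subsection \<open>Consequences of the hypotheses on the kernel\<close>

text \<open>Continuity of \<phi> has to be derived: \<phi> is monotone and, being inverse to F,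
  takes every value above \<phi> v0. The left side of the equation is then continuous, strictly
  increasing and unbounded, so the intermediate value theorem gives exactly one root for large
  H.\<close>

lemma unique_root:
  fixes \<alpha> v0 lam0 :: real and F \<phi> :: "real \<Rightarrow> real"
  assumes \<alpha>: "0 < \<alpha>" and lam0: "0 < lam0" and F: "strict_mono_on {lam0..} F"
    and inv: "\<forall>v\<ge>v0. lam0 \<le> \<phi> v \<and> F (\<phi> v) = v" and \<phi>: "strict_mono_on {v0..} \<phi>"
  shows "\<exists>H0>1. \<forall>H\<ge>H0. \<exists>!\<tau>. v0 \<le> \<tau> / 2 + 1 \<and> \<alpha> * \<tau> + ln (\<phi> (\<tau> / 2 + 1)) = ln (ln H)"
proof -
  \<comment> \<open>Continuing \<phi> below v0 with slope 1 gives a monotone surjection of the real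
    line, which is automatically continuous.\<close>
  define \<psi> where "\<psi> = (\<lambda>v. if v0 \<le> v then \<phi> v else \<phi> v0 + (v - v0))"
  have le: "\<phi> v \<le> \<phi> w" if "v0 \<le> v" "v \<le> w" for v w
    using strict_mono_onD[OF \<phi>, of v w] that by (cases "v = w") auto
  have "\<exists>v. \<psi> v = x" for x
  proof (cases "\<phi> v0 \<le> x")
    case True
    have l: "lam0 \<le> \<phi> v0" "F (\<phi> v0) = v0" using inv by auto
    have "v0 \<le> F x"
      using strict_mono_onD[OF F, of "\<phi> v0" x] True l by (cases "\<phi> v0 = x") auto
    then have "F (\<phi> (F x)) = F x" "\<phi> (F x) \<in> {lam0..}" using inv by blast+
    moreover have "x \<in> {lam0..}" using l True by simp
    ultimately have "\<phi> (F x) = x" using strict_mono_on_imp_inj_on[OF F] inj_onD by metis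
    then show ?thesis using \<open>v0 \<le> F x\<close> by (intro exI[of _ "F x"]) (simp add: \<psi>_def)
  next
    case False
    then show ?thesis by (intro exI[of _ "v0 + (x - \<phi> v0)"]) (simp add: \<psi>_def)
  qed
  then have "range \<psi> = UNIV" by (metis surj_def)
  moreover have "\<psi> v \<le> \<psi> w" if "v \<le> w" for v w
    using that le[of v w] le[of v0 w] by (auto simp: \<psi>_def)
  ultimately have cont: "continuous_on UNIV \<psi>" by (intro continuous_onI_mono) auto
  define a where "a = 2 * (v0 - 1)"
  define h where "h = (\<lambda>\<tau>. \<alpha> * \<tau> + ln (\<psi> (\<tau> / 2 + 1)))"
  have mem: "v0 \<le> \<tau> / 2 + 1 \<longleftrightarrow> a \<le> \<tau>" for \<tau> by (auto simp: a_def)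
  have \<psi>: "\<psi> (\<tau> / 2 + 1) = \<phi> (\<tau> / 2 + 1)" "lam0 \<le> \<psi> (\<tau> / 2 + 1)" if "a \<le> \<tau>" for \<tau>
    using that inv mem[of \<tau>] by (auto simp: \<psi>_def)
  have h_less: "h s < h t" if "a \<le> s" "s < t" for s t
  proof -
    have "ln (\<psi> (s / 2 + 1)) \<le> ln (\<psi> (t / 2 + 1))"
      using \<psi>[of s] \<psi>[of t] that le[of "s / 2 + 1" "t / 2 + 1"] lam0 mem[of s] by (intro ln_mono) auto
    then show ?thesis using that \<alpha> by (simp add: h_def add_less_le_mono)
  qed
  have h_cont: "continuous_on {a..b} h" for b
  proof -
    have "continuous_on {a..b} (\<lambda>\<tau>. \<psi> (\<tau> / 2 + 1))"
      by (rule continuous_on_compose2[OF cont]) (auto intro!: continuous_intros)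
    moreover have "\<psi> (\<tau> / 2 + 1) \<noteq> 0" if "\<tau> \<in> {a..b}" for \<tau>
      using \<psi>(2)[of \<tau>] that lam0 by auto
    ultimately show ?thesis unfolding h_def
      by (intro continuous_on_add continuous_on_ln continuous_on_mult continuous_on_const continuous_on_id) auto
  qed
  show ?thesis
  proof (intro exI[of _ "exp (exp (h a))"] conjI allI impI)
    fix H assume H: "exp (exp (h a)) \<le> H"
    have "exp (h a) \<le> ln H" using H by (metis exp_gt_zero ln_exp ln_mono)
    then have ha: "h a \<le> ln (ln H)" by (metis exp_gt_zero ln_exp ln_mono)
    define b where "b = max a ((ln (ln H) - ln lam0) / \<alpha>)"
    have "ln (ln H) - ln lam0 = \<alpha> * ((ln (ln H) - ln lam0) / \<alpha>)" using \<alpha> by simp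
    also have "\<dots> \<le> \<alpha> * b" using \<alpha> by (intro mult_left_mono) (auto simp: b_def)
    finally have "ln (ln H) \<le> \<alpha> * b + ln lam0" by simp
    also have "\<dots> \<le> h b" unfolding h_def using \<psi>(2)[of b] lam0 by (intro add_left_mono ln_mono) (auto simp: b_def)
    finally obtain \<tau> where \<tau>: "a \<le> \<tau>" "h \<tau> = ln (ln H)"
      using IVT'[OF ha _ _ h_cont, of b] by (auto simp: b_def)
    show "\<exists>!\<tau>. v0 \<le> \<tau> / 2 + 1 \<and> \<alpha> * \<tau> + ln (\<phi> (\<tau> / 2 + 1)) = ln (ln H)"
    proof (rule ex1I[of _ \<tau>])
      show "v0 \<le> \<tau> / 2 + 1 \<and> \<alpha> * \<tau> + ln (\<phi> (\<tau> / 2 + 1)) = ln (ln H)"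
        using \<tau> \<psi>(1)[of \<tau>] mem by (simp add: h_def)
      fix s assume "v0 \<le> s / 2 + 1 \<and> \<alpha> * s + ln (\<phi> (s / 2 + 1)) = ln (ln H)"
      then have "a \<le> s" "h s = h \<tau>" using \<psi>(1)[of s] mem \<tau> by (auto simp: h_def)
      then show "s = \<tau>" using h_less[of s \<tau>] h_less[of \<tau> s] \<tau> by (cases s \<tau> rule: linorder_cases) auto
    qed
  qed simp
qed

text \<open>Integrates G' >= 1, so that beyond w the factor exp (- G u) is at most exp (- G w) exp
  (- (u - w)).\<close>

lemma eventually_slope_ge_1:
  fixes G G' :: "real \<Rightarrow> real"
  assumes deriv: "\<forall>u\<ge>u0. (G has_real_derivative G' u) (at u within {u0..})"
    and lim: "filterlim G' at_top at_top"
  obtains w1 where "u0 \<le> w1" "0 < w1" "\<And>u w. w1 \<le> w \<Longrightarrow> w \<le> u \<Longrightarrow> G w + (u - w) \<le> G u"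
proof -
  have "eventually (\<lambda>u. 1 \<le> G' u) at_top" using lim by (simp add: filterlim_at_top)
  then obtain w0 where w0: "\<And>u. w0 \<le> u \<Longrightarrow> 1 \<le> G' u" unfolding eventually_at_top_linorder by blast
  show thesis
  proof (rule that[of "max w0 (\<bar>u0\<bar> + 1)"])
    fix u w assume w: "max w0 (\<bar>u0\<bar> + 1) \<le> w" and u: "w \<le> u"
    have "G w - w \<le> G u - u"
    proof (rule DERIV_nonneg_imp_nondecreasing[OF u])
      fix x assume x: "w \<le> x" "x \<le> u"
      have "at x within {u0..} = at x"
        by (rule at_within_open_subset[of _ "{u0<..}"]) (use x w in auto)
      moreover have "(G has_real_derivative G' x) (at x within {u0..})" using deriv x w by auto
      ultimately have "(G has_real_derivative G' x) (at x)" by simp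
      then have "((\<lambda>x. G x - x) has_real_derivative G' x - 1) (at x)" by (intro DERIV_diff DERIV_ident)
      moreover have "0 \<le> G' x - 1" using w0[of x] x w by simp
      ultimately show "\<exists>y. ((\<lambda>x. G x - x) has_real_derivative y) (at x) \<and> 0 \<le> y" by blast
    qed
    then show "G w + (u - w) \<le> G u" by simp
  qed auto
qed

text \<open>Near the origin boundedness suffices; beyond w1 half of the exponential decay pays for
  the factor 1 + |u| and the other half for integrability.\<close>

lemma integrable_first_moment:
  fixes \<Phi> :: "complex \<Rightarrow> complex"
  assumes cont: "continuous_on UNIV (\<lambda>u::real. \<Phi> (of_real u))" and M: "\<And>u::real. cmod (\<Phi> (of_real u)) \<le> M"
    and w1: "0 < w1" and tail: "\<And>u::real. w1 \<le> \<bar>u\<bar> \<Longrightarrow> cmod (\<Phi> (of_real u)) \<le> exp (- (\<bar>u\<bar> - w1))"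
  shows "integrable lborel (\<lambda>u. (1 + \<bar>u\<bar>) * cmod (\<Phi> (of_real u)))"
proof (rule Bochner_Integration.integrable_bound)
  define K where "K = 32 * exp w1 + (1 + w1) ^ 3 * M"
  show "integrable lborel (\<lambda>u. K * (1 + \<bar>u\<bar>) powr (- 2))"
    using integrable_decay[of 2] by simp
  have "continuous_on UNIV (\<lambda>u. (1 + \<bar>u\<bar>) * cmod (\<Phi> (of_real u)))" by (intro continuous_intros cont)
  then show "(\<lambda>u. (1 + \<bar>u\<bar>) * cmod (\<Phi> (of_real u))) \<in> borel_measurable lborel"
    using borel_measurable_continuous_onI by simp
  have M0: "0 \<le> M" using M[of 0] norm_ge_zero order_trans by blast
  have K: "32 * exp w1 \<le> K" "(1 + w1) ^ 3 * M \<le> K" using w1 M0 by (auto simp: K_def)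
  have le: "(1 + \<bar>u\<bar>) * cmod (\<Phi> (of_real u)) \<le> K * (1 + \<bar>u\<bar>) powr (- 2)" for u :: real
  proof (cases "w1 \<le> \<bar>u\<bar>")
    case True
    have "1 + \<bar>u\<bar> \<le> 2 * (1 + \<bar>u\<bar> / 2)" by simp
    also have "\<dots> \<le> 2 * exp (\<bar>u\<bar> / 2)" by (intro mult_left_mono exp_ge_add_one_self) auto
    finally have "(1 + \<bar>u\<bar>) * cmod (\<Phi> (of_real u)) \<le> 2 * exp (\<bar>u\<bar> / 2) * exp (- (\<bar>u\<bar> - w1))"
      using tail[OF True] by (intro mult_mono) auto
    also have "\<dots> = 2 * exp w1 * exp (- \<bar>u\<bar> / 2)"
      by (simp add: exp_add[symmetric])
    also have "\<dots> \<le> 2 * exp w1 * (16 * (1 + \<bar>u\<bar>) powr (- 2))" by (intro mult_left_mono exp_neg_half_le) auto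
    also have "\<dots> = 32 * exp w1 * (1 + \<bar>u\<bar>) powr (- 2)" by simp
    also have "\<dots> \<le> K * (1 + \<bar>u\<bar>) powr (- 2)" using K by (intro mult_right_mono) auto
    finally show ?thesis .
  next
    case False
    have p: "0 < 1 + \<bar>u\<bar>" by (simp add: add_pos_nonneg)
    have "(1 + \<bar>u\<bar>) ^ 3 * (1 + \<bar>u\<bar>) powr (- 2) = 1 + \<bar>u\<bar>"
      using p powr_add[of "1 + \<bar>u\<bar>" 3 "- 2"] by (simp add: powr_numeral)
    then have "(1 + \<bar>u\<bar>) * cmod (\<Phi> (of_real u)) = ((1 + \<bar>u\<bar>) ^ 3 * cmod (\<Phi> (of_real u))) * (1 + \<bar>u\<bar>) powr (- 2)"
      by (metis mult.assoc mult.commute)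
    also have "\<dots> \<le> ((1 + w1) ^ 3 * M) * (1 + \<bar>u\<bar>) powr (- 2)"
      using False M[of u] w1 by (intro mult_right_mono mult_mono power_mono) auto
    also have "\<dots> \<le> K * (1 + \<bar>u\<bar>) powr (- 2)" using K by (intro mult_right_mono) auto
    finally show ?thesis .
  qed
  have "norm ((1 + \<bar>u\<bar>) * cmod (\<Phi> (of_real u))) \<le> norm (K * (1 + \<bar>u\<bar>) powr (- 2))" for u :: real
  proof -
    have "norm ((1 + \<bar>u\<bar>) * cmod (\<Phi> (of_real u))) = (1 + \<bar>u\<bar>) * cmod (\<Phi> (of_real u))" by (simp add: abs_mult)
    also have "\<dots> \<le> K * (1 + \<bar>u\<bar>) powr (- 2)" by (rule le)
    also have "\<dots> \<le> norm (K * (1 + \<bar>u\<bar>) powr (- 2))" by simp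
    finally show ?thesis .
  qed
  then show "AE u in lborel. norm ((1 + \<bar>u\<bar>) * cmod (\<Phi> (of_real u))) \<le> norm (K * (1 + \<bar>u\<bar>) powr (- 2))"
    by (rule AE_I2)
qed

text \<open>For |u| >= w the function exp (- (|u| - w)) is dominated by the sum of an integrable
  bump translated to w and to - w; translation invariance makes the constant independent of w and
  v.\<close>

lemma exponential_tail_integral_le:
  fixes \<Phi> :: "complex \<Rightarrow> complex"
  assumes w: "0 < w" and tail: "\<And>u::real. w \<le> \<bar>u\<bar> \<Longrightarrow> cmod (\<Phi> (of_real u)) \<le> exp (- v) * exp (- (\<bar>u\<bar> - w))"
  shows "(LINT u|lborel. indicator {u. w \<le> \<bar>u\<bar>} u * cmod (\<Phi> (of_real u)))
    \<le> 2 * (LINT u|lborel. 16 * (1 + \<bar>u\<bar>) powr (- 2)) * exp (- v)"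
proof -
  define d where "d = (\<lambda>u::real. 16 * (1 + \<bar>u\<bar>) powr (- 2))"
  have d: "integrable lborel d" unfolding d_def using integrable_decay[of 2] by simp
  have d0: "0 \<le> d u" for u by (simp add: d_def)
  have ed: "exp (- \<bar>x\<bar>) \<le> d x" for x
  proof -
    have "exp (- \<bar>x\<bar>) \<le> exp (- \<bar>x\<bar> / 2)" by simp
    also have "\<dots> \<le> d x" unfolding d_def by (rule exp_neg_half_le)
    finally show ?thesis .
  qed
  have int: "integrable lborel (\<lambda>u. d (t + 1 * u))" for t
    using lborel_integrable_real_affine[OF d, of 1 t] by simp
  have "(LINT u|lborel. indicator {u. w \<le> \<bar>u\<bar>} u * cmod (\<Phi> (of_real u)))
      \<le> (LINT u|lborel. exp (- v) * (d (w + 1 * u) + d (- w + 1 * u)))"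
  proof (rule integral_mono')
    show "integrable lborel (\<lambda>u. exp (- v) * (d (w + 1 * u) + d (- w + 1 * u)))"
      by (intro integrable_mult_right Bochner_Integration.integrable_add int)
    fix u :: real
    show "0 \<le> exp (- v) * (d (w + 1 * u) + d (- w + 1 * u))" using d0 by simp
    show "indicator {u. w \<le> \<bar>u\<bar>} u * cmod (\<Phi> (of_real u)) \<le> exp (- v) * (d (w + 1 * u) + d (- w + 1 * u))"
    proof (cases "w \<le> \<bar>u\<bar>")
      case True
      have "exp (- (\<bar>u\<bar> - w)) \<le> d (w + 1 * u) + d (- w + 1 * u)"
      proof (cases "0 \<le> u")
        case u: True
        then have "\<bar>u\<bar> - w = \<bar>- w + 1 * u\<bar>" using True by simp
        then show ?thesis using ed[of "- w + 1 * u"] d0[of "w + 1 * u"] by simp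
      next
        case u: False
        then have "\<bar>u\<bar> - w = \<bar>w + 1 * u\<bar>" using True by simp
        then show ?thesis using ed[of "w + 1 * u"] d0[of "- w + 1 * u"] by simp
      qed
      then have "exp (- v) * exp (- (\<bar>u\<bar> - w)) \<le> exp (- v) * (d (w + 1 * u) + d (- w + 1 * u))"
        by (intro mult_left_mono) auto
      with tail[OF True] have "cmod (\<Phi> (of_real u)) \<le> exp (- v) * (d (w + 1 * u) + d (- w + 1 * u))"
        by (rule order_trans)
      then show ?thesis using True by simp
    qed (use d0 in simp)
  qed
  also have "\<dots> = exp (- v) * ((LINT u|lborel. d (w + 1 * u)) + (LINT u|lborel. d (- w + 1 * u)))"
    by (simp only: integral_mult_right_zero Bochner_Integration.integral_add[OF int int])
  also have "\<dots> = 2 * (LINT u|lborel. d u) * exp (- v)"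
    using lborel_integral_real_affine[of 1 d w] lborel_integral_real_affine[of 1 d "- w"] by simp
  finally show ?thesis by (simp only: d_def)
qed

lemma inverse_tendsto_at_top:
  fixes G g :: "real \<Rightarrow> real"
  assumes mono: "mono_on {u0..} G" and inv: "\<forall>v\<ge>v0. u0 \<le> g v \<and> G (g v) = v"
  shows "filterlim g at_top at_top"
  unfolding filterlim_at_top eventually_at_top_linorder
proof (intro allI)
  fix Z
  define w where "w = max Z u0"
  show "\<exists>N. \<forall>v\<ge>N. Z \<le> g v"
  proof (intro exI[of _ "max v0 (G w + 1)"] allI impI, rule ccontr)
    fix v assume v: "max v0 (G w + 1) \<le> v" and "\<not> Z \<le> g v"
    then have "g v \<le> w" by (simp add: w_def)
    then have "G (g v) \<le> G w" using inv v by (intro mono_onD[OF mono]) (auto simp: w_def)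
    then show False using inv v by auto
  qed
qed

text \<open>The equation for a root is read on the range \<open>v0 \<le> \<tau> / 2 + 1\<close>,
  where \<phi> is the inverse of F. T0 and T1 are chosen before H and the root, so the bounds are
  uniform in H; that \<tau> is large is forced by T through \<open>admissible_large\<close>.\<close>

theorem theoremA:
  fixes \<Phi> :: "complex \<Rightarrow> complex"
    and G G' g g' F \<phi> :: "real \<Rightarrow> real"
    and \<alpha> u0 v0 lam0 :: real
  assumes RH: riemann_hypothesis
    and Phi_nonneg: "\<forall>u::real. \<Phi> (of_real u) \<in> \<real>\<^sub>\<ge>\<^sub>0"
    and Phi_strip: "\<forall>\<tau>>0. \<exists>\<beta>>0. \<exists>\<delta>>0.
        (\<lambda>z. \<Phi> (of_real \<tau> * z)) analytic_on {z. \<bar>Im z\<bar> \<le> 0.5 + \<delta>} \<and>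
        (\<exists>C. \<forall>z. \<bar>Im z\<bar> \<le> 0.5 + \<delta> \<longrightarrow>
               cmod (\<Phi> (of_real \<tau> * z)) \<le> C * (1 + cmod z) powr (- (1 + \<beta>)))"
    and Phi_decay: "0 < u0" "\<forall>u::real. u0 \<le> \<bar>u\<bar> \<longrightarrow> cmod (\<Phi> (of_real u)) \<le> exp (- G \<bar>u\<bar>)"
    and G_deriv: "\<forall>u\<ge>u0. (G has_real_derivative G' u) (at u within {u0..})"
    and G_pos: "\<forall>u\<ge>u0. 0 < G u \<and> 0 < G' u"
    and G_incr: "mono_on {u0..} G" "filterlim G at_top at_top"
    and G'_incr: "mono_on {u0..} G'" "filterlim G' at_top at_top"
    and v0: "0 < v0"
    and g_inverse: "\<forall>v\<ge>v0. u0 \<le> g v \<and> G (g v) = v"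
    and g_deriv: "\<forall>v\<ge>v0. (g has_real_derivative g' v) (at v within {v0..})"
    and g'_decr: "\<forall>v\<ge>v0. 0 < g' v" "antimono_on {v0..} g'"
    and g'_ln_g_decr: "\<forall>v\<ge>v0. 0 < g' v * ln (g v)" "antimono_on {v0..} (\<lambda>v. g' v * ln (g v))"
    and alpha: "0 < \<alpha>"
    and fourier_real: "\<forall>lam. fourier \<Phi> lam \<in> \<real>"
    and fourier_pos: "\<forall>lam\<in>{0..\<alpha>}. 0 < Re (fourier \<Phi> lam)"
    and fourier_decr: "antimono_on {0..\<alpha>} (\<lambda>lam. Re (fourier \<Phi> lam))"
    and fourier_decay: "0 < lam0"
        "\<forall>lam. lam0 \<le> \<bar>lam\<bar> \<longrightarrow> cmod (fourier \<Phi> lam) \<le> exp (- (\<bar>lam\<bar> * F \<bar>lam\<bar>))"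
    and F_incr: "strict_mono_on {lam0..} F"
    and phi_inverse: "\<forall>v\<ge>v0. lam0 \<le> \<phi> v \<and> F (\<phi> v) = v"
    and phi_incr: "strict_mono_on {v0..} \<phi>"
    and phi_bounds: "\<forall>v\<ge>v0. ln v \<le> ln (\<phi> v) \<and> ln (\<phi> v) \<le> exp (0.5 * \<alpha> * v)"
  shows
    "(\<exists>H0>1. \<forall>H\<ge>H0. \<exists>!\<tau>0. v0 \<le> \<tau>0 / 2 + 1 \<and> \<alpha> * \<tau>0 + ln (\<phi> (\<tau>0 / 2 + 1)) = ln (ln H)) \<and>
     (\<exists>T0>0. \<forall>T\<ge>T0. \<forall>H>1. \<forall>\<tau>0.
        v0 \<le> \<tau>0 / 2 + 1 \<and> \<alpha> * \<tau>0 + ln (\<phi> (\<tau>0 / 2 + 1)) = ln (ln H) \<and>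
        g (ln (ln T)) \<le> H * \<tau>0 \<longrightarrow>
        ereal (mu_star \<Phi> \<alpha> \<tau>0) \<le> max_ln_abs_zeta_half (T - H) (T + 2 * H)) \<and>
     ((\<forall>v\<ge>v0. ln (\<phi> v) \<le> 0.5 * v) \<longrightarrow>
      (\<exists>T1>0. \<forall>T\<ge>T1. \<forall>H>1. \<forall>\<tau>1.
        v0 \<le> \<tau>1 / 2 + 1 \<and> \<alpha> * \<tau>1 / 2 + ln (\<phi> (\<tau>1 / 2 + 1)) = ln (ln H) \<and>
        g (ln (ln T)) \<le> H * \<tau>1 \<longrightarrow>
        ereal (mu_star_star \<Phi> \<alpha> \<tau>1) \<le> max_ln_abs_zeta_half (T - H) (T + 2 * H)))"
proof -
  obtain w1 where w1: "u0 \<le> w1" "0 < w1" "\<And>u w. w1 \<le> w \<Longrightarrow> w \<le> u \<Longrightarrow> G w + (u - w) \<le> G u"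
    using eventually_slope_ge_1[OF G_deriv G'_incr(2)] by metis
  have "\<exists>\<beta>>0. \<exists>\<delta>>0. \<Phi> analytic_on {z. \<bar>Im z\<bar> \<le> 0.5 + \<delta>} \<and>
        (\<exists>C. \<forall>z. \<bar>Im z\<bar> \<le> 0.5 + \<delta> \<longrightarrow> cmod (\<Phi> z) \<le> C * (1 + cmod z) powr (- (1 + \<beta>)))"
    using Phi_strip[rule_format, of 1] by simp
  then obtain \<beta> \<delta> C where \<beta>: "0 < \<beta>" and \<delta>: "0 < \<delta>" and an: "\<Phi> analytic_on {z. \<bar>Im z\<bar> \<le> 0.5 + \<delta>}"
    and C: "\<forall>z. \<bar>Im z\<bar> \<le> 0.5 + \<delta> \<longrightarrow> cmod (\<Phi> z) \<le> C * (1 + cmod z) powr (- (1 + \<beta>))"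
    by blast
  have bound: "cmod (\<Phi> (of_real u)) \<le> C" for u :: real
  proof -
    have "cmod (\<Phi> (of_real u)) \<le> C * (1 + \<bar>u\<bar>) powr (- (1 + \<beta>))" using C[rule_format, of "of_real u"] \<delta> by simp
    moreover have "0 \<le> C" using order_trans[OF norm_ge_zero C[rule_format, of 0]] \<delta> by simp
    moreover have "(1 + \<bar>u\<bar>) powr (- (1 + \<beta>)) \<le> (1 + \<bar>u\<bar>) powr 0" using \<beta> by (intro powr_mono) auto
    then have "(1 + \<bar>u\<bar>) powr (- (1 + \<beta>)) \<le> 1" by (simp split: if_splits)
    ultimately show ?thesis using mult_left_le[of "(1 + \<bar>u\<bar>) powr (- (1 + \<beta>))" C] by linarith
  qed
  have "continuous_on {z. \<bar>Im z\<bar> \<le> 0.5 + \<delta>} \<Phi>"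
    using an analytic_imp_holomorphic holomorphic_on_imp_continuous_on by blast
  then have cont: "continuous_on UNIV (\<lambda>u::real. \<Phi> (of_real u))"
    by (rule continuous_on_compose2) (use \<delta> in \<open>auto intro!: continuous_intros\<close>)
  \<comment> \<open>Decay hypothesis and slope combined: measured from its bound exp (- G w) at w,
    the kernel falls off exponentially.\<close>
  have tail: "cmod (\<Phi> (of_real u)) \<le> exp (- G w) * exp (- (\<bar>u\<bar> - w))" if "w1 \<le> w" "w \<le> \<bar>u\<bar>" for u w :: real
  proof -
    have "cmod (\<Phi> (of_real u)) \<le> exp (- G \<bar>u\<bar>)" using Phi_decay(2) w1(1) that by simp
    also have "\<dots> \<le> exp (- G w + - (\<bar>u\<bar> - w))" using w1(3)[of w "\<bar>u\<bar>"] that by simp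
    finally show ?thesis by (simp only: exp_add)
  qed
  have moment: "integrable lborel (\<lambda>u. (1 + \<bar>u\<bar>) * cmod (\<Phi> (of_real u)))"
  proof (rule integrable_first_moment[OF cont bound w1(2)])
    fix u :: real assume u: "w1 \<le> \<bar>u\<bar>"
    have "exp (- G w1) \<le> 1" using G_pos w1(1) by (simp add: less_imp_le)
    then have "exp (- G w1) * exp (- (\<bar>u\<bar> - w1)) \<le> 1 * exp (- (\<bar>u\<bar> - w1))" by (intro mult_right_mono) auto
    then show "cmod (\<Phi> (of_real u)) \<le> exp (- (\<bar>u\<bar> - w1))" using tail[OF order_refl u] by linarith
  qed
  have g_tendsto: "filterlim g at_top at_top" by (rule inverse_tendsto_at_top[OF G_incr(1) g_inverse])
  define J where "J = (LINT u|lborel. 16 * (1 + \<bar>u::real\<bar>) powr (- 2))"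
  have "eventually (\<lambda>v. w1 \<le> g v) at_top" using g_tendsto by (simp add: filterlim_at_top)
  then obtain v1 where v1: "\<And>v. v1 \<le> v \<Longrightarrow> w1 \<le> g v" unfolding eventually_at_top_linorder by blast
  \<comment> \<open>For w >= g v >= w1 the slope bound gives G w >= G (g v) = v, which supplies the
    factor exp (- v).\<close>
  have kernel_tail: "(LINT u|lborel. indicator {u. w \<le> \<bar>u\<bar>} u * cmod (\<Phi> (of_real u))) \<le> 2 * J * exp (- v)"
    if v: "max v0 v1 \<le> v" and w: "g v \<le> w" for v w
    unfolding J_def
  proof (rule exponential_tail_integral_le)
    have gv: "w1 \<le> g v" using v1 v by simp
    then show "0 < w" using w w1(2) by linarith
    fix u :: real assume u: "w \<le> \<bar>u\<bar>"
    have "v \<le> G w" using w1(3)[OF gv w] g_inverse v w by auto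
    then have "exp (- G w) * exp (- (\<bar>u\<bar> - w)) \<le> exp (- v) * exp (- (\<bar>u\<bar> - w))" by (intro mult_right_mono) auto
    then show "cmod (\<Phi> (of_real u)) \<le> exp (- v) * exp (- (\<bar>u\<bar> - w))"
      using tail[OF order_trans[OF gv w] u] by linarith
  qed
  interpret large_value_kernel \<Phi> \<alpha> v0 \<phi> g
  proof
    fix v l assume v: "v0 \<le> v" and l: "\<phi> v \<le> \<bar>l\<bar>"
    \<comment> \<open>Beyond \<phi> v the increasing F is at least F (\<phi> v) = v, so the decay
      rate F |l| may be replaced by v.\<close>
    have "F (\<phi> v) \<le> F \<bar>l\<bar>"
      using strict_mono_onD[OF F_incr, of "\<phi> v" "\<bar>l\<bar>"] l phi_inverse v by (cases "\<phi> v = \<bar>l\<bar>") auto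
    then have "v \<le> F \<bar>l\<bar>" using phi_inverse v by simp
    then have "\<bar>l\<bar> * v \<le> \<bar>l\<bar> * F \<bar>l\<bar>" by (intro mult_left_mono) auto
    moreover have "cmod (fourier \<Phi> l) \<le> exp (- (\<bar>l\<bar> * F \<bar>l\<bar>))"
      using fourier_decay(2) phi_inverse v l order_trans by blast
    ultimately show "cmod (fourier \<Phi> l) \<le> exp (- (\<bar>l\<bar> * v))" by (meson exp_le_cancel_iff neg_le_iff_le order_trans)
  next
    fix v assume v: "v0 \<le> v"
    show "0 < \<phi> v" using phi_inverse fourier_decay(1) v order_less_le_trans by blast
    then show "v \<le> \<phi> v" using phi_bounds v v0 by (meson ln_le_cancel_iff order_less_le_trans)
  next
    fix v w assume "v0 \<le> v" "v \<le> w"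
    then show "\<phi> v \<le> \<phi> w" using strict_mono_onD[OF phi_incr, of v w] by (cases "v = w") auto
  next
    fix l assume "0 \<le> l" "l \<le> \<alpha>"
    then show "Re (fourier \<Phi> \<alpha>) \<le> Re (fourier \<Phi> l)" using fourier_decr alpha by (auto simp: monotone_on_def)
  next
    have "0 \<le> 2 * J" unfolding J_def by (intro mult_nonneg_nonneg integral_nonneg_AE) auto
    then show "\<exists>K v1. 0 \<le> K \<and> (\<forall>v\<ge>v1. \<forall>w\<ge>g v.
        (LINT u|lborel. indicator {u. w \<le> \<bar>u\<bar>} u * cmod (\<Phi> (of_real u))) \<le> K * exp (- v))"
      using kernel_tail by blast
  next
    show "0 < Re (fourier \<Phi> \<alpha>)" "0 < Re (fourier \<Phi> 0)" using fourier_pos alpha by auto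
  qed (rule RH Phi_nonneg Phi_strip moment alpha fourier_real[rule_format] g_tendsto)+
  obtain T0 where T0: "0 < T0" "\<And>T H \<tau>. T0 \<le> T \<Longrightarrow> admissible 1 T H \<tau> \<Longrightarrow>
      ereal (mu_star \<Phi> \<alpha> \<tau>) \<le> max_ln_abs_zeta_half (T - H) (T + 2 * H)"
    using mu_star_lower_bound by blast
  obtain T1 where T1: "0 < T1" "\<And>T H \<tau>. T1 \<le> T \<Longrightarrow> admissible (1 / 2) T H \<tau> \<Longrightarrow>
      ereal (mu_star_star \<Phi> \<alpha> \<tau>) \<le> max_ln_abs_zeta_half (T - H) (T + 2 * H)"
    using mu_star_star_lower_bound by blast
  show ?thesis
  proof (intro conjI impI)
    show "\<exists>H0>1. \<forall>H\<ge>H0. \<exists>!\<tau>0. v0 \<le> \<tau>0 / 2 + 1 \<and> \<alpha> * \<tau>0 + ln (\<phi> (\<tau>0 / 2 + 1)) = ln (ln H)"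
      by (rule unique_root[OF alpha fourier_decay(1) F_incr phi_inverse phi_incr])
    show "\<exists>T0>0. \<forall>T\<ge>T0. \<forall>H>1. \<forall>\<tau>0.
        v0 \<le> \<tau>0 / 2 + 1 \<and> \<alpha> * \<tau>0 + ln (\<phi> (\<tau>0 / 2 + 1)) = ln (ln H) \<and>
        g (ln (ln T)) \<le> H * \<tau>0 \<longrightarrow>
        ereal (mu_star \<Phi> \<alpha> \<tau>0) \<le> max_ln_abs_zeta_half (T - H) (T + 2 * H)"
      by (intro exI[of _ T0] conjI T0(1) allI impI T0(2)) (simp_all add: admissible_def)
    show "\<exists>T1>0. \<forall>T\<ge>T1. \<forall>H>1. \<forall>\<tau>1.
        v0 \<le> \<tau>1 / 2 + 1 \<and> \<alpha> * \<tau>1 / 2 + ln (\<phi> (\<tau>1 / 2 + 1)) = ln (ln H) \<and>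
        g (ln (ln T)) \<le> H * \<tau>1 \<longrightarrow>
        ereal (mu_star_star \<Phi> \<alpha> \<tau>1) \<le> max_ln_abs_zeta_half (T - H) (T + 2 * H)"
      by (intro exI[of _ T1] conjI T1(1) allI impI T1(2)) (simp_all add: admissible_def)
  qed
qed

end
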